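(* Let $\mathfrak d$ be a real vector space of dimension $n$, and let $\Delta\subset\mathfrak d^*$ be a simple convex polytope of dimension $n$ with $d$ facets. Choose inward-pointing normals $X_1,\ldots,X_d\in\mathfrak d$ to the facets of $\Delta$, so that $\Delta=\bigcap_{j=1}^d\{\mu\in\mathfrak d^*\mid\langle\mu,X_j\rangle\ge\lambda_j\}$ with $\lambda_j\in\mathbb R$, and let $Q\subset\mathfrak d$ be a quasilattice containing these vectors. Then the mapping $$\chi:\Psi^{-1}(0)/N\longrightarrow\mathbb C^d_\Delta/N_{\mathbb C},$$ which sends the $N$-orbit of a point of $\Psi^{-1}(0)\subset\mathbb C^d_\Delta$ to its $N_{\mathbb C}$-orbit, is an equivariant diffeomorphism of quasifolds (equivariant with respect to the actions of the quasitori $\mathfrak d/Q$ and $\mathfrak d_{\mathbb C}/Q$). Moreover the induced symplectic form on the complex quasifold $\mathbb C^d_\Delta/N_{\mathbb C}$ (the pullback via $\chi^{-1}$ of the symplectic form of $\Psi^{-1}(0)/N$) is Kähler.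
   Context: **Polytope data.** A polytope of dimension $n$ is simple if exactly $n$ edges stem from each vertex. A quasilattice in $\mathfrak d$ is the $\mathbb Z$-span of a set of vectors spanning $\mathfrak d$. Put $\mathfrak d_{\mathbb C}=\mathfrak d+i\mathfrak d$. The quotients $\mathfrak d/Q$ and $\mathfrak d_{\mathbb C}/Q$ are called a quasitorus and a complex quasitorus. Let $\pi:\mathbb R^d\to\mathfrak d$, $e_j\mapsto X_j$, with complexification $\pi_{\mathbb C}:\mathbb C^d\to\mathfrak d_{\mathbb C}$. These induce homomorphisms $\Pi:T^d=\mathbb R^d/\mathbb Z^d\to\mathfrak d/Q$ and $\Pi_{\mathbb C}:T^d_{\mathbb C}=\mathbb C^d/\mathbb Z^d\to\mathfrak d_{\mathbb C}/Q$, with kernels $N=\ker\Pi$ and $N_{\mathbb C}=\ker\Pi_{\mathbb C}$; let $\mathfrak n=\ker\pi$ (the Lie algebra of $N$) and $\iota:\mathfrak n\to\mathbb R^d$ the inclusion. $T^d_{\mathbb C}$ acts on $\mathbb C^d$ by $[Z]\cdot\underline z=(e^{2\pi iZ_1}z_1,\ldots,e^{2\pi iZ_d}z_d)$. For a nonempty face $F$ of $\Delta$ (including $\Delta$ itself), let $I_F$ be the set of indices $j$ with $\langle\mu,X_j\rangle=\lambda_j$ on $F$; $\mathbb C^d_F=\{\underline z\in\mathbb C^d\mid z_j=0\text{ iff }j\in I_F\}$ and $\mathbb C^d_\Delta=\bigcup_F\mathbb C^d_F$. Let $J:\mathbb C^d\to(\mathbb R^d)^*$, $J(\underline z)=\sum_{j=1}^d(|z_j|^2+\lambda_j)e_j^*$,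 and $\Psi=\iota^*\circ J:\mathbb C^d\to\mathfrak n^*$. One has $\Psi^{-1}(0)\subset\mathbb C^d_\Delta$. The group $\mathfrak d/Q\cong T^d/N$ acts on $\Psi^{-1}(0)/N$ and $\mathfrak d_{\mathbb C}/Q\cong T^d_{\mathbb C}/N_{\mathbb C}$ acts on $\mathbb C^d_\Delta/N_{\mathbb C}$, both induced by the standard action on $\mathbb C^d$; equivariance of $\chi$ means $\chi(t\cdot x)=t\cdot\chi(x)$ for $t\in\mathfrak d/Q\subset\mathfrak d_{\mathbb C}/Q$. **Models and quasifolds.** A (complex, resp. real) model is a triple $(\tilde V/\Gamma,p,\tilde V)$, with $\tilde V$ a connected, simply connected complex (resp. smooth) manifold, $\Gamma$ a discrete group acting holomorphically (resp. smoothly) on $\tilde V$ so that the set of points where the action is free is connected and dense, $\tilde V/\Gamma$ with the quotient topology, and $p$ the projection. If $\tilde V$ is not simply connected, one replaces it by its universal cover $\varpi:V^\#\to\tilde V$ and $\Gamma$ by $\Lambda=\{\lambda\in\mathrm{Diff}(V^\#)\mid\exists\gamma\in\Gamma\ \forall u:\varpi(\lambda(u))=\gamma\cdot\varpi(u)\}$, so $\tilde V/\Gamma=V^\#/\Lambda$. An open $W\subset\tilde V/\Gamma$ is a submodel if $(W,p,p^{-1}(W))$ is a model in this sense. A map of models is holomorphic (smooth) if it has a holomorphic (smooth) lift between the covering manifolds, commuting with the projections; it is a biholomorphism (diffeomorphism) of models if it is bijective and a lift is a biholomorphism (diffeomorphism). A complex (real) quasifold is a topological space $M$ with a maximal atlas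 of charts $(V_\alpha,\phi_\alpha,\tilde V_\alpha/\Gamma_\alpha)$, where the $V_\alpha$ are open and cover $M$, $\tilde V_\alpha/\Gamma_\alpha$ is a model with $\tilde V_\alpha$ open, connected and simply connected in $\mathbb C^k$ (resp. $\mathbb R^k$), $\phi_\alpha:\tilde V_\alpha/\Gamma_\alpha\to V_\alpha$ is a homeomorphism, and for $V_\alpha\cap V_\beta\neq\emptyset$ the sets $\phi_\alpha^{-1}(V_\alpha\cap V_\beta)$, $\phi_\beta^{-1}(V_\alpha\cap V_\beta)$ are submodels with $\phi_\beta^{-1}\circ\phi_\alpha$ a biholomorphism (diffeomorphism) of models. A complex quasifold of dimension $k$ is in particular a real quasifold of dimension $2k$. A continuous map $f:M\to M'$ of real quasifolds is smooth if around each $m\in M$ and around $f(m)$ there are charts $(V,\phi,\tilde V/\Gamma)$, $(W,\psi,\tilde W/\Delta')$ and a smooth map of models $f_m:\tilde V/\Gamma\to\tilde W/\Delta'$ with $\psi\circ f_m=f\circ\phi$; it is a diffeomorphism if it is bijective and each $f_m$ can be taken to be a diffeomorphism of models. **Forms.** A differential form on a model $\tilde V/\Gamma$ is a $\Gamma$-invariant differential form on $\tilde V$. A differential form on a quasifold is the assignment, for a family of charts covering it, of a form $\omega_\alpha$ on each model $\tilde V_\alpha/\Gamma_\alpha$, such that the changes of charts pull $\omega_\beta$ back to $\omega_\alpha$ (computed via lifts). It is symplectic if each form on $\tilde V_\alpha$ is symplectic and Kähler if each form on $\tilde V_\alpha$ is Kähler. Forms are pulled back under diffeomorphisms of quasifolds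 by pulling back via local lifts. Sign convention: a closed real $(1,1)$-form $\omega$ is Kähler if $\omega(\mathcal J\cdot,\cdot)$ is positive definite, $\mathcal J$ being the complex structure; with this convention the standard form $\omega_0=\frac1{2\pi i}\sum_j dz_j\wedge d\bar z_j$ on $\mathbb C^d$ is Kähler. **The two quasifold structures.** For a vertex $\mu$ of $\Delta$ let $I=I_\mu=\{r_1,\ldots,r_n\}$, let $\tilde V_\mu=\prod_{j\in I}\mathbb Ce_j\cong\mathbb C^n$, let $S^\mu_{\mathbb C}=\{[Z]\in T^d_{\mathbb C}\mid Z_j\in\mathbb Z\text{ for }j\notin I\}$, and let $\Gamma_\mu=N_{\mathbb C}\cap S^\mu_{\mathbb C}$ (a discrete group, equal to $N\cap S^\mu_{\mathbb C}$) act on $\tilde V_\mu$ by the standard action. Let $\hat V_\mu=\{\underline z\in\mathbb C^d\mid z_j\ne0\text{ for }j\notin I\}$ and $\underline z^\mu\in\mathbb C^d$ with $z^\mu_j=0$ for $j\in I$, $z^\mu_j=1$ for $j\notin I$. Complex structure: $\mathbb C^d_\Delta/N_{\mathbb C}$ is the complex quasifold of dimension $n$ whose atlas is generated by the charts $V_\mu=\hat V_\mu/N_{\mathbb C}$, $\phi_\mu:\tilde V_\mu/\Gamma_\mu\to V_\mu$, $[\underline z]\mapsto[\underline z^\mu+\underline z]$, with $\mu$ ranging over the vertices. Symplectic structure: write $X_h=\sum_{j=1}^na_{jh}X_{r_j}$ for $h=1,\dots,d$, and let $\tilde U_\mu=\{\underline w\in\tilde V_\mu\mid\sum_{j=1}^na_{jh}(|w_{r_j}|^2+\lambda_{r_j})-\lambda_h>0\text{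 for all }h\notin I\}$, which is $\Gamma_\mu$-invariant. For $\underline w\in\tilde U_\mu$ let $\underline w^\mu\in\mathbb C^d$ have components $w^\mu_h=0$ for $h\in I$ and $w^\mu_h=\sqrt{\sum_{j=1}^na_{jh}(|w_{r_j}|^2+\lambda_{r_j})-\lambda_h}$ for $h\notin I$. The quotient $\Psi^{-1}(0)/N$ is the real quasifold of dimension $2n$ whose atlas is generated by the charts $U_\mu=(\hat V_\mu\cap\Psi^{-1}(0))/N$, $\psi_\mu:\tilde U_\mu/\Gamma_\mu\to U_\mu$, $[\underline w]\mapsto[\underline w^\mu+\underline w]$, with $\mu$ ranging over the vertices. Its symplectic form is the one induced by $\omega_0$: its lift to $\tilde U_\mu$ is the pullback of $\omega_0$ under $\underline w\mapsto\underline w+\underline w^\mu$, i.e. $\frac1{2\pi i}\sum_{j\in I}dw_j\wedge d\bar w_j$. *)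

theory Defs
  imports
    "HOL-Analysis.Analysis"
    "HOL-Algebra.Bij"
    "HOL-Computational_Algebra.Group_Closure"
begin

section \<open>Smooth and holomorphic maps between open sets\<close>

fun Ck_on :: "nat \<Rightarrow> 'e::real_normed_vector set \<Rightarrow> ('e \<Rightarrow> 'f::real_normed_vector) \<Rightarrow> bool" where
  "Ck_on 0 S f \<longleftrightarrow> continuous_on S f"
| "Ck_on (Suc k) S f \<longleftrightarrow>
     (\<forall>x\<in>S. f differentiable (at x)) \<and>
     (\<forall>v. Ck_on k S (\<lambda>x. frechet_derivative f (at x) v))"

definition smooth_on :: "'e::real_normed_vector set \<Rightarrow> ('e \<Rightarrow> 'f::real_normed_vector) \<Rightarrow> bool" where
  "smooth_on S f \<longleftrightarrow> (\<forall>k. Ck_on k S f)"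

definition holomorphic_map_on :: "(complex^'n) set \<Rightarrow> (complex^'n \<Rightarrow> complex^'m) \<Rightarrow> bool" where
  "holomorphic_map_on S f \<longleftrightarrow>
     (\<forall>x\<in>S. \<exists>L. (f has_derivative L) (at x) \<and> (\<forall>c v. L (c *s v) = c *s L v))"


section \<open>Models\<close>

text \<open>
  The manifolds that occur are open subsets of a Euclidean space \<open>'e\<close> and covering spaces of
  such sets. Both are given as a set \<open>C\<close> with a local homeomorphism \<open>p\<close> from \<open>C\<close> into \<open>'e\<close>, which
  is the identity in the first case and the covering projection in the second; the smooth or
  complex structure of \<open>C\<close> is the one whose charts are the local restrictions of \<open>p\<close>.
  \<open>local_section C p x T s\<close> says that \<open>s\<close>, defined on the open set \<open>T\<close>, is the inverse of such a
  restriction near \<open>x\<close>.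
  The argument \<open>reg\<close> of the definitions below is \<open>smooth_on\<close> or \<open>holomorphic_map_on\<close>.
\<close>

definition local_section ::
    "'c::topological_space set \<Rightarrow> ('c \<Rightarrow> 'e::euclidean_space) \<Rightarrow> 'c \<Rightarrow> 'e set \<Rightarrow> ('e \<Rightarrow> 'c) \<Rightarrow> bool" where
  "local_section C p x T s \<longleftrightarrow>
     open T \<and> (\<exists>O'. openin (top_of_set C) O' \<and> x \<in> O' \<and> homeomorphism O' T p s)"

definition manifold_map ::
    "('e::euclidean_space set \<Rightarrow> ('e \<Rightarrow> 'f::euclidean_space) \<Rightarrow> bool) \<Rightarrow>
     'c::topological_space set \<Rightarrow> ('c \<Rightarrow> 'e) \<Rightarrow> 'b::topological_space set \<Rightarrow> ('b \<Rightarrow> 'f) \<Rightarrow>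
     ('c \<Rightarrow> 'b) \<Rightarrow> bool" where
  "manifold_map reg C p D q F \<longleftrightarrow>
     F ` C \<subseteq> D \<and> continuous_on C F \<and>
     (\<forall>x\<in>C. \<exists>T s. local_section C p x T s \<and> reg T (q \<circ> F \<circ> s))"

definition manifold_iso ::
    "('e::euclidean_space set \<Rightarrow> ('e \<Rightarrow> 'e) \<Rightarrow> bool) \<Rightarrow>
     'c::topological_space set \<Rightarrow> ('c \<Rightarrow> 'e) \<Rightarrow> 'b::topological_space set \<Rightarrow> ('b \<Rightarrow> 'e) \<Rightarrow>
     ('c \<Rightarrow> 'b) \<Rightarrow> bool" where
  "manifold_iso reg C p D q F \<longleftrightarrow>
     bij_betw F C D \<and> manifold_map reg C p D q F \<and> manifold_map reg D q C p (inv_into C F)"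

text \<open>
  An action with a free point is faithful, so the group of a model is given as a group of
  bijections of the manifold.
\<close>

definition group_orbit :: "('c \<Rightarrow> 'c) set \<Rightarrow> 'c \<Rightarrow> 'c set" where
  "group_orbit \<Gamma> x = (\<lambda>g. g x) ` \<Gamma>"

definition free_points :: "'c set \<Rightarrow> ('c \<Rightarrow> 'c) set \<Rightarrow> 'c set" where
  "free_points C \<Gamma> = {x \<in> C. \<forall>g\<in>\<Gamma>. g x = x \<longrightarrow> g = (\<lambda>y\<in>C. y)}"

definition is_model ::
    "('e::euclidean_space set \<Rightarrow> ('e \<Rightarrow> 'e) \<Rightarrow> bool) \<Rightarrow>
     'c::euclidean_space set \<Rightarrow> ('c \<Rightarrow> 'e) \<Rightarrow> ('c \<Rightarrow> 'c) set \<Rightarrow> bool" where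
  "is_model reg C p \<Gamma> \<longleftrightarrow>
     C \<noteq> {} \<and> connected C \<and> simply_connected C \<and>
     subgroup \<Gamma> (BijGroup C) \<and> (\<forall>g\<in>\<Gamma>. manifold_map reg C p C p g) \<and>
     connected (free_points C \<Gamma>) \<and> C \<subseteq> closure (free_points C \<Gamma>)"

definition quotient_topology :: "'c topology \<Rightarrow> ('c \<Rightarrow> 'q) \<Rightarrow> 'q topology" where
  "quotient_topology Y f =
     topology (\<lambda>W. W \<subseteq> f ` topspace Y \<and> openin Y {x \<in> topspace Y. f x \<in> W})"

text \<open>
  \<open>f\<close> is a diffeomorphism (biholomorphism) from the model with manifold \<open>(C, p)\<close> and projection
  \<open>a\<close> onto the model with manifold \<open>(D, q)\<close> and projection \<open>b\<close>, and \<open>F\<close> is a lift witnessing this.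
\<close>

definition model_iso_lift ::
    "('e::euclidean_space set \<Rightarrow> ('e \<Rightarrow> 'e) \<Rightarrow> bool) \<Rightarrow>
     'c::topological_space set \<Rightarrow> ('c \<Rightarrow> 'e) \<Rightarrow> ('c \<Rightarrow> 'q) \<Rightarrow>
     'b::topological_space set \<Rightarrow> ('b \<Rightarrow> 'e) \<Rightarrow> ('b \<Rightarrow> 'r) \<Rightarrow>
     ('q \<Rightarrow> 'r) \<Rightarrow> ('c \<Rightarrow> 'b) \<Rightarrow> bool" where
  "model_iso_lift reg C p a D q b f F \<longleftrightarrow>
     bij_betw f (a ` C) (b ` D) \<and> manifold_iso reg C p D q F \<and> (\<forall>x\<in>C. b (F x) = f (a x))"


section \<open>Quasifolds\<close>

record ('e, 'm) quasi_chart =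
  chart_dom :: "'e set"
  chart_group :: "('e \<Rightarrow> 'e) set"
  chart_map :: "'e set \<Rightarrow> 'm"

definition chart_orbits :: "('e, 'm) quasi_chart \<Rightarrow> 'e set set" where
  "chart_orbits c = group_orbit (chart_group c) ` chart_dom c"

definition chart_image :: "('e, 'm) quasi_chart \<Rightarrow> 'm set" where
  "chart_image c = chart_map c ` chart_orbits c"

definition chart_topology :: "('e::topological_space, 'm) quasi_chart \<Rightarrow> 'e set topology" where
  "chart_topology c = quotient_topology (top_of_set (chart_dom c)) (group_orbit (chart_group c))"

definition is_chart ::
    "('e::euclidean_space set \<Rightarrow> ('e \<Rightarrow> 'e) \<Rightarrow> bool) \<Rightarrow> 'm topology \<Rightarrow> ('e, 'm) quasi_chart \<Rightarrow> bool" where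
  "is_chart reg M c \<longleftrightarrow>
     openin M (chart_image c) \<and>
     open (chart_dom c) \<and> is_model reg (chart_dom c) id (chart_group c) \<and>
     homeomorphic_map (chart_topology c) (subtopology M (chart_image c)) (chart_map c)"

text \<open>The group \<open>\<Lambda>\<close> of all lifts of elements of \<open>\<Gamma>\<close> to the universal cover \<open>\<rho>\<close>.\<close>

definition cover_group ::
    "'c::topological_space set \<Rightarrow> ('c \<Rightarrow> 'e::euclidean_space) \<Rightarrow> ('e \<Rightarrow> 'e) set \<Rightarrow> ('c \<Rightarrow> 'c) set" where
  "cover_group C \<rho> \<Gamma> =
     {l \<in> Bij C. manifold_iso smooth_on C \<rho> C \<rho> l \<and> (\<exists>g\<in>\<Gamma>. \<forall>u\<in>C. \<rho> (l u) = g (\<rho> u))}"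

text \<open>
  The open set \<open>W\<close> of orbits is a submodel of the chart \<open>c\<close>, with universal cover \<open>\<rho> : C \<rightarrow> p\<^sup>-\<^sup>1(W)\<close>.
  The universal cover of a connected open subset of the \<open>k\<close>-dimensional space \<open>'e\<close> is a
  \<open>k\<close>-manifold, which embeds in \<open>2k\<close>-dimensional space by Whitney's theorem; hence taking \<open>C\<close> to be
  a subset of \<open>'e \<times> 'e\<close> is no restriction. If \<open>p\<^sup>-\<^sup>1(W)\<close> is simply connected then \<open>\<rho>\<close> is a
  homeomorphism and \<open>\<Lambda>\<close> is just \<open>\<Gamma>\<close>.
\<close>

definition submodel_cover ::
    "('e::euclidean_space set \<Rightarrow> ('e \<Rightarrow> 'e) \<Rightarrow> bool) \<Rightarrow> ('e, 'm) quasi_chart \<Rightarrow> 'e set set \<Rightarrow>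
     ('e \<times> 'e) set \<Rightarrow> ('e \<times> 'e \<Rightarrow> 'e) \<Rightarrow> bool" where
  "submodel_cover reg c W C \<rho> \<longleftrightarrow>
     openin (chart_topology c) W \<and>
     covering_space C \<rho> {x \<in> chart_dom c. group_orbit (chart_group c) x \<in> W} \<and>
     is_model reg C \<rho> (cover_group C \<rho> (chart_group c))"

definition chart_overlap :: "('e, 'm) quasi_chart \<Rightarrow> ('e, 'm) quasi_chart \<Rightarrow> 'e set set" where
  "chart_overlap c c' = {w \<in> chart_orbits c. chart_map c w \<in> chart_image c'}"

definition chart_change ::
    "('e, 'm) quasi_chart \<Rightarrow> ('e, 'm) quasi_chart \<Rightarrow> 'e set \<Rightarrow> 'e set" where
  "chart_change c c' = inv_into (chart_orbits c') (chart_map c') \<circ> chart_map c"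

definition chart_change_lift ::
    "('e::euclidean_space set \<Rightarrow> ('e \<Rightarrow> 'e) \<Rightarrow> bool) \<Rightarrow>
     ('e, 'm) quasi_chart \<Rightarrow> ('e \<times> 'e) set \<Rightarrow> ('e \<times> 'e \<Rightarrow> 'e) \<Rightarrow>
     ('e, 'm) quasi_chart \<Rightarrow> ('e \<times> 'e) set \<Rightarrow> ('e \<times> 'e \<Rightarrow> 'e) \<Rightarrow>
     ('e \<times> 'e \<Rightarrow> 'e \<times> 'e) \<Rightarrow> bool" where
  "chart_change_lift reg c C \<rho> c' C' \<rho>' F \<longleftrightarrow>
     submodel_cover reg c (chart_overlap c c') C \<rho> \<and>
     submodel_cover reg c' (chart_overlap c' c) C' \<rho>' \<and>
     model_iso_lift reg C \<rho> (group_orbit (chart_group c) \<circ> \<rho>)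
                        C' \<rho>' (group_orbit (chart_group c') \<circ> \<rho>') (chart_change c c') F"

definition charts_compatible ::
    "('e::euclidean_space set \<Rightarrow> ('e \<Rightarrow> 'e) \<Rightarrow> bool) \<Rightarrow>
     ('e, 'm) quasi_chart \<Rightarrow> ('e, 'm) quasi_chart \<Rightarrow> bool" where
  "charts_compatible reg c c' \<longleftrightarrow>
     (chart_image c \<inter> chart_image c' \<noteq> {} \<longrightarrow>
       (\<exists>C \<rho> C' \<rho>' F. chart_change_lift reg c C \<rho> c' C' \<rho>' F))"

definition quasifold_atlas ::
    "('e::euclidean_space set \<Rightarrow> ('e \<Rightarrow> 'e) \<Rightarrow> bool) \<Rightarrow> 'm topology \<Rightarrow>
     ('e, 'm) quasi_chart set \<Rightarrow> bool" where
  "quasifold_atlas reg M \<A> \<longleftrightarrow>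
     (\<forall>c\<in>\<A>. is_chart reg M c) \<and> (\<Union>c\<in>\<A>. chart_image c) = topspace M \<and>
     (\<forall>c\<in>\<A>. \<forall>c'\<in>\<A>. charts_compatible reg c c')"

definition quasifold ::
    "('e::euclidean_space set \<Rightarrow> ('e \<Rightarrow> 'e) \<Rightarrow> bool) \<Rightarrow> 'm topology \<Rightarrow>
     ('e, 'm) quasi_chart set \<Rightarrow> bool" where
  "quasifold reg M \<A> \<longleftrightarrow>
     quasifold_atlas reg M \<A> \<and> (\<forall>\<B>. quasifold_atlas reg M \<B> \<and> \<A> \<subseteq> \<B> \<longrightarrow> \<B> = \<A>)"

text \<open>\<open>F\<close> lifts a diffeomorphism \<open>h\<close> of the models of \<open>c\<close> and \<open>c'\<close> which represents \<open>f\<close>.\<close>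

definition diffeo_chart_lift ::
    "('e::euclidean_space, 'm) quasi_chart \<Rightarrow> ('e, 'k) quasi_chart \<Rightarrow> ('m \<Rightarrow> 'k) \<Rightarrow> ('e \<Rightarrow> 'e) \<Rightarrow> bool"
  where
  "diffeo_chart_lift c c' f F \<longleftrightarrow>
     (\<exists>h. model_iso_lift smooth_on
            (chart_dom c) id (group_orbit (chart_group c))
            (chart_dom c') id (group_orbit (chart_group c')) h F \<and>
          (\<forall>w\<in>chart_orbits c. chart_map c' (h w) = f (chart_map c w)))"

definition quasifold_diffeo ::
    "'m topology \<Rightarrow> ('e::euclidean_space, 'm) quasi_chart set \<Rightarrow>
     'k topology \<Rightarrow> ('e, 'k) quasi_chart set \<Rightarrow> ('m \<Rightarrow> 'k) \<Rightarrow> bool" where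
  "quasifold_diffeo M \<A> M' \<A>' f \<longleftrightarrow>
     quasifold smooth_on M \<A> \<and> quasifold smooth_on M' \<A>' \<and>
     continuous_map M M' f \<and> bij_betw f (topspace M) (topspace M') \<and>
     (\<forall>m\<in>topspace M. \<exists>c\<in>\<A>. \<exists>c'\<in>\<A>'. m \<in> chart_image c \<and> f m \<in> chart_image c' \<and>
        (\<exists>F. diffeo_chart_lift c c' f F))"


section \<open>Two-forms\<close>

type_synonym 'e two_form = "'e \<Rightarrow> 'e \<Rightarrow> 'e \<Rightarrow> real"

definition two_form_on :: "'e::euclidean_space set \<Rightarrow> 'e two_form \<Rightarrow> bool" where
  "two_form_on S \<omega> \<longleftrightarrow>
     (\<forall>x\<in>S. bilinear (\<omega> x) \<and> (\<forall>v. \<omega> x v v = 0)) \<and>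
     (\<forall>u v. smooth_on S (\<lambda>x. \<omega> x u v))"

definition closed_two_form_on :: "'e::euclidean_space set \<Rightarrow> 'e two_form \<Rightarrow> bool" where
  "closed_two_form_on S \<omega> \<longleftrightarrow>
     (\<forall>x\<in>S. \<forall>u v w.
        frechet_derivative (\<lambda>y. \<omega> y v w) (at x) u
        - frechet_derivative (\<lambda>y. \<omega> y u w) (at x) v
        + frechet_derivative (\<lambda>y. \<omega> y u v) (at x) w = 0)"

definition symplectic_on :: "'e::euclidean_space set \<Rightarrow> 'e two_form \<Rightarrow> bool" where
  "symplectic_on S \<omega> \<longleftrightarrow>
     two_form_on S \<omega> \<and> closed_two_form_on S \<omega> \<and>
     (\<forall>x\<in>S. \<forall>u. (\<forall>v. \<omega> x u v = 0) \<longrightarrow> u = 0)"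

definition kahler_on :: "(complex^'n) set \<Rightarrow> (complex^'n) two_form \<Rightarrow> bool" where
  "kahler_on S \<omega> \<longleftrightarrow>
     two_form_on S \<omega> \<and> closed_two_form_on S \<omega> \<and>
     (\<forall>x\<in>S. (\<forall>u v. \<omega> x (\<i> *s u) (\<i> *s v) = \<omega> x u v) \<and>
            (\<forall>u. u \<noteq> 0 \<longrightarrow> \<omega> x (\<i> *s u) u > 0))"

text \<open>
  The pullback of \<open>\<omega>'\<close> under \<open>F\<close> is \<open>\<omega>\<close>, where the forms on the manifolds \<open>(C, p)\<close> and \<open>(D, q)\<close> are
  those induced by the forms \<open>\<omega>\<close> and \<open>\<omega>'\<close> on \<open>p ` C\<close> and \<open>q ` D\<close>.
\<close>

definition pulls_back ::
    "'c::topological_space set \<Rightarrow> ('c \<Rightarrow> 'e::euclidean_space) \<Rightarrow>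
     ('b \<Rightarrow> 'e) \<Rightarrow> ('c \<Rightarrow> 'b) \<Rightarrow> 'e two_form \<Rightarrow> 'e two_form \<Rightarrow> bool" where
  "pulls_back C p q F \<omega>' \<omega> \<longleftrightarrow>
     (\<forall>x\<in>C. \<exists>T s. local_section C p x T s \<and>
        (\<forall>u v. \<omega> (p x) u v =
           \<omega>' (q (F x)) (frechet_derivative (q \<circ> F \<circ> s) (at (p x)) u)
                        (frechet_derivative (q \<circ> F \<circ> s) (at (p x)) v)))"

definition quasifold_two_form ::
    "('e::euclidean_space set \<Rightarrow> ('e \<Rightarrow> 'e) \<Rightarrow> bool) \<Rightarrow> 'm topology \<Rightarrow>
     ('e, 'm) quasi_chart set \<Rightarrow> (('e, 'm) quasi_chart \<Rightarrow> 'e two_form) \<Rightarrow> bool" where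
  "quasifold_two_form reg M \<C> \<omega> \<longleftrightarrow>
     quasifold_atlas reg M \<C> \<and>
     (\<forall>c\<in>\<C>. two_form_on (chart_dom c) (\<omega> c) \<and>
        (\<forall>g\<in>chart_group c. pulls_back (chart_dom c) id id g (\<omega> c) (\<omega> c))) \<and>
     (\<forall>c\<in>\<C>. \<forall>c'\<in>\<C>. chart_image c \<inter> chart_image c' \<noteq> {} \<longrightarrow>
        (\<exists>C \<rho> C' \<rho>' F. chart_change_lift reg c C \<rho> c' C' \<rho>' F \<and>
           pulls_back C \<rho> \<rho>' F (\<omega> c') (\<omega> c)))"

definition symplectic_form ::
    "'m topology \<Rightarrow> ('e::euclidean_space, 'm) quasi_chart set \<Rightarrow>
     (('e, 'm) quasi_chart \<Rightarrow> 'e two_form) \<Rightarrow> bool" where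
  "symplectic_form M \<C> \<omega> \<longleftrightarrow>
     quasifold_two_form smooth_on M \<C> \<omega> \<and> (\<forall>c\<in>\<C>. symplectic_on (chart_dom c) (\<omega> c))"

definition kahler_form ::
    "'m topology \<Rightarrow> (complex^'n, 'm) quasi_chart set \<Rightarrow>
     ((complex^'n, 'm) quasi_chart \<Rightarrow> (complex^'n) two_form) \<Rightarrow> bool" where
  "kahler_form M \<C> \<omega> \<longleftrightarrow>
     quasifold_two_form holomorphic_map_on M \<C> \<omega> \<and> (\<forall>c\<in>\<C>. kahler_on (chart_dom c) (\<omega> c))"

text \<open>\<open>(\<C>, \<omega>)\<close> is the pullback of the form \<open>(\<C>', \<omega>')\<close> under the diffeomorphism \<open>f\<close>.\<close>

definition is_pullback_form ::
    "('e::euclidean_space, 'm) quasi_chart set \<Rightarrow> (('e, 'm) quasi_chart \<Rightarrow> 'e two_form) \<Rightarrow>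
     ('e, 'k) quasi_chart set \<Rightarrow> (('e, 'k) quasi_chart \<Rightarrow> 'e two_form) \<Rightarrow> ('m \<Rightarrow> 'k) \<Rightarrow> bool" where
  "is_pullback_form \<C> \<omega> \<C>' \<omega>' f \<longleftrightarrow>
     (\<forall>c\<in>\<C>. \<forall>m\<in>chart_image c. \<exists>c'\<in>\<C>'. f m \<in> chart_image c' \<and>
        (\<exists>F. diffeo_chart_lift c c' f F \<and> pulls_back (chart_dom c) id id F (\<omega>' c') (\<omega> c)))"


section \<open>Polytope data\<close>

text \<open>
  The space \<open>\<dd>\<close> is a Euclidean space \<open>'a\<close>; its dual is identified with \<open>'a\<close> by the inner product,
  so that \<open>\<langle>\<mu>, Y\<rangle>\<close> is \<open>\<mu> \<bullet> Y\<close>. The complexification \<open>\<dd> + i\<dd>\<close> is \<open>'a \<times> 'a\<close>, with \<open>Q\<close> embedded in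
  the first factor.
\<close>

definition simple_polytope :: "'a::euclidean_space set \<Rightarrow> bool" where
  "simple_polytope P \<longleftrightarrow>
     polytope P \<and>
     (\<forall>v. v extreme_point_of P \<longrightarrow> int (card {E. E edge_of P \<and> v \<in> E}) = aff_dim P)"

definition quasilattice :: "'a::euclidean_space set \<Rightarrow> bool" where
  "quasilattice Q \<longleftrightarrow> (\<exists>B. span B = UNIV \<and> Q = group_closure B)"

definition face_index :: "('d \<Rightarrow> 'a::euclidean_space) \<Rightarrow> ('d \<Rightarrow> real) \<Rightarrow> 'a set \<Rightarrow> 'd set" where
  "face_index X lam F = {j. \<forall>\<mu>\<in>F. \<mu> \<bullet> X j = lam j}"

definition stratum :: "'d set \<Rightarrow> (complex^'d) set" where
  "stratum I = {z. \<forall>j. z $ j = 0 \<longleftrightarrow> j \<in> I}"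

definition C_Delta ::
    "'a::euclidean_space set \<Rightarrow> ('d::finite \<Rightarrow> 'a) \<Rightarrow> ('d \<Rightarrow> real) \<Rightarrow> (complex^'d) set" where
  "C_Delta \<Delta> X lam = (\<Union>F\<in>{F. F face_of \<Delta> \<and> F \<noteq> {}}. stratum (face_index X lam F))"

definition pi_map :: "('d::finite \<Rightarrow> 'a::euclidean_space) \<Rightarrow> real^'d \<Rightarrow> 'a" where
  "pi_map X x = (\<Sum>j\<in>UNIV. (x $ j) *\<^sub>R X j)"

definition piC_map :: "('d::finite \<Rightarrow> 'a::euclidean_space) \<Rightarrow> complex^'d \<Rightarrow> 'a \<times> 'a" where
  "piC_map X Z = (pi_map X (\<chi> j. Re (Z $ j)), pi_map X (\<chi> j. Im (Z $ j)))"

definition QC :: "'a::euclidean_space set \<Rightarrow> ('a \<times> 'a) set" where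
  "QC Q = (\<lambda>q. (q, 0)) ` Q"

definition complex_vec :: "real^'d \<Rightarrow> complex^'d" where
  "complex_vec x = (\<chi> j. complex_of_real (x $ j))"

text \<open>
  The class \<open>[Z]\<close> in the complex torus \<open>\<complex>\<^sup>d/\<int>\<^sup>d\<close>; the real torus is the set of classes of real vectors.
\<close>

definition torus_class :: "complex^'d \<Rightarrow> (complex^'d) set" where
  "torus_class Z = {Z'. \<forall>j. Z' $ j - Z $ j \<in> \<int>}"

definition N_group :: "('d::finite \<Rightarrow> 'a::euclidean_space) \<Rightarrow> 'a set \<Rightarrow> (complex^'d) set set" where
  "N_group X Q = {torus_class (complex_vec x) | x. pi_map X x \<in> Q}"

definition NC_group :: "('d::finite \<Rightarrow> 'a::euclidean_space) \<Rightarrow> 'a set \<Rightarrow> (complex^'d) set set" where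
  "NC_group X Q = {torus_class Z | Z. piC_map X Z \<in> QC Q}"

definition torus_act :: "complex^'d \<Rightarrow> complex^'d \<Rightarrow> complex^'d" where
  "torus_act Z z = (\<chi> j. exp (2 * complex_of_real pi * \<i> * Z $ j) * z $ j)"

definition torus_orbit :: "(complex^'d) set set \<Rightarrow> complex^'d \<Rightarrow> (complex^'d) set" where
  "torus_orbit H z = {torus_act Z z | Z. torus_class Z \<in> H}"

definition n_space :: "('d::finite \<Rightarrow> 'a::euclidean_space) \<Rightarrow> (real^'d) set" where
  "n_space X = {x. pi_map X x = 0}"

definition J_map :: "('d::finite \<Rightarrow> real) \<Rightarrow> complex^'d \<Rightarrow> real^'d \<Rightarrow> real" where
  "J_map lam z = (\<lambda>x. \<Sum>j\<in>UNIV. ((cmod (z $ j))\<^sup>2 + lam j) * x $ j)"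

text \<open>Elements of the dual of \<open>\<nn>\<close> are functions restricted to \<open>\<nn>\<close>, and \<open>\<iota>\<^sup>*\<close> is restriction.\<close>

definition Psi_map ::
    "('d::finite \<Rightarrow> 'a::euclidean_space) \<Rightarrow> ('d \<Rightarrow> real) \<Rightarrow> complex^'d \<Rightarrow> real^'d \<Rightarrow> real" where
  "Psi_map X lam z = restrict (J_map lam z) (n_space X)"

definition Psi_zero ::
    "('d::finite \<Rightarrow> 'a::euclidean_space) \<Rightarrow> ('d \<Rightarrow> real) \<Rightarrow> (complex^'d) set" where
  "Psi_zero X lam = {z. Psi_map X lam z = (\<lambda>x\<in>n_space X. 0)}"

definition symplectic_quotient ::
    "('d::finite \<Rightarrow> 'a::euclidean_space) \<Rightarrow> ('d \<Rightarrow> real) \<Rightarrow> 'a set \<Rightarrow> (complex^'d) set topology" where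
  "symplectic_quotient X lam Q =
     quotient_topology (top_of_set (Psi_zero X lam)) (torus_orbit (N_group X Q))"

definition complex_quotient ::
    "'a::euclidean_space set \<Rightarrow> ('d::finite \<Rightarrow> 'a) \<Rightarrow> ('d \<Rightarrow> real) \<Rightarrow> 'a set \<Rightarrow>
     (complex^'d) set topology" where
  "complex_quotient \<Delta> X lam Q =
     quotient_topology (top_of_set (C_Delta \<Delta> X lam)) (torus_orbit (NC_group X Q))"

definition chi_map ::
    "('d::finite \<Rightarrow> 'a::euclidean_space) \<Rightarrow> 'a set \<Rightarrow> (complex^'d) set \<Rightarrow> (complex^'d) set" where
  "chi_map X Q orb = the_elem (torus_orbit (NC_group X Q) ` orb)"


section \<open>The quasitorus actions\<close>

definition quasitorus :: "'a::euclidean_space set \<Rightarrow> 'a set set" where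
  "quasitorus Q = range (\<lambda>Y. (\<lambda>q. Y + q) ` Q)"

definition quasitorus_incl :: "'a::euclidean_space set \<Rightarrow> ('a \<times> 'a) set" where
  "quasitorus_incl t = (\<lambda>Y. (Y, 0)) ` t"

text \<open>
  The element \<open>t\<close> of \<open>\<dd>/Q\<close> corresponds to the coset of \<open>N\<close> formed by all \<open>[x]\<close> in the torus with
  \<open>\<Pi>([x]) = t\<close>, and it sends the orbit \<open>N \<cdot> z\<close> to the set of all \<open>[x] \<cdot> z'\<close> with \<open>[x]\<close> in that coset and
  \<open>z'\<close> in \<open>N \<cdot> z\<close>; similarly in the complex case.
\<close>

definition quasitorus_act ::
    "('d::finite \<Rightarrow> 'a::euclidean_space) \<Rightarrow> 'a set \<Rightarrow> (complex^'d) set \<Rightarrow> (complex^'d) set" where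
  "quasitorus_act X t orb = {torus_act (complex_vec x) z | x z. pi_map X x \<in> t \<and> z \<in> orb}"

definition complex_quasitorus_act ::
    "('d::finite \<Rightarrow> 'a::euclidean_space) \<Rightarrow> ('a \<times> 'a) set \<Rightarrow> (complex^'d) set \<Rightarrow> (complex^'d) set" where
  "complex_quasitorus_act X t orb = {torus_act Z z | Z z. piC_map X Z \<in> t \<and> z \<in> orb}"


section \<open>The charts\<close>

text \<open>
  An injective enumeration \<open>r\<close> of the index set \<open>I = range r\<close> of a vertex identifies \<open>\<complex>\<^sup>n\<close> with the
  coordinate subspace of \<open>\<complex>\<^sup>d\<close> given by the coordinates in \<open>I\<close>.
\<close>

definition embed_coords :: "('n::finite \<Rightarrow> 'd::finite) \<Rightarrow> complex^'n \<Rightarrow> complex^'d" where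
  "embed_coords r w = (\<chi> j. if j \<in> range r then w $ (inv_into UNIV r j) else 0)"

definition select_coords :: "('n::finite \<Rightarrow> 'd::finite) \<Rightarrow> complex^'d \<Rightarrow> complex^'n" where
  "select_coords r z = (\<chi> k. z $ r k)"

definition SC_group :: "'d set \<Rightarrow> (complex^'d) set set" where
  "SC_group I = {torus_class Z | Z. \<forall>j. j \<notin> I \<longrightarrow> Z $ j \<in> \<int>}"

definition Gamma_group ::
    "('d::finite \<Rightarrow> 'a::euclidean_space) \<Rightarrow> 'a set \<Rightarrow> ('n::finite \<Rightarrow> 'd) \<Rightarrow> (complex^'n) set \<Rightarrow>
     (complex^'n \<Rightarrow> complex^'n) set" where
  "Gamma_group X Q r V =
     {restrict (\<lambda>w. select_coords r (torus_act Z (embed_coords r w))) V | Z.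
        torus_class Z \<in> NC_group X Q \<inter> SC_group (range r)}"

definition vertex_enums ::
    "'a::euclidean_space set \<Rightarrow> ('d \<Rightarrow> 'a) \<Rightarrow> ('d \<Rightarrow> real) \<Rightarrow> ('n::finite \<Rightarrow> 'd) set" where
  "vertex_enums \<Delta> X lam =
     {r. \<exists>\<mu>. \<mu> extreme_point_of \<Delta> \<and> bij_betw r UNIV (face_index X lam {\<mu>})}"

definition z_vertex :: "'d set \<Rightarrow> complex^'d" where
  "z_vertex I = (\<chi> j. if j \<in> I then 0 else 1)"

definition complex_chart ::
    "('d::finite \<Rightarrow> 'a::euclidean_space) \<Rightarrow> 'a set \<Rightarrow> ('n::finite \<Rightarrow> 'd) \<Rightarrow>
     (complex^'n, (complex^'d) set) quasi_chart" where
  "complex_chart X Q r =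
     \<lparr>chart_dom = UNIV,
      chart_group = Gamma_group X Q r UNIV,
      chart_map = (\<lambda>orb. the_elem
        ((\<lambda>w. torus_orbit (NC_group X Q) (z_vertex (range r) + embed_coords r w)) ` orb))\<rparr>"

text \<open>
  The coefficient \<open>a\<^sub>j\<^sub>h\<close> of \<open>X\<^sub>j\<close> in the expansion of \<open>X\<^sub>h\<close> in the basis formed by the \<open>X\<^sub>i\<close>, \<open>i \<in> I\<close>, is
  \<open>representation (X ` I) (X h) (X j)\<close>.
\<close>

definition slack ::
    "('d::finite \<Rightarrow> 'a::euclidean_space) \<Rightarrow> ('d \<Rightarrow> real) \<Rightarrow> 'd set \<Rightarrow> complex^'d \<Rightarrow> 'd \<Rightarrow> real" where
  "slack X lam I w h =
     (\<Sum>j\<in>I. representation (X ` I) (X h) (X j) * ((cmod (w $ j))\<^sup>2 + lam j)) - lam h"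

definition w_vertex ::
    "('d::finite \<Rightarrow> 'a::euclidean_space) \<Rightarrow> ('d \<Rightarrow> real) \<Rightarrow> 'd set \<Rightarrow> complex^'d \<Rightarrow> complex^'d" where
  "w_vertex X lam I w = (\<chi> h. if h \<in> I then 0 else complex_of_real (sqrt (slack X lam I w h)))"

definition U_tilde ::
    "('d::finite \<Rightarrow> 'a::euclidean_space) \<Rightarrow> ('d \<Rightarrow> real) \<Rightarrow> ('n::finite \<Rightarrow> 'd) \<Rightarrow> (complex^'n) set" where
  "U_tilde X lam r = {w. \<forall>h. h \<notin> range r \<longrightarrow> slack X lam (range r) (embed_coords r w) h > 0}"

definition symplectic_chart ::
    "('d::finite \<Rightarrow> 'a::euclidean_space) \<Rightarrow> ('d \<Rightarrow> real) \<Rightarrow> 'a set \<Rightarrow> ('n::finite \<Rightarrow> 'd) \<Rightarrow>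
     (complex^'n, (complex^'d) set) quasi_chart" where
  "symplectic_chart X lam Q r =
     \<lparr>chart_dom = U_tilde X lam r,
      chart_group = Gamma_group X Q r (U_tilde X lam r),
      chart_map = (\<lambda>orb. the_elem
        ((\<lambda>w. torus_orbit (N_group X Q)
           (w_vertex X lam (range r) (embed_coords r w) + embed_coords r w)) ` orb))\<rparr>"

definition complex_charts ::
    "'a::euclidean_space set \<Rightarrow> ('d::finite \<Rightarrow> 'a) \<Rightarrow> ('d \<Rightarrow> real) \<Rightarrow> 'a set \<Rightarrow>
     (complex^'n::finite, (complex^'d) set) quasi_chart set" where
  "complex_charts \<Delta> X lam Q = complex_chart X Q ` vertex_enums \<Delta> X lam"

definition symplectic_charts ::
    "'a::euclidean_space set \<Rightarrow> ('d::finite \<Rightarrow> 'a) \<Rightarrow> ('d \<Rightarrow> real) \<Rightarrow> 'a set \<Rightarrow>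
     (complex^'n::finite, (complex^'d) set) quasi_chart set" where
  "symplectic_charts \<Delta> X lam Q = symplectic_chart X lam Q ` vertex_enums \<Delta> X lam"

text \<open>
  The form \<open>(1/2\<pi>i) \<Sum> dw\<^sub>k \<and> d\<bar>w\<^sub>k\<close>, evaluated with \<open>(\<alpha> \<and> \<beta>)(u, v) = \<alpha>(u) \<beta>(v) - \<alpha>(v) \<beta>(u)\<close>. The
  sum is purely imaginary, so taking the real part only changes the type.
\<close>

definition standard_form :: "(complex^'n) two_form" where
  "standard_form x u v =
     Re (1 / (2 * complex_of_real pi * \<i>) *
         (\<Sum>k\<in>UNIV. u $ k * cnj (v $ k) - v $ k * cnj (u $ k)))"

end

theory Submission
  imports Defs
begin

text \<open>
  Both quotients are glued from slices: over a vertex with index set \<open>I\<close> every orbit meets the set of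
  points whose coordinates outside \<open>I\<close> are normalised (equal to 1, respectively positive), and simplicity
  makes the normals \<open>X\<^sub>j\<close>, \<open>j \<in> I\<close>, a basis, so that an element of \<open>\<nn>\<close> is determined by its coordinates
  outside \<open>I\<close>. Passing to logarithms of the coordinates in \<open>I - I'\<close> gives the universal cover of an
  overlap and turns the chart changes into explicit formulas.

  An \<open>N\<^sub>\<complex>\<close>-orbit in \<open>\<complex>\<^sup>d\<^sub>\<Delta>\<close> meets the zero level of \<open>\<Psi>\<close> in one \<open>N\<close>-orbit, since the zero level consists of
  the critical points of a strictly convex and proper function along \<open>\<nn>\<close>. In the charts of a vertex \<open>\<chi>\<close>
  lifts to \<open>F\<^sub>k(w) = w\<^sub>k \<Prod>\<^sub>h slack\<^sub>h(w)\<^bsup>a\<^sub>k\<^sub>h/2\<^esup>\<close>, whose derivative is a complex diagonal matrix times \<open>1 + T\<close>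
  with \<open>T\<close> symmetric, positive semidefinite and \<open>T \<i> T = 0\<close>; this makes \<open>F\<close> a diffeomorphism and the
  transported form Kaehler.
\<close>

section \<open>Calculus of smooth maps\<close>

text \<open>The obstacle is the definition of a submodel: the preimage of an overlap is a Reinhardt
  domain minus coordinate hyperplanes, in general not simply connected, so each chart change must be
  lifted to universal covers together with the full group of lifts. In logarithms the cover is a
  contractible open set, because the slack inequalities are affine in the squared moduli; the group
  of lifts follows from uniqueness of lifts and has the same angle vectors as the original group,
  since \<open>Q\<close> contains the normals. Both quotients are instances of one locale with a
  parameter \<open>\<kappa>\<close>: exponents are purely imaginary for \<open>\<kappa> = 0\<close>
  (the group \<open>N_group\<close> on the zero level) and arbitrary for \<open>\<kappa> = 1\<close>
  (the group \<open>NC_group\<close>). The form on the complex side is defined chart by chart,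
  pulling \<open>standard_form\<close> back along the inverse of the lift F. That these forms agree
  on overlaps is not computed from the holomorphic chart changes: carried to the zero level, a chart
  change becomes a rotation with angles in the kernel of \<open>pi_map\<close>, and such rotations
  preserve the restricted form.\<close>

lemma has_derivative_frechet:
  "f differentiable (at x) \<Longrightarrow> (f has_derivative frechet_derivative f (at x)) (at x)"
  by (simp add: frechet_derivative_works)

lemma frechet_derivative_cong_open:
  assumes "open S" "x \<in> S" "\<And>x. x \<in> S \<Longrightarrow> f x = g x"
  shows "frechet_derivative f (at x) = frechet_derivative g (at x)"
proof -
  have "(f has_derivative D) (at x) \<longleftrightarrow> (g has_derivative D) (at x)" for D
    using has_derivative_transform_within_open[of f D x UNIV S g]
      has_derivative_transform_within_open[of g D x UNIV S f] assms by auto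
  then show ?thesis by (simp add: frechet_derivative_def)
qed

lemma Ck_on_cong:
  assumes "open S" "\<And>x. x \<in> S \<Longrightarrow> f x = g x" "Ck_on k S f"
  shows "Ck_on k S g"
  using assms(2,3)
proof (induction k arbitrary: f g)
  case 0
  then show ?case using continuous_on_cong by fastforce
next
  case (Suc k)
  have "g differentiable (at x)" if "x \<in> S" for x
    using Suc.prems that \<open>open S\<close> has_derivative_transform_within_open[of f _ x UNIV S g]
    by (fastforce simp: differentiable_def)
  moreover have "Ck_on k S (\<lambda>x. frechet_derivative g (at x) v)" for v
    by (rule Suc.IH[of "\<lambda>x. frechet_derivative f (at x) v"])
       (use Suc.prems frechet_derivative_cong_open[OF \<open>open S\<close>, of _ f g] in auto)
  ultimately show ?case by simp
qed

text \<open>\<open>Ck_on\<close> recurses through \<open>frechet_derivative\<close>, a choice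
  operator that does not compute. This rule trades it for an explicit family \<open>f'\<close>, and
  most closure properties below are inductions on \<open>k\<close> through it.\<close>

lemma Ck_on_Suc_derivativeI:
  assumes "\<And>x. x \<in> S \<Longrightarrow> (f has_derivative f' x) (at x)"
    and "\<And>v. Ck_on k S (\<lambda>x. f' x v)" and "open S"
  shows "Ck_on (Suc k) S f"
proof -
  have "f' x = frechet_derivative f (at x)" if "x \<in> S" for x
    using assms(1)[OF that] by (rule frechet_derivative_at)
  then have "Ck_on k S (\<lambda>x. frechet_derivative f (at x) v)" for v
    by (intro Ck_on_cong[OF assms(3) _ assms(2)[of v]]) auto
  then show ?thesis using assms(1) by (auto simp: differentiable_def)
qed

lemma Ck_on_derivative:
  "Ck_on (Suc k) S f \<Longrightarrow> x \<in> S \<Longrightarrow> (f has_derivative frechet_derivative f (at x)) (at x)"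
  by (simp add: has_derivative_frechet)

lemma Ck_on_Suc_imp: "Ck_on (Suc k) S f \<Longrightarrow> Ck_on k S f"
proof (induction k arbitrary: f)
  case 0
  then show ?case
    by (auto intro!: differentiable_imp_continuous_on differentiable_at_imp_differentiable_on)
qed auto

lemma Ck_on_continuous: "Ck_on k S f \<Longrightarrow> continuous_on S f"
  by (induction k) (auto dest: Ck_on_Suc_imp simp del: Ck_on.simps(2))

lemma Ck_on_subset: "Ck_on k S f \<Longrightarrow> T \<subseteq> S \<Longrightarrow> Ck_on k T f"
  by (induction k arbitrary: f) (auto intro: continuous_on_subset)

lemma Ck_on_const: "open S \<Longrightarrow> Ck_on k S (\<lambda>x. c)"
proof (induction k arbitrary: c)
  case (Suc k)
  show ?case by (rule Ck_on_Suc_derivativeI[where f'="\<lambda>x v. 0"]) (use Suc in auto)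
qed auto

lemma Ck_on_bounded_linear: "open S \<Longrightarrow> bounded_linear L \<Longrightarrow> Ck_on k S L"
proof (cases k)
  case 0 then show "bounded_linear L \<Longrightarrow> ?thesis" by (simp add: linear_continuous_on)
next
  case (Suc m)
  show "open S \<Longrightarrow> bounded_linear L \<Longrightarrow> ?thesis" unfolding Suc
    by (rule Ck_on_Suc_derivativeI[where f'="\<lambda>x. L"])
      (auto intro: Ck_on_const bounded_linear_imp_has_derivative)
qed

lemma Ck_on_linear_comp:
  assumes "open S" "bounded_linear L" "Ck_on k S f"
  shows "Ck_on k S (\<lambda>x. L (f x))"
  using assms(3)
proof (induction k arbitrary: f)
  case 0
  then show ?case using assms(2) by (simp add: bounded_linear.continuous_on)
next
  case (Suc k)
  show ?case
  proof (rule Ck_on_Suc_derivativeI[where f'="\<lambda>x v. L (frechet_derivative f (at x) v)"])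
    show "((\<lambda>x. L (f x)) has_derivative (\<lambda>v. L (frechet_derivative f (at x) v))) (at x)" if "x \<in> S" for x
      using Ck_on_derivative[OF Suc.prems that] assms(2) by (rule bounded_linear.has_derivative[rotated])
    show "Ck_on k S (\<lambda>x. L (frechet_derivative f (at x) v))" for v
      using Suc.prems by (intro Suc.IH) simp
  qed (rule assms)
qed

lemma Ck_on_add:
  assumes "open S" "Ck_on k S f" "Ck_on k S g"
  shows "Ck_on k S (\<lambda>x. f x + g x)"
  using assms(2,3)
proof (induction k arbitrary: f g)
  case 0
  then show ?case by (simp add: continuous_on_add)
next
  case (Suc k)
  show ?case
  proof (rule Ck_on_Suc_derivativeI[where
          f'="\<lambda>x v. frechet_derivative f (at x) v + frechet_derivative g (at x) v"])
    show "((\<lambda>x. f x + g x) has_derivative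
        (\<lambda>v. frechet_derivative f (at x) v + frechet_derivative g (at x) v)) (at x)" if "x \<in> S" for x
      using Suc.prems that by (intro has_derivative_add Ck_on_derivative)
    show "Ck_on k S (\<lambda>x. frechet_derivative f (at x) v + frechet_derivative g (at x) v)" for v
      using Suc.prems by (intro Suc.IH) simp_all
  qed (rule assms)
qed

lemma Ck_on_sum:
  assumes "open S" "\<And>i. i \<in> I \<Longrightarrow> Ck_on k S (f i)"
  shows "Ck_on k S (\<lambda>x. \<Sum>i\<in>I. f i x)"
  using assms by (induction I rule: infinite_finite_induct) (auto intro: Ck_on_const Ck_on_add)

lemma Ck_on_bilinear:
  assumes "open S" "bounded_bilinear pr" "Ck_on k S f" "Ck_on k S g"
  shows "Ck_on k S (\<lambda>x. pr (f x) (g x))"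
  using assms(3,4)
proof (induction k arbitrary: f g)
  case 0
  then show ?case using assms(2) by (simp add: bounded_bilinear.continuous_on)
next
  case (Suc k)
  show ?case
  proof (rule Ck_on_Suc_derivativeI[where
          f'="\<lambda>x v. pr (f x) (frechet_derivative g (at x) v) + pr (frechet_derivative f (at x) v) (g x)"])
    show "((\<lambda>x. pr (f x) (g x)) has_derivative
      (\<lambda>v. pr (f x) (frechet_derivative g (at x) v) + pr (frechet_derivative f (at x) v) (g x))) (at x)"
      if "x \<in> S" for x
      using that Suc.prems by (intro bounded_bilinear.FDERIV[OF assms(2)] Ck_on_derivative)
    show "Ck_on k S (\<lambda>x. pr (f x) (frechet_derivative g (at x) v) + pr (frechet_derivative f (at x) v) (g x))"
      for v
      using Suc.prems Ck_on_Suc_imp[OF Suc.prems(1)] Ck_on_Suc_imp[OF Suc.prems(2)]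
      by (intro Ck_on_add assms(1) Suc.IH) simp_all
  qed (rule assms)
qed

text \<open>\<open>Ck_on\<close> controls derivatives only in a fixed direction, whereas the chain
  rule feeds the derivative of \<open>g\<close> the moving direction
  \<open>frechet_derivative f (at x) v\<close>. Expanding that direction in \<open>Basis\<close>
  leaves products of scalar coefficients with derivatives of \<open>g\<close> in fixed directions,
  to which the induction hypothesis applies.\<close>

lemma Ck_on_compose:
  fixes f :: "'e::real_normed_vector \<Rightarrow> 'f::euclidean_space" and g :: "'f \<Rightarrow> 'g::real_normed_vector"
  assumes "open S" "open T" "f ` S \<subseteq> T" "Ck_on k S f" "Ck_on k T g"
  shows "Ck_on k S (\<lambda>x. g (f x))"
  using assms(4,5)
proof (induction k arbitrary: g)
  case 0
  then show ?case using assms(3) by (auto intro: continuous_on_compose2)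
next
  case (Suc k)
  show ?case
  proof (rule Ck_on_Suc_derivativeI[where
        f'="\<lambda>x v. \<Sum>b\<in>Basis. (frechet_derivative f (at x) v \<bullet> b) *\<^sub>R frechet_derivative g (at (f x)) b"])
    fix x assume x: "x \<in> S"
    then have fx: "f x \<in> T" using assms by auto
    have df: "(f has_derivative frechet_derivative f (at x)) (at x)"
      using Suc.prems(1) x by (rule Ck_on_derivative)
    have dg: "(g has_derivative frechet_derivative g (at (f x))) (at (f x))"
      using Suc.prems(2) fx by (rule Ck_on_derivative)
    then have lin: "linear (frechet_derivative g (at (f x)))"
      by (simp add: has_derivative_linear)
    have rep: "frechet_derivative g (at (f x)) u = (\<Sum>b\<in>Basis. (u \<bullet> b) *\<^sub>R frechet_derivative g (at (f x)) b)" for u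
      using linear_sum[OF lin, of "\<lambda>b. (u \<bullet> b) *\<^sub>R b" Basis] lin
      by (simp add: euclidean_representation linear_cmul)
    have "((\<lambda>x. g (f x)) has_derivative
        (\<lambda>v. frechet_derivative g (at (f x)) (frechet_derivative f (at x) v))) (at x)"
      using diff_chain_at[OF df dg] by (simp add: o_def)
    then show "((\<lambda>x. g (f x)) has_derivative (\<lambda>v. \<Sum>b\<in>Basis. (frechet_derivative f (at x) v \<bullet> b) *\<^sub>R
        frechet_derivative g (at (f x)) b)) (at x)"
      by (rule has_derivative_eq_rhs) (intro ext rep)
  next
    fix v
    show "Ck_on k S (\<lambda>x. \<Sum>b\<in>Basis. (frechet_derivative f (at x) v \<bullet> b) *\<^sub>R
        frechet_derivative g (at (f x)) b)"
      using Suc.prems Ck_on_Suc_imp[OF Suc.prems(1)] assms(1)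
      by (intro Ck_on_sum Ck_on_bilinear[OF _ bounded_bilinear_scaleR]
          Ck_on_linear_comp[OF _ bounded_linear_inner_left] Suc.IH) auto
  qed (use assms in auto)
qed

lemma smooth_onI: "(\<And>k. Ck_on k S f) \<Longrightarrow> smooth_on S f" by (simp add: smooth_on_def)
lemma smooth_onD: "smooth_on S f \<Longrightarrow> Ck_on k S f" by (simp add: smooth_on_def)

lemma smooth_on_cong:
  "open S \<Longrightarrow> (\<And>x. x \<in> S \<Longrightarrow> f x = g x) \<Longrightarrow> smooth_on S f \<Longrightarrow> smooth_on S g"
  by (auto simp: smooth_on_def intro: Ck_on_cong)

lemma smooth_on_differentiable: "smooth_on S f \<Longrightarrow> x \<in> S \<Longrightarrow> f differentiable (at x)"
  using smooth_onD[of S f 1] by simp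

lemma smooth_on_continuous: "smooth_on S f \<Longrightarrow> continuous_on S f"
  using smooth_onD[of S f 0] by simp

lemma smooth_on_derivative:
  "smooth_on S f \<Longrightarrow> smooth_on S (\<lambda>x. frechet_derivative f (at x) v)"
  using smooth_onD[of S f "Suc _"] by (intro smooth_onI) auto

lemma smooth_on_subset: "smooth_on S f \<Longrightarrow> T \<subseteq> S \<Longrightarrow> smooth_on T f"
  by (auto simp: smooth_on_def intro: Ck_on_subset)

lemma smooth_on_const: "open S \<Longrightarrow> smooth_on S (\<lambda>x. c)"
  by (simp add: smooth_on_def Ck_on_const)

lemma smooth_on_bounded_linear: "open S \<Longrightarrow> bounded_linear L \<Longrightarrow> smooth_on S L"
  by (simp add: smooth_on_def Ck_on_bounded_linear)

lemma smooth_on_linear_comp: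
  "open S \<Longrightarrow> bounded_linear L \<Longrightarrow> smooth_on S f \<Longrightarrow> smooth_on S (\<lambda>x. L (f x))"
  by (simp add: smooth_on_def Ck_on_linear_comp)

lemma smooth_on_add: "open S \<Longrightarrow> smooth_on S f \<Longrightarrow> smooth_on S g \<Longrightarrow> smooth_on S (\<lambda>x. f x + g x)"
  by (simp add: smooth_on_def Ck_on_add)

lemma smooth_on_sum:
  "open S \<Longrightarrow> (\<And>i. i \<in> I \<Longrightarrow> smooth_on S (f i)) \<Longrightarrow> smooth_on S (\<lambda>x. \<Sum>i\<in>I. f i x)"
  by (simp add: smooth_on_def Ck_on_sum)

lemma smooth_on_bilinear:
  "open S \<Longrightarrow> bounded_bilinear pr \<Longrightarrow> smooth_on S f \<Longrightarrow> smooth_on S g \<Longrightarrow>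
   smooth_on S (\<lambda>x. pr (f x) (g x))"
  by (simp add: smooth_on_def Ck_on_bilinear)

lemma smooth_on_mult:
  fixes f g :: "'e::real_normed_vector \<Rightarrow> 'f::real_normed_algebra"
  shows "open S \<Longrightarrow> smooth_on S f \<Longrightarrow> smooth_on S g \<Longrightarrow> smooth_on S (\<lambda>x. f x * g x)"
  by (rule smooth_on_bilinear[OF _ bounded_bilinear_mult])

lemma smooth_on_compose:
  fixes f :: "'e::real_normed_vector \<Rightarrow> 'f::euclidean_space"
  shows "open S \<Longrightarrow> open T \<Longrightarrow> f ` S \<subseteq> T \<Longrightarrow> smooth_on S f \<Longrightarrow> smooth_on T g \<Longrightarrow>
   smooth_on S (\<lambda>x. g (f x))"
  using Ck_on_compose[of S T f _ g] by (simp add: smooth_on_def)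

lemma smooth_on_vec:
  fixes f :: "'e::real_normed_vector \<Rightarrow> 'f::euclidean_space ^ 'n"
  assumes "open S" "\<And>k. smooth_on S (\<lambda>x. f x $ k)"
  shows "smooth_on S f"
proof -
  have lin: "bounded_linear (axis k :: 'f \<Rightarrow> 'f ^ 'n)" for k
    by (auto simp: linear_conv_bounded_linear[symmetric] axis_def vec_eq_iff intro!: linearI)
  have "f x = (\<Sum>k\<in>UNIV. axis k (f x $ k))" for x
    by (simp add: vec_eq_iff axis_def)
  then have "smooth_on S f \<longleftrightarrow> smooth_on S (\<lambda>x. \<Sum>k\<in>UNIV. axis k (f x $ k))" by simp
  also have "\<dots>" using assms by (intro smooth_on_sum smooth_on_linear_comp[OF _ lin])
  finally show ?thesis .
qed

lemma Ck_on_exp: "Ck_on k UNIV (exp :: 'f::{real_normed_field,banach} \<Rightarrow> 'f)"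
proof (induction k)
  case (Suc k)
  show ?case
  proof (rule Ck_on_Suc_derivativeI[where f'="\<lambda>x v. exp x * v"])
    show "(exp has_derivative (*) (exp x)) (at x)" for x :: 'f
      using DERIV_exp[of x] by (simp add: has_field_derivative_def)
    show "Ck_on k UNIV (\<lambda>x::'f. exp x * v)" for v
      by (rule Ck_on_bilinear[OF _ bounded_bilinear_mult Suc Ck_on_const]) auto
  qed auto
qed (simp add: continuous_on_exp)

lemma smooth_on_exp:
  fixes f :: "'e::real_normed_vector \<Rightarrow> 'f::{real_normed_field,banach,euclidean_space}"
  shows "open S \<Longrightarrow> smooth_on S f \<Longrightarrow> smooth_on S (\<lambda>x. exp (f x))"
  by (rule smooth_on_compose[of S UNIV f exp]) (auto intro: smooth_onI Ck_on_exp)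

lemma Ck_on_inverse:
  "Ck_on k (- {0}) (inverse :: 'f::real_normed_field \<Rightarrow> 'f)"
proof (induction k)
  case (Suc k)
  show ?case
  proof (rule Ck_on_Suc_derivativeI[where f'="\<lambda>x v. (inverse x * inverse x) * (- v)"])
    show "(inverse has_derivative (\<lambda>v. (inverse x * inverse x) * (- v))) (at x)" if "x \<in> - {0}" for x :: 'f
      using has_derivative_inverse'[of x UNIV] that by (simp add: mult_ac)
    show "Ck_on k (- {0}) (\<lambda>x::'f. (inverse x * inverse x) * (- v))" for v
      by (intro Ck_on_bilinear[OF _ bounded_bilinear_mult] Suc Ck_on_const) auto
  qed auto
qed (auto intro!: continuous_intros)

text \<open>Serves the real \<open>ln\<close> and the complex \<open>Ln\<close> on the slit plane at
  once: only the derivative \<open>inverse\<close> matters, and one order of differentiability is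
  gained over \<open>Ck_on_inverse\<close>.\<close>

lemma Ck_on_antiderivative:
  fixes f :: "'f::real_normed_field \<Rightarrow> 'f"
  assumes "open S" "\<And>x. x \<in> S \<Longrightarrow> (f has_field_derivative inverse x) (at x)" "0 \<notin> S"
  shows "Ck_on k S f"
proof -
  have "Ck_on (Suc k) S f" for k
  proof (rule Ck_on_Suc_derivativeI[where f'="\<lambda>x v. inverse x * v"])
    show "(f has_derivative (*) (inverse x)) (at x)" if "x \<in> S" for x
      using assms(2)[OF that] by (simp add: has_field_derivative_def)
    have "Ck_on k S (inverse :: 'f \<Rightarrow> 'f)"
      by (rule Ck_on_subset[OF Ck_on_inverse]) (use assms in auto)
    then show "Ck_on k S (\<lambda>x. inverse x * v)" for v
      by (intro Ck_on_bilinear[OF _ bounded_bilinear_mult] Ck_on_const) (use assms in auto)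
  qed (use assms in auto)
  then show ?thesis by (blast intro: Ck_on_Suc_imp)
qed

lemma smooth_on_ln:
  fixes f :: "'e::real_normed_vector \<Rightarrow> real"
  assumes "open S" "smooth_on S f" "\<And>x. x \<in> S \<Longrightarrow> f x > 0"
  shows "smooth_on S (\<lambda>x. ln (f x))"
  by (rule smooth_on_compose[of S "{0<..}" f ln])
     (use assms in \<open>auto intro!: smooth_onI Ck_on_antiderivative derivative_eq_intros simp: field_simps\<close>)

lemma smooth_on_Ln:
  fixes f :: "'e::real_normed_vector \<Rightarrow> complex"
  assumes "open S" "smooth_on S f" "\<And>x. x \<in> S \<Longrightarrow> f x \<notin> \<real>\<^sub>\<le>\<^sub>0"
  shows "smooth_on S (\<lambda>x. Ln (f x))"
  by (rule smooth_on_compose[of S "- \<real>\<^sub>\<le>\<^sub>0" f Ln])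
     (use assms in \<open>auto intro!: smooth_onI Ck_on_antiderivative has_field_derivative_Ln
        simp: open_Compl\<close>)

lemma smooth_on_sqrt:
  fixes f :: "'e::real_normed_vector \<Rightarrow> real"
  assumes "open S" "smooth_on S f" "\<And>x. x \<in> S \<Longrightarrow> f x > 0"
  shows "smooth_on S (\<lambda>x. sqrt (f x))"
proof (rule smooth_on_cong[OF assms(1)])
  show "smooth_on S (\<lambda>x. exp ((1/2) *\<^sub>R ln (f x)))"
    using assms by (intro smooth_on_exp smooth_on_linear_comp[OF _ bounded_linear_scaleR_right] smooth_on_ln) auto
  fix x assume "x \<in> S"
  then have "f x > 0" using assms by auto
  moreover have "(exp ((1/2) *\<^sub>R ln (f x)))\<^sup>2 = exp (ln (f x))"
    by (simp add: power2_eq_square flip: exp_add)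
  ultimately show "exp ((1/2) *\<^sub>R ln (f x)) = sqrt (f x)"
    by (metis exp_ln exp_ge_zero real_sqrt_unique)
qed

section \<open>Smoothness of inverse maps\<close>

lemma has_derivative_scaleR_vanishing:
  fixes \<phi> :: "'e::real_normed_vector \<Rightarrow> real" and \<psi> :: "'e \<Rightarrow> 'f::real_normed_vector"
  assumes d: "(\<phi> has_derivative \<phi>') (at a)" and "\<phi> a = 0" and c: "continuous (at a) \<psi>"
  shows "((\<lambda>x. \<phi> x *\<^sub>R \<psi> x) has_derivative (\<lambda>u. \<phi>' u *\<^sub>R \<psi> a)) (at a)"
proof -
  have bl: "bounded_linear \<phi>'" using d by (rule has_derivative_bounded_linear)
  obtain K where K: "\<And>u. norm (\<phi>' u) \<le> norm u * K"
    using bounded_linear.bounded[OF bl] by blast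
  have lim: "((\<lambda>h. norm (\<phi> (a + h) - \<phi>' h) / norm h) \<longlongrightarrow> 0) (at 0)"
    using d \<open>\<phi> a = 0\<close> by (simp add: has_derivative_at)
  have \<psi>: "((\<lambda>h. \<psi> (a + h)) \<longlongrightarrow> \<psi> a) (at 0)"
    using c by (simp add: continuous_at LIM_offset_zero_iff)
  have "((\<lambda>h. norm (\<phi> (a + h) - \<phi>' h) / norm h * norm (\<psi> (a + h)) + \<bar>K\<bar> * norm (\<psi> (a + h) - \<psi> a)) \<longlongrightarrow>
      0 * norm (\<psi> a) + \<bar>K\<bar> * norm (\<psi> a - \<psi> a)) (at 0)"
    by (intro tendsto_intros lim \<psi>)
  then have L: "((\<lambda>h. norm (\<phi> (a + h) - \<phi>' h) / norm h * norm (\<psi> (a + h)) + \<bar>K\<bar> * norm (\<psi> (a + h) - \<psi> a)) \<longlongrightarrow> 0) (at 0)"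
    by simp
  have "((\<lambda>h. norm (\<phi> (a + h) *\<^sub>R \<psi> (a + h) - \<phi>' h *\<^sub>R \<psi> a) / norm h) \<longlongrightarrow> 0) (at 0)"
  proof (rule Lim_null_comparison[OF _ L], rule always_eventually, rule allI)
    fix h :: 'e
    show "norm (norm (\<phi> (a + h) *\<^sub>R \<psi> (a + h) - \<phi>' h *\<^sub>R \<psi> a) / norm h) \<le>
      norm (\<phi> (a + h) - \<phi>' h) / norm h * norm (\<psi> (a + h)) + \<bar>K\<bar> * norm (\<psi> (a + h) - \<psi> a)"
    proof (cases "h = 0")
      case False
      \<comment> \<open>The product rule with \<open>\<psi>\<close> merely continuous: where
        \<open>\<phi>\<close> vanishes, a derivative of \<open>\<psi>\<close> would be multiplied by
        zero. In this splitting the first part is small by differentiability of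
        \<open>\<phi>\<close>, the second by continuity of \<open>\<psi>\<close>.\<close>
      have "\<phi> (a + h) *\<^sub>R \<psi> (a + h) - \<phi>' h *\<^sub>R \<psi> a =
        (\<phi> (a + h) - \<phi>' h) *\<^sub>R \<psi> (a + h) + \<phi>' h *\<^sub>R (\<psi> (a + h) - \<psi> a)"
        by (simp add: algebra_simps)
      then have "norm (\<phi> (a + h) *\<^sub>R \<psi> (a + h) - \<phi>' h *\<^sub>R \<psi> a) \<le>
        norm (\<phi> (a + h) - \<phi>' h) * norm (\<psi> (a + h)) + \<bar>\<phi>' h\<bar> * norm (\<psi> (a + h) - \<psi> a)"
        by (metis norm_scaleR norm_triangle_ineq real_norm_def)
      also have "\<bar>\<phi>' h\<bar> * norm (\<psi> (a + h) - \<psi> a) \<le> (norm h * \<bar>K\<bar>) * norm (\<psi> (a + h) - \<psi> a)"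
      proof (rule mult_right_mono)
        have "norm h * K \<le> norm h * \<bar>K\<bar>" by (simp add: mult_left_mono)
        then show "\<bar>\<phi>' h\<bar> \<le> norm h * \<bar>K\<bar>" using K[of h] by simp
      qed simp
      finally show ?thesis using False by (simp add: field_simps)
    qed simp
  qed
  moreover have "bounded_linear (\<lambda>u. \<phi>' u *\<^sub>R \<psi> a)"
    using bl by (rule bounded_linear_scaleR_const)
  ultimately show ?thesis using \<open>\<phi> a = 0\<close> by (simp add: has_derivative_at)
qed

lemma norm_linear_diff_le:
  fixes f g :: "'e::euclidean_space \<Rightarrow> 'f::real_normed_vector"
  assumes "linear f" "linear g"
  shows "norm (f u - g u) \<le> norm u * (\<Sum>b\<in>Basis. norm (f b - g b))"
proof -
  have l: "linear (\<lambda>u. f u - g u)" using assms by (rule linear_compose_sub)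
  have "f u - g u = (\<Sum>b\<in>Basis. (u \<bullet> b) *\<^sub>R (f b - g b))"
    using linear_sum[OF l, of "\<lambda>b. (u \<bullet> b) *\<^sub>R b" Basis] linear_cmul[OF l]
    by (simp add: euclidean_representation)
  also have "norm \<dots> \<le> (\<Sum>b\<in>Basis. norm u * norm (f b - g b))"
    by (rule sum_norm_le) (auto intro!: mult_right_mono Basis_le_norm)
  finally show ?thesis by (simp add: sum_distrib_left)
qed

text \<open>Values on the finite \<open>Basis\<close> control the operator norm, so convergence of
  each \<open>A y u\<close> is uniform in \<open>u\<close> on bounded sets. As soon as
  \<open>A y\<close> is within \<open>m / 2\<close> of \<open>A y0\<close>, the lower bound
  \<open>m\<close> for \<open>A y0\<close> leaves \<open>m / 2\<close> for \<open>A y\<close>, which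
  bounds its inverse uniformly.\<close>

lemma continuous_on_inverse_family:
  fixes A h :: "'p::real_normed_vector \<Rightarrow> 'e::euclidean_space \<Rightarrow> 'e"
  assumes "open S" and lA: "\<And>y. y \<in> S \<Longrightarrow> linear (A y)"
    and Ah: "\<And>y v. y \<in> S \<Longrightarrow> A y (h y v) = v" and hA: "\<And>y v. y \<in> S \<Longrightarrow> h y (A y v) = v"
    and cA: "\<And>u. continuous_on S (\<lambda>y. A y u)"
  shows "continuous_on S (\<lambda>y. h y v)"
proof -
  have "((\<lambda>y. h y v) \<longlongrightarrow> h y0 v) (at y0)" if y0: "y0 \<in> S" for y0
  proof -
    have cA0: "((\<lambda>y. A y u) \<longlongrightarrow> A y0 u) (at y0)" for u
      using cA[of u] y0 \<open>open S\<close> by (simp add: continuous_on_eq_continuous_at continuous_at)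
    obtain m where m: "m > 0" "\<And>u. m * norm u \<le> norm (A y0 u)"
      using linear_inj_bounded_below_pos[OF lA[OF y0]] hA[OF y0] by (metis injI mult.commute)
    have "((\<lambda>y. \<Sum>b\<in>Basis. norm (A y b - A y0 b)) \<longlongrightarrow> (\<Sum>b\<in>Basis. norm (A y0 b - A y0 b))) (at y0)"
      by (intro tendsto_intros cA0)
    then have ev: "\<forall>\<^sub>F y in at y0. (\<Sum>b\<in>Basis. norm (A y b - A y0 b)) < m / 2"
      using m by (intro order_tendstoD(2)[of _ 0]) simp_all
    have ev2: "\<forall>\<^sub>F y in at y0. norm (h y v - h y0 v) \<le> 2 / m * norm (v - A y (h y0 v))"
      using ev eventually_at_in_open'[OF \<open>open S\<close> y0]
    proof eventually_elim
      case (elim y)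
      define u where "u = h y v - h y0 v"
      have "norm (A y u - A y0 u) \<le> norm u * (m / 2)"
        using norm_linear_diff_le[OF lA lA, of y y0 u] elim y0
        by (meson less_imp_le mult_left_mono norm_ge_zero order_trans)
      moreover have "norm (A y0 u) \<le> norm (A y u) + norm (A y u - A y0 u)"
        using norm_triangle_sub[of "A y0 u" "A y u"] by (simp add: norm_minus_commute)
      ultimately have "m / 2 * norm u \<le> norm (A y u)" using m(2)[of u] by (simp add: mult.commute)
      moreover have "A y u = v - A y (h y0 v)"
        unfolding u_def using linear_diff[OF lA] Ah elim by simp
      ultimately have "norm u \<le> 2 / m * norm (v - A y (h y0 v))" using m(1) by (simp add: field_simps)
      then show ?case by (simp only: u_def)
    qed
    have "((\<lambda>y. 2 / m * norm (v - A y (h y0 v))) \<longlongrightarrow> 2 / m * norm (v - A y0 (h y0 v))) (at y0)"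
      by (intro tendsto_intros cA0)
    then have "((\<lambda>y. 2 / m * norm (v - A y (h y0 v))) \<longlongrightarrow> 0) (at y0)"
      using Ah y0 by simp
    from Lim_null_comparison[OF ev2 this] show ?thesis by (rule LIM_zero_cancel)
  qed
  then show ?thesis
    using \<open>open S\<close> by (simp add: continuous_on_eq_continuous_at continuous_at)
qed

text \<open>The derivative of the inverse is \<open>- h A' h\<close>, an expression in
  \<open>h\<close> and the derivative of \<open>A\<close> that is of class \<open>k\<close> once
  \<open>h\<close> is; hence each induction step gains one order.\<close>

lemma Ck_on_inverse_family:
  fixes A h :: "'p::real_normed_vector \<Rightarrow> 'e::euclidean_space \<Rightarrow> 'e"
  assumes "open S" and lA: "\<And>y. y \<in> S \<Longrightarrow> linear (A y)" and lh: "\<And>y. y \<in> S \<Longrightarrow> linear (h y)"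
    and Ah: "\<And>y v. y \<in> S \<Longrightarrow> A y (h y v) = v" and hA: "\<And>y v. y \<in> S \<Longrightarrow> h y (A y v) = v"
    and cA: "\<And>u. Ck_on k S (\<lambda>y. A y u)"
  shows "Ck_on k S (\<lambda>y. h y v)"
  using cA
proof (induction k arbitrary: v)
  case 0
  then show ?case using continuous_on_inverse_family[of S A h v] assms(1-5) by simp
next
  case (Suc k)
  have IH: "Ck_on k S (\<lambda>y. h y v)" for v
    by (rule Suc.IH) (rule Ck_on_Suc_imp[OF Suc.prems])
  define D where "D y u w = frechet_derivative (\<lambda>y. A y w) (at y) u" for y u w
  have rep: "h y x = (\<Sum>b\<in>Basis. (x \<bullet> b) *\<^sub>R h y b)" if "y \<in> S" for y x
    using linear_sum[OF lh[OF that], of "\<lambda>b. (x \<bullet> b) *\<^sub>R b" Basis] linear_cmul[OF lh[OF that]]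
    by (simp add: euclidean_representation)
  have ch: "continuous (at y) (\<lambda>y. h y b)" if "y \<in> S" for y b
    using Ck_on_continuous[OF IH[of b]] that \<open>open S\<close> by (simp add: continuous_on_eq_continuous_at)
  have der: "((\<lambda>y. h y v) has_derivative
      (\<lambda>u. - (\<Sum>b\<in>Basis. (\<Sum>c\<in>Basis. (h y v \<bullet> c) * (D y u c \<bullet> b)) *\<^sub>R h y b))) (at y)" if y: "y \<in> S" for y
  proof -
    have dA: "((\<lambda>z. A z w) has_derivative (\<lambda>u. D y u w)) (at y)" for w
      unfolding D_def using Ck_on_derivative[OF Suc.prems y] .
    define w where "w = h y v"
    have Aw: "A z w = (\<Sum>c\<in>Basis. (w \<bullet> c) *\<^sub>R A z c)" if "z \<in> S" for z
      using linear_sum[OF lA[OF that], of "\<lambda>b. (w \<bullet> b) *\<^sub>R b" Basis] linear_cmul[OF lA[OF that]]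
      by (simp add: euclidean_representation)
    have "((\<lambda>z. \<Sum>c\<in>Basis. (w \<bullet> c) *\<^sub>R A z c) has_derivative (\<lambda>u. \<Sum>c\<in>Basis. (w \<bullet> c) *\<^sub>R D y u c)) (at y)"
      by (intro has_derivative_sum has_derivative_scaleR_right dA)
    then have "((\<lambda>z. A z w) has_derivative (\<lambda>u. \<Sum>c\<in>Basis. (w \<bullet> c) *\<^sub>R D y u c)) (at y)"
      by (rule has_derivative_transform_within_open[OF _ \<open>open S\<close> y]) (simp add: Aw)
    then have "((\<lambda>z. (A z w - v) \<bullet> b) has_derivative (\<lambda>u. (\<Sum>c\<in>Basis. (w \<bullet> c) *\<^sub>R D y u c) \<bullet> b)) (at y)" for b
      by (auto intro!: derivative_eq_intros)
    then have "((\<lambda>z. (A z w - v) \<bullet> b) has_derivative (\<lambda>u. \<Sum>c\<in>Basis. (w \<bullet> c) * (D y u c \<bullet> b))) (at y)" for b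
      by (simp add: inner_sum_left)
    then have "((\<lambda>z. ((A z w - v) \<bullet> b) *\<^sub>R h z b) has_derivative
        (\<lambda>u. (\<Sum>c\<in>Basis. (w \<bullet> c) * (D y u c \<bullet> b)) *\<^sub>R h y b)) (at y)" for b
      by (rule has_derivative_scaleR_vanishing) (use Ah y ch in \<open>auto simp: w_def\<close>)
    then have "((\<lambda>z. w - (\<Sum>b\<in>Basis. ((A z w - v) \<bullet> b) *\<^sub>R h z b)) has_derivative
        (\<lambda>u. 0 - (\<Sum>b\<in>Basis. (\<Sum>c\<in>Basis. (w \<bullet> c) * (D y u c \<bullet> b)) *\<^sub>R h y b))) (at y)"
      by (intro has_derivative_diff has_derivative_sum has_derivative_const)
    then have "((\<lambda>z. w - (\<Sum>b\<in>Basis. ((A z w - v) \<bullet> b) *\<^sub>R h z b)) has_derivative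
        (\<lambda>u. - (\<Sum>b\<in>Basis. (\<Sum>c\<in>Basis. (h y v \<bullet> c) * (D y u c \<bullet> b)) *\<^sub>R h y b))) (at y)"
      by (simp add: w_def)
    then show ?thesis
    proof (rule has_derivative_transform_within_open[OF _ \<open>open S\<close> y])
      fix z assume z: "z \<in> S"
      have "(\<Sum>b\<in>Basis. ((A z w - v) \<bullet> b) *\<^sub>R h z b) = h z (A z w - v)"
        using rep[OF z, of "A z w - v"] by simp
      also have "\<dots> = w - h z v" using linear_diff[OF lh[OF z]] hA[OF z] by simp
      finally show "w - (\<Sum>b\<in>Basis. ((A z w - v) \<bullet> b) *\<^sub>R h z b) = h z v" by simp
    qed
  qed
  have cD: "Ck_on k S (\<lambda>y. D y u c)" for u c
    using Suc.prems[of c] by (simp add: D_def)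
  show ?case
  proof (rule Ck_on_Suc_derivativeI[OF der _ \<open>open S\<close>])
    fix u
    show "Ck_on k S (\<lambda>y. - (\<Sum>b\<in>Basis. (\<Sum>c\<in>Basis. (h y v \<bullet> c) * (D y u c \<bullet> b)) *\<^sub>R h y b))"
      by (intro Ck_on_linear_comp[OF \<open>open S\<close> bounded_linear_minus[OF bounded_linear_ident]]
          Ck_on_sum Ck_on_bilinear[OF _ bounded_bilinear_scaleR] Ck_on_bilinear[OF _ bounded_bilinear_mult]
          Ck_on_linear_comp[OF _ bounded_linear_inner_left] IH cD \<open>open S\<close>)
  qed
qed

text \<open>The inverse is given globally, so only its regularity is at stake, and it bootstraps:
  the derivative of \<open>g\<close> at \<open>y\<close> inverts that of \<open>f\<close> at
  \<open>g y\<close>. If \<open>g\<close> is of class k, then so is this family, by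
  \<open>Ck_on_compose\<close> and \<open>Ck_on_inverse_family\<close>, and \<open>g\<close> is of
  class k + 1.\<close>

lemma smooth_on_inverse_function:
  fixes f g :: "'e::euclidean_space \<Rightarrow> 'e"
  assumes "open S" "open T" and sm: "smooth_on S f" and fS: "f ` S \<subseteq> T" and gT: "g ` T \<subseteq> S"
    and gf: "\<And>x. x \<in> S \<Longrightarrow> g (f x) = x" and fg: "\<And>y. y \<in> T \<Longrightarrow> f (g y) = y"
    and inj: "\<And>x u. x \<in> S \<Longrightarrow> frechet_derivative f (at x) u = 0 \<Longrightarrow> u = 0"
  shows "smooth_on T g"
proof -
  define A where "A y = frechet_derivative f (at (g y))" for y
  define h where "h y = inv_into UNIV (A y)" for y
  have df: "(f has_derivative A y) (at (g y))" if "y \<in> T" for y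
    unfolding A_def using smooth_on_differentiable[OF sm] gT that
    by (intro has_derivative_frechet) auto
  have lA: "linear (A y)" if "y \<in> T" for y
    using df[OF that] by (rule has_derivative_linear)
  have injA: "inj (A y)" if "y \<in> T" for y
    unfolding linear_injective_0[OF lA[OF that]] using inj gT that by (auto simp: A_def)
  then have surjA: "surj (A y)" if "y \<in> T" for y
    using linear_injective_imp_surjective[OF lA] that by auto
  have Ah: "A y (h y v) = v" if "y \<in> T" for y v
    using surjA[OF that] by (simp add: h_def surj_f_inv_f)
  have hA: "h y (A y v) = v" if "y \<in> T" for y v
    using injA[OF that] by (simp add: h_def)
  have lh: "linear (h y)" if "y \<in> T" for y
    unfolding h_def using lA[OF that] injA[OF that] surjA[OF that]
    using inj_linear_imp_inv_linear by blast
  have dg: "(g has_derivative h y) (at y)" if y: "y \<in> T" for y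
  proof (rule has_derivative_inverse_strong_x[OF \<open>open S\<close> _ smooth_on_continuous[OF sm] gf df[OF y]])
    show "A y \<circ> h y = id" using Ah[OF y] by auto
  qed (use y gT fg in auto)
  have "Ck_on k T g" for k
  proof (induction k)
    case 0
    have "continuous (at y) g" if "y \<in> T" for y
      using dg[OF that] by (rule has_derivative_continuous)
    then show ?case using \<open>open T\<close> by (simp add: continuous_on_eq_continuous_at)
  next
    case (Suc k)
    have "Ck_on k T (\<lambda>y. A y u)" for u
      unfolding A_def
      by (rule Ck_on_compose[OF \<open>open T\<close> \<open>open S\<close> gT Suc]) (rule smooth_onD[OF smooth_on_derivative[OF sm]])
    then have "Ck_on k T (\<lambda>y. h y v)" for v
      by (intro Ck_on_inverse_family[OF \<open>open T\<close> lA lh Ah hA]) auto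
    then show ?case by (intro Ck_on_Suc_derivativeI[OF dg _ \<open>open T\<close>])
  qed
  then show ?thesis by (rule smooth_onI)
qed

section \<open>Symmetry of second derivatives and closedness of pulled back forms\<close>

lemma mixed_difference_mean_value:
  fixes f :: "'e::real_normed_vector \<Rightarrow> real"
  assumes S: "ball x r \<subseteq> S" and h: "0 < h" "h * (norm u + norm v) < r"
    and d1: "\<And>y. y \<in> S \<Longrightarrow> f differentiable (at y)"
    and d2: "\<And>y. y \<in> S \<Longrightarrow> (\<lambda>z. frechet_derivative f (at z) u) differentiable (at y)"
  shows "\<exists>p. dist x p < r \<and> f (x + h *\<^sub>R u + h *\<^sub>R v) - f (x + h *\<^sub>R u) - f (x + h *\<^sub>R v) + f x =
           h * h * frechet_derivative (\<lambda>z. frechet_derivative f (at z) u) (at p) v"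
proof -
  have inS: "dist x (x + s *\<^sub>R u + t *\<^sub>R v) < r" if "0 \<le> s" "s \<le> h" "0 \<le> t" "t \<le> h" for s t
  proof -
    have "dist x (x + s *\<^sub>R u + t *\<^sub>R v) = norm (s *\<^sub>R u + t *\<^sub>R v)"
      by (simp add: dist_norm norm_minus_commute add_ac)
    also have "\<dots> \<le> s * norm u + t * norm v" using that norm_triangle_ineq[of "s *\<^sub>R u" "t *\<^sub>R v"] by simp
    also have "\<dots> \<le> h * norm u + h * norm v" using that by (intro add_mono mult_right_mono) auto
    finally show ?thesis using h by (simp add: algebra_simps)
  qed
  then have memS: "x + s *\<^sub>R u + t *\<^sub>R v \<in> S" if "0 \<le> s" "s \<le> h" "0 \<le> t" "t \<le> h" for s t
    using that S by auto
  define \<phi> where "\<phi> s = f (x + s *\<^sub>R u + h *\<^sub>R v) - f (x + s *\<^sub>R u + 0 *\<^sub>R v)" for s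
  define E where "E y = frechet_derivative f (at y) u" for y
  have dline: "((\<lambda>s. f (x + s *\<^sub>R u + t *\<^sub>R v)) has_real_derivative E (x + s *\<^sub>R u + t *\<^sub>R v)) (at s)"
    if "0 \<le> s" "s \<le> h" "0 \<le> t" "t \<le> h" for s t
  proof -
    let ?D = "frechet_derivative f (at (x + s *\<^sub>R u + t *\<^sub>R v))"
    have D: "(f has_derivative ?D) (at (x + s *\<^sub>R u + t *\<^sub>R v))"
      using d1[OF memS[OF that]] by (rule has_derivative_frechet)
    have "((\<lambda>s. x + s *\<^sub>R u + t *\<^sub>R v) has_derivative (\<lambda>a. a *\<^sub>R u)) (at s)"
      by (auto intro!: derivative_eq_intros)
    from diff_chain_at[OF this D] have "((\<lambda>s. f (x + s *\<^sub>R u + t *\<^sub>R v)) has_derivative (\<lambda>a. ?D (a *\<^sub>R u))) (at s)"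
      by (simp add: o_def)
    moreover have "(\<lambda>a. ?D (a *\<^sub>R u)) = (*) (E (x + s *\<^sub>R u + t *\<^sub>R v))"
      using linear_cmul[OF has_derivative_linear[OF D]] by (simp add: E_def fun_eq_iff)
    ultimately show ?thesis by (simp add: has_field_derivative_def)
  qed
  have "\<exists>s. 0 < s \<and> s < h \<and> \<phi> h - \<phi> 0 = (h - 0) * (E (x + s *\<^sub>R u + h *\<^sub>R v) - E (x + s *\<^sub>R u + 0 *\<^sub>R v))"
  proof (rule MVT2)
    show "(\<phi> has_real_derivative E (x + s *\<^sub>R u + h *\<^sub>R v) - E (x + s *\<^sub>R u + 0 *\<^sub>R v)) (at s)"
      if "0 \<le> s" "s \<le> h" for s
      unfolding \<phi>_def using that h by (intro DERIV_diff dline) auto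
  qed (use h in auto)
  then obtain s where s: "0 < s" "s < h"
    "\<phi> h - \<phi> 0 = h * (E (x + s *\<^sub>R u + h *\<^sub>R v) - E (x + s *\<^sub>R u + 0 *\<^sub>R v))" by auto
  have "\<exists>t. 0 < t \<and> t < h \<and> E (x + s *\<^sub>R u + h *\<^sub>R v) - E (x + s *\<^sub>R u + 0 *\<^sub>R v) =
      (h - 0) * frechet_derivative E (at (x + s *\<^sub>R u + t *\<^sub>R v)) v"
  proof (rule MVT2)
    fix t assume t: "0 \<le> t" "t \<le> h"
    let ?D = "frechet_derivative E (at (x + s *\<^sub>R u + t *\<^sub>R v))"
    have D: "(E has_derivative ?D) (at (x + s *\<^sub>R u + t *\<^sub>R v))"
      using d2[OF memS] s t unfolding E_def by (intro has_derivative_frechet) auto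
    have "((\<lambda>t. x + s *\<^sub>R u + t *\<^sub>R v) has_derivative (\<lambda>a. a *\<^sub>R v)) (at t)"
      by (auto intro!: derivative_eq_intros)
    from diff_chain_at[OF this D] have "((\<lambda>t. E (x + s *\<^sub>R u + t *\<^sub>R v)) has_derivative (\<lambda>a. ?D (a *\<^sub>R v))) (at t)"
      by (simp add: o_def)
    moreover have "(\<lambda>a. ?D (a *\<^sub>R v)) = (*) (?D v)"
      using linear_cmul[OF has_derivative_linear[OF D]] by (simp add: fun_eq_iff)
    ultimately show "((\<lambda>t. E (x + s *\<^sub>R u + t *\<^sub>R v)) has_real_derivative ?D v) (at t)"
      by (simp add: has_field_derivative_def)
  qed (use h in auto)
  then obtain t where t: "0 < t" "t < h" "E (x + s *\<^sub>R u + h *\<^sub>R v) - E (x + s *\<^sub>R u + 0 *\<^sub>R v) =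
      h * frechet_derivative E (at (x + s *\<^sub>R u + t *\<^sub>R v)) v" by auto
  have "f (x + h *\<^sub>R u + h *\<^sub>R v) - f (x + h *\<^sub>R u) - f (x + h *\<^sub>R v) + f x = \<phi> h - \<phi> 0"
    by (simp add: \<phi>_def)
  also have "\<dots> = h * h * frechet_derivative E (at (x + s *\<^sub>R u + t *\<^sub>R v)) v"
    using s(3) t(3) by simp
  finally show ?thesis
    using inS[of s t] s t unfolding E_def by (intro exI[of _ "x + s *\<^sub>R u + t *\<^sub>R v"]) auto
qed

text \<open>The second difference over a small parallelogram is symmetric in \<open>u\<close> and
  \<open>v\<close>, and \<open>mixed_difference_mean_value\<close> evaluates it as either mixed
  derivative at some nearby point. Continuity then forces equality at \<open>x\<close>: unequal
  values would stay apart on a ball where each moves by less than half their distance.\<close>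

lemma second_derivative_symmetric_real:
  fixes f :: "'e::real_normed_vector \<Rightarrow> real"
  assumes "open S" "x \<in> S" "smooth_on S f"
  shows "frechet_derivative (\<lambda>y. frechet_derivative f (at y) v) (at x) u =
         frechet_derivative (\<lambda>y. frechet_derivative f (at y) u) (at x) v"
proof (rule ccontr)
  let ?A = "\<lambda>y. frechet_derivative (\<lambda>y. frechet_derivative f (at y) u) (at y) v"
  let ?B = "\<lambda>y. frechet_derivative (\<lambda>y. frechet_derivative f (at y) v) (at y) u"
  assume "?B x \<noteq> ?A x"
  then have e: "\<bar>?A x - ?B x\<bar> / 2 > 0" by simp
  have c: "continuous (at x) ?A" "continuous (at x) ?B"
    using smooth_on_continuous[OF smooth_on_derivative[OF smooth_on_derivative[OF assms(3)]]] assms(1,2)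
    by (auto simp: continuous_on_eq_continuous_at)
  obtain r1 where r1: "r1 > 0" "\<And>y. dist x y < r1 \<Longrightarrow> \<bar>?A y - ?A x\<bar> < \<bar>?A x - ?B x\<bar> / 2"
  proof -
    have "\<exists>d>0. \<forall>y. dist y x < d \<longrightarrow> dist (?A y) (?A x) < \<bar>?A x - ?B x\<bar> / 2"
      using c(1) e unfolding continuous_at_eps_delta by blast
    then show ?thesis using that by (auto simp: dist_real_def dist_commute)
  qed
  obtain r2 where r2: "r2 > 0" "\<And>y. dist x y < r2 \<Longrightarrow> \<bar>?B y - ?B x\<bar> < \<bar>?A x - ?B x\<bar> / 2"
  proof -
    have "\<exists>d>0. \<forall>y. dist y x < d \<longrightarrow> dist (?B y) (?B x) < \<bar>?A x - ?B x\<bar> / 2"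
      using c(2) e unfolding continuous_at_eps_delta by blast
    then show ?thesis using that by (auto simp: dist_real_def dist_commute)
  qed
  obtain r3 where r3: "r3 > 0" "ball x r3 \<subseteq> S" using assms by (meson openE)
  define r where "r = min r1 (min r2 r3)"
  have r: "r > 0" "ball x r \<subseteq> S" using r1 r2 r3 by (auto simp: r_def)
  \<comment> \<open>Makes the two sides of the parallelogram together shorter than \<open>r\<close>;
    the summand 1 covers \<open>u = v = 0\<close>.\<close>
  define h where "h = r / (2 * (norm u + norm v + 1))"
  have np: "norm u + norm v + 1 > 0" by (simp add: add_nonneg_pos)
  have h: "h > 0" using r np by (simp add: h_def)
  have "h * (norm u + norm v) < h * (2 * (norm u + norm v + 1))"
    using h by (intro mult_strict_left_mono) (auto simp: add_nonneg_pos)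
  also have "\<dots> = r" using np by (simp add: h_def)
  finally have hr: "h * (norm u + norm v) < r" "h * (norm v + norm u) < r" by (auto simp: add.commute)
  have d1: "f differentiable (at y)" if "y \<in> S" for y
    using assms(3) that by (rule smooth_on_differentiable)
  have d2: "(\<lambda>z. frechet_derivative f (at z) w) differentiable (at y)" if "y \<in> S" for y w
    using smooth_on_derivative[OF assms(3)] that by (rule smooth_on_differentiable)
  obtain p where p: "dist x p < r"
    "f (x + h *\<^sub>R u + h *\<^sub>R v) - f (x + h *\<^sub>R u) - f (x + h *\<^sub>R v) + f x = h * h * ?A p"
    using mixed_difference_mean_value[OF r(2) h hr(1) d1 d2] by blast
  obtain q where q: "dist x q < r"
    "f (x + h *\<^sub>R v + h *\<^sub>R u) - f (x + h *\<^sub>R v) - f (x + h *\<^sub>R u) + f x = h * h * ?B q"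
    using mixed_difference_mean_value[OF r(2) h hr(2) d1 d2] by blast
  have comm: "x + h *\<^sub>R v + h *\<^sub>R u = x + h *\<^sub>R u + h *\<^sub>R v" by (simp add: add_ac)
  have "h * h * ?A p = h * h * ?B q" using p(2) q(2)[unfolded comm] by linarith
  then have "?A p = ?B q" using h by simp
  moreover have "\<bar>?A p - ?A x\<bar> < \<bar>?A x - ?B x\<bar> / 2" "\<bar>?B q - ?B x\<bar> < \<bar>?A x - ?B x\<bar> / 2"
    using p q r1 r2 by (auto simp: r_def)
  moreover have "c \<noteq> d" if "\<bar>c - a\<bar> < \<bar>a - b\<bar> / 2" "\<bar>d - b\<bar> < \<bar>a - b\<bar> / 2" for a b c d :: real
    using that by (auto simp: abs_real_def split: if_splits)
  ultimately show False by blast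
qed

lemma frechet_derivative_inner_left:
  assumes "f differentiable (at x)"
  shows "frechet_derivative (\<lambda>y. f y \<bullet> b) (at x) u = frechet_derivative f (at x) u \<bullet> b"
proof -
  have "((\<lambda>y. f y \<bullet> b) has_derivative (\<lambda>u. frechet_derivative f (at x) u \<bullet> b)) (at x)"
    using has_derivative_frechet[OF assms] by (rule has_derivative_inner_left)
  then show ?thesis by (simp add: frechet_derivative_at[symmetric])
qed

lemma second_derivative_symmetric:
  fixes f :: "'e::real_normed_vector \<Rightarrow> 'f::euclidean_space"
  assumes "open S" "x \<in> S" "smooth_on S f"
  shows "frechet_derivative (\<lambda>y. frechet_derivative f (at y) v) (at x) u =
         frechet_derivative (\<lambda>y. frechet_derivative f (at y) u) (at x) v"
proof (rule euclidean_eqI)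
  fix b :: 'f
  have sm: "smooth_on S (\<lambda>y. f y \<bullet> b)"
    by (rule smooth_on_linear_comp[OF assms(1) bounded_linear_inner_left assms(3)])
  have "frechet_derivative (\<lambda>y. frechet_derivative f (at y) v) (at x) u \<bullet> b =
      frechet_derivative (\<lambda>y. frechet_derivative (\<lambda>y. f y \<bullet> b) (at y) v) (at x) u" for u v
  proof -
    have "frechet_derivative (\<lambda>y. frechet_derivative (\<lambda>y. f y \<bullet> b) (at y) v) (at x) =
        frechet_derivative (\<lambda>y. frechet_derivative f (at y) v \<bullet> b) (at x)"
      by (rule frechet_derivative_cong_open[OF assms(1,2)])
         (simp add: frechet_derivative_inner_left smooth_on_differentiable[OF assms(3)])
    then show ?thesis
      by (simp add: frechet_derivative_inner_left
          smooth_on_differentiable[OF smooth_on_derivative[OF assms(3)] assms(2)])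
  qed
  then show "frechet_derivative (\<lambda>y. frechet_derivative f (at y) v) (at x) u \<bullet> b =
      frechet_derivative (\<lambda>y. frechet_derivative f (at y) u) (at x) v \<bullet> b"
    using second_derivative_symmetric_real[OF assms(1,2) sm] by simp
qed

text \<open>The exterior derivative of a pulled back constant form involves \<open>G\<close> through
  products of first and second derivatives; by the symmetry of the latter and the antisymmetry of
  \<open>\<omega>\<close> these products cancel in pairs.\<close>

lemma closed_pullback_constant_form:
  fixes G :: "'e::euclidean_space \<Rightarrow> 'f::euclidean_space" and \<omega> :: "'f \<Rightarrow> 'f \<Rightarrow> real"
  assumes "open S" "smooth_on S G" "bounded_bilinear \<omega>" and alt: "\<And>u v. \<omega> u v = - \<omega> v u"
  shows "closed_two_form_on S
    (\<lambda>y u v. \<omega> (frechet_derivative G (at y) u) (frechet_derivative G (at y) v))"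
  unfolding closed_two_form_on_def
proof (intro ballI allI)
  fix x u v w assume x: "x \<in> S"
  let ?D = "\<lambda>v y. frechet_derivative G (at y) v"
  let ?H = "\<lambda>u v. frechet_derivative (?D v) (at x) u"
  have dd: "(?D v has_derivative (\<lambda>u. ?H u v)) (at x)" for v
    using smooth_on_derivative[OF assms(2)] x by (intro has_derivative_frechet smooth_on_differentiable)
  have "((\<lambda>y. \<omega> (?D v y) (?D w y)) has_derivative (\<lambda>u. \<omega> (?D v x) (?H u w) + \<omega> (?H u v) (?D w x))) (at x)" for v w
    by (rule bounded_bilinear.FDERIV[OF assms(3) dd dd])
  from frechet_derivative_at[OF this]
  have *: "frechet_derivative (\<lambda>y. \<omega> (?D v y) (?D w y)) (at x) u = \<omega> (?D v x) (?H u w) + \<omega> (?H u v) (?D w x)" for u v w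
    by (rule fun_cong[OF sym])
  have sym: "?H a b = ?H b a" for a b by (rule second_derivative_symmetric[OF assms(1) x assms(2)])
  show "frechet_derivative (\<lambda>y. \<omega> (?D v y) (?D w y)) (at x) u
     - frechet_derivative (\<lambda>y. \<omega> (?D u y) (?D w y)) (at x) v
     + frechet_derivative (\<lambda>y. \<omega> (?D u y) (?D v y)) (at x) w = 0"
    unfolding * using sym[of u v] sym[of u w] sym[of v w] alt[of "?H u w" "?D v x"] by simp
qed

section \<open>Quotient topologies\<close>

lemma openin_quotient_topology:
  "openin (quotient_topology Y f) W \<longleftrightarrow> W \<subseteq> f ` topspace Y \<and> openin Y {x \<in> topspace Y. f x \<in> W}"
proof -
  have "istopology (\<lambda>W. W \<subseteq> f ` topspace Y \<and> openin Y {x \<in> topspace Y. f x \<in> W})"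
    unfolding istopology_def
  proof (intro conjI allI impI)
    fix S T
    assume S: "S \<subseteq> f ` topspace Y \<and> openin Y {x \<in> topspace Y. f x \<in> S}"
      and T: "T \<subseteq> f ` topspace Y \<and> openin Y {x \<in> topspace Y. f x \<in> T}"
    have "{x \<in> topspace Y. f x \<in> S \<inter> T} = {x \<in> topspace Y. f x \<in> S} \<inter> {x \<in> topspace Y. f x \<in> T}" by auto
    then show "openin Y {x \<in> topspace Y. f x \<in> S \<inter> T}" using S T by auto
  next
    fix \<K> assume K: "\<forall>W\<in>\<K>. W \<subseteq> f ` topspace Y \<and> openin Y {x \<in> topspace Y. f x \<in> W}"
    have "{x \<in> topspace Y. f x \<in> \<Union>\<K>} = (\<Union>W\<in>\<K>. {x \<in> topspace Y. f x \<in> W})" by auto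
    then show "openin Y {x \<in> topspace Y. f x \<in> \<Union>\<K>}" using K by auto
  qed auto
  then show ?thesis unfolding quotient_topology_def by (simp add: topology_inverse')
qed

lemma topspace_quotient_topology: "topspace (quotient_topology Y f) = f ` topspace Y"
proof -
  have "{x \<in> topspace Y. f x \<in> f ` topspace Y} = topspace Y" by auto
  then have "openin (quotient_topology Y f) (f ` topspace Y)"
    by (simp add: openin_quotient_topology)
  from openin_subset[OF this] show ?thesis
    using openin_topspace[of "quotient_topology Y f"] unfolding openin_quotient_topology by blast
qed

lemma continuous_map_quotient_topology:
  assumes "\<And>x. x \<in> topspace Y \<Longrightarrow> h (a x) = g x" "continuous_map Y Z g"
  shows "continuous_map (quotient_topology Y a) Z h"
  unfolding continuous_map_def
proof (intro conjI allI impI)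
  show "h \<in> topspace (quotient_topology Y a) \<rightarrow> topspace Z"
    using assms by (auto simp: topspace_quotient_topology continuous_map_def)
  fix U assume "openin Z U"
  then have "openin Y {x \<in> topspace Y. g x \<in> U}" using assms(2) by (simp add: continuous_map_def)
  also have "{x \<in> topspace Y. g x \<in> U} = {x \<in> topspace Y. a x \<in> {q \<in> a ` topspace Y. h q \<in> U}}"
    using assms(1) by auto (metis assms(1))
  finally show "openin (quotient_topology Y a) {x \<in> topspace (quotient_topology Y a). h x \<in> U}"
    by (auto simp: openin_quotient_topology topspace_quotient_topology)
qed

lemma continuous_map_quotient_projection: "continuous_map Y (quotient_topology Y a) a"
  by (auto simp: continuous_map_def topspace_quotient_topology openin_quotient_topology)

text \<open>Here \<open>\<sigma>\<close> is a slice in \<open>Z\<close> for the orbit map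
  \<open>b\<close>. Continuity of the induced map is formal; openness is the content, and it is
  reduced to the openness in \<open>Z\<close> of saturations of slice neighbourhoods, which
  \<open>chart_open\<close> supplies.\<close>

lemma quotient_chart_homeomorphic:
  assumes cont: "continuous_map Y Z \<sigma>"
    and h: "\<And>x. x \<in> topspace Y \<Longrightarrow> h (a x) = b (\<sigma> x)"
    and inj: "inj_on h (a ` topspace Y)"
    and op: "\<And>V. openin Y V \<Longrightarrow> openin Z {z \<in> topspace Z. b z \<in> b ` \<sigma> ` V}"
  shows "openin (quotient_topology Z b) (h ` a ` topspace Y)"
    and "homeomorphic_map (quotient_topology Y a)
      (subtopology (quotient_topology Z b) (h ` a ` topspace Y)) h"
proof -
  have sub: "\<sigma> ` topspace Y \<subseteq> topspace Z" using cont by (auto simp: continuous_map_def)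
  have openb: "openin (quotient_topology Z b) (b ` \<sigma> ` V)" if "openin Y V" for V
    using op[OF that] sub openin_subset[OF that] by (auto simp: openin_quotient_topology)
  have img: "h ` a ` V = b ` \<sigma> ` V" if "V \<subseteq> topspace Y" for V
    using h that by (force simp: image_iff)
  show o: "openin (quotient_topology Z b) (h ` a ` topspace Y)"
    using openb[of "topspace Y"] img by simp
  have c: "continuous_map (quotient_topology Y a) (quotient_topology Z b) h"
  proof (rule continuous_map_quotient_topology[where g="b \<circ> \<sigma>"])
    show "continuous_map Y (quotient_topology Z b) (b \<circ> \<sigma>)"
      by (rule continuous_map_compose[OF cont continuous_map_quotient_projection])
  qed (simp add: h)
  show "homeomorphic_map (quotient_topology Y a) (subtopology (quotient_topology Z b) (h ` a ` topspace Y)) h"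
  proof (rule bijective_open_imp_homeomorphic_map)
    show "continuous_map (quotient_topology Y a) (subtopology (quotient_topology Z b) (h ` a ` topspace Y)) h"
      using c by (auto simp: continuous_map_in_subtopology topspace_quotient_topology)
    show "open_map (quotient_topology Y a) (subtopology (quotient_topology Z b) (h ` a ` topspace Y)) h"
      unfolding open_map_def
    proof (intro allI impI)
      fix W assume W: "openin (quotient_topology Y a) W"
      let ?V = "{x \<in> topspace Y. a x \<in> W}"
      have V: "openin Y ?V" "W = a ` ?V" using W by (auto simp: openin_quotient_topology)
      have "h ` W = h ` a ` ?V" by (rule arg_cong[OF V(2)])
      also have "\<dots> = b ` \<sigma> ` ?V" by (rule img) auto
      finally have "openin (quotient_topology Z b) (h ` W)" using openb[OF V(1)] by simp
      moreover have "h ` W \<subseteq> h ` a ` topspace Y" using V(2) by blast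
      ultimately show "openin (subtopology (quotient_topology Z b) (h ` a ` topspace Y)) (h ` W)"
        by (simp add: openin_open_subtopology[OF o])
    qed
    show "h ` topspace (quotient_topology Y a) =
        topspace (subtopology (quotient_topology Z b) (h ` a ` topspace Y))"
      using openin_subset[OF o] by (auto simp: topspace_quotient_topology topspace_subtopology)
    show "inj_on h (topspace (quotient_topology Y a))" using inj by (simp add: topspace_quotient_topology)
  qed
qed

section \<open>Simple polytopes near a vertex\<close>

locale polytope_data =
  fixes \<Delta> :: "'a::euclidean_space set" and X :: "'d::finite \<Rightarrow> 'a" and lam :: "'d \<Rightarrow> real"
  assumes simple: "simple_polytope \<Delta>" and full_dim: "aff_dim \<Delta> = int DIM('a)"
    and Delta_eq: "\<Delta> = (\<Inter>j. {\<mu>. \<mu> \<bullet> X j \<ge> lam j})"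
    and facets: "bij_betw (\<lambda>j. {\<mu> \<in> \<Delta>. \<mu> \<bullet> X j = lam j}) UNIV {F. F facet_of \<Delta>}"
begin

abbreviation active :: "'a \<Rightarrow> 'd set" where "active \<nu> \<equiv> face_index X lam {\<nu>}"

lemma mem_Delta: "\<nu> \<in> \<Delta> \<longleftrightarrow> (\<forall>j. \<nu> \<bullet> X j \<ge> lam j)"
  using Delta_eq by blast

lemma mem_active: "j \<in> active \<nu> \<longleftrightarrow> \<nu> \<bullet> X j = lam j"
  by (simp add: face_index_def)

lemma polytope_Delta: "polytope \<Delta>" using simple by (simp add: simple_polytope_def)

lemma compact_Delta: "compact \<Delta>" using polytope_Delta by (rule polytope_imp_compact)
lemma convex_Delta: "convex \<Delta>" using polytope_Delta by (rule polytope_imp_convex)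

text \<open>Active constraints do not decrease along \<open>u\<close>, and the finitely many
  inactive ones have room at \<open>\<nu>\<close>. Strictness of the latter is recorded because
  \<open>point_with_index\<close> reads off the exact active set.\<close>

lemma feasible_direction:
  assumes "\<nu> \<in> \<Delta>" and "\<And>j. j \<in> active \<nu> \<Longrightarrow> u \<bullet> X j \<ge> 0"
  shows "\<forall>\<^sub>F t in at_right (0::real). \<nu> + t *\<^sub>R u \<in> \<Delta> \<and> (\<forall>j. j \<notin> active \<nu> \<longrightarrow> (\<nu> + t *\<^sub>R u) \<bullet> X j > lam j)"
proof -
  have "\<forall>\<^sub>F t in at_right (0::real). j \<notin> active \<nu> \<longrightarrow> (\<nu> + t *\<^sub>R u) \<bullet> X j > lam j" for j
  proof (cases "j \<in> active \<nu>")
    case False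
    then have lt: "lam j < (\<nu> + 0 *\<^sub>R u) \<bullet> X j"
      using assms(1) by (auto simp: mem_Delta mem_active less_le)
    have "((\<lambda>t. (\<nu> + t *\<^sub>R u) \<bullet> X j) \<longlongrightarrow> (\<nu> + 0 *\<^sub>R u) \<bullet> X j) (at_right 0)"
      by (intro tendsto_intros)
    from order_tendstoD(1)[OF this lt] show ?thesis by (rule eventually_mono) simp
  qed simp
  then have "\<forall>\<^sub>F t in at_right (0::real). \<forall>j. j \<notin> active \<nu> \<longrightarrow> (\<nu> + t *\<^sub>R u) \<bullet> X j > lam j"
    by (rule eventually_all_finite)
  moreover have "\<forall>\<^sub>F t in at_right (0::real). t > 0" by (rule eventually_at_right_less)
  ultimately show ?thesis
  proof eventually_elim
    case (elim t)
    have "(\<nu> + t *\<^sub>R u) \<bullet> X j \<ge> lam j" for j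
    proof (cases "j \<in> active \<nu>")
      case True
      then show ?thesis using elim(2) assms(2)[OF True] by (simp add: mem_active inner_add_left)
    qed (use elim in \<open>auto intro: less_imp_le\<close>)
    then show ?case using elim by (simp add: mem_Delta)
  qed
qed

lemma active_face: "{\<nu> \<in> \<Delta>. \<forall>j\<in>J. \<nu> \<bullet> X j = lam j} face_of \<Delta>"
  unfolding face_of_def
proof (intro conjI ballI impI)
  show "convex {\<nu> \<in> \<Delta>. \<forall>j\<in>J. \<nu> \<bullet> X j = lam j}"
  proof -
    have "{\<nu> \<in> \<Delta>. \<forall>j\<in>J. \<nu> \<bullet> X j = lam j} = \<Delta> \<inter> (\<Inter>j\<in>J. {\<nu>. X j \<bullet> \<nu> = lam j})"
      by (auto simp: inner_commute)
    also have "convex \<dots>" by (intro convex_Int convex_Delta convex_INT convex_hyperplane)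
    finally show ?thesis .
  qed
next
  fix a b x assume ab: "a \<in> \<Delta>" "b \<in> \<Delta>" and x: "x \<in> {\<nu> \<in> \<Delta>. \<forall>j\<in>J. \<nu> \<bullet> X j = lam j}"
    and seg: "x \<in> open_segment a b"
  from seg obtain t where t: "0 < t" "t < 1" "x = (1 - t) *\<^sub>R a + t *\<^sub>R b"
    by (auto simp: in_segment)
  have "a \<bullet> X j = lam j \<and> b \<bullet> X j = lam j" if "j \<in> J" for j
  proof -
    have ge: "a \<bullet> X j - lam j \<ge> 0" "b \<bullet> X j - lam j \<ge> 0" using ab by (auto simp: mem_Delta)
    have "(1 - t) * (a \<bullet> X j - lam j) + t * (b \<bullet> X j - lam j) = 0"
      using x that t(3) by (auto simp: inner_add_left algebra_simps)
    moreover have "(1 - t) * (a \<bullet> X j - lam j) \<ge> 0" "t * (b \<bullet> X j - lam j) \<ge> 0"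
      using t ge by auto
    ultimately have "(1 - t) * (a \<bullet> X j - lam j) = 0" "t * (b \<bullet> X j - lam j) = 0" by linarith+
    then show ?thesis using t by auto
  qed
  then show "a \<in> {\<nu> \<in> \<Delta>. \<forall>j\<in>J. \<nu> \<bullet> X j = lam j}" "b \<in> {\<nu> \<in> \<Delta>. \<forall>j\<in>J. \<nu> \<bullet> X j = lam j}"
    using ab by auto
qed auto

lemma not_extreme_if_line:
  assumes "\<nu> \<in> S" "u \<noteq> 0" "\<forall>\<^sub>F t in at_right (0::real). \<nu> + t *\<^sub>R u \<in> S" "\<forall>\<^sub>F t in at_right (0::real). \<nu> + t *\<^sub>R (- u) \<in> S"
  shows "\<not> \<nu> extreme_point_of S"
proof
  assume ex: "\<nu> extreme_point_of S"
  have "\<forall>\<^sub>F t in at_right (0::real). False"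
    using assms(3,4) eventually_at_right_less[of "0::real"]
  proof eventually_elim
    case (elim t)
    have "\<nu> \<in> open_segment (\<nu> + t *\<^sub>R (- u)) (\<nu> + t *\<^sub>R u)"
      unfolding in_segment
    proof (intro conjI exI[of _ "1/2"])
      show "\<nu> + t *\<^sub>R - u \<noteq> \<nu> + t *\<^sub>R u" using elim \<open>u \<noteq> 0\<close>
        by (simp add: neg_eq_iff_add_eq_0 flip: scaleR_add_left)
      show "\<nu> = (1 - 1 / 2) *\<^sub>R (\<nu> + t *\<^sub>R - u) + (1 / 2) *\<^sub>R (\<nu> + t *\<^sub>R u)"
        by (simp add: algebra_simps) (simp flip: scaleR_add_left)
    qed auto
    then show ?case using ex elim by (auto simp: extreme_point_of_def)
  qed
  then show False by simp
qed

text \<open>A nonzero vector orthogonal to all active normals would be a feasible direction together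
  with its negative, which contradicts extremality.\<close>

lemma vertex_normals_span:
  assumes v: "v extreme_point_of \<Delta>"
  shows "span (X ` active v) = UNIV"
proof (rule ccontr)
  assume "span (X ` active v) \<noteq> UNIV"
  then obtain u where u: "u \<noteq> 0" "\<forall>x\<in>span (X ` active v). u \<bullet> x = 0"
    using span_not_UNIV_orthogonal by blast
  then have "u \<bullet> X j = 0" if "j \<in> active v" for j
    using that by (simp add: span_base)
  moreover have "v \<in> \<Delta>" using v by (simp add: extreme_point_of_def)
  ultimately have "\<not> v extreme_point_of \<Delta>"
    using u(1) eventually_mono[OF feasible_direction[of v u], of "\<lambda>t. v + t *\<^sub>R u \<in> \<Delta>"]
      eventually_mono[OF feasible_direction[of v "- u"], of "\<lambda>t. v + t *\<^sub>R (- u) \<in> \<Delta>"]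
    by (intro not_extreme_if_line[of v \<Delta> u]) auto
  then show False using v by simp
qed

lemma edge_direction:
  assumes v: "v extreme_point_of \<Delta>" and E: "E edge_of \<Delta>" "v \<in> E"
  shows "\<exists>u. v + u \<in> E \<and> (\<forall>q\<in>E. \<exists>t\<ge>0. q = v + t *\<^sub>R u)"
proof -
  have dimE: "aff_dim E = 1" and ED: "E \<subseteq> \<Delta>" using E by (auto simp: edge_of_def face_of_imp_subset)
  then have "E \<noteq> {v}" by auto
  then obtain p where p: "p \<in> E" "p \<noteq> v" using E(2) by blast
  have "aff_dim {v, p} = 1" using p by (simp add: aff_dim_2)
  then have hull: "affine hull {v, p} = affine hull E"
    using aff_dim_psubset[of "{v, p}" E] hull_mono[of "{v, p}" E affine] E(2) p dimE by auto
  have "\<exists>t\<ge>0. q = v + t *\<^sub>R (p - v)" if q: "q \<in> E" for q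
  proof -
    have "q \<in> affine hull {v, p}" using hull q hull_inc by metis
    then obtain t where t: "q = v + t *\<^sub>R (p - v)" by (auto simp: affine_hull_2_alt)
    have "t \<ge> 0"
    proof (rule ccontr)
      assume neg: "\<not> t \<ge> 0"
      \<comment> \<open>Solves \<open>(1 - s) * t + s = 0\<close>, so that \<open>v\<close> would be
        the point with parameter \<open>s\<close> strictly between \<open>q\<close> and
        \<open>p\<close>.\<close>
      define s where "s = (- t) / (1 - t)"
      have s: "0 < s" "s < 1" using neg by (auto simp: s_def field_simps)
      have "(1 - s) * t + s = 0" using neg by (simp add: s_def field_simps)
      then have "((1 - s) * t + s) *\<^sub>R (p - v) = 0" by simp
      then have "v = (1 - s) *\<^sub>R q + s *\<^sub>R p" unfolding t by (simp add: algebra_simps)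
      moreover have "q \<noteq> p"
      proof
        assume "q = p"
        then have "(t - 1) *\<^sub>R (p - v) = 0" using t by (simp add: algebra_simps)
        then show False using neg p by simp
      qed
      ultimately have "v \<in> open_segment q p" using s by (auto simp: in_segment)
      then show False using v q p ED by (auto simp: extreme_point_of_def)
    qed
    then show ?thesis using t by blast
  qed
  then show ?thesis using p by (intro exI[of _ "p - v"]) auto
qed

text \<open>The hyperplane separates \<open>v\<close> from all other vertices, so the section is the
  vertex figure. The face cut out by the constraints active at \<open>q\<close> meets the hyperplane
  only in \<open>q\<close> (a further common direction would let \<open>q\<close> move both ways),
  hence has dimension one; if it missed \<open>v\<close>, all its vertices would lie strictly beyond
  the hyperplane, and so would \<open>q\<close>.\<close>

lemma vertex_figure:
  assumes v: "v extreme_point_of \<Delta>" and av: "a \<bullet> v < b"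
    and aw: "\<And>w. w extreme_point_of \<Delta> \<Longrightarrow> w \<noteq> v \<Longrightarrow> a \<bullet> w > b"
    and q: "q extreme_point_of (\<Delta> \<inter> {x. a \<bullet> x = b})"
  shows "\<exists>E. E edge_of \<Delta> \<and> v \<in> E \<and> q \<in> E"
proof -
  have qD: "q \<in> \<Delta>" and qb: "a \<bullet> q = b" using q by (auto simp: extreme_point_of_def)
  define F where "F = {\<nu> \<in> \<Delta>. \<forall>j\<in>active q. \<nu> \<bullet> X j = lam j}"
  have F: "F face_of \<Delta>" unfolding F_def by (rule active_face)
  have qF: "q \<in> F" using qD by (auto simp: F_def mem_active)
  have L0: "u = 0" if u: "\<And>j. j \<in> active q \<Longrightarrow> u \<bullet> X j = 0" "a \<bullet> u = 0" for u
  proof (rule ccontr)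
    assume "u \<noteq> 0"
    have "\<not> q extreme_point_of (\<Delta> \<inter> {x. a \<bullet> x = b})"
    proof (rule not_extreme_if_line[OF _ \<open>u \<noteq> 0\<close>])
      show "\<forall>\<^sub>F t in at_right 0. q + t *\<^sub>R u \<in> \<Delta> \<inter> {x. a \<bullet> x = b}"
        by (rule eventually_mono[OF feasible_direction[OF qD, of u]]) (auto simp: u qb inner_add_right inner_diff_right)
      show "\<forall>\<^sub>F t in at_right 0. q + t *\<^sub>R (- u) \<in> \<Delta> \<inter> {x. a \<bullet> x = b}"
        by (rule eventually_mono[OF feasible_direction[OF qD, of "- u"]]) (auto simp: u qb inner_add_right inner_diff_right)
    qed (use qD qb in auto)
    then show False using q by simp
  qed
  have "F \<noteq> {q}"
  proof
    assume "F = {q}"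
    then have "q extreme_point_of \<Delta>" using F by (simp add: face_of_singleton)
    then show False using av aw[of q] qb by (cases "q = v") auto
  qed
  then obtain p where p: "p \<in> F" "p \<noteq> q" using qF by blast
  define u where "u = p - q"
  have dirF: "(x - q) \<bullet> X j = 0" if "x \<in> F" "j \<in> active q" for x j
    using that by (simp add: F_def mem_active inner_diff_left)
  have au: "a \<bullet> u \<noteq> 0"
    using L0[of u] dirF p by (auto simp: u_def)
  have "F \<subseteq> affine hull {q, p}"
  proof
    fix x assume x: "x \<in> F"
    define t where "t = (a \<bullet> (x - q)) / (a \<bullet> u)"
    have "(x - q) - t *\<^sub>R u = 0"
    proof (rule L0)
      show "(x - q - t *\<^sub>R u) \<bullet> X j = 0" if "j \<in> active q" for j
        using dirF[OF x that] dirF[OF p(1) that] by (simp add: inner_diff_left u_def)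
      show "a \<bullet> (x - q - t *\<^sub>R u) = 0" using au by (simp add: inner_diff_right t_def)
    qed
    then have "x = q + t *\<^sub>R (p - q)" by (simp add: u_def algebra_simps)
    then show "x \<in> affine hull {q, p}" by (auto simp: affine_hull_2_alt)
  qed
  then have "aff_dim F \<le> 1"
    using aff_dim_subset[of F "affine hull {q, p}"] p by (simp add: aff_dim_2)
  moreover have "aff_dim {q, p} \<le> aff_dim F" using p qF by (intro aff_dim_subset) auto
  ultimately have edge: "F edge_of \<Delta>" using F p by (simp add: edge_of_def aff_dim_2)
  have "v \<in> F"
  proof (rule ccontr)
    assume "v \<notin> F"
    have "compact F" using F compact_Delta convex_Delta face_of_imp_compact by blast
    moreover have "convex F" using F by (rule face_of_imp_convex)
    ultimately have "F = convex hull {x. x extreme_point_of F}" by (rule Krein_Milman_Minkowski)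
    moreover have "convex hull {x. x extreme_point_of F} \<subseteq> {x. a \<bullet> x > b}"
    proof (rule hull_minimal)
      show "{x. x extreme_point_of F} \<subseteq> {x. a \<bullet> x > b}"
        using extreme_point_of_face[OF F] aw \<open>v \<notin> F\<close> by blast
    qed (rule convex_halfspace_gt)
    ultimately show False using qF qb by auto
  qed
  then show ?thesis using edge qF by blast
qed

text \<open>The vertex figure is the hull of points on edges through \<open>v\<close>, and every
  other vertex lies on a ray from \<open>v\<close> through the vertex figure. So the convex cone of
  the edges at \<open>v\<close> contains all vertices, hence the polytope.\<close>

lemma vertex_cone:
  assumes v: "v extreme_point_of \<Delta>"
  shows "\<exists>u. \<forall>x\<in>\<Delta>. \<exists>c. (\<forall>E\<in>{E. E edge_of \<Delta> \<and> v \<in> E}. c E \<ge> 0 \<and> v + u E \<in> \<Delta>) \<and>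
     x = v + (\<Sum>E\<in>{E. E edge_of \<Delta> \<and> v \<in> E}. c E *\<^sub>R u E)"
proof -
  define W where "W = {w. w extreme_point_of \<Delta> \<and> w \<noteq> v}"
  have "finite {w. w extreme_point_of \<Delta>}" using polytope_Delta by (simp add: finite_polyhedron_extreme_points polytope_imp_polyhedron)
  then have "finite W" by (simp add: W_def)
  have WD: "convex hull W \<subseteq> \<Delta>"
    by (rule hull_minimal) (auto simp: W_def extreme_point_of_def convex_Delta)
  have "v \<notin> convex hull W"
  proof
    assume "v \<in> convex hull W"
    then have "v extreme_point_of (convex hull W)" using v WD by (auto simp: extreme_point_of_def)
    then have "v \<in> W" by (rule extreme_point_of_convex_hull)
    then show False by (simp add: W_def)
  qed
  then obtain a b where ab: "a \<bullet> v < b" "\<And>x. x \<in> convex hull W \<Longrightarrow> a \<bullet> x > b"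
    using separating_hyperplane_closed_point[of "convex hull W" v] \<open>finite W\<close>
    by (auto simp: finite_imp_compact_convex_hull compact_imp_closed)
  define \<E> where "\<E> = {E. E edge_of \<Delta> \<and> v \<in> E}"
  have "finite \<E>"
    by (rule finite_subset[OF _ finite_polytope_faces[OF polytope_Delta]]) (auto simp: \<E>_def edge_of_def)
  have "\<exists>u. \<forall>E\<in>\<E>. v + u E \<in> E \<and> (\<forall>q\<in>E. \<exists>t\<ge>0. q = v + t *\<^sub>R u E)"
    using edge_direction[OF v] by (intro bchoice) (auto simp: \<E>_def)
  then obtain u where u: "\<And>E. E \<in> \<E> \<Longrightarrow> v + u E \<in> E" "\<And>E q. E \<in> \<E> \<Longrightarrow> q \<in> E \<Longrightarrow> \<exists>t\<ge>0. q = v + t *\<^sub>R u E"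
    by metis
  have uD: "v + u E \<in> \<Delta>" if "E \<in> \<E>" for E
    using u(1)[OF that] that by (auto simp: \<E>_def edge_of_def face_of_def)
  define K where "K = {x. \<exists>c. (\<forall>E\<in>\<E>. c E \<ge> 0) \<and> x = v + (\<Sum>E\<in>\<E>. c E *\<^sub>R u E)}"
  have "convex K"
    unfolding convex_alt
  proof (intro ballI allI impI)
    fix x y and t :: real assume "x \<in> K" "y \<in> K" and t: "0 \<le> t \<and> t \<le> 1"
    then obtain c c' where c: "\<forall>E\<in>\<E>. c E \<ge> 0" "x = v + (\<Sum>E\<in>\<E>. c E *\<^sub>R u E)"
      and c': "\<forall>E\<in>\<E>. c' E \<ge> 0" "y = v + (\<Sum>E\<in>\<E>. c' E *\<^sub>R u E)" by (auto simp: K_def)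
    have "(1 - t) *\<^sub>R x + t *\<^sub>R y = v + (\<Sum>E\<in>\<E>. ((1 - t) * c E + t * c' E) *\<^sub>R u E)"
      unfolding c c' by (simp add: algebra_simps scaleR_sum_right sum.distrib sum_subtractf)
    moreover have "\<forall>E\<in>\<E>. (1 - t) * c E + t * c' E \<ge> 0" using t c c' by auto
    ultimately show "(1 - t) *\<^sub>R x + t *\<^sub>R y \<in> K" by (auto simp: K_def)
  qed
  have EK: "E \<subseteq> K" if E: "E \<in> \<E>" for E
  proof
    fix q assume "q \<in> E"
    then obtain t where t: "t \<ge> 0" "q = v + t *\<^sub>R u E" using u(2)[OF E] by blast
    have "(\<Sum>E'\<in>\<E>. (if E' = E then t else 0) *\<^sub>R u E') = t *\<^sub>R u E"
      using \<open>finite \<E>\<close> E by (simp add: if_distrib[of "\<lambda>c. c *\<^sub>R _"] sum.delta cong: if_cong)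
    then show "q \<in> K" unfolding K_def using t by (auto intro!: exI[of _ "\<lambda>E'. if E' = E then t else 0"])
  qed
  have "\<Delta> \<inter> {x. a \<bullet> x = b} \<subseteq> K"
  proof -
    let ?S = "\<Delta> \<inter> {x. a \<bullet> x = b}"
    have "compact ?S" using compact_Delta by (simp add: compact_Int_closed closed_hyperplane)
    moreover have "convex ?S" by (intro convex_Int convex_Delta convex_hyperplane)
    ultimately have "?S = convex hull {x. x extreme_point_of ?S}" by (rule Krein_Milman_Minkowski)
    also have "\<dots> \<subseteq> K"
    proof (rule hull_minimal)
      show "{x. x extreme_point_of ?S} \<subseteq> K"
      proof clarify
        fix x assume "x extreme_point_of ?S"
        then obtain E where "E \<in> \<E>" "x \<in> E"
          using vertex_figure[OF v ab(1) _, of x] ab(2) hull_inc[of _ W convex] by (auto simp: \<E>_def W_def)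
        then show "x \<in> K" using EK by blast
      qed
    qed (rule \<open>convex K\<close>)
    finally show ?thesis .
  qed
  moreover have "w \<in> K" if w: "w \<in> W" for w
  proof -
    have wb: "a \<bullet> w > b" using ab(2) w by (simp add: hull_inc)
    \<comment> \<open>Parameter at which the segment from \<open>v\<close> to \<open>w\<close>
      crosses the separating hyperplane.\<close>
    define t where "t = (b - a \<bullet> v) / (a \<bullet> w - a \<bullet> v)"
    have t: "0 < t" "t < 1" using ab(1) wb by (auto simp: t_def field_simps)
    have "a \<bullet> (v + t *\<^sub>R (w - v)) = b" using ab(1) wb by (simp add: inner_add_right inner_diff_right t_def)
    moreover have "v + t *\<^sub>R (w - v) \<in> \<Delta>"
    proof -
      have "v \<in> \<Delta>" "w \<in> \<Delta>" using v w by (auto simp: W_def extreme_point_of_def)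
      then have "(1 - t) *\<^sub>R v + t *\<^sub>R w \<in> \<Delta>" using convex_Delta t by (auto simp: convex_alt)
      then show ?thesis by (simp add: algebra_simps)
    qed
    ultimately obtain c where c: "\<forall>E\<in>\<E>. c E \<ge> 0" "v + t *\<^sub>R (w - v) = v + (\<Sum>E\<in>\<E>. c E *\<^sub>R u E)"
      using \<open>\<Delta> \<inter> {x. a \<bullet> x = b} \<subseteq> K\<close> by (auto simp: K_def)
    have "w - v = (1 / t) *\<^sub>R (t *\<^sub>R (w - v))" using t by simp
    also have "t *\<^sub>R (w - v) = (\<Sum>E\<in>\<E>. c E *\<^sub>R u E)" using c(2) by simp
    finally have "w = v + (\<Sum>E\<in>\<E>. (c E / t) *\<^sub>R u E)" by (simp add: scaleR_sum_right algebra_simps)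
    moreover have "\<forall>E\<in>\<E>. c E / t \<ge> 0" using c t by auto
    ultimately show ?thesis by (auto simp: K_def)
  qed
  moreover have "v \<in> K" unfolding K_def by (auto intro!: exI[of _ "\<lambda>_. 0"])
  moreover have "\<Delta> = convex hull {w. w extreme_point_of \<Delta>}"
    using compact_Delta convex_Delta by (rule Krein_Milman_Minkowski)
  ultimately have "\<Delta> \<subseteq> K"
    using \<open>convex K\<close> hull_minimal[of "{w. w extreme_point_of \<Delta>}" K convex] by (auto simp: W_def)
  then show ?thesis using uD unfolding K_def \<E>_def by (intro exI[of _ u]) blast
qed

text \<open>Here simplicity enters. The edge directions at \<open>v\<close>, as many as the
  dimension n, span the space. A facet through \<open>v\<close> lies in the span, based at
  \<open>v\<close>, of those edges on which its normal vanishes; having dimension n - 1 it needs n -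
  1 of them, so at most one edge leaves it. That edge, rescaled, is the dual vector.\<close>

lemma vertex_dual_basis:
  assumes v: "v extreme_point_of \<Delta>"
  shows "\<exists>y. \<forall>i\<in>active v. \<forall>j\<in>active v. y i \<bullet> X j = (if i = j then 1 else 0)"
proof -
  have vD: "v \<in> \<Delta>" using v by (simp add: extreme_point_of_def)
  define \<E> where "\<E> = {E. E edge_of \<Delta> \<and> v \<in> E}"
  have finE: "finite \<E>"
    by (rule finite_subset[OF _ finite_polytope_faces[OF polytope_Delta]]) (auto simp: \<E>_def edge_of_def)
  have cardE: "card \<E> = DIM('a)"
    using simple v full_dim by (simp add: simple_polytope_def \<E>_def)
  obtain u where u: "\<And>x. x \<in> \<Delta> \<Longrightarrow> \<exists>c. (\<forall>E\<in>\<E>. c E \<ge> 0 \<and> v + u E \<in> \<Delta>) \<and> x = v + (\<Sum>E\<in>\<E>. c E *\<^sub>R u E)"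
    using vertex_cone[OF v] unfolding \<E>_def by blast
  have uX: "u E \<bullet> X j \<ge> 0" if "E \<in> \<E>" "j \<in> active v" for E j
  proof -
    have "v + u E \<in> \<Delta>" using u[OF vD] that by blast
    then show ?thesis using that(2) by (simp add: mem_Delta mem_active inner_add_left) (metis add_le_same_cancel1 le_add_same_cancel1)
  qed
  have dim_sub: "aff_dim S \<le> int (card T)" if S: "S \<subseteq> (+) v ` span (u ` T)" and "T \<subseteq> \<E>" for S T
  proof -
    have fT: "finite T" using that finE finite_subset by blast
    have "aff_dim S \<le> aff_dim ((+) v ` span (u ` T))" using S by (rule aff_dim_subset)
    also have "\<dots> = int (dim (span (u ` T)))" by (simp add: aff_dim_translation_eq aff_dim_subspace)
    also have "dim (span (u ` T)) \<le> card T"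
      using dim_le_card'[of "u ` T"] card_image_le[OF fT, of u] fT by (simp add: dim_span)
    finally show ?thesis by simp
  qed
  have span: "span (u ` \<E>) = UNIV"
  proof -
    have sub: "\<Delta> \<subseteq> (+) v ` span (u ` \<E>)"
    proof
      fix x assume "x \<in> \<Delta>"
      then obtain c where "x = v + (\<Sum>E\<in>\<E>. c E *\<^sub>R u E)" using u by blast
      then show "x \<in> (+) v ` span (u ` \<E>)" using imageI[of "\<Sum>E\<in>\<E>. c E *\<^sub>R u E" "span (u ` \<E>)" "(+) v"]
        by (simp add: span_sum span_scale span_base)
    qed
    have "int DIM('a) \<le> aff_dim ((+) v ` span (u ` \<E>))" using aff_dim_subset[OF sub] full_dim by simp
    also have "\<dots> = int (dim (u ` \<E>))" by (simp add: aff_dim_translation_eq aff_dim_subspace)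
    finally have "dim (u ` \<E>) = DIM('a)" using dim_subset_UNIV[of "u ` \<E>"] by linarith
    then show ?thesis by (simp add: dim_eq_full)
  qed
  have Xnz: "x = 0" if "\<And>E. E \<in> \<E> \<Longrightarrow> u E \<bullet> x = 0" for x
  proof -
    have "x \<in> span (u ` \<E>)" using span by simp
    then have "orthogonal x x"
      using that by (intro orthogonal_to_span[of x "u ` \<E>"]) (auto simp: orthogonal_def inner_commute[of x])
    then show ?thesis by (simp add: orthogonal_def)
  qed
  have one: "\<exists>!E. E \<in> \<E> \<and> u E \<bullet> X j \<noteq> 0" if j: "j \<in> active v" for j
  proof -
    let ?F = "{\<mu> \<in> \<Delta>. \<mu> \<bullet> X j = lam j}"
    let ?T = "{E \<in> \<E>. u E \<bullet> X j = 0}"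
    have facet: "?F facet_of \<Delta>" using facets by (auto simp: bij_betw_def)
    have nz: "X j \<noteq> 0"
    proof
      assume "X j = 0"
      moreover have "lam j = 0" using j \<open>X j = 0\<close> by (simp add: mem_active)
      ultimately have "?F = \<Delta>" by auto
      then show False using facet by (auto simp: facet_of_def)
    qed
    have "?F \<subseteq> (+) v ` span (u ` ?T)"
    proof
      fix x assume x: "x \<in> ?F"
      then obtain c where c: "\<forall>E\<in>\<E>. c E \<ge> 0" "x = v + (\<Sum>E\<in>\<E>. c E *\<^sub>R u E)" using u[of x] by blast
      \<comment> \<open>On the facet the slack is a vanishing sum of nonnegative terms, so only
        edges inside the facet can have a nonzero coefficient.\<close>
      have "(\<Sum>E\<in>\<E>. c E * (u E \<bullet> X j)) = 0"
        using x c(2) j by (simp add: mem_active inner_add_left inner_sum_left)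
      then have "\<forall>E\<in>\<E>. c E * (u E \<bullet> X j) = 0"
        using c(1) uX j by (subst (asm) sum_nonneg_eq_0_iff[OF finE]) auto
      then have "(\<Sum>E\<in>\<E>. c E *\<^sub>R u E) = (\<Sum>E\<in>?T. c E *\<^sub>R u E)"
        using finE by (intro sum.mono_neutral_right) auto
      moreover have "(\<Sum>E\<in>?T. c E *\<^sub>R u E) \<in> span (u ` ?T)"
        by (rule span_sum) (rule span_scale, rule span_base, rule imageI)
      ultimately show "x \<in> (+) v ` span (u ` ?T)" unfolding c(2) by simp
    qed
    then have "aff_dim ?F \<le> int (card ?T)" by (rule dim_sub) auto
    then have "card \<E> \<le> card ?T + 1" using facet full_dim cardE by (simp add: facet_of_def)
    moreover have "card \<E> = card ?T + card {E \<in> \<E>. u E \<bullet> X j \<noteq> 0}"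
      using finE by (subst card_Un_disjoint[symmetric]) (auto intro!: arg_cong[of _ _ card])
    ultimately have le1: "card {E \<in> \<E>. u E \<bullet> X j \<noteq> 0} \<le> 1" by simp
    obtain E where E: "E \<in> \<E>" "u E \<bullet> X j \<noteq> 0" using Xnz[of "X j"] nz by blast
    show ?thesis
    proof (rule ex1I[of _ E])
      show "E' = E" if "E' \<in> \<E> \<and> u E' \<bullet> X j \<noteq> 0" for E'
        using card_le_Suc0_iff_eq[of "{E \<in> \<E>. u E \<bullet> X j \<noteq> 0}"] le1 finE that E by auto
    qed (use E in auto)
  qed
  then obtain e where e: "\<And>j. j \<in> active v \<Longrightarrow> e j \<in> \<E>" "\<And>j. j \<in> active v \<Longrightarrow> u (e j) \<bullet> X j \<noteq> 0"
    "\<And>j E. j \<in> active v \<Longrightarrow> E \<in> \<E> \<Longrightarrow> u E \<bullet> X j \<noteq> 0 \<Longrightarrow> E = e j"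
    by metis
  have epos: "u (e j) \<bullet> X j > 0" if "j \<in> active v" for j
    using e(1,2)[OF that] uX[OF e(1)[OF that] that] by simp
  \<comment> \<open>If one edge leaves two facets, a combination of their normals vanishes on every
    edge direction, so the normals are proportional with a positive factor. The facets then
    coincide, and facets are enumerated injectively.\<close>
  have einj: "i = j" if i: "i \<in> active v" and j: "j \<in> active v" and eq: "e i = e j" for i j
  proof -
    define s where "s = (u (e j) \<bullet> X j) / (u (e i) \<bullet> X i)"
    have s: "s > 0" using epos i j by (simp add: s_def)
    have "X j - s *\<^sub>R X i = 0"
    proof (rule Xnz)
      fix E assume "E \<in> \<E>"
      show "u E \<bullet> (X j - s *\<^sub>R X i) = 0"
      proof (cases "E = e i")
        case True
        then show ?thesis using epos[OF i] by (simp add: inner_diff_right s_def eq)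
      next
        case False
        then have "u E \<bullet> X i = 0" "u E \<bullet> X j = 0"
          using e(3)[OF i \<open>E \<in> \<E>\<close>] e(3)[OF j \<open>E \<in> \<E>\<close>] eq by metis+
        then show ?thesis by (simp add: inner_diff_right)
      qed
    qed
    then have Xj: "X j = s *\<^sub>R X i" by simp
    have "lam j = s * lam i" using i j by (simp add: mem_active Xj) 
    then have "{\<mu> \<in> \<Delta>. \<mu> \<bullet> X i = lam i} = {\<mu> \<in> \<Delta>. \<mu> \<bullet> X j = lam j}"
      using s by (auto simp: Xj)
    then show ?thesis using facets by (auto simp: bij_betw_def inj_on_def)
  qed
  show ?thesis
  proof (intro exI[of _ "\<lambda>i. (1 / (u (e i) \<bullet> X i)) *\<^sub>R u (e i)"] ballI)
    fix i j assume ij: "i \<in> active v" "j \<in> active v"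
    show "((1 / (u (e i) \<bullet> X i)) *\<^sub>R u (e i)) \<bullet> X j = (if i = j then 1 else 0)"
      using e(3)[OF ij(2) e(1)[OF ij(1)]] einj[OF ij] e(2)[OF ij(1)] by auto
  qed
qed

end

section \<open>Regular maps and groups of bijections\<close>

lemma local_section_open_id: "open C \<Longrightarrow> x \<in> C \<Longrightarrow> local_section C id x C id"
  unfolding local_section_def
  by (intro conjI exI[of _ C]) (auto simp: homeomorphism_def)

lemma holomorphic_map_on_cong:
  assumes "open S" "\<And>x. x \<in> S \<Longrightarrow> f x = g x" "holomorphic_map_on S f"
  shows "holomorphic_map_on S g"
  unfolding holomorphic_map_on_def
proof
  fix x assume x: "x \<in> S"
  then obtain L where L: "(f has_derivative L) (at x)" "\<And>c v. L (c *s v) = c *s L v"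
    using assms(3) by (auto simp: holomorphic_map_on_def)
  have "(g has_derivative L) (at x)"
    by (rule has_derivative_transform_within_open[OF L(1) assms(1) x assms(2)])
  then show "\<exists>L. (g has_derivative L) (at x) \<and> (\<forall>c v. L (c *s v) = c *s L v)" using L by blast
qed

text \<open>The two notions are treated together: for the group actions below it is enough that
  regularity is invariant under equality on open sets and holds for complex linear maps.\<close>

definition regularity :: "((complex^'n::finite) set \<Rightarrow> (complex^'n \<Rightarrow> complex^'n) \<Rightarrow> bool) \<Rightarrow> bool" where
  "regularity reg \<longleftrightarrow> reg = smooth_on \<or> reg = holomorphic_map_on"

lemma regularity_cong:
  "regularity reg \<Longrightarrow> open S \<Longrightarrow> (\<And>x. x \<in> S \<Longrightarrow> f x = g x) \<Longrightarrow> reg S f \<Longrightarrow> reg S g"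
  using smooth_on_cong[of S f g] holomorphic_map_on_cong[of S f g] by (auto simp: regularity_def)

lemma regularity_complex_linear:
  fixes L :: "complex^'n \<Rightarrow> complex^'n"
  assumes "regularity reg" "open S" "linear L" "\<And>c v. L (c *s v) = c *s L v"
  shows "reg S L"
proof -
  have bl: "bounded_linear L" using assms(3) by (simp add: linear_conv_bounded_linear)
  then show ?thesis
    using assms(1,2,4) smooth_on_bounded_linear[OF assms(2) bl] bounded_linear_imp_has_derivative[OF bl]
    unfolding regularity_def holomorphic_map_on_def by blast
qed

text \<open>Additivity in the parameter turns sums into compositions and negatives into inverses;
  the restriction to \<open>C\<close> makes the maps extensional, as \<open>Bij\<close>
  demands.\<close>

lemma subgroup_of_family:
  fixes S :: "'g::ab_group_add set"
  assumes S: "0 \<in> S" "\<And>\<alpha> \<beta>. \<alpha> \<in> S \<Longrightarrow> \<beta> \<in> S \<Longrightarrow> \<alpha> + \<beta> \<in> S" "\<And>\<alpha>. \<alpha> \<in> S \<Longrightarrow> - \<alpha> \<in> S"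
    and \<tau>C: "\<And>\<alpha> x. \<alpha> \<in> S \<Longrightarrow> x \<in> C \<Longrightarrow> \<tau> \<alpha> x \<in> C"
    and \<tau>0: "\<And>x. x \<in> C \<Longrightarrow> \<tau> 0 x = x"
    and \<tau>add: "\<And>\<alpha> \<beta> x. x \<in> C \<Longrightarrow> \<tau> (\<alpha> + \<beta>) x = \<tau> \<alpha> (\<tau> \<beta> x)"
  shows "subgroup ((\<lambda>\<alpha>. restrict (\<tau> \<alpha>) C) ` S) (BijGroup C)"
proof -
  let ?t = "\<lambda>\<alpha>. restrict (\<tau> \<alpha>) C"
  have inv: "\<tau> (- \<alpha>) (\<tau> \<alpha> x) = x" "\<tau> \<alpha> (\<tau> (- \<alpha>) x) = x" if "x \<in> C" for \<alpha> x
    using that \<tau>add[of x "- \<alpha>" \<alpha>] \<tau>add[of x \<alpha> "- \<alpha>"] \<tau>0 by auto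
  have bij: "?t \<alpha> \<in> Bij C" if "\<alpha> \<in> S" for \<alpha>
  proof -
    have "bij_betw (\<tau> \<alpha>) C C"
      by (rule bij_betwI[where g="\<tau> (- \<alpha>)"]) (use that inv \<tau>C S in auto)
    then show ?thesis by (auto simp: Bij_def cong: bij_betw_cong)
  qed
  have mult: "?t \<alpha> \<otimes>\<^bsub>BijGroup C\<^esub> ?t \<beta> = ?t (\<alpha> + \<beta>)" if "\<alpha> \<in> S" "\<beta> \<in> S" for \<alpha> \<beta>
    using bij[OF that(1)] bij[OF that(2)] \<tau>add \<tau>C[OF that(2)]
    by (auto simp: BijGroup_def compose_def fun_eq_iff)
  show ?thesis
  proof (rule group.subgroupI[OF group_BijGroup])
    show "?t ` S \<subseteq> carrier (BijGroup C)" using bij by (auto simp: BijGroup_def)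
    show "?t ` S \<noteq> {}" using S by auto
    show "inv\<^bsub>BijGroup C\<^esub> a \<in> ?t ` S" if a: "a \<in> ?t ` S" for a
    proof -
      obtain \<alpha> where \<alpha>: "\<alpha> \<in> S" "a = ?t \<alpha>" using a by auto
      have "?t (- \<alpha>) \<otimes>\<^bsub>BijGroup C\<^esub> ?t \<alpha> = \<one>\<^bsub>BijGroup C\<^esub>"
        using mult[OF S(3)[OF \<alpha>(1)] \<alpha>(1)] \<tau>0 by (auto simp: BijGroup_def)
      then have "inv\<^bsub>BijGroup C\<^esub> a = ?t (- \<alpha>)"
        unfolding \<alpha>(2) using bij \<alpha>(1) S(3)
        by (intro group.inv_equality[OF group_BijGroup]) (auto simp: BijGroup_def)
      then show ?thesis using S \<alpha> by auto
    qed
    show "a \<otimes>\<^bsub>BijGroup C\<^esub> b \<in> ?t ` S" if ab: "a \<in> ?t ` S" "b \<in> ?t ` S" for a b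
    proof -
      obtain \<alpha> \<beta> where "\<alpha> \<in> S" "\<beta> \<in> S" "a = ?t \<alpha>" "b = ?t \<beta>" using ab by auto
      then show ?thesis using mult[of \<alpha> \<beta>] S(2)[of \<alpha> \<beta>] by auto
    qed
  qed
qed

section \<open>Torus-invariant domains and their universal covers\<close>

text \<open>Squared moduli rather than moduli, because the inequalities that cut out the symplectic
  chart domains are affine in them; convex sets \<open>A\<close> therefore describe all domains that
  occur.\<close>

definition modsq :: "complex^'n::finite \<Rightarrow> real^'n" where
  "modsq w = (\<chi> k. (cmod (w $ k))\<^sup>2)"

definition reinhardt :: "(real^'n::finite) set \<Rightarrow> (complex^'n) set" where
  "reinhardt A = {w. modsq w \<in> A}"

definition partial_exp :: "'n set \<Rightarrow> complex^'n::finite \<Rightarrow> complex^'n" where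
  "partial_exp K x = (\<chi> k. if k \<in> K then exp (x $ k) else x $ k)"

text \<open>Total space of the universal cover of \<open>nonvanishing A K\<close>: logarithmic
  coordinates for the indices in \<open>K\<close>, where a coordinate must not vanish, and the
  original ones elsewhere. For \<open>K = {}\<close> it is the domain itself.\<close>

definition log_domain :: "(real^'n::finite) set \<Rightarrow> 'n set \<Rightarrow> (complex^'n) set" where
  "log_domain A K = {x. partial_exp K x \<in> reinhardt A}"

definition nonvanishing :: "(real^'n::finite) set \<Rightarrow> 'n set \<Rightarrow> (complex^'n) set" where
  "nonvanishing A K = {w \<in> reinhardt A. \<forall>k\<in>K. w $ k \<noteq> 0}"

definition phase :: "real^'n::finite \<Rightarrow> complex^'n \<Rightarrow> complex^'n" where
  "phase \<alpha> w = (\<chi> k. exp (\<i> * complex_of_real (\<alpha> $ k)) * w $ k)"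

text \<open>Lift of \<open>phase\<close> to logarithmic coordinates, where a rotation becomes an
  imaginary translation; angle vectors that differ by periods in \<open>K\<close> give the same
  phase but different lifts.\<close>

definition log_phase :: "'n set \<Rightarrow> real^'n::finite \<Rightarrow> complex^'n \<Rightarrow> complex^'n" where
  "log_phase K \<alpha> x = (\<chi> k. if k \<in> K then x $ k + \<i> * complex_of_real (\<alpha> $ k)
     else exp (\<i> * complex_of_real (\<alpha> $ k)) * x $ k)"

lemma continuous_on_modsq: "continuous_on S modsq"
  unfolding modsq_def by (intro continuous_intros)

lemma continuous_on_partial_exp: "continuous_on S (partial_exp K)"
  unfolding partial_exp_def
proof (rule continuous_on_vec_lambda)
  show "continuous_on S (\<lambda>x. if i \<in> K then exp (x $ i) else x $ i)" for i
    by (cases "i \<in> K") (auto intro!: continuous_intros)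
qed

lemma continuous_on_log_phase: "continuous_on S (log_phase K \<alpha>)"
  unfolding log_phase_def
proof (rule continuous_on_vec_lambda)
  show "continuous_on S (\<lambda>x. if i \<in> K then x $ i + \<i> * complex_of_real (\<alpha> $ i)
     else exp (\<i> * complex_of_real (\<alpha> $ i)) * x $ i)" for i
    by (cases "i \<in> K") (auto intro!: continuous_intros)
qed

lemma open_reinhardt: "open A \<Longrightarrow> open (reinhardt A)"
  using open_vimage[OF _ continuous_on_modsq[of UNIV]] by (simp add: reinhardt_def vimage_def)

lemma open_log_domain: "open A \<Longrightarrow> open (log_domain A K)"
  using open_vimage[OF open_reinhardt continuous_on_partial_exp[of UNIV K]]
  by (simp add: log_domain_def vimage_def)

lemma open_nonvanishing:
  assumes "open A" shows "open (nonvanishing A K)"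
proof -
  have "nonvanishing A K = reinhardt A \<inter> (\<Inter>k\<in>K. {w. w $ k \<noteq> 0})"
    by (auto simp: nonvanishing_def)
  also have "open \<dots>"
    using assms by (intro open_Int open_reinhardt open_INT) (auto intro!: open_Collect_neq continuous_intros)
  finally show ?thesis .
qed

lemma partial_exp_empty [simp]: "partial_exp {} = id"
  by (auto simp: partial_exp_def fun_eq_iff vec_eq_iff)

lemma log_domain_empty [simp]: "log_domain A {} = reinhardt A"
  by (simp add: log_domain_def)

lemma log_phase_empty [simp]: "log_phase {} \<alpha> = phase \<alpha>"
  by (auto simp: log_phase_def phase_def fun_eq_iff)

lemma modsq_phase [simp]: "modsq (phase \<alpha> w) = modsq w"
  by (simp add: modsq_def phase_def norm_mult norm_exp_i_times)

lemma phase_reinhardt: "phase \<alpha> w \<in> reinhardt A \<longleftrightarrow> w \<in> reinhardt A"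
  by (simp add: reinhardt_def)

lemma partial_exp_log_phase: "partial_exp K (log_phase K \<alpha> x) = phase \<alpha> (partial_exp K x)"
  by (auto simp: partial_exp_def log_phase_def phase_def vec_eq_iff exp_add)

lemma log_phase_add: "log_phase K (\<alpha> + \<beta>) x = log_phase K \<alpha> (log_phase K \<beta> x)"
  by (auto simp: log_phase_def vec_eq_iff exp_add algebra_simps)

lemma log_phase_zero [simp]: "log_phase K 0 x = x"
  by (auto simp: log_phase_def vec_eq_iff)

lemma log_phase_domain: "log_phase K \<alpha> x \<in> log_domain A K \<longleftrightarrow> x \<in> log_domain A K"
  by (simp add: log_domain_def partial_exp_log_phase phase_reinhardt)

lemma linear_phase: "linear (phase \<alpha>)"
  by (rule linearI) (auto simp: phase_def vec_eq_iff algebra_simps)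

lemma phase_cmul: "phase \<alpha> (c *s v) = c *s phase \<alpha> v"
  by (auto simp: phase_def vec_eq_iff)

text \<open>The squared moduli of \<open>H(t, x)\<close> interpolate linearly between those of \<open>x\<close> and \<open>s\<close>, so that
  the convexity of \<open>A\<close> keeps the homotopy inside.\<close>

lemma contractible_log_domain:
  fixes A :: "(real^'n::finite) set"
  assumes "convex A" "s \<in> A" and s: "\<And>k. if k \<in> K then s $ k > 0 else s $ k = 0"
  shows "contractible (log_domain A K)"
proof -
  define H where "H = (\<lambda>(t::real, x::complex^'n). (\<chi> k. if k \<in> K
     then Complex (ln ((1 - t) * exp (2 * Re (x $ k)) + t * s $ k) / 2) ((1 - t) * Im (x $ k))
     else complex_of_real (sqrt (1 - t)) * x $ k))"
  let ?D = "log_domain A K"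
  have pos: "(1 - t) * exp (2 * r) + t * s $ k > 0" if "k \<in> K" "t \<in> {0..1}" for t r k
  proof (cases "t = 1")
    case True then show ?thesis using s[of k] that by simp
  next
    case False
    then have "(1 - t) * exp (2 * r) > 0" "t * s $ k \<ge> 0" using that s[of k] by auto
    then show ?thesis by linarith
  qed
  have cont: "continuous_on ({0..1} \<times> ?D) H"
    unfolding H_def case_prod_unfold
  proof (rule continuous_on_vec_lambda)
    fix k
    show "continuous_on ({0..1} \<times> ?D) (\<lambda>p. if k \<in> K
     then Complex (ln ((1 - fst p) * exp (2 * Re (snd p $ k)) + fst p * s $ k) / 2) ((1 - fst p) * Im (snd p $ k))
     else complex_of_real (sqrt (1 - fst p)) * snd p $ k)"
    proof (cases "k \<in> K")
      case True
      show ?thesis unfolding if_P[OF True] Complex_eq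
        by (intro continuous_intros) (use pos[OF True] in \<open>force simp: less_le\<close>)+
    next
      case False
      show ?thesis unfolding if_not_P[OF False] by (intro continuous_intros)
    qed
  qed
  have mod: "modsq (partial_exp K (H (t, x))) = (1 - t) *\<^sub>R modsq (partial_exp K x) + t *\<^sub>R s"
    if t: "t \<in> {0..1}" for t x
  proof (rule vec_eq_iff[THEN iffD2], rule allI)
    fix k
    show "modsq (partial_exp K (H (t, x))) $ k = ((1 - t) *\<^sub>R modsq (partial_exp K x) + t *\<^sub>R s) $ k"
    proof (cases "k \<in> K")
      case True
      have e: "(exp a)\<^sup>2 = exp (2 * a)" for a :: real by (simp add: exp_double)
      show ?thesis using True pos[OF True t] by (simp add: modsq_def partial_exp_def H_def norm_exp_eq_Re e)
    next
      case False
      then show ?thesis using s[of k] t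
        by (simp add: modsq_def partial_exp_def H_def norm_mult power_mult_distrib)
    qed
  qed
  have im: "H ` ({0..1} \<times> ?D) \<subseteq> ?D"
  proof clarify
    fix t :: real and x :: "complex^'n" assume t: "t \<in> {0..1}" and x: "x \<in> ?D"
    have "(1 - t) *\<^sub>R modsq (partial_exp K x) + t *\<^sub>R s \<in> A"
      using \<open>convex A\<close> x \<open>s \<in> A\<close> t by (auto simp: convex_alt log_domain_def reinhardt_def)
    then show "H (t, x) \<in> ?D" using mod[OF t] by (simp add: log_domain_def reinhardt_def)
  qed
  have "H (0, x) = id x" for x
    by (auto simp: H_def vec_eq_iff complex_eq_iff)
  moreover have "H (1, x) = (\<chi> k. if k \<in> K then Complex (ln (s $ k) / 2) 0 else 0)" for x
    by (auto simp: H_def vec_eq_iff)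
  ultimately have "homotopic_with_canon (\<lambda>x. True) ?D ?D id (\<lambda>x. \<chi> k. if k \<in> K then Complex (ln (s $ k) / 2) 0 else 0)"
    unfolding homotopic_with_def using cont im
    by (intro exI[of _ H]) (auto simp: image_subset_iff)
  then show ?thesis unfolding contractible_def by blast
qed

text \<open>The branch of the logarithm that takes the value \<open>x0\<close> over
  \<open>exp x0\<close>. It is defined off the rays opposite to the centre
  (\<open>slit_domain\<close>), and its image is the strip of height 2 pi around \<open>x0\<close>
  (\<open>sheet\<close>); both conditions concern the indices in \<open>K\<close>.\<close>

definition log_section :: "'n set \<Rightarrow> complex^'n::finite \<Rightarrow> complex^'n \<Rightarrow> complex^'n" where
  "log_section K x0 w = (\<chi> k. if k \<in> K then x0 $ k + Ln (w $ k / exp (x0 $ k)) else w $ k)"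

definition slit_domain :: "(real^'n::finite) set \<Rightarrow> 'n set \<Rightarrow> complex^'n \<Rightarrow> (complex^'n) set" where
  "slit_domain A K w0 = {w \<in> reinhardt A. \<forall>k\<in>K. w $ k / w0 $ k \<notin> \<real>\<^sub>\<le>\<^sub>0}"

definition sheet :: "(real^'n::finite) set \<Rightarrow> 'n set \<Rightarrow> complex^'n \<Rightarrow> (complex^'n) set" where
  "sheet A K x0 = {x \<in> log_domain A K. \<forall>k\<in>K. \<bar>Im (x $ k - x0 $ k)\<bar> < pi}"

lemma exp_notin_nonpos_Reals: "\<bar>Im y\<bar> < pi \<Longrightarrow> exp y \<notin> \<real>\<^sub>\<le>\<^sub>0"
proof
  assume y: "\<bar>Im y\<bar> < pi" and "exp y \<in> \<real>\<^sub>\<le>\<^sub>0"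
  then have "Re (exp y) \<le> 0" "Im (exp y) = 0" by (auto simp: complex_nonpos_Reals_iff)
  moreover from this have "Re (exp y) \<noteq> 0" using exp_not_eq_zero[of y] by (metis complex_eq_iff zero_complex.simps)
  ultimately have "Im (Ln (exp y)) = pi" by (simp add: Im_Ln_eq_pi)
  then show False using y by (simp add: abs_less_iff)
qed

lemma open_slit_domain:
  fixes A :: "(real^'n::finite) set"
  assumes "open A" "\<And>k. k \<in> K \<Longrightarrow> w0 $ k \<noteq> 0"
  shows "open (slit_domain A K w0)"
proof -
  have "slit_domain A K w0 = reinhardt A \<inter> (\<Inter>k\<in>K. (\<lambda>w. w $ k / w0 $ k) -` (- \<real>\<^sub>\<le>\<^sub>0))"
    by (auto simp: slit_domain_def)
  also have "open \<dots>"
    using assms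
    by (intro open_Int open_reinhardt open_INT ballI finite open_vimage)
       (auto intro!: continuous_intros)
  finally show ?thesis .
qed

lemma open_sheet:
  fixes A :: "(real^'n::finite) set"
  assumes "open A"
  shows "open (sheet A K x0)"
proof -
  have "sheet A K x0 = log_domain A K \<inter> (\<Inter>k\<in>K. {x. \<bar>Im (x $ k - x0 $ k)\<bar> < pi})"
    by (auto simp: sheet_def)
  also have "open \<dots>"
    using assms
    by (intro open_Int open_log_domain open_INT ballI finite open_Collect_less)
       (auto intro!: continuous_intros)
  finally show ?thesis .
qed

lemma homeomorphism_sheet:
  fixes A :: "(real^'n::finite) set"
  assumes w0: "w0 = partial_exp K x0"
  shows "homeomorphism (sheet A K x0) (slit_domain A K w0) (partial_exp K) (log_section K x0)"
proof
  have w0k: "w0 $ k = exp (x0 $ k)" if "k \<in> K" for k using that by (simp add: w0 partial_exp_def)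
  show "continuous_on (slit_domain A K w0) (log_section K x0)"
    unfolding log_section_def
  proof (rule continuous_on_vec_lambda)
    show "continuous_on (slit_domain A K w0) (\<lambda>w. if k \<in> K then x0 $ k + Ln (w $ k / exp (x0 $ k)) else w $ k)" for k
      by (cases "k \<in> K") (auto intro!: continuous_intros simp: slit_domain_def w0k)
  qed
  show 1: "partial_exp K (log_section K x0 w) = w" if "w \<in> slit_domain A K w0" for w
  proof -
    have "w $ k \<noteq> 0" if "k \<in> K" for k
      using \<open>w \<in> slit_domain A K w0\<close> that by (auto simp: slit_domain_def)
    then show ?thesis by (auto simp: partial_exp_def log_section_def vec_eq_iff exp_add)
  qed
  show 2: "log_section K x0 (partial_exp K x) = x" if "x \<in> sheet A K x0" for x
  proof -
    have "x0 $ k + Ln (exp (x $ k) / exp (x0 $ k)) = x $ k" if "k \<in> K" for k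
      using \<open>x \<in> sheet A K x0\<close> that by (auto simp: sheet_def abs_less_iff simp flip: exp_diff)
    then show ?thesis by (auto simp: partial_exp_def log_section_def vec_eq_iff)
  qed
  show "partial_exp K ` sheet A K x0 \<subseteq> slit_domain A K w0"
  proof clarify
    fix x assume x: "x \<in> sheet A K x0"
    have "partial_exp K x $ k / w0 $ k \<notin> \<real>\<^sub>\<le>\<^sub>0" if k: "k \<in> K" for k
      using exp_notin_nonpos_Reals[of "x $ k - x0 $ k"] x k
      by (auto simp: sheet_def w0k partial_exp_def exp_diff)
    then show "partial_exp K x \<in> slit_domain A K w0" using x
      by (auto simp: slit_domain_def sheet_def log_domain_def)
  qed
  show "log_section K x0 ` slit_domain A K w0 \<subseteq> sheet A K x0"
  proof clarify
    fix w assume w: "w \<in> slit_domain A K w0"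
    have "\<bar>Im (Ln (w $ k / exp (x0 $ k)))\<bar> < pi" if "k \<in> K" for k
    proof -
      have n: "w $ k / exp (x0 $ k) \<notin> \<real>\<^sub>\<le>\<^sub>0" using w that by (auto simp: slit_domain_def w0k)
      then have "w $ k / exp (x0 $ k) \<noteq> 0" by auto
      from mpi_less_Im_Ln[OF this] show ?thesis using Im_Ln_less_pi[OF n] by linarith
    qed
    then show "log_section K x0 w \<in> sheet A K x0"
      using w 1[OF w] by (auto simp: sheet_def log_domain_def slit_domain_def log_section_def)
  qed
qed (rule continuous_on_partial_exp)

lemma partial_exp_image: "partial_exp K ` log_domain A K = nonvanishing A K"
proof
  show "partial_exp K ` log_domain A K \<subseteq> nonvanishing A K"
    by (auto simp: log_domain_def nonvanishing_def) (simp add: partial_exp_def)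
  show "nonvanishing A K \<subseteq> partial_exp K ` log_domain A K"
  proof
    fix w assume w: "w \<in> nonvanishing A K"
    have "partial_exp K (\<chi> k. if k \<in> K then Ln (w $ k) else w $ k) = w"
      using w by (auto simp: nonvanishing_def partial_exp_def vec_eq_iff)
    then show "w \<in> partial_exp K ` log_domain A K"
      using w by (intro image_eqI[of _ _ "\<chi> k. if k \<in> K then Ln (w $ k) else w $ k"])
       (auto simp: log_domain_def nonvanishing_def)
  qed
qed

text \<open>The second factor is a dummy: \<open>submodel_cover\<close> takes covers inside the
  product of the space with itself, so the cover is embedded as
  \<open>log_domain A K \<times> {0}\<close>.\<close>

definition cover_proj :: "'n set \<Rightarrow> (complex^'n::finite) \<times> (complex^'n) \<Rightarrow> complex^'n" where
  "cover_proj K = partial_exp K \<circ> fst"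

lemma homeomorphism_Times_zero:
  fixes p :: "'a::topological_space \<Rightarrow> 'b::topological_space"
  assumes "homeomorphism U T p s"
  shows "homeomorphism (U \<times> {0::'c::{zero,topological_space}}) T (p \<circ> fst) (\<lambda>w. (s w, 0))"
proof
  have "continuous_on U p" "continuous_on T s" using assms by (auto simp: homeomorphism_def)
  then show "continuous_on (U \<times> {0::'c}) (p \<circ> fst)" "continuous_on T (\<lambda>w. (s w, 0::'c))"
    unfolding o_def by (auto intro!: continuous_intros intro: continuous_on_compose2[of U p _ fst])
qed (use assms in \<open>auto simp: homeomorphism_def\<close>)

lemma openin_sheet:
  fixes A :: "(real^'n::finite) set"
  assumes "open A"
  shows "openin (top_of_set (log_domain A K \<times> {0})) (sheet A K x0 \<times> {0})"
proof -
  have "sheet A K x0 \<subseteq> log_domain A K" by (auto simp: sheet_def)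
  then have "openin (top_of_set (log_domain A K)) (sheet A K x0)"
    using open_sheet[OF assms] by (auto simp: openin_open)
  then show ?thesis by (intro openin_Times) auto
qed

lemma local_section_cover:
  fixes A :: "(real^'n::finite) set"
  assumes "open A" "x0 \<in> log_domain A K"
  shows "local_section (log_domain A K \<times> {0}) (cover_proj K) (x0, 0)
     (slit_domain A K (partial_exp K x0)) (\<lambda>w. (log_section K x0 w, 0))"
  unfolding local_section_def cover_proj_def
proof (intro conjI exI[of _ "sheet A K x0 \<times> {0}"])
  show "open (slit_domain A K (partial_exp K x0))"
    by (rule open_slit_domain[OF assms(1)]) (simp add: partial_exp_def)
  show "openin (top_of_set (log_domain A K \<times> {0})) (sheet A K x0 \<times> {0})"
    by (rule openin_sheet[OF assms(1)])
  show "(x0, 0) \<in> sheet A K x0 \<times> {0}" using assms(2) by (simp add: sheet_def)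
qed (rule homeomorphism_Times_zero[OF homeomorphism_sheet[OF refl]])

lemma covering_space_cover:
  fixes A :: "(real^'n::finite) set"
  assumes "open A"
  shows "covering_space (log_domain A K \<times> {0}) (cover_proj K) (nonvanishing A K)"
proof
  show "continuous_on (log_domain A K \<times> {0}) (cover_proj K)"
    unfolding cover_proj_def
    by (intro continuous_on_compose continuous_on_fst continuous_on_partial_exp continuous_on_id)
  show "cover_proj K ` (log_domain A K \<times> {0}) = nonvanishing A K"
    unfolding partial_exp_image[symmetric] by (force simp: cover_proj_def)
next
  fix w0 assume w0: "w0 \<in> nonvanishing A K"
  let ?T = "slit_domain A K w0" and ?v = "{sheet A K x0 \<times> {0::complex^'n} | x0. partial_exp K x0 = w0}"
  have "open ?T" using w0 by (intro open_slit_domain assms) (auto simp: nonvanishing_def)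
  moreover have "?T \<subseteq> nonvanishing A K" by (auto simp: slit_domain_def nonvanishing_def)
  ultimately have 1: "openin (top_of_set (nonvanishing A K)) ?T" by (auto simp: openin_open)
  have 2: "w0 \<in> ?T" using w0 by (auto simp: slit_domain_def nonvanishing_def)
  have 3: "\<Union>?v = (log_domain A K \<times> {0}) \<inter> cover_proj K -` ?T"
  proof (intro equalityI subsetI)
    fix p assume "p \<in> \<Union>?v"
    then obtain x0 where x0: "w0 = partial_exp K x0" "p \<in> sheet A K x0 \<times> {0}" by blast
    then show "p \<in> (log_domain A K \<times> {0}) \<inter> cover_proj K -` ?T"
      using homeomorphism_sheet[OF x0(1), of A] by (auto simp: sheet_def cover_proj_def homeomorphism_def)
  next
    fix p assume p: "p \<in> (log_domain A K \<times> {0}) \<inter> cover_proj K -` ?T"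
    obtain x where x: "p = (x, 0)" "x \<in> log_domain A K" "partial_exp K x \<in> ?T"
      using p by (auto simp: cover_proj_def)
    \<comment> \<open>The preimage of \<open>w0\<close> on the sheet through \<open>x\<close>: off
      the slit the principal logarithm of the quotient has imaginary part of modulus below pi, so
      \<open>x\<close> lies in the strip around \<open>x0\<close>.\<close>
    define x0 where "x0 = (\<chi> k. if k \<in> K then x $ k - Ln (exp (x $ k) / w0 $ k) else w0 $ k)"
    have nz: "w0 $ k \<noteq> 0" if "k \<in> K" for k using w0 that by (auto simp: nonvanishing_def)
    have "partial_exp K x0 = w0"
      using nz by (auto simp: partial_exp_def x0_def vec_eq_iff exp_diff)
    moreover have "x \<in> sheet A K x0"
    proof -
      have "\<bar>Im (Ln (exp (x $ k) / w0 $ k))\<bar> < pi" if k: "k \<in> K" for k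
      proof -
        have n: "exp (x $ k) / w0 $ k \<notin> \<real>\<^sub>\<le>\<^sub>0" using x(3) k by (auto simp: slit_domain_def partial_exp_def)
        then have "exp (x $ k) / w0 $ k \<noteq> 0" by auto
        from mpi_less_Im_Ln[OF this] show ?thesis using Im_Ln_less_pi[OF n] by linarith
      qed
      then show ?thesis using x(2) by (auto simp: sheet_def x0_def)
    qed
    ultimately show "p \<in> \<Union>?v" using x(1) by blast
  qed
  have 4: "\<forall>u\<in>?v. openin (top_of_set (log_domain A K \<times> {0})) u"
    using openin_sheet[OF assms] by blast
  have 5: "pairwise disjnt ?v"
  proof (rule pairwiseI)
    fix u u' assume "u \<in> ?v" "u' \<in> ?v" "u \<noteq> u'"
    then obtain y y' where y: "u = sheet A K y \<times> {0}" "partial_exp K y = w0"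
      and y': "u' = sheet A K y' \<times> {0}" "partial_exp K y' = w0" by blast
    show "disjnt u u'"
    proof (rule ccontr)
      assume "\<not> disjnt u u'"
      then obtain x where x: "x \<in> sheet A K y" "x \<in> sheet A K y'" unfolding y y' by (auto simp: disjnt_def)
      have "y $ k = y' $ k" for k
      proof (cases "k \<in> K")
        case True
        have e: "exp (y $ k) = exp (y' $ k)" using y(2) y'(2) True by (auto simp: partial_exp_def vec_eq_iff) (metis)
        \<comment> \<open>The imaginary part of a common point is within pi of those of both
          centres, so these differ by less than one period and equal exponentials force equal
          centres.\<close>
        show ?thesis
        proof (rule exp_complex_eqI[OF _ e])
          have "\<bar>Im (x $ k - y $ k)\<bar> < pi" "\<bar>Im (x $ k - y' $ k)\<bar> < pi" using x True by (auto simp: sheet_def)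
          then show "\<bar>Im (y $ k) - Im (y' $ k)\<bar> < 2 * pi" by (simp add: abs_less_iff)
        qed
      next
        case False
        then show ?thesis using y(2) y'(2) by (auto simp: partial_exp_def vec_eq_iff) (metis)
      qed
      then have "y = y'" by (simp add: vec_eq_iff)
      then show False using \<open>u \<noteq> u'\<close> y y' by simp
    qed
  qed
  have 6: "\<forall>u\<in>?v. \<exists>q. homeomorphism u ?T (cover_proj K) q"
    using homeomorphism_Times_zero[OF homeomorphism_sheet] unfolding cover_proj_def by blast
  show "\<exists>T. w0 \<in> T \<and> openin (top_of_set (nonvanishing A K)) T \<and>
     (\<exists>v. \<Union>v = (log_domain A K \<times> {0}) \<inter> cover_proj K -` T \<and>
        (\<forall>u\<in>v. openin (top_of_set (log_domain A K \<times> {0})) u) \<and> pairwise disjnt v \<and>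
        (\<forall>u\<in>v. \<exists>q. homeomorphism u T (cover_proj K) q))"
    using 1 2 3 4 5 6 by blast
qed

lemma dense_nonzero_coordinates:
  "closure {x :: complex^'n::finite. \<forall>k. x $ k \<noteq> 0} = UNIV"
proof -
  have "x \<in> closure {x. \<forall>k. x $ k \<noteq> 0}" for x :: "complex^'n"
    unfolding closure_sequential
  proof (intro exI conjI allI)
    let ?y = "\<lambda>n. \<chi> k. if x $ k = 0 then complex_of_real (inverse (real (Suc n))) else x $ k"
    show "?y n \<in> {x. \<forall>k. x $ k \<noteq> 0}" for n by (auto simp del: of_nat_Suc)
    show "?y \<longlonglongrightarrow> x"
    proof (rule vec_tendstoI)
      fix k
      have "(\<lambda>n. complex_of_real (inverse (real (Suc n)))) \<longlonglongrightarrow> of_real 0"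
        by (intro tendsto_of_real LIMSEQ_inverse_real_of_nat)
      then show "(\<lambda>n. ?y n $ k) \<longlonglongrightarrow> x $ k"
        by (cases "x $ k = 0") (simp_all del: of_nat_Suc of_real_inverse)
    qed
  qed
  then show ?thesis by blast
qed

text \<open>Exponentiating the coordinates outside \<open>K\<close> as well presents the locus
  without further zeros as a continuous image of the contractible \<open>log_domain A UNIV\<close>.
  It is also dense, and any set between a connected set and its closure is connected.
  \<open>F\<close> stands for a set of free points.\<close>

lemma connected_dense_log_domain:
  fixes A :: "(real^'n::finite) set"
  assumes "open A" "convex A" "0 \<in> A"
    and F: "{x \<in> log_domain A K. \<forall>k. k \<notin> K \<longrightarrow> x $ k \<noteq> 0} \<subseteq> F" "F \<subseteq> log_domain A K"
  shows "connected F" "log_domain A K \<subseteq> closure F"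
proof -
  let ?G = "{x \<in> log_domain A K. \<forall>k. k \<notin> K \<longrightarrow> x $ k \<noteq> 0}"
  have "log_domain A K \<subseteq> closure (log_domain A K \<inter> {x. \<forall>k. x $ k \<noteq> 0})"
    using open_Int_closure_subset[OF open_log_domain[OF assms(1)], of K "{x. \<forall>k. x $ k \<noteq> 0}"]
    by (simp add: dense_nonzero_coordinates)
  also have "\<dots> \<subseteq> closure ?G" by (rule closure_mono) auto
  finally have dense: "log_domain A K \<subseteq> closure ?G" .
  then show "log_domain A K \<subseteq> closure F" using closure_mono[OF F(1)] by blast
  obtain e where e: "e > 0" "ball 0 e \<subseteq> A" using assms(1,3) by (meson openE)
  \<comment> \<open>Puts a vector with equal positive entries, of norm \<open>e / 2\<close>, into
    \<open>A\<close>; it serves as the centre for contracting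
    \<open>log_domain A UNIV\<close>.\<close>
  define t where "t = e / (2 * norm (1 :: real^'n))"
  have "norm (1 :: real^'n) > 0" by simp
  then have t: "t > 0" using e by (simp add: t_def)
  have "norm (t *\<^sub>R (1 :: real^'n)) < e" using e \<open>norm (1 :: real^'n) > 0\<close> by (simp add: t_def)
  then have sA: "t *\<^sub>R (1 :: real^'n) \<in> A" using e(2) by auto
  have "contractible (log_domain A UNIV)"
    by (rule contractible_log_domain[OF assms(2) sA]) (simp add: t)
  then have conn: "connected (log_domain A UNIV)" by (rule contractible_imp_connected)
  have "?G = partial_exp (- K) ` log_domain A UNIV"
  proof (intro equalityI subsetI)
    fix x assume x: "x \<in> ?G"
    let ?y = "\<chi> k. if k \<in> K then x $ k else Ln (x $ k)"
    have "partial_exp (- K) ?y = x" using x by (auto simp: partial_exp_def vec_eq_iff)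
    moreover have "partial_exp UNIV ?y = partial_exp K x" using x by (auto simp: partial_exp_def vec_eq_iff)
    ultimately show "x \<in> partial_exp (- K) ` log_domain A UNIV"
      using x by (intro image_eqI[of _ _ ?y]) (auto simp: log_domain_def)
  next
    fix x assume "x \<in> partial_exp (- K) ` log_domain A UNIV"
    then obtain y where y: "x = partial_exp (- K) y" "y \<in> log_domain A UNIV" by blast
    have "partial_exp K x = partial_exp UNIV y" by (auto simp: y partial_exp_def vec_eq_iff)
    then show "x \<in> ?G" using y by (auto simp: log_domain_def) (simp add: partial_exp_def)
  qed
  then have "connected ?G"
    using connected_continuous_image[OF continuous_on_partial_exp conn] by simp
  then show "connected F"
    by (rule connected_intermediate_closure[OF _ F(1)]) (use F(2) dense in blast)
qed

section \<open>Groups of phases and their lifts to the covers\<close>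

locale phase_group =
  fixes A :: "(real^'n::finite) set" and S :: "(real^'n) set"
  assumes openA: "open A" and convexA: "convex A" and zeroA: "0 \<in> A"
    and S_zero: "0 \<in> S" and S_diff: "\<And>\<alpha> \<beta>. \<alpha> \<in> S \<Longrightarrow> \<beta> \<in> S \<Longrightarrow> \<alpha> - \<beta> \<in> S"
    and S_period: "\<And>\<alpha> \<beta>. \<alpha> \<in> S \<Longrightarrow> (\<And>k. \<exists>m::int. \<beta> $ k - \<alpha> $ k = 2 * pi * of_int m) \<Longrightarrow> \<beta> \<in> S"
begin

lemma S_minus: "\<alpha> \<in> S \<Longrightarrow> - \<alpha> \<in> S" using S_diff[OF S_zero] by force
lemma S_add: "\<alpha> \<in> S \<Longrightarrow> \<beta> \<in> S \<Longrightarrow> \<alpha> + \<beta> \<in> S" using S_diff[of \<alpha> "- \<beta>"] S_minus by force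

definition phase_maps :: "(complex^'n \<Rightarrow> complex^'n) set" where
  "phase_maps = (\<lambda>\<alpha>. restrict (phase \<alpha>) (reinhardt A)) ` S"

definition deck_maps :: "'n set \<Rightarrow> ((complex^'n) \<times> (complex^'n) \<Rightarrow> (complex^'n) \<times> (complex^'n)) set" where
  "deck_maps K = (\<lambda>\<alpha>. restrict (\<lambda>p. (log_phase K \<alpha> (fst p), 0)) (log_domain A K \<times> {0})) ` S"

lemma reinhardt_model:
  assumes "regularity reg"
  shows "is_model reg (reinhardt A) id phase_maps"
  unfolding is_model_def
proof (intro conjI ballI)
  have c: "contractible (log_domain A {})"
    by (rule contractible_log_domain[OF convexA zeroA]) simp
  show "connected (reinhardt A)" "simply_connected (reinhardt A)"
    using contractible_imp_connected[OF c] contractible_imp_simply_connected[OF c] by auto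
  have "modsq 0 = 0" by (simp add: modsq_def vec_eq_iff)
  then show "reinhardt A \<noteq> {}" using zeroA unfolding reinhardt_def by (metis (mono_tags) empty_Collect_eq)
  show "subgroup phase_maps (BijGroup (reinhardt A))"
    unfolding phase_maps_def
    by (rule subgroup_of_family[OF S_zero S_add S_minus])
       (use log_phase_zero[of "{}"] log_phase_add[of "{}"] in \<open>auto simp: phase_reinhardt\<close>)
  show "manifold_map reg (reinhardt A) id (reinhardt A) id g" if gP: "g \<in> phase_maps" for g
  proof -
    obtain \<alpha> where g: "g = restrict (phase \<alpha>) (reinhardt A)" using gP by (auto simp: phase_maps_def)
    have "reg (reinhardt A) (phase \<alpha>)"
      by (rule regularity_complex_linear[OF assms open_reinhardt[OF openA] linear_phase phase_cmul])
    then have "reg (reinhardt A) (id \<circ> g \<circ> id)"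
      by (rule regularity_cong[OF assms open_reinhardt[OF openA], rotated]) (simp add: g)
    moreover have "continuous_on (reinhardt A) g"
      using continuous_on_log_phase[of "reinhardt A" "{}" \<alpha>] by (simp add: g cong: continuous_on_cong)
    ultimately show ?thesis
      using local_section_open_id[OF open_reinhardt[OF openA]]
      unfolding manifold_map_def by (intro conjI ballI exI[of _ "reinhardt A"] exI[of _ id])
        (auto simp: g phase_reinhardt)
  qed
  have F: "{x \<in> log_domain A {}. \<forall>k. k \<notin> {} \<longrightarrow> x $ k \<noteq> 0} \<subseteq> free_points (reinhardt A) phase_maps"
  proof clarify
    fix x assume x: "x \<in> log_domain A {}" "\<forall>k. k \<notin> {} \<longrightarrow> x $ k \<noteq> 0"
    have "g = (\<lambda>y\<in>reinhardt A. y)" if gP: "g \<in> phase_maps" "g x = x" for g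
    proof -
      obtain \<alpha> where g: "g = restrict (phase \<alpha>) (reinhardt A)" using gP by (auto simp: phase_maps_def)
      have "exp (\<i> * complex_of_real (\<alpha> $ k)) * x $ k = x $ k" for k
        using gP(2) x by (simp add: g phase_def vec_eq_iff)
      then have "exp (\<i> * complex_of_real (\<alpha> $ k)) = 1" for k using x(2) by simp
      then have "phase \<alpha> y = y" for y by (simp add: phase_def vec_eq_iff)
      then show ?thesis by (auto simp: g fun_eq_iff)
    qed
    then show "x \<in> free_points (reinhardt A) phase_maps" using x by (simp add: free_points_def)
  qed
  have F': "free_points (reinhardt A) phase_maps \<subseteq> log_domain A {}" by (auto simp: free_points_def)
  show "connected (free_points (reinhardt A) phase_maps)"
      "reinhardt A \<subseteq> closure (free_points (reinhardt A) phase_maps)"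
    using connected_dense_log_domain[OF openA convexA zeroA F F'] by simp_all
qed

text \<open>Read in the coordinates of the base, a deck map is \<open>phase \<alpha>\<close>, which
  is complex linear and so regular in either sense.\<close>

lemma deck_manifold_map:
  assumes "regularity reg" "\<And>x. x \<in> log_domain A K \<Longrightarrow> l (x, 0) = (log_phase K \<alpha> x, 0)"
  shows "manifold_map reg (log_domain A K \<times> {0}) (cover_proj K) (log_domain A K \<times> {0}) (cover_proj K) l"
  unfolding manifold_map_def
proof (intro conjI ballI)
  show "l ` (log_domain A K \<times> {0}) \<subseteq> log_domain A K \<times> {0}"
    using assms(2) by (auto simp: log_phase_domain)
  have "continuous_on (log_domain A K \<times> {0}) (\<lambda>p. (log_phase K \<alpha> (fst p), 0::complex^'n))"
    by (intro continuous_intros continuous_on_compose2[OF continuous_on_log_phase]) auto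
  then show "continuous_on (log_domain A K \<times> {0}) l"
    by (rule continuous_on_eq) (use assms(2) in auto)
  fix p assume "p \<in> log_domain A K \<times> {0::complex^'n}"
  then obtain x0 where x0: "p = (x0, 0)" "x0 \<in> log_domain A K" by auto
  let ?T = "slit_domain A K (partial_exp K x0)" and ?s = "\<lambda>w. (log_section K x0 w, 0::complex^'n)"
  have sec: "local_section (log_domain A K \<times> {0}) (cover_proj K) p ?T ?s"
    unfolding x0(1) by (rule local_section_cover[OF openA x0(2)])
  have oT: "open ?T" using sec by (simp add: local_section_def)
  have "reg ?T (phase \<alpha>)"
    by (rule regularity_complex_linear[OF assms(1) oT linear_phase phase_cmul])
  then have "reg ?T (cover_proj K \<circ> l \<circ> ?s)"
  proof (rule regularity_cong[OF assms(1) oT, rotated])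
    fix w assume w: "w \<in> ?T"
    have "log_section K x0 w \<in> log_domain A K" "partial_exp K (log_section K x0 w) = w"
      using homeomorphism_sheet[OF refl, of A K x0] w by (auto simp: homeomorphism_def sheet_def)
    then show "phase \<alpha> w = (cover_proj K \<circ> l \<circ> ?s) w"
      by (simp add: assms(2) cover_proj_def partial_exp_log_phase)
  qed
  then show "\<exists>T s. local_section (log_domain A K \<times> {0}) (cover_proj K) p T s \<and> reg T (cover_proj K \<circ> l \<circ> s)"
    using sec by blast
qed

text \<open>A lift is determined by its value at one point, the cover being connected. There it
  agrees with \<open>log_phase K \<alpha>0\<close> up to periods in the coordinates of
  \<open>K\<close>, and \<open>S_period\<close> lets these be absorbed into the angle
  vector.\<close>

lemma cover_group_eq:
  assumes K: "\<exists>s\<in>A. \<forall>k. if k \<in> K then s $ k > 0 else s $ k = 0"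
  shows "cover_group (log_domain A K \<times> {0}) (cover_proj K) phase_maps = deck_maps K"
proof (intro equalityI subsetI)
  let ?C = "log_domain A K \<times> {0::complex^'n}"
  obtain s where s: "s \<in> A" "\<And>k. if k \<in> K then s $ k > 0 else s $ k = 0" using K by blast
  have conn: "connected ?C"
    using contractible_imp_connected[OF contractible_log_domain[OF convexA s]] by (intro connected_Times) auto
  fix l assume "l \<in> cover_group ?C (cover_proj K) phase_maps"
  then obtain \<alpha>0 where l: "l \<in> Bij ?C" "manifold_iso smooth_on ?C (cover_proj K) ?C (cover_proj K) l"
    "\<alpha>0 \<in> S" "\<And>u. u \<in> ?C \<Longrightarrow> cover_proj K (l u) = restrict (phase \<alpha>0) (reinhardt A) (cover_proj K u)"
    by (auto simp: cover_group_def phase_maps_def)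
  have lC: "continuous_on ?C l" "l ` ?C \<subseteq> ?C"
    using l(2) by (auto simp: manifold_iso_def manifold_map_def)
  have pl: "cover_proj K (l u) = phase \<alpha>0 (cover_proj K u)" if "u \<in> ?C" for u
    using l(4)[OF that] that by (auto simp: cover_proj_def log_domain_def)
  let ?x0 = "\<chi> k. if k \<in> K then complex_of_real (ln (s $ k) / 2) else 0"
  have "modsq (partial_exp K ?x0) = s"
  proof (rule vec_eq_iff[THEN iffD2], rule allI)
    fix k
    have "(exp (ln (s $ k) / 2))\<^sup>2 = exp (ln (s $ k))" by (simp flip: exp_double)
    then show "modsq (partial_exp K ?x0) $ k = s $ k"
      using s(2)[of k] by (auto simp: modsq_def partial_exp_def norm_exp_eq_Re)
  qed
  then have x0: "?x0 \<in> log_domain A K" using s(1) by (simp add: log_domain_def reinhardt_def)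
  obtain y where y: "l (?x0, 0) = (y, 0)" "y \<in> log_domain A K" using lC(2) x0 by blast
  have py: "partial_exp K y = phase \<alpha>0 (partial_exp K ?x0)"
    using pl[of "(?x0, 0)"] x0 y by (simp add: cover_proj_def)
  have "\<exists>m::int. y $ k = ?x0 $ k + \<i> * complex_of_real (\<alpha>0 $ k) + (of_int (2 * m) * pi) * \<i>" if "k \<in> K" for k
  proof -
    have "exp (y $ k) = exp (?x0 $ k + \<i> * complex_of_real (\<alpha>0 $ k))"
      using arg_cong[OF py, of "\<lambda>v. v $ k"] that by (simp add: partial_exp_def phase_def exp_add)
    then show ?thesis unfolding exp_eq by simp
  qed
  then have "\<exists>m. \<forall>k\<in>K. y $ k = ?x0 $ k + \<i> * complex_of_real (\<alpha>0 $ k) + (of_int (2 * m k) * pi) * \<i>"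
    by (intro bchoice) blast
  then obtain m where m: "\<And>k. k \<in> K \<Longrightarrow> y $ k = ?x0 $ k + \<i> * complex_of_real (\<alpha>0 $ k) + (of_int (2 * m k) * pi) * \<i>"
    by blast
  \<comment> \<open>Adding whole periods in \<open>K\<close> leaves \<open>phase\<close> unchanged
    but moves the lift so that it hits \<open>y\<close>.\<close>
  define \<alpha> where "\<alpha> = (\<chi> k. \<alpha>0 $ k + (if k \<in> K then 2 * pi * of_int (m k) else 0))"
  have \<alpha>S: "\<alpha> \<in> S"
  proof (rule S_period[OF l(3)])
    show "\<exists>n::int. \<alpha> $ k - \<alpha>0 $ k = 2 * pi * of_int n" for k
      by (auto simp: \<alpha>_def intro: exI[of _ 0])
  qed
  have ph: "phase \<alpha> = phase \<alpha>0"
  proof -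
    have "exp (\<i> * complex_of_real (\<alpha> $ k)) = exp (\<i> * complex_of_real (\<alpha>0 $ k))" for k
      unfolding exp_eq by (auto simp: \<alpha>_def algebra_simps intro: exI[of _ "m k"] exI[of _ 0])
    then show ?thesis by (simp add: phase_def fun_eq_iff)
  qed
  have start: "l (?x0, 0) = (log_phase K \<alpha> (fst (?x0, 0::complex^'n)), 0)"
  proof -
    have "y $ k = log_phase K \<alpha> ?x0 $ k" for k
      using m[of k] arg_cong[OF py, of "\<lambda>v. v $ k"]
      by (auto simp: log_phase_def \<alpha>_def partial_exp_def phase_def algebra_simps)
    then show ?thesis using y by (simp add: vec_eq_iff)
  qed
  have "l p = (log_phase K \<alpha> (fst p), 0)" if "p \<in> ?C" for p
  proof (rule covering_space_lift_unique[OF covering_space_cover[OF openA], of l "(?x0, 0)"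
        "\<lambda>p. (log_phase K \<alpha> (fst p), 0)" ?C "\<lambda>p. phase \<alpha>0 (cover_proj K p)" K])
    show "continuous_on ?C (\<lambda>p. phase \<alpha>0 (cover_proj K p))"
      using continuous_on_compose2[OF continuous_on_log_phase[of UNIV "{}" \<alpha>0]
          covering_space_imp_continuous[OF covering_space_cover[OF openA, of K]]] by simp
    show "(\<lambda>p. phase \<alpha>0 (cover_proj K p)) \<in> ?C \<rightarrow> nonvanishing A K"
      by (auto simp: cover_proj_def nonvanishing_def log_domain_def phase_reinhardt)
         (simp add: phase_def partial_exp_def)
    show "continuous_on ?C (\<lambda>p. (log_phase K \<alpha> (fst p), 0::complex^'n))"
      by (intro continuous_intros continuous_on_compose2[OF continuous_on_log_phase]) auto
    show "(\<lambda>p. (log_phase K \<alpha> (fst p), 0::complex^'n)) \<in> ?C \<rightarrow> ?C"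
      by (auto simp: log_phase_domain)
    show "phase \<alpha>0 (cover_proj K p) = cover_proj K (log_phase K \<alpha> (fst p), 0)" if "p \<in> ?C" for p
      by (simp add: cover_proj_def partial_exp_log_phase ph)
  qed (use lC pl conn x0 that start in auto)
  then have "l = restrict (\<lambda>p. (log_phase K \<alpha> (fst p), 0)) ?C"
    using l(1) by (auto simp: Bij_def extensional_def fun_eq_iff)
  then show "l \<in> deck_maps K" using \<alpha>S by (auto simp: deck_maps_def)
next
  let ?C = "log_domain A K \<times> {0::complex^'n}"
  fix l assume "l \<in> deck_maps K"
  then obtain \<alpha> where \<alpha>: "\<alpha> \<in> S" and l: "l = restrict (\<lambda>p. (log_phase K \<alpha> (fst p), 0)) ?C"
    by (auto simp: deck_maps_def)
  have inv: "log_phase K (- \<alpha>) (log_phase K \<alpha> x) = x" "log_phase K \<alpha> (log_phase K (- \<alpha>) x) = x" for x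
    using log_phase_add[of K "- \<alpha>" \<alpha> x] log_phase_add[of K \<alpha> "- \<alpha>" x] by simp_all
  have bij: "bij_betw l ?C ?C"
    by (rule bij_betwI[where g="\<lambda>p. (log_phase K (- \<alpha>) (fst p), 0)"])
       (auto simp: l log_phase_domain inv)
  have invl: "inv_into ?C l (x, 0) = (log_phase K (- \<alpha>) x, 0)" if "x \<in> log_domain A K" for x
    by (rule inv_into_f_eq[OF bij_betw_imp_inj_on[OF bij]]) (use that in \<open>auto simp: l log_phase_domain inv\<close>)
  have "manifold_iso smooth_on ?C (cover_proj K) ?C (cover_proj K) l"
    unfolding manifold_iso_def
    using deck_manifold_map[of smooth_on K l \<alpha>] deck_manifold_map[of smooth_on K "inv_into ?C l" "- \<alpha>"] bij invl
    by (auto simp: regularity_def l)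
  moreover have "l \<in> Bij ?C" using bij by (simp add: Bij_def l)
  moreover have "\<exists>g\<in>phase_maps. \<forall>u\<in>?C. cover_proj K (l u) = g (cover_proj K u)"
    using \<alpha> unfolding phase_maps_def
    by (intro bexI[of _ "restrict (phase \<alpha>) (reinhardt A)"])
       (auto simp: l cover_proj_def partial_exp_log_phase log_domain_def)
  ultimately show "l \<in> cover_group ?C (cover_proj K) phase_maps" by (simp add: cover_group_def)
qed

lemma cover_model:
  assumes "regularity reg" and K: "\<exists>s\<in>A. \<forall>k. if k \<in> K then s $ k > 0 else s $ k = 0"
  shows "is_model reg (log_domain A K \<times> {0}) (cover_proj K)
    (cover_group (log_domain A K \<times> {0}) (cover_proj K) phase_maps)"
  unfolding is_model_def cover_group_eq[OF K]
proof (intro conjI ballI)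
  let ?C = "log_domain A K \<times> {0::complex^'n}"
  obtain s where s: "s \<in> A" "\<And>k. if k \<in> K then s $ k > 0 else s $ k = 0" using K by blast
  have c: "contractible ?C"
    using contractible_log_domain[OF convexA s] by (intro contractible_Times) auto
  show "connected ?C" "simply_connected ?C"
    using contractible_imp_connected[OF c] contractible_imp_simply_connected[OF c] by auto
  let ?x0 = "\<chi> k. if k \<in> K then complex_of_real (ln (s $ k) / 2) else 0"
  have "modsq (partial_exp K ?x0) = s"
  proof (rule vec_eq_iff[THEN iffD2], rule allI)
    fix k
    have "(exp (ln (s $ k) / 2))\<^sup>2 = exp (ln (s $ k))" by (simp flip: exp_double)
    then show "modsq (partial_exp K ?x0) $ k = s $ k"
      using s(2)[of k] by (auto simp: modsq_def partial_exp_def norm_exp_eq_Re)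
  qed
  then have x0: "?x0 \<in> log_domain A K" using s(1) by (simp add: log_domain_def reinhardt_def)
  then show "?C \<noteq> {}" by auto
  show "subgroup (deck_maps K) (BijGroup ?C)"
    unfolding deck_maps_def
    by (rule subgroup_of_family[OF S_zero S_add S_minus]) (auto simp: log_phase_domain log_phase_add)
  show "manifold_map reg ?C (cover_proj K) ?C (cover_proj K) g" if g: "g \<in> deck_maps K" for g
  proof -
    obtain \<alpha> where "g = restrict (\<lambda>p. (log_phase K \<alpha> (fst p), 0)) ?C" using g by (auto simp: deck_maps_def)
    then show ?thesis by (intro deck_manifold_map[OF assms(1), of K g \<alpha>]) simp
  qed
  define F where "F = fst ` free_points ?C (deck_maps K)"
  have F: "free_points ?C (deck_maps K) = F \<times> {0}"
    by (force simp: F_def free_points_def)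
  have F1: "{x \<in> log_domain A K. \<forall>k. k \<notin> K \<longrightarrow> x $ k \<noteq> 0} \<subseteq> F"
  proof clarify
    fix x assume x: "x \<in> log_domain A K" "\<forall>k. k \<notin> K \<longrightarrow> x $ k \<noteq> 0"
    have "g = (\<lambda>y\<in>?C. y)" if gD: "g \<in> deck_maps K" "g (x, 0) = (x, 0)" for g
    proof -
      obtain \<alpha> where g: "g = restrict (\<lambda>p. (log_phase K \<alpha> (fst p), 0)) ?C" using gD by (auto simp: deck_maps_def)
      have eq: "log_phase K \<alpha> x $ k = x $ k" for k using gD(2) x by (simp add: g)
      \<comment> \<open>In \<open>K\<close> a fixed point forces the angle to vanish, since the
        action is a translation; outside \<open>K\<close> the coordinate of \<open>x\<close> is
        nonzero, so the phase factor is 1.\<close>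
      have "log_phase K \<alpha> y = y" for y
      proof (rule vec_eq_iff[THEN iffD2], rule allI)
        fix k show "log_phase K \<alpha> y $ k = y $ k"
          using eq[of k] x(2) by (cases "k \<in> K") (auto simp: log_phase_def)
      qed
      then show ?thesis by (auto simp: g fun_eq_iff)
    qed
    then have "(x, 0) \<in> free_points ?C (deck_maps K)" using x by (simp add: free_points_def)
    then show "x \<in> F" by (force simp: F_def)
  qed
  have F2: "F \<subseteq> log_domain A K" by (auto simp: F_def free_points_def)
  show "connected (free_points ?C (deck_maps K))"
    unfolding F using connected_dense_log_domain(1)[OF openA convexA zeroA F1 F2]
    by (intro connected_Times) auto
  show "?C \<subseteq> closure (free_points ?C (deck_maps K))"
    unfolding F closure_Times using connected_dense_log_domain(2)[OF openA convexA zeroA F1 F2] by auto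
qed

end

section \<open>Charts from slices\<close>

definition coef :: "('d::finite \<Rightarrow> 'a::euclidean_space) \<Rightarrow> ('n::finite \<Rightarrow> 'd) \<Rightarrow> 'd \<Rightarrow> 'n \<Rightarrow> real" where
  "coef X r h k = representation (X ` range r) (X h) (X (r k))"

text \<open>For \<open>\<kappa> = 1\<close> this is the identity and for \<open>\<kappa> = 0\<close> the projection to the imaginary axis; this
  distinguishes the complexified group \<open>N\<^sub>\<complex>\<close> from the compact one.\<close>

definition im_proj :: "real \<Rightarrow> complex \<Rightarrow> complex" where
  "im_proj \<kappa> x = Complex (\<kappa> * Re x) (Im x)"

definition exp_act :: "complex^'d::finite \<Rightarrow> complex^'d \<Rightarrow> complex^'d" where
  "exp_act \<zeta> z = (\<chi> j. exp (\<zeta> $ j) * z $ j)"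

text \<open>Exponents instead of torus classes: an exponent is 2 pi \<i> times a representative
  \<open>Z\<close>, so its real part must lie in the kernel of \<open>pi_map\<close> and its
  imaginary part over 2 pi must map into \<open>Q\<close>. For \<open>\<kappa> = 1\<close> this is
  the preimage of \<open>NC_group\<close>; for \<open>\<kappa> = 0\<close>, where only imaginary
  exponents remain, that of \<open>N_group\<close>.\<close>

definition exp_group :: "('d::finite \<Rightarrow> 'a::euclidean_space) \<Rightarrow> 'a set \<Rightarrow> real \<Rightarrow> (complex^'d) set" where
  "exp_group X Q \<kappa> = {\<zeta>. (\<forall>j. im_proj \<kappa> (\<zeta> $ j) = \<zeta> $ j) \<and>
     (\<Sum>j\<in>UNIV. Re (\<zeta> $ j) *\<^sub>R X j) = 0 \<and> (\<Sum>j\<in>UNIV. (Im (\<zeta> $ j) / (2 * pi)) *\<^sub>R X j) \<in> Q}"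

definition exp_orbit :: "('d::finite \<Rightarrow> 'a::euclidean_space) \<Rightarrow> 'a set \<Rightarrow> real \<Rightarrow> complex^'d \<Rightarrow> (complex^'d) set" where
  "exp_orbit X Q \<kappa> z = (\<lambda>\<zeta>. exp_act \<zeta> z) ` exp_group X Q \<kappa>"

definition slice_point :: "('n::finite \<Rightarrow> 'd::finite) \<Rightarrow> real^'d \<Rightarrow> complex^'n \<Rightarrow> complex^'d" where
  "slice_point r a w = (\<chi> j. if j \<in> range r then w $ inv_into UNIV r j else complex_of_real (a $ j))"

text \<open>The element of the complexification of \<open>\<nn>\<close> with prescribed coordinates outside \<open>range r\<close>.\<close>

definition null_extend :: "('d::finite \<Rightarrow> 'a::euclidean_space) \<Rightarrow> ('n::finite \<Rightarrow> 'd) \<Rightarrow> ('d \<Rightarrow> complex) \<Rightarrow> complex^'d" where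
  "null_extend X r f = (\<chi> j. if j \<in> range r
     then - (\<Sum>h\<in>- range r. complex_of_real (coef X r h (inv_into UNIV r j)) * f h) else f j)"

lemma exp_act_zero [simp]: "exp_act 0 z = z" by (simp add: exp_act_def vec_eq_iff)

lemma exp_act_add: "exp_act (\<zeta> + \<zeta>') z = exp_act \<zeta> (exp_act \<zeta>' z)"
  by (simp add: exp_act_def vec_eq_iff exp_add)

lemma exp_act_minus [simp]: "exp_act (- \<zeta>) (exp_act \<zeta> z) = z" "exp_act \<zeta> (exp_act (- \<zeta>) z) = z"
  by (simp_all flip: exp_act_add)

lemma continuous_on_exp_act: "continuous_on S (exp_act \<zeta>)"
  unfolding exp_act_def by (intro continuous_intros)

lemma linear_im_proj: "linear (im_proj \<kappa>)"
  by (rule linearI) (auto simp: im_proj_def complex_eq_iff algebra_simps)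

lemma bounded_linear_im_proj: "bounded_linear (im_proj \<kappa>)"
  using linear_im_proj by (simp add: linear_conv_bounded_linear)

lemma im_proj_one [simp]: "im_proj 1 = id"
  by (auto simp: im_proj_def fun_eq_iff complex_eq_iff)

lemma sum_split_range:
  fixes g :: "'d::finite \<Rightarrow> 'b::comm_monoid_add"
  assumes "inj (r :: 'n::finite \<Rightarrow> 'd)"
  shows "(\<Sum>j\<in>UNIV. g j) = (\<Sum>k\<in>UNIV. g (r k)) + (\<Sum>h\<in>- range r. g h)"
proof -
  have "(\<Sum>j\<in>UNIV. g j) = (\<Sum>j\<in>range r \<union> - range r. g j)" by simp
  also have "\<dots> = (\<Sum>j\<in>range r. g j) + (\<Sum>h\<in>- range r. g h)"
    by (rule sum.union_disjoint) auto
  also have "(\<Sum>j\<in>range r. g j) = (\<Sum>k\<in>UNIV. g (r k))"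
    using sum.reindex[OF assms, of g] by simp
  finally show ?thesis .
qed

lemma slice_point_range [simp]: "inj r \<Longrightarrow> slice_point r a w $ r k = w $ k"
  by (simp add: slice_point_def)

lemma slice_point_outside [simp]: "h \<notin> range r \<Longrightarrow> slice_point r a w $ h = complex_of_real (a $ h)"
  by (simp add: slice_point_def)

lemma select_slice_point [simp]: "inj r \<Longrightarrow> select_coords r (slice_point r a w) = w"
  by (simp add: select_coords_def vec_eq_iff)

lemma scalar_holomorphic_compose:
  fixes f :: "complex^'n \<Rightarrow> complex"
  assumes "\<exists>L. (f has_derivative L) (at x) \<and> (\<forall>c v. L (c *s v) = c * L v)"
    and "(g has_field_derivative g') (at (f x))"
  shows "\<exists>L. ((\<lambda>x. g (f x)) has_derivative L) (at x) \<and> (\<forall>c v. L (c *s v) = c * L v)"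
proof -
  obtain L where L: "(f has_derivative L) (at x)" "\<And>c v. L (c *s v) = c * L v" using assms by blast
  have "((\<lambda>x. g (f x)) has_derivative (\<lambda>v. g' * L v)) (at x)"
    using diff_chain_at[OF L(1) assms(2)[unfolded has_field_derivative_def]] by (simp add: o_def)
  then show ?thesis using L(2) by (intro exI[of _ "\<lambda>v. g' * L v"]) auto
qed

lemma scalar_holomorphic_mult:
  fixes f g :: "complex^'n \<Rightarrow> complex"
  assumes "\<exists>L. (f has_derivative L) (at x) \<and> (\<forall>c v. L (c *s v) = c * L v)"
    and "\<exists>L. (g has_derivative L) (at x) \<and> (\<forall>c v. L (c *s v) = c * L v)"
  shows "\<exists>L. ((\<lambda>x. f x * g x) has_derivative L) (at x) \<and> (\<forall>c v. L (c *s v) = c * L v)"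
proof -
  obtain L L' where L: "(f has_derivative L) (at x)" "\<And>c v. L (c *s v) = c * L v"
    and L': "(g has_derivative L') (at x)" "\<And>c v. L' (c *s v) = c * L' v" using assms by blast
  show ?thesis using has_derivative_mult[OF L(1) L'(1)] L(2) L'(2)
    by (intro exI[of _ "\<lambda>h. f x * L' h + L h * g x"]) (auto simp: algebra_simps)
qed

lemma scalar_holomorphic_sum:
  fixes f :: "'i \<Rightarrow> complex^'n \<Rightarrow> complex"
  assumes "\<And>i. i \<in> I \<Longrightarrow> \<exists>L. (f i has_derivative L) (at x) \<and> (\<forall>c v. L (c *s v) = c * L v)"
  shows "\<exists>L. ((\<lambda>x. \<Sum>i\<in>I. f i x) has_derivative L) (at x) \<and> (\<forall>c v. L (c *s v) = c * L v)"
proof -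
  have "\<exists>L. \<forall>i\<in>I. (f i has_derivative L i) (at x) \<and> (\<forall>c v. L i (c *s v) = c * L i v)"
    using assms by (intro bchoice) blast
  then obtain L where L: "\<And>i. i \<in> I \<Longrightarrow> (f i has_derivative L i) (at x)"
    "\<And>i c v. i \<in> I \<Longrightarrow> L i (c *s v) = c * L i v" by blast
  show ?thesis using has_derivative_sum[of I f L, OF L(1)] L(2)
    by (intro exI[of _ "\<lambda>v. \<Sum>i\<in>I. L i v"]) (auto simp: sum_distrib_left)
qed

lemma scalar_holomorphic_nth:
  fixes x :: "complex^'n"
  shows "\<exists>L. ((\<lambda>x. x $ k) has_derivative L) (at x) \<and> (\<forall>c v. L (c *s v) = c * L v)"
  by (intro exI[of _ "\<lambda>v. v $ k"]) (auto intro!: bounded_linear_imp_has_derivative bounded_linear_vec_nth)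

lemma scalar_holomorphic_const:
  fixes x :: "complex^'n"
  shows "\<exists>L. ((\<lambda>x. a::complex) has_derivative L) (at x) \<and> (\<forall>c v. L (c *s v) = c * L v)"
  by (intro exI[of _ "\<lambda>v. 0"]) auto

lemma has_derivative_vec:
  fixes f :: "'e::real_normed_vector \<Rightarrow> 'f::euclidean_space^'m"
  assumes "\<And>k. ((\<lambda>x. f x $ k) has_derivative L k) F"
  shows "(f has_derivative (\<lambda>v. \<chi> k. L k v)) F"
proof -
  have lin: "bounded_linear (axis k :: 'f \<Rightarrow> 'f^'m)" for k
    by (auto simp: linear_conv_bounded_linear[symmetric] axis_def vec_eq_iff intro!: linearI)
  have eq: "(\<Sum>k\<in>UNIV. axis k (y $ k)) = y" for y :: "'f^'m" by (simp add: vec_eq_iff axis_def)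
  have "((\<lambda>x. \<Sum>k\<in>UNIV. axis k (f x $ k)) has_derivative (\<lambda>v. \<Sum>k\<in>UNIV. axis k ((\<chi> k. L k v) $ k))) F"
    using assms by (intro has_derivative_sum bounded_linear.has_derivative[OF lin]) simp
  then show ?thesis unfolding eq .
qed

lemma holomorphic_map_on_vec:
  fixes f :: "complex^'n \<Rightarrow> complex^'m"
  assumes "\<And>x k. x \<in> S \<Longrightarrow> \<exists>L. ((\<lambda>x. f x $ k) has_derivative L) (at x) \<and> (\<forall>c v. L (c *s v) = c * L v)"
  shows "holomorphic_map_on S f"
  unfolding holomorphic_map_on_def
proof
  fix x assume "x \<in> S"
  then obtain L where L: "\<And>k. ((\<lambda>x. f x $ k) has_derivative L k) (at x)" "\<And>k c v. L k (c *s v) = c * L k v"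
    using assms by metis
  from has_derivative_vec[OF L(1)] have "(f has_derivative (\<lambda>v. \<chi> k. L k v)) (at x)" .
  then show "\<exists>L. (f has_derivative L) (at x) \<and> (\<forall>c v. L (c *s v) = c *s L v)"
    using L(2) by (intro exI[of _ "\<lambda>v. \<chi> k. L k v"]) (auto simp: vec_eq_iff)
qed

section \<open>Frames of normals and the exponents that act\<close>

locale normal_frames =
  fixes X :: "'d::finite \<Rightarrow> 'a::euclidean_space" and Q :: "'a set" and R :: "('n::finite \<Rightarrow> 'd) set"
  assumes Q_zero: "0 \<in> Q" and Q_diff: "\<And>x y. x \<in> Q \<Longrightarrow> y \<in> Q \<Longrightarrow> x - y \<in> Q" and X_in_Q: "\<And>j. X j \<in> Q"
    and inj_frame: "\<And>r. r \<in> R \<Longrightarrow> inj r"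
    and indep_frame: "\<And>r t k. r \<in> R \<Longrightarrow> (\<Sum>k\<in>UNIV. t k *\<^sub>R X (r k)) = 0 \<Longrightarrow> t k = 0"
    and coef_sum: "\<And>r h. r \<in> R \<Longrightarrow> X h = (\<Sum>k\<in>UNIV. coef X r h k *\<^sub>R X (r k))"
begin

lemma Q_minus: "x \<in> Q \<Longrightarrow> - x \<in> Q" using Q_diff[OF Q_zero] by force
lemma Q_add: "x \<in> Q \<Longrightarrow> y \<in> Q \<Longrightarrow> x + y \<in> Q" using Q_diff[of x "- y"] Q_minus by force

lemma Q_sum: "(\<And>i. i \<in> I \<Longrightarrow> f i \<in> Q) \<Longrightarrow> sum f I \<in> Q"
  by (induction I rule: infinite_finite_induct) (auto intro: Q_zero Q_add)

lemma Q_of_int: "x \<in> Q \<Longrightarrow> of_int m *\<^sub>R x \<in> Q"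
proof -
  assume x: "x \<in> Q"
  have nat: "of_nat n *\<^sub>R x \<in> Q" for n
    by (induction n) (auto simp: algebra_simps intro: Q_zero Q_add x)
  show ?thesis using nat Q_minus[OF nat] by (cases m) (auto simp: scaleR_minus_left simp del: of_nat_Suc)
qed

lemma exp_group_zero: "0 \<in> exp_group X Q \<kappa>"
  by (auto simp: exp_group_def im_proj_def complex_eq_iff Q_zero)

lemma exp_group_add: "\<zeta> \<in> exp_group X Q \<kappa> \<Longrightarrow> \<zeta>' \<in> exp_group X Q \<kappa> \<Longrightarrow> \<zeta> + \<zeta>' \<in> exp_group X Q \<kappa>"
  by (auto simp: exp_group_def linear_add[OF linear_im_proj] scaleR_add_left sum.distrib add_divide_distrib Q_add)

lemma exp_group_minus: "\<zeta> \<in> exp_group X Q \<kappa> \<Longrightarrow> - \<zeta> \<in> exp_group X Q \<kappa>"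
  by (auto simp: exp_group_def linear_neg[OF linear_im_proj] sum_negf Q_minus)

lemma exp_orbit_eq_iff:
  "exp_orbit X Q \<kappa> z = exp_orbit X Q \<kappa> z' \<longleftrightarrow> (\<exists>\<zeta>\<in>exp_group X Q \<kappa>. z' = exp_act \<zeta> z)"
proof
  assume "exp_orbit X Q \<kappa> z = exp_orbit X Q \<kappa> z'"
  moreover have "z' \<in> exp_orbit X Q \<kappa> z'"
    using exp_group_zero[of \<kappa>] by (auto simp: exp_orbit_def intro!: image_eqI[of _ _ 0])
  ultimately show "\<exists>\<zeta>\<in>exp_group X Q \<kappa>. z' = exp_act \<zeta> z" by (auto simp: exp_orbit_def)
next
  assume "\<exists>\<zeta>\<in>exp_group X Q \<kappa>. z' = exp_act \<zeta> z"
  then obtain \<zeta> where \<zeta>: "\<zeta> \<in> exp_group X Q \<kappa>" "z' = exp_act \<zeta> z" by blast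
  show "exp_orbit X Q \<kappa> z = exp_orbit X Q \<kappa> z'"
  proof (intro equalityI subsetI)
    fix y assume "y \<in> exp_orbit X Q \<kappa> z"
    then obtain \<xi> where \<xi>: "\<xi> \<in> exp_group X Q \<kappa>" "y = exp_act \<xi> z" by (auto simp: exp_orbit_def)
    have "y = exp_act (\<xi> + (- \<zeta>)) z'" unfolding exp_act_add \<zeta>(2) \<xi>(2) by simp
    then show "y \<in> exp_orbit X Q \<kappa> z'"
      using exp_group_add[OF \<xi>(1) exp_group_minus[OF \<zeta>(1)]] by (auto simp: exp_orbit_def)
  next
    fix y assume "y \<in> exp_orbit X Q \<kappa> z'"
    then obtain \<xi> where \<xi>: "\<xi> \<in> exp_group X Q \<kappa>" "y = exp_act \<xi> z'" by (auto simp: exp_orbit_def)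
    have "y = exp_act (\<xi> + \<zeta>) z" unfolding exp_act_add \<xi>(2) \<zeta>(2) ..
    then show "y \<in> exp_orbit X Q \<kappa> z"
      using exp_group_add[OF \<xi>(1) \<zeta>(1)] by (auto simp: exp_orbit_def)
  qed
qed

lemma exp_orbit_act: "\<zeta> \<in> exp_group X Q \<kappa> \<Longrightarrow> exp_orbit X Q \<kappa> (exp_act \<zeta> z) = exp_orbit X Q \<kappa> z"
  using exp_orbit_eq_iff[of \<kappa> z "exp_act \<zeta> z"] by blast

lemma null_extend_outside: "h \<notin> range r \<Longrightarrow> null_extend X r f $ h = f h"
  by (simp add: null_extend_def)

lemma null_extend_range: "r \<in> R \<Longrightarrow> null_extend X r f $ r k = - (\<Sum>h\<in>- range r. complex_of_real (coef X r h k) * f h)"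
  using inj_frame[of r] by (simp add: null_extend_def)

text \<open>Inserting the expansion of \<open>X h\<close> in the frame turns the frame part of the
  sum into the negative of the outside part. \<open>P\<close> is instantiated with \<open>Re\<close>
  and \<open>Im\<close>.\<close>

lemma null_extend_sum:
  assumes r: "r \<in> R" and P: "linear P"
  shows "(\<Sum>j\<in>UNIV. (P (null_extend X r f $ j) :: real) *\<^sub>R X j) = 0"
proof -
  have PX: "P (complex_of_real a * z) = a * P z" for a z
    using linear_cmul[OF P, of a z] by (simp add: scaleR_conv_of_real)
  have "(\<Sum>k\<in>UNIV. P (null_extend X r f $ r k) *\<^sub>R X (r k)) =
      - (\<Sum>k\<in>UNIV. \<Sum>h\<in>- range r. (P (f h) * coef X r h k) *\<^sub>R X (r k))"
    by (simp add: null_extend_range[OF r] linear_neg[OF P] linear_sum[OF P] PX scaleR_sum_left sum_negf)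
      (simp add: mult.commute)
  also have "\<dots> = - (\<Sum>h\<in>- range r. \<Sum>k\<in>UNIV. (P (f h) * coef X r h k) *\<^sub>R X (r k))"
    by (subst sum.swap) simp
  also have "\<dots> = - (\<Sum>h\<in>- range r. P (f h) *\<^sub>R (\<Sum>k\<in>UNIV. coef X r h k *\<^sub>R X (r k)))"
    by (simp add: scaleR_sum_right)
  also have "\<dots> = - (\<Sum>h\<in>- range r. P (f h) *\<^sub>R X h)"
    by (simp only: coef_sum[OF r, symmetric])
  finally show ?thesis
    by (simp add: sum_split_range[OF inj_frame[OF r]] null_extend_outside)
qed

lemma null_extend_Re: "r \<in> R \<Longrightarrow> (\<Sum>j\<in>UNIV. Re (null_extend X r f $ j) *\<^sub>R X j) = 0"
  by (rule null_extend_sum) (auto intro!: linearI)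

lemma null_extend_Im: "r \<in> R \<Longrightarrow> (\<Sum>j\<in>UNIV. Im (null_extend X r f $ j) *\<^sub>R X j) = 0"
  by (rule null_extend_sum) (auto intro!: linearI)

lemma null_extend_im_proj:
  assumes "\<And>h. im_proj \<kappa> (f h) = f h"
  shows "im_proj \<kappa> (null_extend X r f $ j) = null_extend X r f $ j"
proof -
  have "im_proj \<kappa> (complex_of_real a * z) = a * im_proj \<kappa> z" for a z
    using linear_cmul[OF linear_im_proj, of \<kappa> a z] by (simp add: scaleR_conv_of_real)
  then show ?thesis
    using assms by (simp add: null_extend_def linear_neg[OF linear_im_proj] linear_sum[OF linear_im_proj])
qed

lemma null_extend_exp_group:
  assumes r: "r \<in> R" and "\<And>h. im_proj \<kappa> (f h) = f h"
  shows "null_extend X r f \<in> exp_group X Q \<kappa>"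
proof -
  have "(\<Sum>j\<in>UNIV. (Im (null_extend X r f $ j) / (2 * pi)) *\<^sub>R X j) =
      (1 / (2 * pi)) *\<^sub>R (\<Sum>j\<in>UNIV. Im (null_extend X r f $ j) *\<^sub>R X j)"
    by (simp add: scaleR_sum_right)
  then show ?thesis
    using null_extend_Re[OF r, of f] null_extend_Im[OF r, of f] null_extend_im_proj[of \<kappa> f r] assms(2) Q_zero
    by (auto simp: exp_group_def)
qed

text \<open>With zeros outside the frame, both sums are relations among the independent frame
  normals. Two exponents in the complexified kernel are compared below through this, by looking only
  at coordinates outside a frame.\<close>

lemma null_vector_unique:
  assumes r: "r \<in> R" and "(\<Sum>j\<in>UNIV. Re (\<zeta> $ j) *\<^sub>R X j) = 0" "(\<Sum>j\<in>UNIV. Im (\<zeta> $ j) *\<^sub>R X j) = 0"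
    and out: "\<And>h. h \<notin> range r \<Longrightarrow> \<zeta> $ h = 0"
  shows "\<zeta> = 0"
proof -
  have "(\<Sum>k\<in>UNIV. Re (\<zeta> $ r k) *\<^sub>R X (r k)) = 0" "(\<Sum>k\<in>UNIV. Im (\<zeta> $ r k) *\<^sub>R X (r k)) = 0"
    using assms(2,3) out by (auto simp: sum_split_range[OF inj_frame[OF r]])
  from indep_frame[OF r this(1)] indep_frame[OF r this(2)] have "\<zeta> $ r k = 0" for k
    by (simp add: complex_eq_iff)
  then have "\<zeta> $ j = 0" for j using out by (cases "j \<in> range r") auto
  then show ?thesis by (simp add: vec_eq_iff)
qed

text \<open>Logarithms of the group of a vertex: the angle vectors that, multiplied by \<i> and
  extended by zero outside the frame, belong to the acting exponents. Whole periods are kept, as the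
  lifts to the covers need them.\<close>

definition admissible :: "('n \<Rightarrow> 'd) \<Rightarrow> (real^'n) set" where
  "admissible r = {\<alpha>. (\<Sum>k\<in>UNIV. (\<alpha> $ k / (2 * pi)) *\<^sub>R X (r k)) \<in> Q}"

text \<open>Invariance under periods holds because the normals belong to \<open>Q\<close>.\<close>

lemma phase_group_admissible:
  assumes "open A" "convex A" "0 \<in> A"
  shows "phase_group A (admissible r)"
proof
  show "0 \<in> admissible r" by (simp add: admissible_def Q_zero)
  show "\<alpha> - \<beta> \<in> admissible r" if "\<alpha> \<in> admissible r" "\<beta> \<in> admissible r" for \<alpha> \<beta>
    using that Q_diff by (simp add: admissible_def diff_divide_distrib scaleR_diff_left sum_subtractf)
  show "\<beta> \<in> admissible r" if \<alpha>: "\<alpha> \<in> admissible r" and per: "\<And>k. \<exists>m::int. \<beta> $ k - \<alpha> $ k = 2 * pi * of_int m" for \<alpha> \<beta>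
  proof -
    obtain m where m: "\<And>k. \<beta> $ k - \<alpha> $ k = 2 * pi * of_int (m k)" using per by metis
    have "\<beta> $ k / (2 * pi) = \<alpha> $ k / (2 * pi) + of_int (m k)" for k
      using m[of k] by (simp add: field_simps)
    then have "(\<Sum>k\<in>UNIV. (\<beta> $ k / (2 * pi)) *\<^sub>R X (r k)) =
        (\<Sum>k\<in>UNIV. (\<alpha> $ k / (2 * pi)) *\<^sub>R X (r k)) + (\<Sum>k\<in>UNIV. of_int (m k) *\<^sub>R X (r k))"
      by (simp add: scaleR_add_left sum.distrib)
    then show ?thesis using \<alpha> by (auto simp: admissible_def intro!: Q_add Q_sum Q_of_int X_in_Q)
  qed
qed (use assms in auto)

definition phase_vec :: "('n \<Rightarrow> 'd) \<Rightarrow> real^'n \<Rightarrow> complex^'d" where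
  "phase_vec r \<alpha> = (\<chi> j. if j \<in> range r then \<i> * complex_of_real (\<alpha> $ inv_into UNIV r j) else 0)"

lemma phase_vec_exp_group:
  assumes r: "r \<in> R" and \<alpha>: "\<alpha> \<in> admissible r"
  shows "phase_vec r \<alpha> \<in> exp_group X Q \<kappa>"
proof -
  have "(\<Sum>j\<in>UNIV. (Im (phase_vec r \<alpha> $ j) / (2 * pi)) *\<^sub>R X j) = (\<Sum>k\<in>UNIV. (\<alpha> $ k / (2 * pi)) *\<^sub>R X (r k))"
    using inj_frame[OF r] by (simp add: sum_split_range[OF inj_frame[OF r]] phase_vec_def)
  moreover have "Re (phase_vec r \<alpha> $ j) = 0" for j by (simp add: phase_vec_def)
  ultimately show ?thesis using \<alpha> by (auto simp: exp_group_def admissible_def im_proj_def complex_eq_iff)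
qed

end

text \<open>Common setting of the two quotients. By \<open>slice\<close>, a point of
  \<open>M0\<close> with positive coordinates outside a frame, all equal to 1 if
  \<open>\<kappa> = 1\<close>, is recovered from its frame coordinates; \<open>c\<close> gives the
  outside ones. \<open>A_mid\<close> provides a centre for contracting the cover of each overlap.
  \<open>reg_cases\<close> couples holomorphy to \<open>\<kappa> = 1\<close>, where
  \<open>im_proj\<close> is the identity and \<open>c\<close> is constant.\<close>

locale quasi_slice = normal_frames X Q R
  for X :: "'d::finite \<Rightarrow> 'a::euclidean_space" and Q and R :: "('n::finite \<Rightarrow> 'd) set" +
  fixes \<kappa> :: real and M0 :: "(complex^'d) set" and A :: "('n \<Rightarrow> 'd) \<Rightarrow> (real^'n) set"
    and c :: "('n \<Rightarrow> 'd) \<Rightarrow> complex^'n \<Rightarrow> real^'d"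
    and reg :: "(complex^'n) set \<Rightarrow> (complex^'n \<Rightarrow> complex^'n) \<Rightarrow> bool"
  assumes kappa: "\<kappa> = 0 \<or> \<kappa> = 1"
    and M0_inv: "\<And>z \<zeta>. z \<in> M0 \<Longrightarrow> \<zeta> \<in> exp_group X Q \<kappa> \<Longrightarrow> exp_act \<zeta> z \<in> M0"
    and slice_in: "\<And>r w. r \<in> R \<Longrightarrow> w \<in> reinhardt (A r) \<Longrightarrow> slice_point r (c r w) w \<in> M0"
    and c_pos: "\<And>r w h. r \<in> R \<Longrightarrow> w \<in> reinhardt (A r) \<Longrightarrow> h \<notin> range r \<Longrightarrow> c r w $ h > 0"
    and c_one: "\<And>r w h. \<kappa> = 1 \<Longrightarrow> c r w $ h = 1"
    and slice: "\<And>r z. r \<in> R \<Longrightarrow> z \<in> M0 \<Longrightarrow>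
       (\<And>h. h \<notin> range r \<Longrightarrow> \<exists>t>0. z $ h = complex_of_real t \<and> (\<kappa> = 1 \<longrightarrow> t = 1)) \<Longrightarrow>
       select_coords r z \<in> reinhardt (A r) \<and> slice_point r (c r (select_coords r z)) (select_coords r z) = z"
    and A_open: "\<And>r. r \<in> R \<Longrightarrow> open (A r)" and A_convex: "\<And>r. r \<in> R \<Longrightarrow> convex (A r)"
    and A_zero: "\<And>r. r \<in> R \<Longrightarrow> 0 \<in> A r"
    and A_mid: "\<And>r r'. r \<in> R \<Longrightarrow> r' \<in> R \<Longrightarrow>
       \<exists>s\<in>A r. \<forall>k. if r k \<notin> range r' then s $ k > 0 else s $ k = 0"
    and M0_cover: "\<And>z. z \<in> M0 \<Longrightarrow> \<exists>r\<in>R. \<forall>h. h \<notin> range r \<longrightarrow> z $ h \<noteq> 0"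
    and c_smooth: "\<And>r h. r \<in> R \<Longrightarrow> smooth_on (reinhardt (A r)) (\<lambda>w. c r w $ h)"
    and reg_cases: "reg = smooth_on \<or> reg = holomorphic_map_on \<and> \<kappa> = 1"
begin

lemma regularity: "regularity reg" using reg_cases by (auto simp: regularity_def)

abbreviation "U r \<equiv> reinhardt (A r)"
abbreviation "sg r w \<equiv> slice_point r (c r w) w"
abbreviation "orb \<equiv> exp_orbit X Q \<kappa>"
abbreviation "H \<equiv> exp_group X Q \<kappa>"
abbreviation "\<Gamma> r \<equiv> phase_group.phase_maps (A r) (admissible r)"

definition gchart :: "('n \<Rightarrow> 'd) \<Rightarrow> (complex^'n, (complex^'d) set) quasi_chart" where
  "gchart r = \<lparr>chart_dom = U r, chart_group = \<Gamma> r, chart_map = (\<lambda>S. the_elem ((\<lambda>w. orb (sg r w)) ` S))\<rparr>"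

lemma pg: "r \<in> R \<Longrightarrow> phase_group (A r) (admissible r)"
  by (rule phase_group_admissible) (use A_open A_convex A_zero in auto)

lemma open_U: "r \<in> R \<Longrightarrow> open (U r)" by (simp add: open_reinhardt A_open)

lemma group_orbit_Gamma:
  assumes "r \<in> R" "w \<in> U r"
  shows "group_orbit (\<Gamma> r) w = (\<lambda>\<alpha>. phase \<alpha> w) ` admissible r"
  using assms by (auto simp: group_orbit_def phase_group.phase_maps_def[OF pg] image_image)

text \<open>Rotating frame coordinates leaves the positive outside coordinates alone, so the rotated
  point still satisfies the hypothesis of \<open>slice\<close> and must be the slice point of its
  own frame coordinates.\<close>

lemma sg_phase:
  assumes r: "r \<in> R" and w: "w \<in> U r" and \<alpha>: "\<alpha> \<in> admissible r"
  shows "sg r (phase \<alpha> w) = exp_act (phase_vec r \<alpha>) (sg r w)"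
proof -
  let ?z = "exp_act (phase_vec r \<alpha>) (sg r w)"
  have sel: "select_coords r ?z = phase \<alpha> w"
    using inj_frame[OF r] by (simp add: select_coords_def exp_act_def phase_vec_def phase_def vec_eq_iff)
  have "?z \<in> M0" using M0_inv[OF slice_in[OF r w] phase_vec_exp_group[OF r \<alpha>]] .
  then have "slice_point r (c r (select_coords r ?z)) (select_coords r ?z) = ?z"
    by (rule slice[OF r, THEN conjunct2])
       (use c_pos[OF r w] c_one[of r w] in \<open>auto simp: exp_act_def phase_vec_def\<close>)
  then show ?thesis unfolding sel by simp
qed

lemma orb_phase:
  assumes "r \<in> R" "w \<in> U r" "\<alpha> \<in> admissible r"
  shows "orb (sg r (phase \<alpha> w)) = orb (sg r w)"
  using exp_orbit_eq_iff[of \<kappa> "sg r w" "sg r (phase \<alpha> w)"] sg_phase[OF assms] phase_vec_exp_group[OF assms(1,3)] by blast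

lemma chart_map_gchart:
  assumes "r \<in> R" "w \<in> U r"
  shows "chart_map (gchart r) (group_orbit (\<Gamma> r) w) = orb (sg r w)"
proof -
  have "(\<lambda>w. orb (sg r w)) ` group_orbit (\<Gamma> r) w = {orb (sg r w)}"
    using orb_phase[OF assms] phase_group.S_zero[OF pg[OF assms(1)]]
    by (auto simp: group_orbit_Gamma[OF assms] image_image)
  then show ?thesis by (simp add: gchart_def)
qed

text \<open>Both slice points have the same positive coordinates outside the frame (moduli are
  preserved if \<open>\<kappa> = 0\<close>, and all are 1 if \<open>\<kappa> = 1\<close>), so there
  the connecting exponent is an integral multiple of 2 pi \<i>. Those integers contribute an element
  of \<open>Q\<close>; what remains on the frame is an admissible angle vector, the real part
  vanishing by independence.\<close>

lemma chart_injective: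
  assumes r: "r \<in> R" and w: "w \<in> U r" "w' \<in> U r" and eq: "orb (sg r w) = orb (sg r w')"
  shows "group_orbit (\<Gamma> r) w = group_orbit (\<Gamma> r) w'"
proof -
  obtain \<zeta> where \<zeta>: "\<zeta> \<in> H" "sg r w' = exp_act \<zeta> (sg r w)"
    using eq unfolding exp_orbit_eq_iff by blast
  have "\<exists>m::int. Re (\<zeta> $ h) = 0 \<and> Im (\<zeta> $ h) = 2 * pi * of_int m" if h: "h \<notin> range r" for h
  proof -
    have eqh: "complex_of_real (c r w' $ h) = exp (\<zeta> $ h) * complex_of_real (c r w $ h)"
      using arg_cong[OF \<zeta>(2), of "\<lambda>z. z $ h"] h by (simp add: exp_act_def)
    have pos: "c r w $ h > 0" "c r w' $ h > 0" using c_pos[OF r _ h] w by auto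
    have "c r w $ h = c r w' $ h"
    proof (cases "\<kappa> = 1")
      case True then show ?thesis by (simp add: c_one)
    next
      case False
      then have "Re (\<zeta> $ h) = 0" using \<zeta>(1) kappa by (auto simp: exp_group_def im_proj_def complex_eq_iff)
      then have "cmod (exp (\<zeta> $ h)) = 1" by (simp add: norm_exp_eq_Re)
      then show ?thesis using arg_cong[OF eqh, of cmod] pos by (simp add: norm_mult)
    qed
    then have "exp (\<zeta> $ h) = 1" using eqh pos by simp
    then show ?thesis unfolding exp_eq_1 by (auto simp: mult_ac)
  qed
  then obtain m where m: "\<And>h. h \<notin> range r \<Longrightarrow> Re (\<zeta> $ h) = 0 \<and> Im (\<zeta> $ h) = 2 * pi * of_int (m h)"
    by metis
  have "(\<Sum>k\<in>UNIV. Re (\<zeta> $ r k) *\<^sub>R X (r k)) = 0"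
    using \<zeta>(1) m by (simp add: exp_group_def sum_split_range[OF inj_frame[OF r]])
  then have Re0: "Re (\<zeta> $ r k) = 0" for k by (rule indep_frame[OF r])
  define \<alpha> where "\<alpha> = (\<chi> k. Im (\<zeta> $ r k))"
  have "(\<Sum>k\<in>UNIV. (\<alpha> $ k / (2 * pi)) *\<^sub>R X (r k)) =
      (\<Sum>j\<in>UNIV. (Im (\<zeta> $ j) / (2 * pi)) *\<^sub>R X j) - (\<Sum>h\<in>- range r. of_int (m h) *\<^sub>R X h)"
    using m by (simp add: sum_split_range[OF inj_frame[OF r]] \<alpha>_def)
  then have \<alpha>: "\<alpha> \<in> admissible r"
    using \<zeta>(1) by (auto simp: admissible_def exp_group_def intro!: Q_diff Q_sum Q_of_int X_in_Q)
  have "w' $ k = phase \<alpha> w $ k" for k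
  proof -
    have "\<zeta> $ r k = \<i> * complex_of_real (\<alpha> $ k)" using Re0[of k] by (simp add: \<alpha>_def complex_eq_iff)
    then show ?thesis using arg_cong[OF \<zeta>(2), of "\<lambda>z. z $ r k"] inj_frame[OF r]
      by (simp add: exp_act_def phase_def)
  qed
  then have w': "w' = phase \<alpha> w" by (simp add: vec_eq_iff)
  have add: "phase (\<beta> + \<gamma>) v = phase \<beta> (phase \<gamma> v)" for \<beta> \<gamma> and v :: "complex^'n"
    using log_phase_add[of "{}" \<beta> \<gamma> v] by simp
  interpret phase_group "A r" "admissible r" by (rule pg[OF r])
  show ?thesis unfolding group_orbit_Gamma[OF r w(1)] group_orbit_Gamma[OF r w(2)]
  proof (intro equalityI subsetI)
    fix y assume "y \<in> (\<lambda>\<alpha>. phase \<alpha> w) ` admissible r"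
    then obtain \<beta> where \<beta>: "\<beta> \<in> admissible r" "y = phase \<beta> w" by blast
    then have "y = phase (\<beta> - \<alpha>) w'" unfolding w' add[symmetric] by simp
    then show "y \<in> (\<lambda>\<alpha>. phase \<alpha> w') ` admissible r" using S_diff[OF \<beta>(1) \<alpha>] by blast
  next
    fix y assume "y \<in> (\<lambda>\<alpha>. phase \<alpha> w') ` admissible r"
    then obtain \<beta> where \<beta>: "\<beta> \<in> admissible r" "y = phase (\<beta> + \<alpha>) w" by (auto simp: w' add)
    then show "y \<in> (\<lambda>\<alpha>. phase \<alpha> w) ` admissible r" using S_add[OF \<beta>(1) \<alpha>] by blast
  qed
qed

text \<open>The exponent that normalises the coordinates outside the frame: for
  \<open>\<kappa> = 1\<close> it divides them by themselves, for \<open>\<kappa> = 0\<close> it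
  removes their arguments and keeps their moduli.\<close>

definition nrm :: "('n \<Rightarrow> 'd) \<Rightarrow> complex^'d \<Rightarrow> complex^'d" where
  "nrm r z = null_extend X r (\<lambda>h. - im_proj \<kappa> (Ln (z $ h)))"

lemma im_proj_idem: "im_proj \<kappa> (im_proj \<kappa> x) = im_proj \<kappa> x"
  using kappa by (auto simp: im_proj_def)

lemma im_proj_neg: "im_proj \<kappa> (- x) = - im_proj \<kappa> x"
  by (rule linear_neg[OF linear_im_proj])

lemma nrm_H: "r \<in> R \<Longrightarrow> nrm r z \<in> H"
  unfolding nrm_def by (rule null_extend_exp_group) (auto simp: im_proj_idem im_proj_neg)

lemma exp_minus_im_proj: "exp (x - im_proj \<kappa> x) = complex_of_real (exp ((1 - \<kappa>) * Re x))"
proof -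
  have "x - im_proj \<kappa> x = complex_of_real ((1 - \<kappa>) * Re x)"
    by (simp add: im_proj_def complex_eq_iff algebra_simps)
  then show ?thesis by (simp only: exp_of_real)
qed

lemma normalized:
  assumes r: "r \<in> R" and z: "z \<in> M0" and nz: "\<And>h. h \<notin> range r \<Longrightarrow> z $ h \<noteq> 0"
  defines "w \<equiv> select_coords r (exp_act (nrm r z) z)"
  shows "w \<in> U r" "sg r w = exp_act (nrm r z) z" "orb (sg r w) = orb z"
proof -
  have "\<exists>t>0. exp_act (nrm r z) z $ h = complex_of_real t \<and> (\<kappa> = 1 \<longrightarrow> t = 1)" if h: "h \<notin> range r" for h
  proof -
    have "exp_act (nrm r z) z $ h = exp (Ln (z $ h) - im_proj \<kappa> (Ln (z $ h)))"
      using nz[OF h] h by (simp add: exp_act_def nrm_def null_extend_outside exp_diff exp_minus field_simps)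
    also have "\<dots> = complex_of_real (exp ((1 - \<kappa>) * Re (Ln (z $ h))))" by (rule exp_minus_im_proj)
    finally show ?thesis by (intro exI[of _ "exp ((1 - \<kappa>) * Re (Ln (z $ h)))"]) auto
  qed
  from slice[OF r M0_inv[OF z nrm_H[OF r]] this]
  show "w \<in> U r" and sg: "sg r w = exp_act (nrm r z) z" by (auto simp: w_def)
  show "orb (sg r w) = orb z"
    unfolding sg by (rule exp_orbit_act[OF nrm_H[OF r]])
qed

lemma nrm_sg:
  assumes r: "r \<in> R" and w: "w \<in> U r"
  shows "nrm r (sg r w) = 0"
proof -
  have f0: "im_proj \<kappa> (Ln (sg r w $ h)) = 0" if h: "h \<notin> range r" for h
  proof -
    have "im_proj \<kappa> (complex_of_real (ln (c r w $ h))) = 0"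
      using kappa c_one[of r w h] by (auto simp: im_proj_def complex_eq_iff)
    then show ?thesis using h c_pos[OF r w h] by (simp add: Ln_of_real)
  qed
  show ?thesis
    unfolding nrm_def null_extend_def using f0 by (auto simp: vec_eq_iff intro!: sum.neutral)
qed

lemma sg_continuous: "r \<in> R \<Longrightarrow> continuous_on (U r) (sg r)"
  unfolding slice_point_def
proof (rule continuous_on_vec_lambda)
  fix j assume r: "r \<in> R"
  show "continuous_on (U r) (\<lambda>w. if j \<in> range r then w $ inv_into UNIV r j else complex_of_real (c r w $ j))"
    using smooth_on_continuous[OF c_smooth[OF r, of j]]
    by (cases "j \<in> range r") (auto intro!: continuous_intros)
qed

lemma continuous_on_normal_form:
  "continuous_on {z. \<forall>h. h \<notin> range r \<longrightarrow> z $ h \<notin> \<real>\<^sub>\<le>\<^sub>0} (\<lambda>z. select_coords r (exp_act (nrm r z) z))"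
proof -
  have "continuous_on {z. \<forall>h. h \<notin> range r \<longrightarrow> z $ h \<notin> \<real>\<^sub>\<le>\<^sub>0} (\<lambda>z. nrm r z $ j)" for j
    unfolding nrm_def null_extend_def
    by (cases "j \<in> range r")
       (auto intro!: continuous_intros bounded_linear.continuous_on[OF bounded_linear_im_proj])
  then have "continuous_on {z. \<forall>h. h \<notin> range r \<longrightarrow> z $ h \<notin> \<real>\<^sub>\<le>\<^sub>0} (\<lambda>z. \<chi> j. nrm r z $ j)"
    by (rule continuous_on_vec_lambda)
  then show ?thesis
    unfolding select_coords_def exp_act_def by (auto intro!: continuous_intros)
qed

text \<open>A point \<open>z0\<close> of the saturation is moved back to the slice by a fixed group
  element. Near the slice the outside coordinates avoid the branch cut of \<open>Ln\<close>, so
  normalisation is continuous there and sends nearby points into \<open>V\<close>.\<close>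

lemma chart_open:
  assumes r: "r \<in> R" and V: "openin (top_of_set (U r)) V"
  shows "openin (top_of_set M0) {z \<in> M0. orb z \<in> orb ` sg r ` V}"
proof (subst openin_subopen, intro ballI)
  have oV: "open V" and VU: "V \<subseteq> U r"
    using V open_U[OF r] by (auto simp: openin_open_eq)
  fix z0 assume z0: "z0 \<in> {z \<in> M0. orb z \<in> orb ` sg r ` V}"
  then obtain w0 where w0: "w0 \<in> V" "orb (sg r w0) = orb z0" by auto
  then obtain \<zeta> where \<zeta>: "\<zeta> \<in> H" "z0 = exp_act \<zeta> (sg r w0)" unfolding exp_orbit_eq_iff by blast
  let ?D = "{z. \<forall>h. h \<notin> range r \<longrightarrow> z $ h \<notin> \<real>\<^sub>\<le>\<^sub>0} :: (complex^'d) set"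
  let ?n = "\<lambda>z. select_coords r (exp_act (nrm r z) z)"
  have "open ?D"
  proof -
    have "?D = (\<Inter>h\<in>- range r. (\<lambda>z. z $ h) -` (- \<real>\<^sub>\<le>\<^sub>0))" by auto
    also have "open \<dots>" by (intro open_INT ballI finite open_vimage) (auto intro!: continuous_intros)
    finally show ?thesis .
  qed
  then have "open (?D \<inter> ?n -` V)"
    using continuous_open_preimage[OF continuous_on_normal_form _ oV] by blast
  then have oT: "open (exp_act (- \<zeta>) -` (?D \<inter> ?n -` V))"
    by (rule open_vimage[OF _ continuous_on_exp_act])
  let ?T = "M0 \<inter> exp_act (- \<zeta>) -` (?D \<inter> ?n -` V)"
  have "openin (top_of_set M0) ?T" using oT by (auto simp: openin_open)
  moreover have "z0 \<in> ?T"
  proof -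
    have w0U: "w0 \<in> U r" using w0 VU by blast
    have "sg r w0 $ h \<notin> \<real>\<^sub>\<le>\<^sub>0" if "h \<notin> range r" for h using c_pos[OF r w0U that] that by simp
    then have "sg r w0 \<in> ?D" by blast
    moreover have "?n (sg r w0) = w0" by (simp add: nrm_sg[OF r w0U] inj_frame[OF r])
    ultimately show ?thesis using z0 w0 by (simp add: \<zeta>(2))
  qed
  moreover have "?T \<subseteq> {z \<in> M0. orb z \<in> orb ` sg r ` V}"
  proof
    fix z assume z: "z \<in> ?T"
    let ?y = "exp_act (- \<zeta>) z"
    have y: "?y \<in> M0" using M0_inv[OF _ exp_group_minus[OF \<zeta>(1)]] z by blast
    have "orb z = orb ?y" by (rule exp_orbit_act[OF exp_group_minus[OF \<zeta>(1)], symmetric])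
    also have "\<dots> = orb (sg r (?n ?y))"
      by (rule normalized(3)[OF r y, symmetric]) (use z in auto)
    finally show "z \<in> {z \<in> M0. orb z \<in> orb ` sg r ` V}" using z by auto
  qed
  ultimately show "\<exists>T. openin (top_of_set M0) T \<and> z0 \<in> T \<and> T \<subseteq> {z \<in> M0. orb z \<in> orb ` sg r ` V}" by blast
qed

abbreviation "M \<equiv> quotient_topology (top_of_set M0) orb"

lemma chart_orbits_gchart: "chart_orbits (gchart r) = group_orbit (\<Gamma> r) ` U r"
  by (simp add: chart_orbits_def gchart_def)

lemma chart_image_gchart: "r \<in> R \<Longrightarrow> chart_image (gchart r) = orb ` sg r ` U r"
  using chart_map_gchart by (force simp: chart_image_def chart_orbits_gchart image_image)

lemma chart_map_inj_on: "r \<in> R \<Longrightarrow> inj_on (chart_map (gchart r)) (group_orbit (\<Gamma> r) ` U r)"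
proof (rule inj_onI, elim imageE)
  fix p q w w' assume r: "r \<in> R" and eq: "chart_map (gchart r) p = chart_map (gchart r) q"
    and w: "p = group_orbit (\<Gamma> r) w" "w \<in> U r" "q = group_orbit (\<Gamma> r) w'" "w' \<in> U r"
  have "orb (sg r w) = orb (sg r w')" using eq chart_map_gchart[OF r] w by simp
  then show "p = q" using chart_injective[OF r w(2,4)] w(1,3) by simp
qed

lemma mem_chart_image:
  assumes r: "r \<in> R" and z: "z \<in> M0"
  shows "orb z \<in> chart_image (gchart r) \<longleftrightarrow> (\<forall>h. h \<notin> range r \<longrightarrow> z $ h \<noteq> 0)"
proof
  assume "orb z \<in> chart_image (gchart r)"
  then obtain w where w: "w \<in> U r" "orb (sg r w) = orb z" by (auto simp: chart_image_gchart[OF r])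
  then obtain \<zeta> where "z = exp_act \<zeta> (sg r w)" unfolding exp_orbit_eq_iff by blast
  then show "\<forall>h. h \<notin> range r \<longrightarrow> z $ h \<noteq> 0" using c_pos[OF r w(1)] by (force simp: exp_act_def)
next
  assume nz: "\<forall>h. h \<notin> range r \<longrightarrow> z $ h \<noteq> 0"
  have "orb z = orb (sg r (select_coords r (exp_act (nrm r z) z)))"
    by (rule normalized(3)[OF r z, symmetric]) (use nz in auto)
  moreover have "select_coords r (exp_act (nrm r z) z) \<in> U r"
    by (rule normalized(1)[OF r z]) (use nz in auto)
  ultimately show "orb z \<in> chart_image (gchart r)" unfolding chart_image_gchart[OF r] by simp
qed

lemma is_chart_gchart:
  assumes r: "r \<in> R"
  shows "is_chart reg M (gchart r)"
proof -
  note Q = quotient_chart_homeomorphic[of "top_of_set (U r)" "top_of_set M0" "sg r" "chart_map (gchart r)"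
      "group_orbit (\<Gamma> r)" orb]
  have 1: "continuous_map (top_of_set (U r)) (top_of_set M0) (sg r)"
    using sg_continuous[OF r] slice_in[OF r] by (auto simp: continuous_map_in_subtopology)
  have img: "chart_image (gchart r) = chart_map (gchart r) ` group_orbit (\<Gamma> r) ` U r"
    by (simp add: chart_image_def chart_orbits_gchart)
  have "openin M (chart_image (gchart r))"
    unfolding img using Q(1)[OF 1] chart_map_gchart[OF r] chart_map_inj_on[OF r] chart_open[OF r] by auto
  moreover have "homeomorphic_map (chart_topology (gchart r)) (subtopology M (chart_image (gchart r))) (chart_map (gchart r))"
    unfolding img chart_topology_def
    using Q(2)[OF 1] chart_map_gchart[OF r] chart_map_inj_on[OF r] chart_open[OF r] by (auto simp: gchart_def)
  moreover have "is_model reg (U r) id (\<Gamma> r)"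
    by (rule phase_group.reinhardt_model[OF pg[OF r] regularity])
  ultimately show ?thesis using open_U[OF r] by (simp add: is_chart_def gchart_def)
qed

lemma charts_cover: "(\<Union>r\<in>R. chart_image (gchart r)) = topspace M"
proof -
  have "topspace M = orb ` M0" by (simp add: topspace_quotient_topology)
  moreover have "chart_image (gchart r) \<subseteq> orb ` M0" if "r \<in> R" for r
    using slice_in that by (auto simp: chart_image_gchart)
  moreover have "orb z \<in> (\<Union>r\<in>R. chart_image (gchart r))" if "z \<in> M0" for z
    using M0_cover[OF that] mem_chart_image[OF _ that] by auto
  ultimately show ?thesis by (intro equalityI UN_least) (auto simp del: UN_iff)
qed

section \<open>Chart changes lifted to the covers\<close>

definition new_index :: "('n \<Rightarrow> 'd) \<Rightarrow> ('n \<Rightarrow> 'd) \<Rightarrow> 'n set" where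
  "new_index r r' = {k. r k \<notin> range r'}"

lemma overlap_preimage:
  assumes r: "r \<in> R" and r': "r' \<in> R"
  shows "{x \<in> U r. group_orbit (\<Gamma> r) x \<in> chart_overlap (gchart r) (gchart r')} = nonvanishing (A r) (new_index r r')"
proof -
  have "group_orbit (\<Gamma> r) x \<in> chart_overlap (gchart r) (gchart r') \<longleftrightarrow> (\<forall>k\<in>new_index r r'. x $ k \<noteq> 0)" if x: "x \<in> U r" for x
  proof -
    have "group_orbit (\<Gamma> r) x \<in> chart_overlap (gchart r) (gchart r') \<longleftrightarrow> orb (sg r x) \<in> chart_image (gchart r')"
      using x chart_map_gchart[OF r x] by (simp add: chart_overlap_def chart_orbits_gchart)
    also have "\<dots> \<longleftrightarrow> (\<forall>h. h \<notin> range r' \<longrightarrow> sg r x $ h \<noteq> 0)"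
      by (rule mem_chart_image[OF r' slice_in[OF r x]])
    also have "\<dots> \<longleftrightarrow> (\<forall>k\<in>new_index r r'. x $ k \<noteq> 0)"
    proof
      assume "\<forall>h. h \<notin> range r' \<longrightarrow> sg r x $ h \<noteq> 0"
      then show "\<forall>k\<in>new_index r r'. x $ k \<noteq> 0"
        using slice_point_range[OF inj_frame[OF r]] by (metis mem_Collect_eq new_index_def)
    next
      assume nz: "\<forall>k\<in>new_index r r'. x $ k \<noteq> 0"
      show "\<forall>h. h \<notin> range r' \<longrightarrow> sg r x $ h \<noteq> 0"
      proof (intro allI impI)
        fix h assume h: "h \<notin> range r'"
        show "sg r x $ h \<noteq> 0"
        proof (cases "h \<in> range r")
          case True
          then obtain k where "h = r k" by blast
          then show ?thesis using nz h inj_frame[OF r] by (auto simp: new_index_def)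
        next
          case False
          then show ?thesis using c_pos[OF r x False] by simp
        qed
      qed
    qed
    finally show ?thesis .
  qed
  then show ?thesis by (auto simp: nonvanishing_def)
qed

abbreviation "LD r r' \<equiv> log_domain (A r) (new_index r r')"
abbreviation "CV r r' \<equiv> LD r r' \<times> {0::complex^'n}"
abbreviation "CP r r' \<equiv> cover_proj (new_index r r')"
abbreviation "PE r r' \<equiv> partial_exp (new_index r r')"

lemma submodel_cover_gchart:
  assumes r: "r \<in> R" and r': "r' \<in> R"
  shows "submodel_cover reg (gchart r) (chart_overlap (gchart r) (gchart r')) (CV r r') (CP r r')"
  unfolding submodel_cover_def
proof (intro conjI)
  have pre: "{x \<in> chart_dom (gchart r). group_orbit (chart_group (gchart r)) x \<in> chart_overlap (gchart r) (gchart r')} =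
      nonvanishing (A r) (new_index r r')"
    using overlap_preimage[OF r r'] by (simp add: gchart_def)
  show "covering_space (CV r r') (CP r r')
     {x \<in> chart_dom (gchart r). group_orbit (chart_group (gchart r)) x \<in> chart_overlap (gchart r) (gchart r')}"
    unfolding pre by (rule covering_space_cover[OF A_open[OF r]])
  have "nonvanishing (A r) (new_index r r') \<subseteq> U r" by (auto simp: nonvanishing_def)
  moreover have "open (nonvanishing (A r) (new_index r r'))" by (rule open_nonvanishing[OF A_open[OF r]])
  ultimately have "openin (top_of_set (U r)) (nonvanishing (A r) (new_index r r'))" by (auto simp: openin_open)
  moreover have "chart_overlap (gchart r) (gchart r') \<subseteq> group_orbit (\<Gamma> r) ` U r"
    by (auto simp: chart_overlap_def chart_orbits_gchart)
  moreover have "chart_topology (gchart r) = quotient_topology (top_of_set (U r)) (group_orbit (\<Gamma> r))"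
    by (simp add: chart_topology_def gchart_def)
  ultimately show "openin (chart_topology (gchart r)) (chart_overlap (gchart r) (gchart r'))"
    using overlap_preimage[OF r r'] by (simp add: openin_quotient_topology)
  have "\<exists>s\<in>A r. \<forall>k. if k \<in> new_index r r' then s $ k > 0 else s $ k = 0"
    using A_mid[OF r r'] by (simp add: new_index_def)
  then show "is_model reg (CV r r') (CP r r') (cover_group (CV r r') (CP r r') (chart_group (gchart r)))"
    using phase_group.cover_model[OF pg[OF r] regularity] by (simp add: gchart_def)
qed

text \<open>The exponent that carries the slice of \<open>r\<close> to that of \<open>r'\<close>: it
  cancels the coordinates that leave the frame. Since \<open>x\<close> already holds their
  logarithms, no branch has to be chosen and the formula is global on the cover. For
  \<open>\<kappa> = 0\<close> only the arguments are cancelled.\<close>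

definition zeta :: "('n \<Rightarrow> 'd) \<Rightarrow> ('n \<Rightarrow> 'd) \<Rightarrow> complex^'n \<Rightarrow> complex^'d" where
  "zeta r r' x = null_extend X r' (\<lambda>h. if h \<in> range r then - im_proj \<kappa> (x $ inv_into UNIV r h) else 0)"

definition moved :: "('n \<Rightarrow> 'd) \<Rightarrow> ('n \<Rightarrow> 'd) \<Rightarrow> complex^'n \<Rightarrow> complex^'d" where
  "moved r r' x = exp_act (zeta r r' x) (sg r (PE r r' x))"

text \<open>Coordinates that newly enter the frame need a logarithm on the target cover. There
  \<open>moved\<close> is the exponential of the \<open>zeta\<close> coordinate times the positive
  number \<open>c\<close>, which yields the explicit logarithm of the second case.\<close>

definition change_lift :: "('n \<Rightarrow> 'd) \<Rightarrow> ('n \<Rightarrow> 'd) \<Rightarrow> complex^'n \<Rightarrow> complex^'n" where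
  "change_lift r r' x = (\<chi> k. if r' k \<in> range r then moved r r' x $ r' k
     else zeta r r' x $ r' k + complex_of_real (ln (c r (PE r r' x) $ r' k)))"

lemma zeta_im_proj: "im_proj \<kappa> (zeta r r' x $ j) = zeta r r' x $ j"
  unfolding zeta_def by (rule null_extend_im_proj) (auto simp: im_proj_idem im_proj_neg linear_0[OF linear_im_proj])

lemma zeta_H: "r' \<in> R \<Longrightarrow> zeta r r' x \<in> H"
  unfolding zeta_def
  by (rule null_extend_exp_group) (auto simp: im_proj_idem im_proj_neg linear_0[OF linear_im_proj])

lemma moved_slice:
  assumes r: "r \<in> R" and r': "r' \<in> R" and x: "x \<in> LD r r'"
  shows "moved r r' x \<in> M0" and "select_coords r' (moved r r' x) \<in> U r'"
    and "sg r' (select_coords r' (moved r r' x)) = moved r r' x"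
    and "h \<in> range r \<Longrightarrow> h \<notin> range r' \<Longrightarrow> moved r r' x $ h = complex_of_real (exp ((1 - \<kappa>) * Re (x $ inv_into UNIV r h)))"
proof -
  have w: "PE r r' x \<in> U r" using x by (simp add: log_domain_def)
  show z: "moved r r' x \<in> M0" unfolding moved_def by (rule M0_inv[OF slice_in[OF r w] zeta_H[OF r']])
  have old: "moved r r' x $ h = complex_of_real (exp ((1 - \<kappa>) * Re (x $ inv_into UNIV r h)))"
    if h: "h \<in> range r" "h \<notin> range r'" for h
  proof -
    obtain k where k: "h = r k" using h by blast
    then have "k \<in> new_index r r'" using h by (simp add: new_index_def)
    then have "moved r r' x $ h = exp (- im_proj \<kappa> (x $ k)) * exp (x $ k)"
      using h k inj_frame[OF r] by (simp add: moved_def exp_act_def zeta_def null_extend_outside partial_exp_def)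
    also have "\<dots> = exp (x $ k - im_proj \<kappa> (x $ k))" by (simp flip: exp_add)
    finally show ?thesis using k inj_frame[OF r] by (simp add: exp_minus_im_proj)
  qed
  then show "h \<in> range r \<Longrightarrow> h \<notin> range r' \<Longrightarrow> moved r r' x $ h = complex_of_real (exp ((1 - \<kappa>) * Re (x $ inv_into UNIV r h)))" .
  have "\<exists>t>0. moved r r' x $ h = complex_of_real t \<and> (\<kappa> = 1 \<longrightarrow> t = 1)" if h: "h \<notin> range r'" for h
  proof (cases "h \<in> range r")
    case True
    then show ?thesis using old[OF True h] by (intro exI[of _ "exp ((1 - \<kappa>) * Re (x $ inv_into UNIV r h))"]) auto
  next
    case False
    then have "moved r r' x $ h = complex_of_real (c r (PE r r' x) $ h)"
      using h by (simp add: moved_def exp_act_def zeta_def null_extend_outside)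
    then show ?thesis using c_pos[OF r w False] c_one by blast
  qed
  from slice[OF r' z this] show "select_coords r' (moved r r' x) \<in> U r'"
    and "sg r' (select_coords r' (moved r r' x)) = moved r r' x" by blast+
qed

lemma change_lift_exp:
  assumes r: "r \<in> R" and r': "r' \<in> R" and x: "x \<in> LD r r'"
  shows "PE r' r (change_lift r r' x) = select_coords r' (moved r r' x)"
proof -
  have w: "PE r r' x \<in> U r" using x by (simp add: log_domain_def)
  have "PE r' r (change_lift r r' x) $ k = moved r r' x $ r' k" for k
  proof (cases "r' k \<in> range r")
    case True
    then show ?thesis by (simp add: partial_exp_def new_index_def change_lift_def)
  next
    case False
    then have "c r (PE r r' x) $ r' k > 0" by (rule c_pos[OF r w])
    then show ?thesis using False
      by (simp add: partial_exp_def new_index_def change_lift_def moved_def exp_act_def exp_add exp_of_real)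
  qed
  then show ?thesis by (simp add: select_coords_def vec_eq_iff)
qed

lemma change_lift_in:
  assumes "r \<in> R" "r' \<in> R" "x \<in> LD r r'"
  shows "change_lift r r' x \<in> LD r' r"
  using change_lift_exp[OF assms] moved_slice(2)[OF assms] by (simp add: log_domain_def)

lemma change_lift_orb:
  assumes "r \<in> R" "r' \<in> R" "x \<in> LD r r'"
  shows "orb (sg r' (PE r' r (change_lift r r' x))) = orb (sg r (PE r r' x))"
  unfolding change_lift_exp[OF assms] moved_slice(3)[OF assms] unfolding moved_def
  by (rule exp_orbit_act[OF zeta_H[OF assms(2)]])

lemma change_lift_inverse:
  assumes r: "r \<in> R" and r': "r' \<in> R" and x: "x \<in> LD r r'"
  shows "change_lift r' r (change_lift r r' x) = x"
proof -
  define y where "y = change_lift r r' x"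
  have w: "PE r r' x \<in> U r" using x by (simp add: log_domain_def)
  have inj: "inj r" "inj r'" using inj_frame r r' by auto
  \<comment> \<open>The two exponents cancel in every coordinate outside the frame \<open>r\<close>,
    hence everywhere by \<open>null_vector_unique\<close>.\<close>
  have sum0: "zeta r' r y + zeta r r' x = 0"
  proof (rule null_vector_unique[OF r])
    show "(\<Sum>j\<in>UNIV. Re ((zeta r' r y + zeta r r' x) $ j) *\<^sub>R X j) = 0"
      "(\<Sum>j\<in>UNIV. Im ((zeta r' r y + zeta r r' x) $ j) *\<^sub>R X j) = 0"
      using null_extend_Re[OF r] null_extend_Im[OF r] null_extend_Re[OF r'] null_extend_Im[OF r']
      by (auto simp: zeta_def scaleR_add_left sum.distrib)
    fix h assume h: "h \<notin> range r"
    show "(zeta r' r y + zeta r r' x) $ h = 0"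
    proof (cases "h \<in> range r'")
      case True
      then obtain k where k: "h = r' k" by blast
      have "im_proj \<kappa> (complex_of_real (ln (c r (PE r r' x) $ h))) = 0"
        using kappa c_one[of r "PE r r' x" h] by (auto simp: im_proj_def complex_eq_iff)
      then have "im_proj \<kappa> (y $ k) = zeta r r' x $ h"
        using h k by (simp add: y_def change_lift_def linear_add[OF linear_im_proj] zeta_im_proj)
      then show ?thesis using h k inj by (simp add: zeta_def[of r' r] null_extend_outside)
    next
      case False
      then show ?thesis using h by (simp add: zeta_def null_extend_outside)
    qed
  qed
  have sgy: "sg r' (PE r' r y) = moved r r' x"
    unfolding y_def change_lift_exp[OF r r' x] by (rule moved_slice(3)[OF r r' x])
  have returned: "moved r' r y = sg r (PE r r' x)"
    unfolding moved_def[of r' r] sgy unfolding moved_def exp_act_add[symmetric] sum0 by simp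
  have "change_lift r' r y $ k = x $ k" for k
  proof (cases "r k \<in> range r'")
    case True
    then show ?thesis using inj by (simp add: change_lift_def[of r' r] returned partial_exp_def new_index_def)
  next
    case False
    have "complex_of_real (c r' (PE r' r y) $ r k) = sg r' (PE r' r y) $ r k" using False by simp
    also have "\<dots> = complex_of_real (exp ((1 - \<kappa>) * Re (x $ k)))"
      unfolding sgy using moved_slice(4)[OF r r' x, of "r k"] False inj by simp
    finally have c: "c r' (PE r' r y) $ r k = exp ((1 - \<kappa>) * Re (x $ k))" by (simp only: of_real_eq_iff)
    have "zeta r' r y $ r k = - zeta r r' x $ r k"
      using arg_cong[OF sum0, of "\<lambda>z. z $ r k"] by (simp add: add_eq_0_iff2)
    also have "\<dots> = im_proj \<kappa> (x $ k)" using False inj by (simp add: zeta_def null_extend_outside)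
    \<comment> \<open>The part of the logarithm that the exponent removed returns through
      \<open>zeta\<close>; the rest, its real part if \<open>\<kappa> = 0\<close>, was stored in
      \<open>c\<close> and returns through \<open>ln\<close>.\<close>
    finally have "change_lift r' r y $ k = im_proj \<kappa> (x $ k) + complex_of_real ((1 - \<kappa>) * Re (x $ k))"
      using False by (simp add: change_lift_def[of r' r] c)
    also have "\<dots> = x $ k" by (simp add: im_proj_def complex_eq_iff algebra_simps)
    finally show ?thesis .
  qed
  then show ?thesis by (simp add: y_def vec_eq_iff)
qed

lemma zeta_component: "r' \<in> R \<Longrightarrow> zeta r r' x $ r' k =
    (\<Sum>h\<in>range r - range r'. complex_of_real (coef X r' h k) * im_proj \<kappa> (x $ inv_into UNIV r h))"
proof -
  assume r': "r' \<in> R"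
  have "zeta r r' x $ r' k = - (\<Sum>h\<in>- range r'. complex_of_real (coef X r' h k) *
      (if h \<in> range r then - im_proj \<kappa> (x $ inv_into UNIV r h) else 0))"
    unfolding zeta_def by (rule null_extend_range[OF r'])
  also have "\<dots> = (\<Sum>h\<in>- range r'. if h \<in> range r then complex_of_real (coef X r' h k) * im_proj \<kappa> (x $ inv_into UNIV r h) else 0)"
    unfolding sum_negf[symmetric] by (rule sum.cong) auto
  also have "\<dots> = (\<Sum>h\<in>range r - range r'. complex_of_real (coef X r' h k) * im_proj \<kappa> (x $ inv_into UNIV r h))"
    by (rule sum.mono_neutral_cong_right) auto
  finally show ?thesis .
qed

lemma zeta_outside: "h \<notin> range r' \<Longrightarrow> zeta r r' x $ h = (if h \<in> range r then - im_proj \<kappa> (x $ inv_into UNIV r h) else 0)"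
  by (simp add: zeta_def null_extend_outside)

lemma continuous_on_zeta: "r' \<in> R \<Longrightarrow> continuous_on S (\<lambda>x. zeta r r' x $ j)"
proof -
  assume r': "r' \<in> R"
  have ip: "continuous_on S (\<lambda>x. im_proj \<kappa> (x $ k))" for S :: "(complex^'n) set" and k
    by (intro bounded_linear.continuous_on[OF bounded_linear_im_proj] continuous_intros)
  show ?thesis
  proof (cases "j \<in> range r'")
    case True
    then obtain k where "j = r' k" by blast
    then show ?thesis using zeta_component[OF r'] ip by (auto intro!: continuous_intros)
  next
    case False
    then show ?thesis using zeta_outside[OF False] ip
      by (cases "j \<in> range r") (auto intro!: continuous_intros)
  qed
qed

lemma continuous_on_change_lift:
  assumes r: "r \<in> R" and r': "r' \<in> R"
  shows "continuous_on (LD r r') (change_lift r r')"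
  unfolding change_lift_def
proof (rule continuous_on_vec_lambda)
  fix k
  have sub: "PE r r' ` LD r r' \<subseteq> U r" by (auto simp: log_domain_def)
  have csg: "continuous_on (LD r r') (\<lambda>x. sg r (PE r r' x) $ j)" for j
    using continuous_on_compose2[OF sg_continuous[OF r] continuous_on_partial_exp sub] by (intro continuous_intros)
  have cc: "continuous_on (LD r r') (\<lambda>x. c r (PE r r' x) $ j)" for j
    by (rule continuous_on_compose2[OF smooth_on_continuous[OF c_smooth[OF r]] continuous_on_partial_exp sub])
  show "continuous_on (LD r r') (\<lambda>x. if r' k \<in> range r then moved r r' x $ r' k
     else zeta r r' x $ r' k + complex_of_real (ln (c r (PE r r' x) $ r' k)))"
  proof (cases "r' k \<in> range r")
    case True
    then show ?thesis
      by (auto simp: moved_def exp_act_def intro!: continuous_intros continuous_on_zeta[OF r'] csg)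
  next
    case False
    have "c r (PE r r' x) $ r' k \<noteq> 0" if "x \<in> LD r r'" for x
      using c_pos[OF r _ False, of "PE r r' x"] that by (auto simp: log_domain_def)
    then show ?thesis using False
      by (auto intro!: continuous_intros continuous_on_zeta[OF r'] cc)
  qed
qed

abbreviation "SL r r' x0 \<equiv> slit_domain (A r) (new_index r r') (PE r r' x0)"
abbreviation "LS r r' x0 \<equiv> log_section (new_index r r') x0"

text \<open>The lifted chart change read on the base: the branch \<open>log_section\<close> selects
  a sheet, and the target is projected down. Regularity and pullbacks are tested on this
  map.\<close>

definition local_change :: "('n \<Rightarrow> 'd) \<Rightarrow> ('n \<Rightarrow> 'd) \<Rightarrow> complex^'n \<Rightarrow> complex^'n \<Rightarrow> complex^'n" where
  "local_change r r' x0 w = select_coords r' (exp_act (zeta r r' (LS r r' x0 w)) (sg r w))"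

lemma log_section_facts:
  assumes "w \<in> SL r r' x0"
  shows "LS r r' x0 w \<in> LD r r'" "PE r r' (LS r r' x0 w) = w" "w \<in> U r"
  using homeomorphism_sheet[OF refl, of "A r" "new_index r r'" x0] assms
  by (auto simp: homeomorphism_def sheet_def slit_domain_def)

lemma open_SL: "r \<in> R \<Longrightarrow> open (SL r r' x0)"
  by (rule open_slit_domain[OF A_open]) (auto simp: partial_exp_def)

lemma smooth_on_log_section:
  assumes "r \<in> R" "k \<in> new_index r r'"
  shows "smooth_on (SL r r' x0) (\<lambda>w. LS r r' x0 w $ k)"
proof -
  have "smooth_on (SL r r' x0) (\<lambda>w. x0 $ k + Ln (inverse (exp (x0 $ k)) * w $ k))"
    by (intro smooth_on_add smooth_on_const smooth_on_Ln open_SL[OF assms(1)]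
        smooth_on_linear_comp[OF _ bounded_linear_mult_right] smooth_on_bounded_linear bounded_linear_vec_nth)
       (use assms(2) in \<open>auto simp: slit_domain_def partial_exp_def divide_inverse mult.commute\<close>)
  then show ?thesis using assms(2) by (simp add: log_section_def divide_inverse mult.commute)
qed

lemma smooth_on_zeta:
  assumes r: "r \<in> R" and r': "r' \<in> R"
  shows "smooth_on (SL r r' x0) (\<lambda>w. zeta r r' (LS r r' x0 w) $ j)"
proof -
  have ip: "smooth_on (SL r r' x0) (\<lambda>w. im_proj \<kappa> (LS r r' x0 w $ inv_into UNIV r h))" if "h \<in> range r - range r'" for h
  proof -
    have "inv_into UNIV r h \<in> new_index r r'" using that inj_frame[OF r] by (auto simp: new_index_def)
    then show ?thesis
      by (intro smooth_on_linear_comp[OF open_SL[OF r] bounded_linear_im_proj] smooth_on_log_section r)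
  qed
  show ?thesis
  proof (cases "j \<in> range r'")
    case True
    then obtain k where "j = r' k" by blast
    then show ?thesis using zeta_component[OF r'] ip
      by (auto intro!: smooth_on_sum smooth_on_linear_comp[OF _ bounded_linear_mult_right] open_SL[OF r])
  next
    case False
    then show ?thesis using zeta_outside[OF False] ip[of j]
        smooth_on_linear_comp[OF open_SL[OF r] bounded_linear_minus[OF bounded_linear_ident]]
      by (cases "j \<in> range r") (auto intro!: smooth_on_const open_SL[OF r])
  qed
qed

lemma smooth_on_sg:
  assumes r: "r \<in> R"
  shows "smooth_on (U r) (\<lambda>w. sg r w $ j)"
proof (cases "j \<in> range r")
  case True
  then show ?thesis
    by (auto simp: slice_point_def intro!: smooth_on_bounded_linear open_U[OF r] bounded_linear_vec_nth)
next
  case False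
  then show ?thesis
    by (auto intro!: smooth_on_linear_comp[OF _ bounded_linear_of_real] c_smooth open_U r)
qed

text \<open>For \<open>\<kappa> = 1\<close> the projection \<open>im_proj\<close> is the identity
  and \<open>c\<close> is constant, so the formula is built from holomorphic functions; smoothness
  holds for either value of \<open>\<kappa>\<close>.\<close>

lemma regular_local_change:
  assumes r: "r \<in> R" and r': "r' \<in> R"
  shows "reg (SL r r' x0) (local_change r r' x0)"
proof -
  have sub: "SL r r' x0 \<subseteq> U r" by (auto simp: slit_domain_def)
  have "smooth_on (SL r r' x0) (local_change r r' x0)"
  proof (rule smooth_on_vec[OF open_SL[OF r]])
    show "smooth_on (SL r r' x0) (\<lambda>w. local_change r r' x0 w $ k)" for k
      unfolding local_change_def select_coords_def exp_act_def
      using smooth_on_subset[OF smooth_on_sg[OF r] sub] smooth_on_zeta[OF r r']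
      by (auto intro!: smooth_on_mult smooth_on_exp open_SL[OF r])
  qed
  moreover have "holomorphic_map_on (SL r r' x0) (local_change r r' x0)" if k1: "\<kappa> = 1"
  proof (rule holomorphic_map_on_vec)
    fix x k assume x: "x \<in> SL r r' x0"
    have ls: "\<exists>L. ((\<lambda>w. LS r r' x0 w $ inv_into UNIV r h) has_derivative L) (at x) \<and> (\<forall>c v. L (c *s v) = c * L v)"
      if h: "h \<in> range r - range r'" for h
    proof -
      let ?k = "inv_into UNIV r h"
      have k: "?k \<in> new_index r r'" using h inj_frame[OF r] by (auto simp: new_index_def)
      have n: "x $ ?k / exp (x0 $ ?k) \<notin> \<real>\<^sub>\<le>\<^sub>0" using x k by (auto simp: slit_domain_def partial_exp_def)
      have "\<exists>L. ((\<lambda>w. (\<lambda>y. x0 $ ?k + Ln (y / exp (x0 $ ?k))) (w $ ?k)) has_derivative L) (at x) \<and> (\<forall>c v. L (c *s v) = c * L v)"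
        by (rule scalar_holomorphic_compose[OF scalar_holomorphic_nth])
           (use n in \<open>auto intro!: derivative_eq_intros\<close>)
      then show ?thesis using k by (simp add: log_section_def)
    qed
    have z: "\<exists>L. ((\<lambda>w. zeta r r' (LS r r' x0 w) $ r' k) has_derivative L) (at x) \<and> (\<forall>c v. L (c *s v) = c * L v)"
      unfolding zeta_component[OF r'] unfolding k1 im_proj_one id_apply
      by (intro scalar_holomorphic_sum scalar_holomorphic_mult scalar_holomorphic_const ls)
    have s: "\<exists>L. ((\<lambda>w. sg r w $ r' k) has_derivative L) (at x) \<and> (\<forall>c v. L (c *s v) = c * L v)"
      using scalar_holomorphic_nth[where ?'n='n] scalar_holomorphic_const[where ?'n='n]
      by (cases "r' k \<in> range r") (simp_all add: slice_point_def c_one[OF k1])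
    show "\<exists>L. ((\<lambda>w. local_change r r' x0 w $ k) has_derivative L) (at x) \<and> (\<forall>c v. L (c *s v) = c * L v)"
      unfolding local_change_def select_coords_def exp_act_def vec_lambda_beta
      by (intro scalar_holomorphic_mult s scalar_holomorphic_compose[OF z DERIV_exp])
  qed
  ultimately show ?thesis using reg_cases by auto
qed

lemma local_change_eq:
  assumes r: "r \<in> R" and r': "r' \<in> R" and w: "w \<in> SL r r' x0"
  shows "PE r' r (change_lift r r' (LS r r' x0 w)) = local_change r r' x0 w"
    and "sg r' (local_change r r' x0 w) = exp_act (zeta r r' (LS r r' x0 w)) (sg r w)"
    and "local_change r r' x0 w \<in> U r'"
  using change_lift_exp[OF r r' log_section_facts(1)[OF w]] moved_slice(2,3)[OF r r' log_section_facts(1)[OF w]]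
  by (auto simp: moved_def local_change_def log_section_facts[OF w])

lemma change_manifold_map:
  assumes r: "r \<in> R" and r': "r' \<in> R"
    and l: "\<And>x. x \<in> LD r r' \<Longrightarrow> l (x, 0) = (change_lift r r' x, 0)"
  shows "manifold_map reg (CV r r') (CP r r') (CV r' r) (CP r' r) l"
  unfolding manifold_map_def
proof (intro conjI ballI)
  show "l ` CV r r' \<subseteq> CV r' r" using l change_lift_in[OF r r'] by auto
  have "continuous_on (CV r r') (\<lambda>p. (change_lift r r' (fst p), 0::complex^'n))"
    by (intro continuous_intros continuous_on_compose2[OF continuous_on_change_lift[OF r r']]) auto
  then show "continuous_on (CV r r') l"
    by (rule continuous_on_eq) (use l in auto)
  fix p assume "p \<in> CV r r'"
  then obtain x0 where x0: "p = (x0, 0)" "x0 \<in> LD r r'" by auto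
  have sec: "local_section (CV r r') (CP r r') p (SL r r' x0) (\<lambda>w. (LS r r' x0 w, 0))"
    unfolding x0(1) by (rule local_section_cover[OF A_open[OF r] x0(2)])
  have "local_change r r' x0 w = (CP r' r \<circ> l \<circ> (\<lambda>w. (LS r r' x0 w, 0))) w" if "w \<in> SL r r' x0" for w
    using l[OF log_section_facts(1)[OF that]] local_change_eq(1)[OF r r' that] by (simp add: cover_proj_def)
  with regularity_cong[of reg "SL r r' x0" "local_change r r' x0" "CP r' r \<circ> l \<circ> (\<lambda>w. (LS r r' x0 w, 0))"]
  have "reg (SL r r' x0) (CP r' r \<circ> l \<circ> (\<lambda>w. (LS r r' x0 w, 0)))"
    using regularity open_SL[OF r] regular_local_change[OF r r'] by blast
  then show "\<exists>T s. local_section (CV r r') (CP r r') p T s \<and> reg T (CP r' r \<circ> l \<circ> s)"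
    using sec by (intro exI[of _ "SL r r' x0"] exI[of _ "\<lambda>w. (LS r r' x0 w, 0)"] conjI)
qed

definition lift_map :: "('n \<Rightarrow> 'd) \<Rightarrow> ('n \<Rightarrow> 'd) \<Rightarrow> (complex^'n) \<times> (complex^'n) \<Rightarrow> (complex^'n) \<times> (complex^'n)" where
  "lift_map r r' p = (change_lift r r' (fst p), 0)"

lemma lift_map_bij:
  assumes r: "r \<in> R" and r': "r' \<in> R"
  shows "bij_betw (lift_map r r') (CV r r') (CV r' r)"
  by (rule bij_betwI[where g="lift_map r' r"])
     (auto simp: lift_map_def change_lift_in r r' change_lift_inverse)

lemma manifold_iso_lift_map:
  assumes r: "r \<in> R" and r': "r' \<in> R"
  shows "manifold_iso reg (CV r r') (CP r r') (CV r' r) (CP r' r) (lift_map r r')"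
proof -
  have "inv_into (CV r r') (lift_map r r') (x, 0) = (change_lift r' r x, 0)" if "x \<in> LD r' r" for x
    by (rule inv_into_f_eq[OF bij_betw_imp_inj_on[OF lift_map_bij[OF r r']]])
       (use that in \<open>auto simp: lift_map_def change_lift_in r r' change_lift_inverse\<close>)
  then show ?thesis
    unfolding manifold_iso_def
    using lift_map_bij[OF r r'] change_manifold_map[OF r r'] change_manifold_map[OF r' r]
    by (simp add: lift_map_def)
qed

lemma chart_change_orbit:
  assumes r: "r \<in> R" and r': "r' \<in> R" and x: "x \<in> LD r r'"
  shows "chart_change (gchart r) (gchart r') (group_orbit (\<Gamma> r) (PE r r' x)) =
    group_orbit (\<Gamma> r') (PE r' r (change_lift r r' x))"
proof -
  have w: "PE r r' x \<in> U r" "PE r' r (change_lift r r' x) \<in> U r'"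
    using x change_lift_in[OF r r' x] by (auto simp: log_domain_def)
  have "chart_map (gchart r) (group_orbit (\<Gamma> r) (PE r r' x)) =
      chart_map (gchart r') (group_orbit (\<Gamma> r') (PE r' r (change_lift r r' x)))"
    using chart_map_gchart[OF r w(1)] chart_map_gchart[OF r' w(2)] change_lift_orb[OF r r' x] by simp
  then show ?thesis
    using chart_map_inj_on[OF r'] w(2) by (simp add: chart_change_def chart_orbits_gchart)
qed

lemma chart_change_lift_gchart:
  assumes r: "r \<in> R" and r': "r' \<in> R"
  shows "chart_change_lift reg (gchart r) (CV r r') (CP r r') (gchart r') (CV r' r) (CP r' r) (lift_map r r')"
  unfolding chart_change_lift_def model_iso_lift_def
proof (intro conjI ballI submodel_cover_gchart manifold_iso_lift_map r r')
  let ?a = "group_orbit (chart_group (gchart r)) \<circ> CP r r'"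
  let ?b = "group_orbit (chart_group (gchart r')) \<circ> CP r' r"
  show comm: "?b (lift_map r r' p) = chart_change (gchart r) (gchart r') (?a p)" if "p \<in> CV r r'" for p
    using that chart_change_orbit[OF r r'] by (auto simp: lift_map_def cover_proj_def gchart_def)
  show "bij_betw (chart_change (gchart r) (gchart r')) (?a ` CV r r') (?b ` CV r' r)"
  proof (rule bij_betw_imageI)
    have "chart_change (gchart r) (gchart r') ` ?a ` CV r r' = (\<lambda>p. ?b (lift_map r r' p)) ` CV r r'"
      unfolding image_image by (rule image_cong[OF refl]) (rule comm[symmetric])
    also have "\<dots> = ?b ` lift_map r r' ` CV r r'" by (simp only: image_image)
    finally show "chart_change (gchart r) (gchart r') ` ?a ` CV r r' = ?b ` CV r' r"
      by (simp only: bij_betw_imp_surj_on[OF lift_map_bij[OF r r']])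
    show "inj_on (chart_change (gchart r) (gchart r')) (?a ` CV r r')"
    proof (rule inj_onI, elim imageE)
      fix u v p q assume u: "u = ?a p" "p \<in> CV r r'" and v: "v = ?a q" "q \<in> CV r r'"
        and eq: "chart_change (gchart r) (gchart r') u = chart_change (gchart r) (gchart r') v"
      obtain x y where p: "p = (x, 0)" "x \<in> LD r r'" and q: "q = (y, 0)" "y \<in> LD r r'" using u v by auto
      have w: "PE r r' x \<in> U r" "PE r r' y \<in> U r" "PE r' r (change_lift r r' x) \<in> U r'" "PE r' r (change_lift r r' y) \<in> U r'"
        using p q change_lift_in[OF r r'] by (auto simp: log_domain_def)
      have "group_orbit (\<Gamma> r') (PE r' r (change_lift r r' x)) = group_orbit (\<Gamma> r') (PE r' r (change_lift r r' y))"
        using eq chart_change_orbit[OF r r'] p q by (simp add: u v cover_proj_def gchart_def)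
      then have "orb (sg r' (PE r' r (change_lift r r' x))) = orb (sg r' (PE r' r (change_lift r r' y)))"
        using chart_map_gchart[OF r' w(3)] chart_map_gchart[OF r' w(4)] by simp
      then have "orb (sg r (PE r r' x)) = orb (sg r (PE r r' y))"
        using change_lift_orb[OF r r'] p q by simp
      then show "u = v" using chart_injective[OF r w(1,2)] p q by (simp add: u v cover_proj_def gchart_def)
    qed
  qed
qed

theorem quasifold_atlas_gchart: "quasifold_atlas reg M (gchart ` R)"
  unfolding quasifold_atlas_def
proof (intro conjI ballI)
  show "is_chart reg M x" if "x \<in> gchart ` R" for x using that is_chart_gchart by blast
  show "(\<Union>x\<in>gchart ` R. chart_image x) = topspace M" using charts_cover by simp
  fix x y assume "x \<in> gchart ` R" "y \<in> gchart ` R"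
  then obtain r r' where "x = gchart r" "y = gchart r'" "r \<in> R" "r' \<in> R" by blast
  then have "chart_change_lift reg x (CV r r') (CP r r') y (CV r' r) (CP r' r) (lift_map r r')"
    by (simp only: chart_change_lift_gchart)
  then show "charts_compatible reg x y" unfolding charts_compatible_def by (intro impI exI)
qed

text \<open>\<open>pulls_back\<close> asks for an identity at each point with some local section
  there, so each point may be tested with the branch centred at it.\<close>

lemma pulls_back_lift_map:
  assumes r: "r \<in> R" and r': "r' \<in> R"
    and "\<And>x0 u v. x0 \<in> LD r r' \<Longrightarrow> \<omega> (PE r r' x0) u v =
      \<omega>' (local_change r r' x0 (PE r r' x0))
        (frechet_derivative (local_change r r' x0) (at (PE r r' x0)) u)
        (frechet_derivative (local_change r r' x0) (at (PE r r' x0)) v)"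
  shows "pulls_back (CV r r') (CP r r') (CP r' r) (lift_map r r') \<omega>' \<omega>"
  unfolding pulls_back_def
proof
  fix p assume "p \<in> CV r r'"
  then obtain x0 where x0: "p = (x0, 0)" "x0 \<in> LD r r'" by auto
  have sec: "local_section (CV r r') (CP r r') p (SL r r' x0) (\<lambda>w. (LS r r' x0 w, 0))"
    unfolding x0(1) by (rule local_section_cover[OF A_open[OF r] x0(2)])
  have eq: "(CP r' r \<circ> lift_map r r' \<circ> (\<lambda>w. (LS r r' x0 w, 0))) w = local_change r r' x0 w" if "w \<in> SL r r' x0" for w
    using that by (simp add: cover_proj_def lift_map_def local_change_eq[OF r r'])
  have w0: "PE r r' x0 \<in> SL r r' x0" using x0(2)
    by (auto simp: slit_domain_def log_domain_def) (simp add: partial_exp_def)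
  have "LS r r' x0 (PE r r' x0) = x0" by (auto simp: log_section_def partial_exp_def vec_eq_iff)
  then have pt: "CP r' r (lift_map r r' p) = local_change r r' x0 (PE r r' x0)"
    using eq[OF w0] by (simp add: x0(1))
  have D: "frechet_derivative (CP r' r \<circ> lift_map r r' \<circ> (\<lambda>w. (LS r r' x0 w, 0))) (at (PE r r' x0)) =
      frechet_derivative (local_change r r' x0) (at (PE r r' x0))"
    by (rule frechet_derivative_cong_open[OF open_SL[OF r] w0 eq])
  have cp: "CP r r' p = PE r r' x0" by (simp add: x0(1) cover_proj_def)
  show "\<exists>T s. local_section (CV r r') (CP r r') p T s \<and> (\<forall>u v. \<omega> (CP r r' p) u v =
     \<omega>' (CP r' r (lift_map r r' p)) (frechet_derivative (CP r' r \<circ> lift_map r r' \<circ> s) (at (CP r r' p)) u)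
        (frechet_derivative (CP r' r \<circ> lift_map r r' \<circ> s) (at (CP r r' p)) v))"
    by (intro exI conjI, rule sec) (simp only: cp pt D assms(3)[OF x0(2)], simp)
qed

end

section \<open>Symplectic and complex slices of a simple polytope\<close>

context polytope_data
begin

lemma vertex_normals:
  assumes v: "v extreme_point_of \<Delta>"
  shows "inj_on X (active v)" "independent (X ` active v)" "card (active v) = DIM('a)"
proof -
  obtain y where y: "\<And>i j. i \<in> active v \<Longrightarrow> j \<in> active v \<Longrightarrow> y i \<bullet> X j = (if i = j then 1 else 0)"
    using vertex_dual_basis[OF v] by blast
  show inj: "inj_on X (active v)"
  proof (rule inj_onI)
    fix i j assume ij: "i \<in> active v" "j \<in> active v" "X i = X j"
    then show "i = j" using y[of i i] y[of i j] by (auto split: if_splits)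
  qed
  show indep: "independent (X ` active v)"
  proof (rule independent_if_scalars_zero)
    fix f x assume sum: "(\<Sum>x\<in>X ` active v. f x *\<^sub>R x) = 0" and x: "x \<in> X ` active v"
    obtain i where i: "i \<in> active v" "x = X i" using x by blast
    have "0 = y i \<bullet> (\<Sum>x\<in>X ` active v. f x *\<^sub>R x)" by (simp add: sum)
    also have "\<dots> = (\<Sum>j\<in>active v. f (X j) * (y i \<bullet> X j))"
      by (simp add: sum.reindex[OF inj] inner_sum_right)
    also have "\<dots> = (\<Sum>j\<in>active v. if i = j then f (X j) else 0)"
      by (rule sum.cong) (use y[OF i(1)] in auto)
    also have "\<dots> = f x" using i by simp
    finally show "f x = 0" by simp
  qed simp
  show "card (active v) = DIM('a)"
    using dim_span_eq_card_independent[OF indep] vertex_normals_span[OF v] card_image[OF inj] by simp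
qed

lemma face_contains_vertex:
  assumes F: "F face_of \<Delta>" "F \<noteq> {}"
  obtains v where "v \<in> F" "v extreme_point_of \<Delta>"
proof -
  have "compact F" "convex F" using F compact_Delta convex_Delta face_of_imp_compact face_of_imp_convex by blast+
  then obtain v where "v extreme_point_of F" using extreme_point_exists_convex F(2) by blast
  then show ?thesis using that extreme_point_of_face[OF F(1)] by (auto simp: extreme_point_of_def)
qed

text \<open>From \<open>v\<close> one moves along the sum of the dual vectors with index outside
  \<open>J\<close>: this leaves exactly the facets in \<open>active v - J\<close>, and a short step
  makes no new constraint active.\<close>

lemma point_with_index:
  assumes v: "v extreme_point_of \<Delta>" and J: "J \<subseteq> active v"
  obtains \<nu> where "\<nu> \<in> \<Delta>" "active \<nu> = J"
proof -
  obtain y where y: "\<And>i j. i \<in> active v \<Longrightarrow> j \<in> active v \<Longrightarrow> y i \<bullet> X j = (if i = j then 1 else 0)"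
    using vertex_dual_basis[OF v] by blast
  have vD: "v \<in> \<Delta>" using v by (simp add: extreme_point_of_def)
  define u where "u = (\<Sum>i\<in>active v - J. y i)"
  have u: "u \<bullet> X j = (if j \<in> J then 0 else 1)" if "j \<in> active v" for j
  proof -
    have "u \<bullet> X j = (\<Sum>i\<in>active v - J. if i = j then 1 else 0)"
      unfolding u_def inner_sum_left by (rule sum.cong) (use y that in auto)
    then show ?thesis using that by simp
  qed
  have "\<forall>\<^sub>F t in at_right (0::real). v + t *\<^sub>R u \<in> \<Delta> \<and> (\<forall>j. j \<notin> active v \<longrightarrow> (v + t *\<^sub>R u) \<bullet> X j > lam j)"
    by (rule feasible_direction[OF vD]) (simp add: u)
  then have "\<forall>\<^sub>F t in at_right (0::real). t > 0 \<and> v + t *\<^sub>R u \<in> \<Delta> \<and> (\<forall>j. j \<notin> active v \<longrightarrow> (v + t *\<^sub>R u) \<bullet> X j > lam j)"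
    using eventually_at_right_less[of "0::real"] by eventually_elim auto
  then obtain t where t: "t > 0" "v + t *\<^sub>R u \<in> \<Delta>" "\<And>j. j \<notin> active v \<Longrightarrow> (v + t *\<^sub>R u) \<bullet> X j > lam j"
    using eventually_happens[of _ "at_right (0::real)"] by (auto simp: trivial_limit_at_right_real)
  have act: "(v + t *\<^sub>R u) \<bullet> X j = lam j \<longleftrightarrow> j \<in> J" for j
  proof (cases "j \<in> active v")
    case True
    then show ?thesis using u[OF True] t(1) by (simp add: inner_add_left mem_active)
  next
    case False
    then show ?thesis using t(3)[OF False] J by auto
  qed
  have "active (v + t *\<^sub>R u) = J" by (rule Set.set_eqI) (simp only: mem_active act)
  then show ?thesis using that t(2) by blast
qed

lemma face_with_index:
  assumes v: "v extreme_point_of \<Delta>" and J: "J \<subseteq> active v"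
  obtains F where "F face_of \<Delta>" "F \<noteq> {}" "face_index X lam F = J"
proof -
  obtain \<nu> where \<nu>: "\<nu> \<in> \<Delta>" "active \<nu> = J" using point_with_index[OF v J] .
  define F where "F = {\<mu> \<in> \<Delta>. \<forall>j\<in>J. \<mu> \<bullet> X j = lam j}"
  have "\<nu> \<in> F" using \<nu> by (auto simp: F_def mem_active)
  moreover have "face_index X lam F = J"
    using \<open>\<nu> \<in> F\<close> \<nu>(2) by (auto simp: face_index_def F_def)
  ultimately show ?thesis using that[of F] active_face[of J] unfolding F_def by blast
qed

end

definition torus_vec :: "complex^'d \<Rightarrow> complex^'d" where
  "torus_vec Z = (\<chi> j. 2 * complex_of_real pi * \<i> * Z $ j)"

lemma torus_act_eq: "torus_act Z z = exp_act (torus_vec Z) z"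
  by (simp add: torus_act_def exp_act_def torus_vec_def)

lemma torus_vec_surj: "torus_vec (\<chi> j. \<zeta> $ j / (2 * complex_of_real pi * \<i>)) = \<zeta>"
  by (simp add: torus_vec_def vec_eq_iff)

lemma torus_class_eq_iff: "torus_class Z = torus_class Z' \<longleftrightarrow> (\<forall>j. Z $ j - Z' $ j \<in> \<int>)"
proof
  assume "torus_class Z = torus_class Z'"
  moreover have "Z \<in> torus_class Z" by (simp add: torus_class_def)
  ultimately show "\<forall>j. Z $ j - Z' $ j \<in> \<int>" by (simp add: torus_class_def)
next
  assume Z: "\<forall>j. Z $ j - Z' $ j \<in> \<int>"
  have "Y $ j - Z $ j \<in> \<int> \<longleftrightarrow> Y $ j - Z' $ j \<in> \<int>" for Y j
    using Ints_add[of "Y $ j - Z $ j" "Z $ j - Z' $ j"] Ints_diff[of "Y $ j - Z' $ j" "Z $ j - Z' $ j"] Z by auto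
  then show "torus_class Z = torus_class Z'" by (simp add: torus_class_def)
qed

locale toric = polytope_data \<Delta> X lam
  for \<Delta> :: "'a::euclidean_space set" and X :: "'d::finite \<Rightarrow> 'a" and lam +
  fixes Q :: "'a set" and R :: "('n::finite \<Rightarrow> 'd) set"
  assumes card_n: "CARD('n) = DIM('a)" and lattice: "quasilattice Q" and XQ: "range X \<subseteq> Q"
    and R: "R = vertex_enums \<Delta> X lam"
begin

lemma frame_vertex:
  assumes "r \<in> R"
  obtains v where "v extreme_point_of \<Delta>" "range r = active v" "inj r"
  using assms by (auto simp: R vertex_enums_def bij_betw_def)

lemma vertex_frame:
  assumes v: "v extreme_point_of \<Delta>"
  obtains r where "r \<in> R" "range r = active v"
proof -
  have "card (UNIV :: 'n set) = card (active v)" using vertex_normals(3)[OF v] card_n by simp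
  then obtain r where "bij_betw r (UNIV :: 'n set) (active v)"
    using finite_same_card_bij[of "UNIV :: 'n set" "active v"] by auto
  then show ?thesis using that[of r] v by (auto simp: R vertex_enums_def bij_betw_def)
qed

sublocale normal_frames X Q R
proof
  obtain B where B: "Q = group_closure B" using lattice by (auto simp: quasilattice_def)
  show "0 \<in> Q" by (simp add: B)
  show "x - y \<in> Q" if "x \<in> Q" "y \<in> Q" for x y using that by (simp add: B group_closure.diff)
  show "X j \<in> Q" for j using XQ by auto
  fix r assume r: "r \<in> R"
  obtain v where v: "v extreme_point_of \<Delta>" "range r = active v" "inj r" using frame_vertex[OF r] .
  show "inj r" by fact
  note n = vertex_normals[OF v(1), folded v(2)] and sp = vertex_normals_span[OF v(1), folded v(2)]
  have injXr: "inj (\<lambda>k. X (r k))" using n(1) v(3) by (auto simp: inj_on_def)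
  have im: "(\<lambda>k. X (r k)) ` UNIV = X ` range r" by auto
  have reix: "(\<Sum>x\<in>X ` range r. g x) = (\<Sum>k\<in>UNIV. g (X (r k)))" for g :: "'a \<Rightarrow> 'a"
    unfolding im[symmetric] by (subst sum.reindex[OF injXr]) simp
  show "X h = (\<Sum>k\<in>UNIV. coef X r h k *\<^sub>R X (r k))" for h
  proof -
    have "(\<Sum>b\<in>X ` range r. representation (X ` range r) (X h) b *\<^sub>R b) = X h"
      by (rule real_vector.sum_representation_eq[OF n(2)]) (use sp in auto)
    then show ?thesis unfolding reix coef_def by simp
  qed
  show "t k = 0" if t: "(\<Sum>k\<in>UNIV. t k *\<^sub>R X (r k)) = 0" for t k
  proof -
    let ?u = "\<lambda>x. t (inv_into UNIV (\<lambda>k. X (r k)) x)"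
    have iv: "inv_into UNIV (\<lambda>k. X (r k)) (X (r k)) = k" for k
      using inv_into_f_f[OF injXr, of k] by simp
    have "(\<Sum>x\<in>X ` range r. ?u x *\<^sub>R x) = 0" unfolding reix iv by (rule t)
    with n(2)[unfolded independent_explicit, THEN conjunct2, THEN spec, of ?u]
    have "\<forall>v\<in>X ` range r. ?u v = 0" by (rule mp)
    then have "?u (X (r k)) = 0" by blast
    then show ?thesis unfolding iv .
  qed
qed

lemma exists_vertex: obtains v where "v extreme_point_of \<Delta>"
proof -
  have "\<Delta> \<noteq> {}" using full_dim by auto
  then show ?thesis using extreme_point_exists_convex[OF compact_Delta convex_Delta] that by blast
qed

section \<open>Slacks of points of the dual space and the zero level\<close>

definition slk :: "('n \<Rightarrow> 'd) \<Rightarrow> real^'n \<Rightarrow> 'd \<Rightarrow> real" where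
  "slk r s h = (\<Sum>k\<in>UNIV. coef X r h k * (s $ k + lam (r k))) - lam h"

lemma slk_point:
  assumes r: "r \<in> R" and \<nu>: "\<And>k. \<nu> \<bullet> X (r k) - lam (r k) = s $ k"
  shows "slk r s h = \<nu> \<bullet> X h - lam h"
proof -
  have "\<nu> \<bullet> X h = \<nu> \<bullet> (\<Sum>k\<in>UNIV. coef X r h k *\<^sub>R X (r k))"
    by (rule arg_cong[OF coef_sum[OF r]])
  also have "\<dots> = (\<Sum>k\<in>UNIV. coef X r h k * (s $ k + lam (r k)))"
    unfolding inner_sum_right by (rule sum.cong) (use \<nu> in \<open>auto simp: algebra_simps\<close>)
  finally show ?thesis by (simp add: slk_def)
qed

text \<open>The dual basis of a vertex allows the slacks at its facets to be prescribed arbitrarily,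
  and they determine all others. Applied to the squared moduli of the frame coordinates of a point
  of the zero level, this gives its moment map image.\<close>

lemma dual_point:
  assumes r: "r \<in> R"
  obtains \<nu> where "\<And>k. \<nu> \<bullet> X (r k) - lam (r k) = s $ k" "\<And>h. slk r s h = \<nu> \<bullet> X h - lam h"
proof -
  obtain v where v: "v extreme_point_of \<Delta>" "range r = active v" "inj r" using frame_vertex[OF r] .
  obtain y where y: "\<And>i j. i \<in> active v \<Longrightarrow> j \<in> active v \<Longrightarrow> y i \<bullet> X j = (if i = j then 1 else 0)"
    using vertex_dual_basis[OF v(1)] by blast
  define \<nu> where "\<nu> = (\<Sum>k\<in>UNIV. (s $ k + lam (r k)) *\<^sub>R y (r k))"
  have "\<nu> \<bullet> X (r k) - lam (r k) = s $ k" for k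
  proof -
    have "y (r i) \<bullet> X (r k) = (if i = k then 1 else 0)" for i
    proof -
      have "r i \<in> active v" "r k \<in> active v" using v(2) by auto
      from y[OF this] show ?thesis using v(3) by (auto simp: inj_eq)
    qed
    then have "\<nu> \<bullet> X (r k) = (\<Sum>i\<in>UNIV. if i = k then s $ i + lam (r i) else 0)"
      unfolding \<nu>_def inner_sum_left by (intro sum.cong) auto
    then show ?thesis by simp
  qed
  then show ?thesis using that[of \<nu>] slk_point[OF r] by blast
qed

lemma slk_range: "r \<in> R \<Longrightarrow> slk r s (r k) = s $ k"
  using dual_point[of r s] by metis

text \<open>A functional that vanishes on the kernel of \<open>pi_map\<close> factors through
  \<open>pi_map\<close>, and \<open>\<nu>\<close> is the factor. Such a \<open>\<nu>\<close> lies in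
  the polytope because squared moduli are nonnegative.\<close>

lemma mem_Psi_zero: "z \<in> Psi_zero X lam \<longleftrightarrow> (\<exists>\<nu>. \<forall>j. \<nu> \<bullet> X j - lam j = (cmod (z $ j))\<^sup>2)"
proof -
  have P: "z \<in> Psi_zero X lam \<longleftrightarrow> (\<forall>x. pi_map X x = 0 \<longrightarrow> J_map lam z x = 0)"
    by (auto simp: Psi_zero_def Psi_map_def n_space_def fun_eq_iff restrict_def)
  show ?thesis
  proof
    assume z: "z \<in> Psi_zero X lam"
    obtain v where v: "v extreme_point_of \<Delta>" using exists_vertex .
    obtain r where r: "r \<in> R" "range r = active v" using vertex_frame[OF v] .
    note r = r(1)
    obtain \<nu> where \<nu>: "\<And>k. \<nu> \<bullet> X (r k) - lam (r k) = (modsq (select_coords r z)) $ k"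
      "\<And>h. slk r (modsq (select_coords r z)) h = \<nu> \<bullet> X h - lam h" using dual_point[OF r, of "modsq (select_coords r z)"] by metis
    have "\<nu> \<bullet> X h - lam h = (cmod (z $ h))\<^sup>2" for h
    proof (cases "h \<in> range r")
      case True
      then show ?thesis using \<nu>(1) by (auto simp: modsq_def select_coords_def)
    next
      case False
      \<comment> \<open>Test vector: the element of the kernel whose only nonzero coordinate outside
        the frame is 1 at \<open>h\<close>. Pairing with it isolates the slack at
        \<open>h\<close>.\<close>
      define x where "x = (\<chi> j. Re (null_extend X r (\<lambda>j. if j = h then 1 else 0) $ j))"
      have "pi_map X x = 0" using null_extend_Re[OF r] by (simp add: pi_map_def x_def)
      then have "J_map lam z x = 0" using z P by blast
      moreover have "x $ r k = - coef X r h k" for k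
        using False by (simp add: x_def null_extend_range[OF r] if_distrib cong: if_cong)
      moreover have "x $ j = (if j = h then 1 else 0)" if "j \<notin> range r" for j
        using that by (simp add: x_def null_extend_outside)
      moreover have "J_map lam z x = (\<Sum>k\<in>UNIV. ((cmod (z $ r k))\<^sup>2 + lam (r k)) * x $ r k) +
          (\<Sum>j\<in>- range r. ((cmod (z $ j))\<^sup>2 + lam j) * x $ j)"
        unfolding J_map_def by (rule sum_split_range[OF inj_frame[OF r]])
      moreover have "(\<Sum>j\<in>- range r. ((cmod (z $ j))\<^sup>2 + lam j) * (if j = h then 1 else 0)) = (cmod (z $ h))\<^sup>2 + lam h"
        using False by (simp add: if_distrib cong: if_cong)
      ultimately have "(cmod (z $ h))\<^sup>2 + lam h - (\<Sum>k\<in>UNIV. ((cmod (z $ r k))\<^sup>2 + lam (r k)) * coef X r h k) = 0"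
        by (simp add: sum_negf)
      then have "slk r (modsq (select_coords r z)) h = (cmod (z $ h))\<^sup>2"
        by (simp add: slk_def modsq_def select_coords_def mult.commute)
      then show ?thesis using \<nu>(2) by simp
    qed
    then show "\<exists>\<nu>. \<forall>j. \<nu> \<bullet> X j - lam j = (cmod (z $ j))\<^sup>2" by blast
  next
    assume "\<exists>\<nu>. \<forall>j. \<nu> \<bullet> X j - lam j = (cmod (z $ j))\<^sup>2"
    then obtain \<nu> where \<nu>: "\<And>j. (cmod (z $ j))\<^sup>2 + lam j = \<nu> \<bullet> X j" by (metis diff_add_cancel)
    have "J_map lam z x = \<nu> \<bullet> pi_map X x" for x
      unfolding J_map_def pi_map_def \<nu> by (simp add: inner_sum_right mult.commute)
    then show "z \<in> Psi_zero X lam" using P by simp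
  qed
qed

definition A_sym :: "('n \<Rightarrow> 'd) \<Rightarrow> (real^'n) set" where
  "A_sym r = {s. \<forall>h. h \<notin> range r \<longrightarrow> slk r s h > 0}"

definition c_sym :: "('n \<Rightarrow> 'd) \<Rightarrow> complex^'n \<Rightarrow> real^'d" where
  "c_sym r w = (\<chi> h. if h \<in> range r then 1 else sqrt (slk r (modsq w) h))"

lemma open_A_sym: "open (A_sym r)"
proof -
  have "A_sym r = (\<Inter>h\<in>- range r. {s. slk r s h > 0})" by (auto simp: A_sym_def)
  also have "open \<dots>" unfolding slk_def
    by (intro open_INT ballI finite open_Collect_less continuous_intros)
  finally show ?thesis .
qed

lemma convex_A_sym: "convex (A_sym r)"
  unfolding convex_alt
proof (intro ballI allI impI)
  fix s s' and t :: real assume s: "s \<in> A_sym r" "s' \<in> A_sym r" and t: "0 \<le> t \<and> t \<le> 1"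
  have "slk r ((1 - t) *\<^sub>R s + t *\<^sub>R s') h = (1 - t) * slk r s h + t * slk r s' h" for h
    by (simp add: slk_def algebra_simps sum.distrib sum_subtractf sum_distrib_left)
  moreover have "(1 - t) * slk r s h + t * slk r s' h > 0" if "h \<notin> range r" for h
  proof -
    have p: "slk r s h > 0" "slk r s' h > 0" using s that by (auto simp: A_sym_def)
    show ?thesis
    proof (cases "t = 0")
      case False
      then have "t * slk r s' h > 0" "(1 - t) * slk r s h \<ge> 0" using p t by auto
      then show ?thesis by linarith
    qed (use p in simp)
  qed
  ultimately show "(1 - t) *\<^sub>R s + t *\<^sub>R s' \<in> A_sym r" by (simp add: A_sym_def)
qed

lemma vertex_slack:
  assumes "v extreme_point_of \<Delta>"
  shows "v \<bullet> X j \<ge> lam j" "j \<notin> active v \<Longrightarrow> v \<bullet> X j > lam j"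
  using assms by (auto simp: extreme_point_of_def mem_Delta mem_active less_le)

text \<open>The midpoint of the two vertices has zero slack exactly at their common facets;
  \<open>s\<close> lists its slacks at the facets of the frame \<open>r\<close>.\<close>

lemma A_sym_mid:
  assumes r: "r \<in> R" and r': "r' \<in> R"
  shows "\<exists>s\<in>A_sym r. \<forall>k. if r k \<notin> range r' then s $ k > 0 else s $ k = 0"
proof -
  obtain v where v: "v extreme_point_of \<Delta>" "range r = active v" "inj r" using frame_vertex[OF r] .
  obtain v' where v': "v' extreme_point_of \<Delta>" "range r' = active v'" "inj r'" using frame_vertex[OF r'] .
  define m where "m = (1/2) *\<^sub>R (v + v')"
  have m: "m \<bullet> X j - lam j = ((v \<bullet> X j - lam j) + (v' \<bullet> X j - lam j)) / 2" for j
    by (simp add: m_def inner_add_left field_simps)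
  define s where "s = (\<chi> k. m \<bullet> X (r k) - lam (r k))"
  have sl: "slk r s h = m \<bullet> X h - lam h" for h by (rule slk_point[OF r]) (simp add: s_def)
  have "s \<in> A_sym r"
  proof -
    have "slk r s h > 0" if "h \<notin> range r" for h
      using sl[of h] m[of h] vertex_slack(2)[OF v(1), of h] vertex_slack(1)[OF v'(1), of h] v(2) that by auto
    then show ?thesis by (simp add: A_sym_def)
  qed
  moreover have "if r k \<notin> range r' then s $ k > 0 else s $ k = 0" for k
  proof -
    have "v \<bullet> X (r k) = lam (r k)" using v(2) mem_active[of "r k" v] by auto
    then have "s $ k = (v' \<bullet> X (r k) - lam (r k)) / 2" using m by (simp add: s_def)
    then show ?thesis using vertex_slack(2)[OF v'(1), of "r k"] v'(2) mem_active[of "r k" v'] by auto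
  qed
  ultimately show ?thesis by blast
qed

lemma A_sym_zero:
  assumes r: "r \<in> R" shows "0 \<in> A_sym r"
proof -
  obtain s where s: "s \<in> A_sym r" "\<And>k. if r k \<notin> range r then s $ k > 0 else s $ k = 0"
    using A_sym_mid[OF r r] by blast
  then have "s = 0" by (simp add: vec_eq_iff)
  then show ?thesis using s by simp
qed

lemma smooth_on_slk: "open S \<Longrightarrow> smooth_on S (\<lambda>w. slk r (modsq w) h)"
proof -
  assume S: "open S"
  have 1: "smooth_on S (\<lambda>w::complex^'n. Re (w $ k))" "smooth_on S (\<lambda>w::complex^'n. Im (w $ k))" for k
    by (intro smooth_on_linear_comp[OF S bounded_linear_Re] smooth_on_linear_comp[OF S bounded_linear_Im]
        smooth_on_bounded_linear S bounded_linear_vec_nth)+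
  have "smooth_on S (\<lambda>w::complex^'n. modsq w $ k)" for k
    unfolding modsq_def vec_lambda_beta cmod_power2 unfolding power2_eq_square
    by (intro smooth_on_add smooth_on_mult S 1)
  then have "smooth_on S (\<lambda>w. (\<Sum>k\<in>UNIV. coef X r h k * (modsq w $ k + lam (r k))) + (- lam h))"
    by (intro smooth_on_add smooth_on_sum smooth_on_linear_comp[OF S bounded_linear_mult_right] smooth_on_const S)
  then show ?thesis by (simp add: slk_def)
qed

text \<open>The vanishing coordinates are the constraints active at a point of the polytope, and a
  vertex of the face that they cut out has them all active.\<close>

lemma Psi_zero_cover:
  assumes z: "z \<in> Psi_zero X lam"
  shows "\<exists>r\<in>R. \<forall>h. h \<notin> range r \<longrightarrow> z $ h \<noteq> 0"
proof -
  obtain \<nu> where \<nu>: "\<And>j. \<nu> \<bullet> X j - lam j = (cmod (z $ j))\<^sup>2" using z mem_Psi_zero by blast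
  have D: "\<nu> \<in> \<Delta>" unfolding mem_Delta
  proof
    fix j show "lam j \<le> \<nu> \<bullet> X j" using \<nu>[of j] zero_le_power2[of "cmod (z $ j)"] by linarith
  qed
  let ?F = "{\<mu> \<in> \<Delta>. \<forall>j\<in>active \<nu>. \<mu> \<bullet> X j = lam j}"
  have "\<nu> \<in> ?F" using D by (auto simp: mem_active)
  then obtain v where v: "v \<in> ?F" "v extreme_point_of \<Delta>"
    using face_contains_vertex[OF active_face, of "active \<nu>"] by blast
  obtain r where r: "r \<in> R" "range r = active v" using vertex_frame[OF v(2)] .
  have "h \<in> range r" if "z $ h = 0" for h
    using that \<nu>[of h] v(1) r(2) by (auto simp: mem_active)
  then show ?thesis using r(1) by blast
qed

lemma C_Delta_cover:
  assumes z: "z \<in> C_Delta \<Delta> X lam"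
  shows "\<exists>r\<in>R. \<forall>h. h \<notin> range r \<longrightarrow> z $ h \<noteq> 0"
proof -
  obtain F where F: "F face_of \<Delta>" "F \<noteq> {}" "z \<in> stratum (face_index X lam F)"
    using z by (auto simp: C_Delta_def)
  obtain v where v: "v \<in> F" "v extreme_point_of \<Delta>" using face_contains_vertex[OF F(1,2)] .
  obtain r where r: "r \<in> R" "range r = active v" using vertex_frame[OF v(2)] .
  have "h \<in> range r" if "z $ h = 0" for h
    using that F(3) v(1) unfolding r(2) by (auto simp: stratum_def face_index_def)
  then show ?thesis using r(1) by blast
qed

text \<open>For a simple polytope every subset of the active set of a vertex is the index set of
  some face, so any zero set inside a frame occurs.\<close>

lemma C_Delta_frame:
  assumes r: "r \<in> R" and nz: "\<And>h. h \<notin> range r \<Longrightarrow> z $ h \<noteq> 0"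
  shows "z \<in> C_Delta \<Delta> X lam"
proof -
  obtain v where v: "v extreme_point_of \<Delta>" "range r = active v" "inj r" using frame_vertex[OF r] .
  have "{h. z $ h = 0} \<subseteq> active v" using nz v(2) by blast
  then obtain F where "F face_of \<Delta>" "F \<noteq> {}" "face_index X lam F = {h. z $ h = 0}"
    using face_with_index[OF v(1)] by blast
  then show ?thesis by (auto simp: C_Delta_def stratum_def)
qed

lemma mem_C_Delta: "z \<in> C_Delta \<Delta> X lam \<longleftrightarrow> (\<exists>r\<in>R. \<forall>h. h \<notin> range r \<longrightarrow> z $ h \<noteq> 0)"
  using C_Delta_cover C_Delta_frame by blast

sublocale sym: quasi_slice X Q R 0 "Psi_zero X lam" A_sym c_sym smooth_on
proof
  show "exp_act \<zeta> z \<in> Psi_zero X lam" if z: "z \<in> Psi_zero X lam" and \<zeta>: "\<zeta> \<in> exp_group X Q 0" for z \<zeta>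
  proof -
    have "Re (\<zeta> $ j) = 0" for j using \<zeta> by (auto simp: exp_group_def im_proj_def complex_eq_iff)
    then have "cmod (exp_act \<zeta> z $ j) = cmod (z $ j)" for j
      by (simp add: exp_act_def norm_mult norm_exp_eq_Re)
    then show ?thesis using z by (simp add: mem_Psi_zero)
  qed
  show "slice_point r (c_sym r w) w \<in> Psi_zero X lam" if r: "r \<in> R" and w: "w \<in> reinhardt (A_sym r)" for r w
  proof -
    obtain \<nu> where \<nu>: "\<And>h. slk r (modsq w) h = \<nu> \<bullet> X h - lam h" using dual_point[OF r, of "modsq w"] by metis
    have "\<nu> \<bullet> X j - lam j = (cmod (slice_point r (c_sym r w) w $ j))\<^sup>2" for j
    proof (cases "j \<in> range r")
      case True
      then obtain k where k: "j = r k" by blast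
      then show ?thesis using \<nu>[of j] slk_range[OF r, of "modsq w" k] inj_frame[OF r] by (simp add: modsq_def)
    next
      case False
      then have "slk r (modsq w) j > 0" using w by (simp add: reinhardt_def A_sym_def)
      then show ?thesis using False \<nu>[of j] by (simp add: c_sym_def)
    qed
    then show ?thesis unfolding mem_Psi_zero by blast
  qed
  show "c_sym r w $ h > 0" if "r \<in> R" "w \<in> reinhardt (A_sym r)" "h \<notin> range r" for r w h
    using that by (simp add: c_sym_def reinhardt_def A_sym_def)
  show "select_coords r z \<in> reinhardt (A_sym r) \<and> slice_point r (c_sym r (select_coords r z)) (select_coords r z) = z"
    if r: "r \<in> R" and z: "z \<in> Psi_zero X lam"
      and t: "\<And>h. h \<notin> range r \<Longrightarrow> \<exists>t>0. z $ h = complex_of_real t \<and> ((0::real) = 1 \<longrightarrow> t = 1)" for r z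
  proof -
    obtain \<nu> where \<nu>: "\<And>j. \<nu> \<bullet> X j - lam j = (cmod (z $ j))\<^sup>2" using z mem_Psi_zero by blast
    have sl: "slk r (modsq (select_coords r z)) h = (cmod (z $ h))\<^sup>2" for h
      using slk_point[OF r, of \<nu> "modsq (select_coords r z)" h] \<nu> by (simp add: modsq_def select_coords_def)
    have c: "slk r (modsq (select_coords r z)) h > 0 \<and> complex_of_real (sqrt (slk r (modsq (select_coords r z)) h)) = z $ h"
      if "h \<notin> range r" for h
      using t[OF that] sl[of h] by auto
    have "slice_point r (c_sym r (select_coords r z)) (select_coords r z) $ j = z $ j" for j
    proof (cases "j \<in> range r")
      case True
      then show ?thesis using inj_frame[OF r] by (auto simp: select_coords_def)
    next
      case False
      then show ?thesis using c by (simp add: c_sym_def)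
    qed
    then show ?thesis using c by (auto simp: vec_eq_iff reinhardt_def A_sym_def)
  qed
  show "smooth_on (reinhardt (A_sym r)) (\<lambda>w. c_sym r w $ h)" if r: "r \<in> R" for r h
  proof (cases "h \<in> range r")
    case True
    then show ?thesis by (simp add: c_sym_def smooth_on_const open_reinhardt open_A_sym)
  next
    case False
    then show ?thesis unfolding c_sym_def vec_lambda_beta if_not_P[OF False]
      by (intro smooth_on_sqrt smooth_on_slk open_reinhardt open_A_sym) (auto simp: reinhardt_def A_sym_def)
  qed
qed (use open_A_sym convex_A_sym A_sym_zero A_sym_mid Psi_zero_cover in auto)

sublocale cpx: quasi_slice X Q R 1 "C_Delta \<Delta> X lam" "\<lambda>_. UNIV" "\<lambda>_ _. 1" holomorphic_map_on
proof
  show "exp_act \<zeta> z \<in> C_Delta \<Delta> X lam" if "z \<in> C_Delta \<Delta> X lam" for z \<zeta>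
    using that by (simp add: mem_C_Delta exp_act_def)
  show "slice_point r 1 w \<in> C_Delta \<Delta> X lam" if "r \<in> R" for r w
    using that by (auto simp: mem_C_Delta intro!: bexI[of _ r])
  show "select_coords r z \<in> reinhardt UNIV \<and> slice_point r 1 (select_coords r z) = z"
    if r: "r \<in> R" and t: "\<And>h. h \<notin> range r \<Longrightarrow> \<exists>t>0. z $ h = complex_of_real t \<and> ((1::real) = 1 \<longrightarrow> t = 1)" for r z
  proof -
    have "slice_point r 1 (select_coords r z) $ j = z $ j" for j
      using inj_frame[OF r] t[of j] by (cases "j \<in> range r") (auto simp: select_coords_def)
    then show ?thesis by (simp add: vec_eq_iff reinhardt_def)
  qed
  show "\<exists>s\<in>(UNIV :: (real^'n) set). \<forall>k. if r k \<notin> range r' then s $ k > 0 else s $ k = 0" for r r' :: "'n \<Rightarrow> 'd"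
    by (intro bexI[of _ "\<chi> k. if r k \<notin> range r' then 1 else 0"]) auto
  show "smooth_on (reinhardt UNIV) (\<lambda>w. (1::real^'d) $ h)" for h
    by (simp add: smooth_on_const open_reinhardt)
qed (use C_Delta_cover in auto)

section \<open>The given groups, orbits and charts in terms of exponents\<close>

lemma reinhardt_UNIV [simp]: "reinhardt UNIV = UNIV" by (simp add: reinhardt_def)

lemma piC_QC: "piC_map X Z \<in> QC Q \<longleftrightarrow> torus_vec Z \<in> exp_group X Q 1"
proof -
  have "(\<Sum>j\<in>UNIV. Re (torus_vec Z $ j) *\<^sub>R X j) = (- 2 * pi) *\<^sub>R pi_map X (\<chi> j. Im (Z $ j))"
    by (simp add: torus_vec_def pi_map_def scaleR_sum_right sum_negf)
  then show ?thesis
    by (auto simp: piC_map_def QC_def exp_group_def pi_map_def torus_vec_def)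
qed

text \<open>Integral vectors belong to the group since the normals lie in \<open>Q\<close>; hence
  membership depends only on the torus class, and exponents may replace classes.\<close>

lemma exp_group_int:
  assumes "\<zeta> \<in> exp_group X Q \<kappa>" "\<And>j. Z $ j \<in> \<int>"
  shows "\<zeta> + torus_vec Z \<in> exp_group X Q \<kappa>"
proof -
  have "\<exists>m::int. Z $ j = of_int m" for j using assms(2)[of j] by (auto elim: Ints_cases)
  then obtain m where m: "\<And>j. Z $ j = of_int (m j)" by metis
  have "torus_vec Z \<in> exp_group X Q \<kappa>"
    using Q_sum[of UNIV "\<lambda>j. of_int (m j) *\<^sub>R X j"] Q_of_int[OF X_in_Q]
    by (auto simp: exp_group_def torus_vec_def m im_proj_def complex_eq_iff)
  then show ?thesis by (rule exp_group_add[OF assms(1)])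
qed

lemma torus_vec_add: "torus_vec (Z + Z') = torus_vec Z + torus_vec Z'"
  by (simp add: torus_vec_def vec_eq_iff algebra_simps)

lemma NC_iff: "torus_class Z \<in> NC_group X Q \<longleftrightarrow> torus_vec Z \<in> exp_group X Q 1"
proof
  assume "torus_class Z \<in> NC_group X Q"
  then obtain Z' where Z': "torus_class Z = torus_class Z'" "torus_vec Z' \<in> exp_group X Q 1"
    by (auto simp: NC_group_def piC_QC)
  have "torus_vec Z = torus_vec Z' + torus_vec (Z - Z')" by (simp flip: torus_vec_add)
  then show "torus_vec Z \<in> exp_group X Q 1"
    using exp_group_int[OF Z'(2), of "Z - Z'"] Z'(1) by (simp add: torus_class_eq_iff)
qed (auto simp: NC_group_def piC_QC)

lemma N_iff: "torus_class Z \<in> N_group X Q \<longleftrightarrow> torus_vec Z \<in> exp_group X Q 0"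
proof -
  have cv: "torus_vec (complex_vec x) \<in> exp_group X Q 0 \<longleftrightarrow> pi_map X x \<in> Q" for x
    by (auto simp: exp_group_def torus_vec_def complex_vec_def pi_map_def im_proj_def complex_eq_iff)
  show ?thesis
  proof
    assume "torus_class Z \<in> N_group X Q"
    then obtain x where x: "torus_class Z = torus_class (complex_vec x)" "pi_map X x \<in> Q"
      by (auto simp: N_group_def)
    have "torus_vec Z = torus_vec (complex_vec x) + torus_vec (Z - complex_vec x)" by (simp flip: torus_vec_add)
    then show "torus_vec Z \<in> exp_group X Q 0"
      using exp_group_int[of "torus_vec (complex_vec x)" 0 "Z - complex_vec x"] x cv by (simp add: torus_class_eq_iff)
  next
    assume Z: "torus_vec Z \<in> exp_group X Q 0"
    then have "Im (Z $ j) = 0" for j by (auto simp: exp_group_def torus_vec_def im_proj_def complex_eq_iff)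
    then have eq: "complex_vec (\<chi> j. Re (Z $ j)) = Z" by (simp add: complex_vec_def vec_eq_iff complex_eq_iff)
    then have "pi_map X (\<chi> j. Re (Z $ j)) \<in> Q" using cv[of "\<chi> j. Re (Z $ j)"] Z by simp
    then have "torus_class (complex_vec (\<chi> j. Re (Z $ j))) \<in> N_group X Q" unfolding N_group_def by blast
    then show "torus_class Z \<in> N_group X Q" unfolding eq .
  qed
qed

lemma torus_orbit_eq:
  assumes "\<And>Z. torus_class Z \<in> G \<longleftrightarrow> torus_vec Z \<in> exp_group X Q \<kappa>"
  shows "torus_orbit G = exp_orbit X Q \<kappa>"
proof
  fix z
  have "torus_orbit G z = {exp_act (torus_vec Z) z | Z. torus_vec Z \<in> exp_group X Q \<kappa>}"
    by (simp add: torus_orbit_def assms torus_act_eq)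
  also have "\<dots> = exp_orbit X Q \<kappa> z"
    unfolding exp_orbit_def by (auto simp: image_iff) (metis torus_vec_surj)
  finally show "torus_orbit G z = exp_orbit X Q \<kappa> z" .
qed

lemmas torus_orbit_NC = torus_orbit_eq[OF NC_iff]
lemmas torus_orbit_N = torus_orbit_eq[OF N_iff]

lemma SC_iff: "torus_class Z \<in> SC_group I \<longleftrightarrow> (\<forall>j. j \<notin> I \<longrightarrow> Z $ j \<in> \<int>)"
proof
  assume "torus_class Z \<in> SC_group I"
  then obtain Z' where Z': "torus_class Z = torus_class Z'" "\<forall>j. j \<notin> I \<longrightarrow> Z' $ j \<in> \<int>" by (auto simp: SC_group_def)
  then have "Z $ j - Z' $ j \<in> \<int>" for j by (simp add: torus_class_eq_iff)
  then show "\<forall>j. j \<notin> I \<longrightarrow> Z $ j \<in> \<int>" using Z'(2) Ints_add by (metis diff_add_cancel)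
qed (auto simp: SC_group_def)

text \<open>An element with integral coordinates outside the frame has real ones inside it, since
  its imaginary part is a relation among the independent frame normals. So the group of a vertex,
  although defined through the complexified torus, acts by phases.\<close>

lemma Gamma_group_eq:
  assumes r: "r \<in> R"
  shows "Gamma_group X Q r V = (\<lambda>\<alpha>. restrict (phase \<alpha>) V) ` admissible r"
proof -
  have act: "select_coords r (torus_act Z (embed_coords r w)) = (\<chi> k. exp (2 * complex_of_real pi * \<i> * Z $ r k) * w $ k)" for Z w
    using inj_frame[OF r] by (simp add: select_coords_def torus_act_def embed_coords_def vec_eq_iff)
  show ?thesis
  proof (intro equalityI subsetI)
    fix g assume "g \<in> Gamma_group X Q r V"
    then obtain Z where g: "g = restrict (\<lambda>w. select_coords r (torus_act Z (embed_coords r w))) V"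
      and Z: "torus_vec Z \<in> exp_group X Q 1" "\<And>j. j \<notin> range r \<Longrightarrow> Z $ j \<in> \<int>"
      by (auto simp: Gamma_group_def NC_iff SC_iff)
    have "\<exists>m::int. Z $ j = of_int m" if "j \<notin> range r" for j using Z(2)[OF that] by (auto elim: Ints_cases)
    then obtain m where m: "\<And>j. j \<notin> range r \<Longrightarrow> Z $ j = of_int (m j)" by metis
    have "(\<Sum>j\<in>UNIV. Re (torus_vec Z $ j) *\<^sub>R X j) = 0" using Z(1) by (simp add: exp_group_def)
    then have "(\<Sum>k\<in>UNIV. (- 2 * pi * Im (Z $ r k)) *\<^sub>R X (r k)) = 0"
      by (simp add: sum_split_range[OF inj_frame[OF r]] torus_vec_def m)
    then have Im0: "Im (Z $ r k) = 0" for k using indep_frame[OF r] by fastforce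
    define \<alpha> where "\<alpha> = (\<chi> k. 2 * pi * Re (Z $ r k))"
    have "(\<Sum>k\<in>UNIV. (\<alpha> $ k / (2 * pi)) *\<^sub>R X (r k)) =
        (\<Sum>j\<in>UNIV. (Im (torus_vec Z $ j) / (2 * pi)) *\<^sub>R X j) - (\<Sum>h\<in>- range r. of_int (m h) *\<^sub>R X h)"
      by (simp add: sum_split_range[OF inj_frame[OF r]] \<alpha>_def torus_vec_def m)
    then have "\<alpha> \<in> admissible r"
      using Z(1) by (auto simp: admissible_def exp_group_def intro!: Q_diff Q_sum Q_of_int X_in_Q)
    moreover have "2 * complex_of_real pi * \<i> * Z $ r k = \<i> * complex_of_real (\<alpha> $ k)" for k
      using Im0[of k] by (simp add: \<alpha>_def complex_eq_iff)
    then have "g = restrict (phase \<alpha>) V" unfolding g act phase_def by (simp only:)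
    ultimately show "g \<in> (\<lambda>\<alpha>. restrict (phase \<alpha>) V) ` admissible r" by blast
  next
    fix g assume "g \<in> (\<lambda>\<alpha>. restrict (phase \<alpha>) V) ` admissible r"
    then obtain \<alpha> where \<alpha>: "\<alpha> \<in> admissible r" "g = restrict (phase \<alpha>) V" by blast
    define Z where "Z = (\<chi> j. phase_vec r \<alpha> $ j / (2 * complex_of_real pi * \<i>))"
    have tZ: "torus_vec Z = phase_vec r \<alpha>" unfolding Z_def by (rule torus_vec_surj)
    have "torus_class Z \<in> NC_group X Q \<inter> SC_group (range r)"
      using phase_vec_exp_group[OF r \<alpha>(1), of 1] by (auto simp: NC_iff SC_iff tZ) (simp add: Z_def phase_vec_def)
    moreover have "2 * complex_of_real pi * \<i> * Z $ r k = \<i> * complex_of_real (\<alpha> $ k)" for k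
      using inj_frame[OF r] by (simp add: Z_def phase_vec_def)
    then have "g = restrict (\<lambda>w. select_coords r (torus_act Z (embed_coords r w))) V"
      unfolding \<alpha>(2) act phase_def by (simp only:)
    ultimately show "g \<in> Gamma_group X Q r V" unfolding Gamma_group_def by blast
  qed
qed

lemma complex_chart_eq:
  assumes r: "r \<in> R" shows "complex_chart X Q r = cpx.gchart r"
proof -
  have "z_vertex (range r) + embed_coords r w = slice_point r 1 w" for w
    by (auto simp: z_vertex_def embed_coords_def slice_point_def vec_eq_iff)
  then show ?thesis
    unfolding complex_chart_def cpx.gchart_def Gamma_group_eq[OF r] phase_group.phase_maps_def[OF cpx.pg[OF r]] torus_orbit_NC
    by simp
qed

lemma slack_eq:
  assumes r: "r \<in> R"
  shows "slack X lam (range r) (embed_coords r w) h = slk r (modsq w) h"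
  unfolding slack_def slk_def coef_def using inj_frame[OF r]
  by (simp add: sum.reindex embed_coords_def modsq_def)

lemma U_tilde_eq: "r \<in> R \<Longrightarrow> U_tilde X lam r = reinhardt (A_sym r)"
  by (simp add: U_tilde_def reinhardt_def A_sym_def slack_eq)

lemma symplectic_chart_eq:
  assumes r: "r \<in> R" shows "symplectic_chart X lam Q r = sym.gchart r"
proof -
  have "w_vertex X lam (range r) (embed_coords r w) + embed_coords r w = slice_point r (c_sym r w) w" for w
    unfolding w_vertex_def slack_eq[OF r] c_sym_def slice_point_def
    by (simp add: vec_eq_iff embed_coords_def)
  then show ?thesis
    unfolding symplectic_chart_def sym.gchart_def Gamma_group_eq[OF r] phase_group.phase_maps_def[OF sym.pg[OF r]]
      torus_orbit_N U_tilde_eq[OF r]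
    by simp
qed

lemma symplectic_charts_eq: "symplectic_charts \<Delta> X lam Q = sym.gchart ` R"
  unfolding symplectic_charts_def R[symmetric] by (rule image_cong) (auto simp: symplectic_chart_eq)

lemma complex_charts_eq: "complex_charts \<Delta> X lam Q = cpx.gchart ` R"
  unfolding complex_charts_def R[symmetric] by (rule image_cong) (auto simp: complex_chart_eq)

lemma symplectic_quotient_eq: "symplectic_quotient X lam Q = sym.M"
  by (simp add: symplectic_quotient_def torus_orbit_N)

lemma complex_quotient_eq: "complex_quotient \<Delta> X lam Q = cpx.M"
  by (simp add: complex_quotient_def torus_orbit_NC)

end

section \<open>The standard form\<close>

text \<open>In each coordinate the alternating expression is an inner product after the second
  argument is multiplied by \<i>. In this shape \<open>standard_form x (\<i> *s u) u\<close> is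
  visibly positive for nonzero \<open>u\<close>, as the sign convention requires.\<close>

lemma standard_form_inner: "standard_form x u v = (u \<bullet> (\<i> *s v)) / pi"
proof -
  have "Re (1 / (2 * complex_of_real pi * \<i>) * (a * cnj b - b * cnj a)) = (a \<bullet> (\<i> * b)) / pi" for a b
    by (simp add: inner_complex_def Re_divide field_simps power2_eq_square)
  then show ?thesis
    unfolding standard_form_def sum_distrib_left Re_sum by (simp add: inner_vec_def sum_divide_distrib)
qed

lemma inner_i_i: "(\<i> *s u) \<bullet> (\<i> *s v) = u \<bullet> (v :: complex^'n)"
  by (simp add: inner_vec_def inner_complex_def algebra_simps)

lemma i_i [simp]: "\<i> *s (\<i> *s u) = - (u :: complex^'n)"
  by (simp add: vec_eq_iff)

lemma inner_i_swap: "(\<i> *s u) \<bullet> v = - (u \<bullet> (\<i> *s (v :: complex^'n)))"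
  by (simp add: inner_vec_def inner_complex_def sum_negf[symmetric] algebra_simps)

lemma linear_i: "linear (\<lambda>v :: complex^'n. \<i> *s v)"
  by (rule linearI) (auto simp: vec_eq_iff algebra_simps)

lemma i_add: "\<i> *s (u + v) = \<i> *s u + \<i> *s (v :: complex^'n)"
  by (rule linear_add[OF linear_i])

lemma standard_form_alt: "standard_form x u v = - standard_form x v u"
  using inner_i_swap[of v u] by (simp add: standard_form_inner inner_commute)

lemma standard_form_bilinear: "bounded_bilinear (standard_form x)"
proof -
  have "bilinear (standard_form x)"
    unfolding bilinear_def standard_form_inner
    by (auto intro!: linearI simp: i_add inner_add_left inner_add_right add_divide_distrib
        linear_cmul[OF linear_i])
  then show ?thesis by (simp add: bilinear_conv_bounded_bilinear)
qed

lemma standard_form_indep: "standard_form x = standard_form y"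
  by (simp add: fun_eq_iff standard_form_inner)

lemma standard_form_sum:
  "standard_form x u v = (\<Sum>k\<in>UNIV. Im (u $ k * cnj (v $ k))) / pi"
  by (simp add: standard_form_inner inner_vec_def inner_complex_def algebra_simps)

lemma standard_form_phase: "standard_form x (phase \<alpha> u) (phase \<alpha> v) = standard_form y u v"
proof -
  have "exp (\<i> * complex_of_real a) * cnj (exp (\<i> * complex_of_real a)) = 1" for a
    using complex_norm_square[of "exp (\<i> * complex_of_real a)"] by (simp add: norm_exp_i_times)
  then have "phase \<alpha> u $ k * cnj (phase \<alpha> v $ k) = u $ k * cnj (v $ k)" for k
    by (simp add: phase_def)
  then show ?thesis by (simp only: standard_form_sum)
qed

text \<open>With \<open>p = (1 + T)\<^sup>-\<^sup>1 a\<close> and \<open>q = (1 + T)\<^sup>-\<^sup>1 \<i> a\<close> this says that the pullback of \<open>\<langle>p, \<i> p'\<rangle>\<close> under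
  \<open>(1 + T)\<^sup>-\<^sup>1\<close> is of type (1,1) and positive.\<close>

lemma
  fixes T :: "complex^'n \<Rightarrow> complex^'n"
  assumes sym: "\<And>u v. u \<bullet> T v = v \<bullet> T u" and pos: "\<And>u. u \<bullet> T u \<ge> 0"
    and null: "\<And>u. u \<bullet> T u = 0 \<Longrightarrow> T u = 0" and iT: "\<And>u. T (\<i> *s T u) = 0"
    and q: "q + T q = \<i> *s (p + T p)"
  shows one_one_form: "q' + T q' = \<i> *s (p' + T p') \<Longrightarrow> q \<bullet> (\<i> *s q') = p \<bullet> (\<i> *s p')"
    and positive_form: "p \<noteq> 0 \<Longrightarrow> q \<bullet> (\<i> *s p) > 0"
proof -
  \<comment> \<open>Symmetry moves one \<open>T\<close> across the inner product, where
    \<open>T (\<i> *s T u) = 0\<close> applies: the image of \<open>T\<close> is isotropic.\<close>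
  have TT: "T u \<bullet> (\<i> *s T v) = 0" for u v
    using sym[of "\<i> *s T v" u] iT[of v] by (simp add: inner_commute)
  {
    assume q': "q' + T q' = \<i> *s (p' + T p')"
    define a b where "a = p + T p" and "b = p' + T p'"
    have ia: "\<i> *s a = q + T q" and ib: "\<i> *s b = q' + T q'" using q q' by (auto simp: a_def b_def)
    have e1: "q = \<i> *s a - T q" and e2: "q' = \<i> *s b - T q'" and e3: "p = a - T p" and e4: "p' = b - T p'"
      using ia ib by (auto simp: a_def b_def)
    have "q \<bullet> (\<i> *s q') = (\<i> *s a - T q) \<bullet> (\<i> *s (\<i> *s b - T q'))"
      by (simp only: e1[symmetric] e2[symmetric])
    also have "\<dots> = (\<i> *s a - T q) \<bullet> (- b - \<i> *s T q')" by (simp add: linear_diff[OF linear_i])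
    also have "\<dots> = - ((\<i> *s a) \<bullet> b) - a \<bullet> T q' + T q \<bullet> b"
      using TT[of q q'] inner_i_i[of a "T q'"] by (simp add: inner_diff_left inner_diff_right)
    finally have L: "q \<bullet> (\<i> *s q') = - ((\<i> *s a) \<bullet> b) - a \<bullet> T q' + T q \<bullet> b" .
    have "p \<bullet> (\<i> *s p') = (a - T p) \<bullet> (\<i> *s (b - T p'))" by (simp only: e3[symmetric] e4[symmetric])
    also have "\<dots> = (a - T p) \<bullet> (\<i> *s b - \<i> *s T p')" by (simp add: linear_diff[OF linear_i])
    also have "\<dots> = - ((\<i> *s a) \<bullet> b) + (\<i> *s a) \<bullet> T p' - T p \<bullet> (\<i> *s b)"
      using TT[of p p'] by (simp add: inner_diff_left inner_diff_right inner_i_swap)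
    finally have R: "p \<bullet> (\<i> *s p') = - ((\<i> *s a) \<bullet> b) + (\<i> *s a) \<bullet> T p' - T p \<bullet> (\<i> *s b)" .
    have "a \<bullet> T q' = T p \<bullet> (\<i> *s b)" unfolding ib unfolding a_def
      using sym[of p q'] by (simp add: inner_add_left inner_add_right inner_commute)
    moreover have "T q \<bullet> b = (\<i> *s a) \<bullet> T p'" unfolding ia unfolding b_def
      using sym[of q p'] by (simp add: inner_add_left inner_add_right inner_commute)
    ultimately show "q \<bullet> (\<i> *s q') = p \<bullet> (\<i> *s p')" using L R by simp
  }
  {
    assume "p \<noteq> 0"
    define a where "a = p + T p"
    have ia: "\<i> *s a = q + T q" using q by (simp add: a_def)
    have "q \<bullet> (\<i> *s p) = (\<i> *s a) \<bullet> (\<i> *s p) - T q \<bullet> (\<i> *s p)" by (simp add: ia inner_add_left)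
    also have "\<dots> = a \<bullet> p + (\<i> *s T q) \<bullet> p" by (simp add: inner_i_i inner_i_swap)
    finally have 1: "q \<bullet> (\<i> *s p) = p \<bullet> p + p \<bullet> T p + p \<bullet> (\<i> *s T q)"
      by (simp add: a_def inner_add_left inner_add_right inner_commute)
    have "(q + T q) \<bullet> T q = - (a \<bullet> (\<i> *s T q))" by (simp add: ia[symmetric] inner_i_swap)
    then have "q \<bullet> T q + T q \<bullet> T q + p \<bullet> (\<i> *s T q) = 0"
      using TT[of p q] by (simp add: a_def inner_add_left)
    moreover have "(p + \<i> *s T q) \<bullet> (p + \<i> *s T q) = p \<bullet> p + 2 * (p \<bullet> (\<i> *s T q)) + T q \<bullet> T q"
      by (simp add: inner_add_left inner_add_right inner_commute inner_i_i)
    \<comment> \<open>Completing the square: the value becomes a sum of three nonnegative terms. If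
      all vanish, then \<open>T q = 0\<close> and hence \<open>p = 0\<close>.\<close>
    ultimately have eq: "q \<bullet> (\<i> *s p) = (p + \<i> *s T q) \<bullet> (p + \<i> *s T q) + p \<bullet> T p + q \<bullet> T q"
      using 1 by simp
    have "q \<bullet> (\<i> *s p) \<noteq> 0"
    proof
      assume "q \<bullet> (\<i> *s p) = 0"
      then have "(p + \<i> *s T q) \<bullet> (p + \<i> *s T q) = 0" "q \<bullet> T q = 0"
        using eq pos[of p] pos[of q] inner_ge_zero[of "p + \<i> *s T q"] by linarith+
      then have "p + \<i> *s T q = 0" "T q = 0" using null by auto
      then show False using \<open>p \<noteq> 0\<close> by (simp add: vec_eq_iff)
    qed
    moreover have "q \<bullet> (\<i> *s p) \<ge> 0" using eq pos[of p] pos[of q] inner_ge_zero[of "p + \<i> *s T q"] by linarith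
    ultimately show "q \<bullet> (\<i> *s p) > 0" by simp
  }
qed

section \<open>Minimising the Kempf--Ness function\<close>

text \<open>The linear term grows for negative \<open>t\<close>, and for positive \<open>t\<close>
  the exponential dominates through its quadratic Taylor bound. The first claim bounds the summands
  of the function to be minimised from below, the second makes their sublevel sets bounded.\<close>

lemma exp_linear_bounds:
  fixes a b :: real
  assumes "a > 0" "b > 0"
  shows "\<exists>m. \<forall>t. m \<le> a * exp (2 * t) / 2 - b * t"
    and "\<exists>B. \<forall>t. a * exp (2 * t) / 2 - b * t \<le> C \<longrightarrow> \<bar>t\<bar> \<le> B"
proof -
  let ?g = "\<lambda>t. a * exp (2 * t) / 2 - b * t"
  have neg: "?g t \<ge> b * \<bar>t\<bar>" if "t \<le> 0" for t using that assms by simp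
  have pos: "?g t \<ge> a * t\<^sup>2 - b * t" if "t \<ge> 0" for t
  proof -
    have "1 + 2 * t + (2 * t)\<^sup>2 / 2 \<le> exp (2 * t)" using that by (intro exp_lower_Taylor_quadratic) simp
    then have "2 * t\<^sup>2 \<le> exp (2 * t)" using that by (simp add: power2_eq_square)
    then have "a * (2 * t\<^sup>2) \<le> a * exp (2 * t)" using assms by (intro mult_left_mono) auto
    then show ?thesis by simp
  qed
  have "- (b\<^sup>2 / (4 * a)) \<le> ?g t" for t
  proof (cases "t \<le> 0")
    case True
    have "b * \<bar>t\<bar> \<ge> 0" "b\<^sup>2 / (4 * a) \<ge> 0" using assms by auto
    then show ?thesis using neg[OF True] by linarith
  next
    case False
    have "a * t\<^sup>2 - b * t + b\<^sup>2 / (4 * a) = (2 * a * t - b)\<^sup>2 / (4 * a)"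
      using assms by (simp add: power2_eq_square field_simps)
    also have "\<dots> \<ge> 0" using assms by simp
    finally show ?thesis using pos[of t] False by linarith
  qed
  then show "\<exists>m. \<forall>t. m \<le> ?g t" by blast
  have "\<bar>t\<bar> \<le> \<bar>C\<bar> / b + (b + 1) / a + \<bar>C\<bar>" if t: "?g t \<le> C" for t
  proof -
    have nn: "\<bar>C\<bar> / b \<ge> 0" "(b + 1) / a \<ge> 0" using assms by auto
    show ?thesis
    proof (cases "t \<le> 0")
      case True
      then have "b * \<bar>t\<bar> \<le> \<bar>C\<bar>" using neg[OF True] t by linarith
      then have "\<bar>t\<bar> \<le> \<bar>C\<bar> / b" using assms by (simp add: field_simps)
      then show ?thesis using nn by linarith
    next
      case False
      show ?thesis
      proof (cases "t \<le> (b + 1) / a")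
        case True then show ?thesis using nn False by linarith
      next
        case large: False
        then have "a * t - b \<ge> 1" using assms by (simp add: field_simps)
        then have "t * 1 \<le> t * (a * t - b)" using False by (intro mult_left_mono) auto
        also have "\<dots> = a * t\<^sup>2 - b * t" by (simp add: power2_eq_square algebra_simps)
        also have "\<dots> \<le> \<bar>C\<bar>" using pos[of t] False t by linarith
        finally show ?thesis using nn False by linarith
      qed
    qed
  qed
  then show "\<exists>B. \<forall>t. ?g t \<le> C \<longrightarrow> \<bar>t\<bar> \<le> B" by blast
qed

context toric
begin

lemma null_real:
  assumes r: "r \<in> R" and y: "pi_map X y = 0"
  shows "y $ r k = - (\<Sum>h\<in>- range r. coef X r h k * y $ h)"
proof -
  let ?n = "null_extend X r (\<lambda>h. complex_of_real (y $ h))"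
  have "complex_vec y - ?n = 0"
  proof (rule null_vector_unique[OF r])
    show "(\<Sum>j\<in>UNIV. Re ((complex_vec y - ?n) $ j) *\<^sub>R X j) = 0"
      using null_extend_Re[OF r] y by (simp add: complex_vec_def pi_map_def scaleR_diff_left sum_subtractf)
    show "(\<Sum>j\<in>UNIV. Im ((complex_vec y - ?n) $ j) *\<^sub>R X j) = 0"
      using null_extend_Im[OF r] by (simp add: complex_vec_def sum_negf)
    show "(complex_vec y - ?n) $ h = 0" if "h \<notin> range r" for h
      using that by (simp add: complex_vec_def null_extend_outside)
  qed
  then have "Re (complex_vec y $ r k) = Re (?n $ r k)" by simp
  then show ?thesis by (simp add: complex_vec_def null_extend_range[OF r])
qed

lemma norm_exp_act_complex_vec: "(cmod (exp_act (complex_vec y) z $ j))\<^sup>2 = exp (2 * y $ j) * (cmod (z $ j))\<^sup>2"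
proof -
  have "(exp (y $ j))\<^sup>2 = exp (2 * y $ j)" by (simp add: exp_double)
  then show ?thesis by (simp add: exp_act_def complex_vec_def norm_mult power_mult_distrib norm_exp_eq_Re)
qed

lemma Psi_zero_exists:
  assumes z: "z \<in> C_Delta \<Delta> X lam"
  shows "\<exists>y. pi_map X y = 0 \<and> exp_act (complex_vec y) z \<in> Psi_zero X lam"
proof -
  obtain r where r: "r \<in> R" "\<And>h. h \<notin> range r \<Longrightarrow> z $ h \<noteq> 0" using C_Delta_cover[OF z] by blast
  obtain v where v: "v extreme_point_of \<Delta>" "range r = active v" "inj r" using frame_vertex[OF r(1)] .
  have "{j. z $ j = 0} \<subseteq> active v" using r(2) v(2) by blast
  \<comment> \<open>A point of the polytope active exactly where \<open>z\<close> vanishes. It makes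
    the linear coefficient \<open>b j\<close> positive precisely where the exponential coefficient
    \<open>a j\<close> is, so every summand below is bounded from below.\<close>
  then obtain \<nu> where \<nu>: "\<nu> \<in> \<Delta>" "active \<nu> = {j. z $ j = 0}" using point_with_index[OF v(1)] by metis
  define a b where "a j = (cmod (z $ j))\<^sup>2" and "b j = \<nu> \<bullet> X j - lam j" for j
  have ab: "a j > 0 \<and> b j > 0" if "z $ j \<noteq> 0" for j
  proof -
    have "j \<notin> active \<nu>" using that \<nu>(2) by simp
    then show ?thesis using that \<nu>(1) by (auto simp: a_def b_def mem_active mem_Delta less_le)
  qed
  have ab0: "a j = 0 \<and> b j = 0" if "z $ j = 0" for j
  proof -
    have "j \<in> active \<nu>" using that \<nu>(2) by simp
    then show ?thesis using that by (simp add: a_def b_def mem_active)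
  qed
  define g where "g j t = a j * exp (2 * t) / 2 - b j * t" for j t
  \<comment> \<open>On the kernel of \<open>pi_map\<close> the terms
    \<open>(\<nu> \<bullet> X j) * y $ j\<close> sum to zero, so there the derivative of
    \<open>f\<close> is the pairing with \<open>J_map\<close>; including them makes the bounds
    available summand by summand.\<close>
  define f where "f y = (\<Sum>j\<in>UNIV. g j (y $ j))" for y :: "real^'d"
  have "\<exists>m. \<forall>t. m \<le> g j t" for j
  proof (cases "z $ j = 0")
    case True then show ?thesis using ab0[OF True] by (auto simp: g_def)
  next
    case False then show ?thesis using exp_linear_bounds(1)[of "a j" "b j"] ab[OF False] by (simp add: g_def)
  qed
  then obtain m where m: "\<And>j t. m j \<le> g j t" by metis
  \<comment> \<open>Bounds a single summand on the sublevel set of \<open>f 0\<close>, each of the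
    others being at least \<open>- \<bar>m j\<bar>\<close>.\<close>
  define C where "C = f 0 + (\<Sum>j\<in>UNIV. \<bar>m j\<bar>)"
  have gC: "g h (y $ h) \<le> C" if "f y \<le> f 0" for y h
  proof -
    have "f y = g h (y $ h) + (\<Sum>j\<in>UNIV - {h}. g j (y $ j))"
      unfolding f_def by (rule sum.remove) auto
    moreover have "(\<Sum>j\<in>UNIV - {h}. g j (y $ j)) \<ge> (\<Sum>j\<in>UNIV - {h}. - \<bar>m j\<bar>)"
      using m by (intro sum_mono) (meson abs_ge_minus_self minus_le_iff order_trans neg_le_iff_le)
    moreover have "(\<Sum>j\<in>UNIV - {h}. \<bar>m j\<bar>) \<le> (\<Sum>j\<in>UNIV. \<bar>m j\<bar>)" by (intro sum_mono2) auto
    ultimately show ?thesis using that by (simp add: C_def sum_negf)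
  qed
  have "\<exists>B. \<forall>t. g h t \<le> C \<longrightarrow> \<bar>t\<bar> \<le> B" if "h \<notin> range r" for h
    using exp_linear_bounds(2)[of "a h" "b h" C] ab[OF r(2)[OF that]] by (simp add: g_def)
  then obtain B where B: "\<And>h t. h \<notin> range r \<Longrightarrow> g h t \<le> C \<Longrightarrow> \<bar>t\<bar> \<le> B h" by metis
  define S where "S = {y. pi_map X y = 0 \<and> f y \<le> f 0}"
  have contf: "continuous_on UNIV f" unfolding f_def g_def by (intro continuous_intros) auto
  have contpi: "continuous_on UNIV (pi_map X)" unfolding pi_map_def by (intro continuous_intros)
  have "closed S"
    unfolding S_def by (intro closed_Collect_conj closed_Collect_eq closed_Collect_le contf contpi continuous_on_const)
  moreover have "bounded S"
  proof -
    \<comment> \<open>Outside the frame \<open>z\<close> has no zeros, so \<open>B\<close> bounds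
      those coordinates of \<open>y\<close>; the frame coordinates are linear in them by
      \<open>null_real\<close>.\<close>
    define D where "D j = (if j \<in> range r then (\<Sum>h\<in>- range r. \<bar>coef X r h (inv_into UNIV r j)\<bar> * B h) else B j)" for j
    have "\<bar>y $ j\<bar> \<le> D j" if y: "y \<in> S" for y j
    proof -
      have out: "\<bar>y $ h\<bar> \<le> B h" if "h \<notin> range r" for h
        using B[OF that gC] y by (simp add: S_def)
      show ?thesis
      proof (cases "j \<in> range r")
        case True
        then obtain k where k: "j = r k" by blast
        have "\<bar>y $ r k\<bar> = \<bar>\<Sum>h\<in>- range r. coef X r h k * y $ h\<bar>"
          using null_real[OF r(1), of y k] y by (simp add: S_def)
        also have "\<dots> \<le> (\<Sum>h\<in>- range r. \<bar>coef X r h k * y $ h\<bar>)" by (rule sum_abs)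
        also have "\<dots> \<le> (\<Sum>h\<in>- range r. \<bar>coef X r h k\<bar> * B h)"
          by (intro sum_mono) (auto simp: abs_mult intro!: mult_left_mono out)
        finally show ?thesis using k v(3) by (simp add: D_def)
      next
        case False then show ?thesis using out by (simp add: D_def)
      qed
    qed
    then have "norm y \<le> (\<Sum>j\<in>UNIV. D j)" if "y \<in> S" for y
      using that norm_le_l1_cart[of y] sum_mono[of UNIV "\<lambda>j. \<bar>y $ j\<bar>" D] by force
    then show ?thesis by (auto simp: bounded_iff)
  qed
  ultimately have "compact S" by (simp add: compact_eq_bounded_closed)
  moreover have S0: "0 \<in> S" by (simp add: S_def pi_map_def)
  ultimately obtain y where y: "y \<in> S" "\<And>x. x \<in> S \<Longrightarrow> f y \<le> f x"
    using continuous_attains_inf[of S f] continuous_on_subset[OF contf, of S] by (metis empty_iff subset_UNIV)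
  have min: "f y \<le> f x" if "pi_map X x = 0" for x
    using that y(2)[of x] y(1) by (cases "f x \<le> f 0") (auto simp: S_def)
  have crit: "(\<Sum>j\<in>UNIV. (a j * exp (2 * y $ j) - b j) * x $ j) = 0" if x: "pi_map X x = 0" for x
  proof (rule DERIV_local_min)
    show "((\<lambda>t. f (y + t *\<^sub>R x)) has_real_derivative (\<Sum>j\<in>UNIV. (a j * exp (2 * y $ j) - b j) * x $ j)) (at 0)"
      unfolding f_def g_def
      by (auto intro!: derivative_eq_intros sum.cong simp: algebra_simps)
    show "\<forall>t. \<bar>0 - t\<bar> < 1 \<longrightarrow> f (y + 0 *\<^sub>R x) \<le> f (y + t *\<^sub>R x)"
    proof (intro allI impI)
      fix t
      have "pi_map X (y + t *\<^sub>R x) = pi_map X y + t *\<^sub>R pi_map X x"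
        by (simp add: pi_map_def scaleR_add_left sum.distrib scaleR_sum_right)
      then show "f (y + 0 *\<^sub>R x) \<le> f (y + t *\<^sub>R x)" using min[of "y + t *\<^sub>R x"] y(1) x by (simp add: S_def)
    qed
  qed simp
  have "J_map lam (exp_act (complex_vec y) z) x = 0" if x: "pi_map X x = 0" for x
  proof -
    have "(\<Sum>j\<in>UNIV. (\<nu> \<bullet> X j) * x $ j) = \<nu> \<bullet> pi_map X x"
      unfolding pi_map_def inner_sum_right by (rule sum.cong) auto
    also have "\<dots> = 0" using x by simp
    finally have 0: "(\<Sum>j\<in>UNIV. (\<nu> \<bullet> X j) * x $ j) = 0" .
    have "J_map lam (exp_act (complex_vec y) z) x =
        (\<Sum>j\<in>UNIV. (a j * exp (2 * y $ j) - b j) * x $ j) + (\<Sum>j\<in>UNIV. (\<nu> \<bullet> X j) * x $ j)"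
      unfolding J_map_def norm_exp_act_complex_vec sum.distrib[symmetric]
      by (rule sum.cong) (auto simp: a_def b_def algebra_simps)
    then show ?thesis using crit[OF x] 0 by simp
  qed
  then have "exp_act (complex_vec y) z \<in> Psi_zero X lam"
    by (auto simp: Psi_zero_def Psi_map_def n_space_def fun_eq_iff restrict_def)
  then show ?thesis using y(1) by (auto simp: S_def)
qed

text \<open>Pairing the difference of the two moment values with \<open>y\<close> gives zero, yet
  each summand is a nonnegative multiple of \<open>(exp (2 * t) - 1) * t\<close>, which vanishes
  only at \<open>t = 0\<close>. So \<open>y\<close> vanishes wherever \<open>z\<close> does
  not.\<close>

lemma Psi_zero_unique:
  assumes z: "z \<in> Psi_zero X lam" and y: "pi_map X y = 0" and ez: "exp_act (complex_vec y) z \<in> Psi_zero X lam"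
  shows "exp_act (complex_vec y) z = z"
proof -
  obtain \<nu> where \<nu>: "\<And>j. \<nu> \<bullet> X j - lam j = (cmod (z $ j))\<^sup>2" using z mem_Psi_zero by blast
  obtain \<nu>' where \<nu>': "\<And>j. \<nu>' \<bullet> X j - lam j = exp (2 * y $ j) * (cmod (z $ j))\<^sup>2"
    using ez unfolding mem_Psi_zero norm_exp_act_complex_vec by blast
  have "(\<Sum>j\<in>UNIV. (cmod (z $ j))\<^sup>2 * ((exp (2 * y $ j) - 1) * y $ j)) = (\<nu>' - \<nu>) \<bullet> pi_map X y"
    unfolding pi_map_def inner_sum_right
  proof (rule sum.cong[OF refl])
    fix j
    have "(cmod (z $ j))\<^sup>2 * (exp (2 * y $ j) - 1) = (\<nu>' - \<nu>) \<bullet> X j"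
      using \<nu>[of j] \<nu>'[of j] by (simp add: algebra_simps inner_diff_left)
    then show "(cmod (z $ j))\<^sup>2 * ((exp (2 * y $ j) - 1) * y $ j) = (\<nu>' - \<nu>) \<bullet> (y $ j *\<^sub>R X j)"
      by (simp add: mult.assoc[symmetric])
  qed
  also have "\<dots> = 0" using y by simp
  finally have sum0: "(\<Sum>j\<in>UNIV. (cmod (z $ j))\<^sup>2 * ((exp (2 * y $ j) - 1) * y $ j)) = 0" .
  have pos: "(exp (2 * t) - 1) * t \<ge> 0" for t :: real
    by (cases "t \<ge> 0") (auto simp: mult_nonpos_nonpos)
  have "\<forall>j\<in>UNIV. (cmod (z $ j))\<^sup>2 * ((exp (2 * y $ j) - 1) * y $ j) = 0"
    using sum0 pos by (subst (asm) sum_nonneg_eq_0_iff) auto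
  then have "y $ j = 0 \<or> z $ j = 0" for j by auto
  then show ?thesis unfolding exp_act_def complex_vec_def vec_eq_iff
    by (metis (no_types, lifting) exp_zero mult_1 mult_zero_right of_real_0 vec_lambda_beta)
qed

lemma complex_vec_exp_group: "pi_map X y = 0 \<Longrightarrow> complex_vec y \<in> exp_group X Q 1"
  by (simp add: exp_group_def complex_vec_def pi_map_def Q_zero)

lemma exp_group_mono: "exp_group X Q 0 \<subseteq> exp_group X Q 1"
  by (auto simp: exp_group_def)

text \<open>The exponent splits into its real part, in the kernel of \<open>pi_map\<close>, and its
  imaginary part, in the compact group. The rotation preserves the zero level, and
  \<open>Psi_zero_unique\<close> makes the real part act trivially on the rotated point.\<close>

lemma Psi_zero_orbit:
  assumes z: "z \<in> Psi_zero X lam" and \<zeta>: "\<zeta> \<in> exp_group X Q 1" and ez: "exp_act \<zeta> z \<in> Psi_zero X lam"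
  shows "exp_act \<zeta> z = exp_act (\<chi> j. \<i> * complex_of_real (Im (\<zeta> $ j))) z"
    and "(\<chi> j. \<i> * complex_of_real (Im (\<zeta> $ j))) \<in> exp_group X Q 0"
proof -
  let ?\<xi> = "\<chi> j. \<i> * complex_of_real (Im (\<zeta> $ j))" and ?y = "\<chi> j. Re (\<zeta> $ j)"
  show \<xi>: "?\<xi> \<in> exp_group X Q 0"
    using \<zeta> by (auto simp: exp_group_def im_proj_def complex_eq_iff)
  have y: "pi_map X ?y = 0" using \<zeta> by (simp add: exp_group_def pi_map_def)
  have split: "\<zeta> = complex_vec ?y + ?\<xi>" by (simp add: vec_eq_iff complex_vec_def complex_eq_iff)
  have eq: "exp_act \<zeta> z = exp_act (complex_vec ?y) (exp_act ?\<xi> z)"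
    unfolding exp_act_add[symmetric] by (rule arg_cong[OF split])
  show "exp_act \<zeta> z = exp_act ?\<xi> z"
    unfolding eq by (rule Psi_zero_unique[OF sym.M0_inv[OF z \<xi>] y]) (use ez eq in simp)
qed

lemma Psi_zero_subset: "Psi_zero X lam \<subseteq> C_Delta \<Delta> X lam"
  using Psi_zero_cover mem_C_Delta by blast

section \<open>The quotient map: bijectivity, continuity and equivariance\<close>

lemma chi_orbit: "chi_map X Q (sym.orb z) = cpx.orb z"
proof -
  have "cpx.orb ` sym.orb z = {cpx.orb z}"
  proof -
    have "cpx.orb (exp_act \<zeta> z) = cpx.orb z" if "\<zeta> \<in> exp_group X Q 0" for \<zeta>
      using that exp_group_mono by (intro exp_orbit_act) blast
    then show ?thesis using exp_group_zero[of 0] by (force simp: exp_orbit_def[of X Q 0])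
  qed
  then show ?thesis by (simp add: chi_map_def torus_orbit_NC)
qed

lemma topspace_sym: "topspace sym.M = sym.orb ` Psi_zero X lam"
  by (simp add: topspace_quotient_topology)

lemma topspace_cpx: "topspace cpx.M = cpx.orb ` C_Delta \<Delta> X lam"
  by (simp add: topspace_quotient_topology)

lemma chi_inj:
  assumes "z \<in> Psi_zero X lam" "z' \<in> Psi_zero X lam" "cpx.orb z = cpx.orb z'"
  shows "sym.orb z = sym.orb z'"
proof -
  obtain \<zeta> where \<zeta>: "\<zeta> \<in> exp_group X Q 1" "z' = exp_act \<zeta> z" using assms(3) unfolding exp_orbit_eq_iff by blast
  from Psi_zero_orbit[OF assms(1) \<zeta>(1)] assms(2) \<zeta>(2) show ?thesis unfolding exp_orbit_eq_iff by blast
qed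

lemma chi_bij: "bij_betw (chi_map X Q) (topspace sym.M) (topspace cpx.M)"
  unfolding topspace_sym topspace_cpx
proof (rule bij_betw_imageI)
  show "inj_on (chi_map X Q) (sym.orb ` Psi_zero X lam)"
  proof (rule inj_onI, elim imageE)
    fix p q z z' assume "chi_map X Q p = chi_map X Q q" "p = sym.orb z" "z \<in> Psi_zero X lam" "q = sym.orb z'" "z' \<in> Psi_zero X lam"
    then show "p = q" using chi_inj[of z z'] by (simp add: chi_orbit)
  qed
  show "chi_map X Q ` sym.orb ` Psi_zero X lam = cpx.orb ` C_Delta \<Delta> X lam"
  proof (intro equalityI subsetI)
    fix p assume "p \<in> chi_map X Q ` sym.orb ` Psi_zero X lam"
    then show "p \<in> cpx.orb ` C_Delta \<Delta> X lam" using Psi_zero_subset by (auto simp: chi_orbit)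
  next
    fix p assume "p \<in> cpx.orb ` C_Delta \<Delta> X lam"
    then obtain z where z: "z \<in> C_Delta \<Delta> X lam" "p = cpx.orb z" by blast
    obtain y where y: "pi_map X y = 0" "exp_act (complex_vec y) z \<in> Psi_zero X lam" using Psi_zero_exists[OF z(1)] by blast
    have "p = chi_map X Q (sym.orb (exp_act (complex_vec y) z))"
      unfolding chi_orbit z(2) by (rule exp_orbit_act[OF complex_vec_exp_group[OF y(1)], symmetric])
    then show "p \<in> chi_map X Q ` sym.orb ` Psi_zero X lam" using y(2) by blast
  qed
qed

lemma chi_continuous: "continuous_map sym.M cpx.M (chi_map X Q)"
proof (rule continuous_map_quotient_topology[where g="cpx.orb"])
  have "continuous_map (top_of_set (Psi_zero X lam)) (top_of_set (C_Delta \<Delta> X lam)) id"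
    using Psi_zero_subset by (auto simp: continuous_map_in_subtopology)
  from continuous_map_compose[OF this continuous_map_quotient_projection]
  show "continuous_map (top_of_set (Psi_zero X lam)) cpx.M cpx.orb" by simp
qed (simp add: chi_orbit)

lemma pi_surj: "\<exists>x. pi_map X x = Y"
proof -
  obtain v where v: "v extreme_point_of \<Delta>" using exists_vertex .
  have "X ` active v \<subseteq> range (pi_map X)"
  proof clarify
    fix j
    have "pi_map X (axis j 1) = X j"
      by (simp add: pi_map_def axis_def if_distrib[of "\<lambda>c. c *\<^sub>R _"] cong: if_cong)
    then show "X j \<in> range (pi_map X)" by (metis rangeI)
  qed
  moreover have "subspace (range (pi_map X))"
  proof -
    have "linear (pi_map X)"
      by (rule linearI) (auto simp: pi_map_def scaleR_add_left sum.distrib scaleR_sum_right)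
    then show ?thesis using linear_subspace_image[of "pi_map X" UNIV] by simp
  qed
  ultimately have "span (X ` active v) \<subseteq> range (pi_map X)" by (rule span_minimal)
  then have "Y \<in> range (pi_map X)" using vertex_normals_span[OF v] by auto
  then show ?thesis by (auto simp: image_iff)
qed

text \<open>With \<open>x0\<close> fixed over \<open>Y\<close>, the element \<open>t\<close> carries
  the orbit of \<open>z\<close> to the orbit of the translate of \<open>z\<close> by
  \<open>x0\<close>, in both quotients, because the groups are commutative and the cosets are
  translates of them.\<close>

lemma chi_equivariant:
  assumes t: "t \<in> quasitorus Q" and x: "x \<in> topspace sym.M"
  shows "chi_map X Q (quasitorus_act X t x) = complex_quasitorus_act X (quasitorus_incl t) (chi_map X Q x)"
proof -
  obtain Y where Y: "t = (\<lambda>q. Y + q) ` Q" using t by (auto simp: quasitorus_def)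
  obtain z where z: "x = sym.orb z" using x by (auto simp: topspace_sym)
  obtain x0 where x0: "pi_map X x0 = Y" using pi_surj by blast
  have pi_diff: "pi_map X (a - b) = pi_map X a - pi_map X b" for a b
    by (simp add: pi_map_def scaleR_diff_left sum_subtractf)
  have mem: "u \<in> t \<longleftrightarrow> u - Y \<in> Q" for u
    unfolding Y by (auto simp: image_iff) (metis add_diff_cancel_left' diff_add_cancel add.commute)
  have r0: "pi_map X a \<in> t \<longleftrightarrow> torus_vec (complex_vec (a - x0)) \<in> exp_group X Q 0" for a
    unfolding mem x0[symmetric] pi_diff[symmetric]
    by (auto simp: exp_group_def torus_vec_def complex_vec_def pi_map_def im_proj_def complex_eq_iff)
  have c0: "piC_map X Z \<in> quasitorus_incl t \<longleftrightarrow> torus_vec (Z - complex_vec x0) \<in> exp_group X Q 1" for Z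
  proof -
    have "piC_map X Z \<in> quasitorus_incl t \<longleftrightarrow> pi_map X (\<chi> j. Re (Z $ j)) - pi_map X x0 \<in> Q \<and> pi_map X (\<chi> j. Im (Z $ j)) = 0"
      unfolding x0 mem[symmetric] by (auto simp: piC_map_def quasitorus_incl_def)
    also have "\<dots> \<longleftrightarrow> piC_map X (Z - complex_vec x0) \<in> QC Q"
      by (auto simp: piC_map_def QC_def complex_vec_def pi_map_def scaleR_diff_left sum_subtractf)
    finally show ?thesis unfolding piC_QC .
  qed
  have tv: "torus_vec Z = torus_vec (Z - Z') + torus_vec Z'" for Z Z' by (simp flip: torus_vec_add)
  let ?z0 = "exp_act (torus_vec (complex_vec x0)) z"
  have comm: "exp_act \<zeta> (exp_act \<xi> y) = exp_act \<xi> (exp_act \<zeta> y)" for \<zeta> \<xi> y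
    by (simp flip: exp_act_add add: add.commute)
  have "quasitorus_act X t (sym.orb z) = sym.orb ?z0"
  proof (intro equalityI subsetI)
    fix p assume "p \<in> quasitorus_act X t (sym.orb z)"
    then obtain a \<zeta> where a: "torus_vec (complex_vec (a - x0)) \<in> exp_group X Q 0" "\<zeta> \<in> exp_group X Q 0"
      "p = exp_act (torus_vec (complex_vec a)) (exp_act \<zeta> z)"
      unfolding quasitorus_act_def r0 by (auto simp: torus_act_eq exp_orbit_def)
    have "complex_vec a - complex_vec x0 = complex_vec (a - x0)" by (simp add: complex_vec_def vec_eq_iff)
    then have "p = exp_act (torus_vec (complex_vec (a - x0)) + \<zeta>) ?z0"
      unfolding a(3) tv[of "complex_vec a" "complex_vec x0"] exp_act_add by (simp add: comm[of \<zeta>])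
    then show "p \<in> sym.orb ?z0" using exp_group_add[OF a(1,2)] by (auto simp: exp_orbit_def)
  next
    fix p assume "p \<in> sym.orb ?z0"
    then obtain \<zeta> where \<zeta>: "\<zeta> \<in> exp_group X Q 0" "p = exp_act \<zeta> ?z0" by (auto simp: exp_orbit_def)
    define a where "a = x0 + (\<chi> j. Im (\<zeta> $ j) / (2 * pi))"
    have \<zeta>a: "torus_vec (complex_vec (a - x0)) = \<zeta>"
      using \<zeta>(1) by (auto simp: torus_vec_def complex_vec_def a_def vec_eq_iff complex_eq_iff exp_group_def im_proj_def)
    have "complex_vec a - complex_vec x0 = complex_vec (a - x0)" by (simp add: complex_vec_def vec_eq_iff)
    then have "p = exp_act (torus_vec (complex_vec a)) z"
      unfolding \<zeta>(2) tv[of "complex_vec a" "complex_vec x0"] exp_act_add by (simp add: \<zeta>a)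
    moreover have "z \<in> sym.orb z" using exp_group_zero[of 0] by (force simp: exp_orbit_def)
    ultimately show "p \<in> quasitorus_act X t (sym.orb z)"
      unfolding quasitorus_act_def r0 using \<zeta>(1) \<zeta>a by (auto simp: torus_act_eq)
  qed
  moreover have "complex_quasitorus_act X (quasitorus_incl t) (cpx.orb z) = cpx.orb ?z0"
  proof (intro equalityI subsetI)
    fix p assume "p \<in> complex_quasitorus_act X (quasitorus_incl t) (cpx.orb z)"
    then obtain Z \<zeta> where a: "torus_vec (Z - complex_vec x0) \<in> exp_group X Q 1" "\<zeta> \<in> exp_group X Q 1"
      "p = exp_act (torus_vec Z) (exp_act \<zeta> z)"
      unfolding complex_quasitorus_act_def c0 by (auto simp: torus_act_eq exp_orbit_def)
    have "p = exp_act (torus_vec (Z - complex_vec x0) + \<zeta>) ?z0"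
      unfolding a(3) tv[of Z "complex_vec x0"] exp_act_add by (simp add: comm[of \<zeta>])
    then show "p \<in> cpx.orb ?z0" using exp_group_add[OF a(1,2)] by (auto simp: exp_orbit_def)
  next
    fix p assume "p \<in> cpx.orb ?z0"
    then obtain \<zeta> where \<zeta>: "\<zeta> \<in> exp_group X Q 1" "p = exp_act \<zeta> ?z0" by (auto simp: exp_orbit_def)
    define Z where "Z = complex_vec x0 + (\<chi> j. \<zeta> $ j / (2 * complex_of_real pi * \<i>))"
    have \<zeta>Z: "torus_vec (Z - complex_vec x0) = \<zeta>" unfolding Z_def by (simp add: torus_vec_surj)
    have "p = exp_act (torus_vec Z) z"
      unfolding \<zeta>(2) tv[of Z "complex_vec x0"] exp_act_add by (simp add: \<zeta>Z)
    moreover have "z \<in> cpx.orb z" using exp_group_zero[of 1] by (force simp: exp_orbit_def)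
    ultimately show "p \<in> complex_quasitorus_act X (quasitorus_incl t) (cpx.orb z)"
      unfolding complex_quasitorus_act_def c0 using \<zeta>(1) \<zeta>Z by (auto simp: torus_act_eq)
  qed
  ultimately show ?thesis unfolding z chi_orbit by (simp add: chi_orbit)
qed

end

section \<open>The lift of the quotient map\<close>

lemma manifold_map_open:
  assumes "open C" "F ` C \<subseteq> D" "smooth_on C F"
  shows "manifold_map smooth_on C id D id F"
  unfolding manifold_map_def
  using assms smooth_on_continuous[OF assms(3)] local_section_open_id[OF assms(1)]
  by (intro conjI ballI exI[of _ C] exI[of _ id]) auto

text \<open>The map of models is forced by the chart maps; its surjectivity comes from that of
  \<open>F\<close> and its injectivity from that of \<open>f\<close>.\<close>

lemma diffeo_chart_liftI:
  assumes iso: "manifold_iso smooth_on (chart_dom c) id (chart_dom c') id F"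
    and comm: "\<And>x. x \<in> chart_dom c \<Longrightarrow>
      chart_map c' (group_orbit (chart_group c') (F x)) = f (chart_map c (group_orbit (chart_group c) x))"
    and inj: "inj_on (chart_map c) (chart_orbits c)" "inj_on (chart_map c') (chart_orbits c')"
    and injf: "inj_on f (chart_image c)"
  shows "diffeo_chart_lift c c' f F"
proof -
  let ?a = "group_orbit (chart_group c)" and ?b = "group_orbit (chart_group c')"
  have bij: "bij_betw F (chart_dom c) (chart_dom c')" using iso by (simp add: manifold_iso_def)
  then have FD: "F x \<in> chart_dom c'" if "x \<in> chart_dom c" for x using that by (auto simp: bij_betw_def)
  define h where "h = inv_into (chart_orbits c') (chart_map c') \<circ> f \<circ> chart_map c"
  have h: "h (?a x) = ?b (F x)" if x: "x \<in> chart_dom c" for x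
    using inv_into_f_f[OF inj(2), of "?b (F x)"] FD[OF x] comm[OF x] by (simp add: h_def chart_orbits_def)
  have "bij_betw h (?a ` chart_dom c) (?b ` chart_dom c')"
  proof (rule bij_betw_imageI)
    have "h ` ?a ` chart_dom c = ?b ` F ` chart_dom c" using h by (simp add: image_image)
    then show "h ` ?a ` chart_dom c = ?b ` chart_dom c'" using bij by (simp add: bij_betw_def)
    show "inj_on h (?a ` chart_dom c)"
    proof (rule inj_onI, elim imageE)
      fix p q x y assume eq: "h p = h q" and x: "p = ?a x" "x \<in> chart_dom c" and y: "q = ?a y" "y \<in> chart_dom c"
      have "f (chart_map c p) = f (chart_map c q)"
        using eq h comm x y by metis
      moreover have "p \<in> chart_orbits c" "q \<in> chart_orbits c" using x y by (auto simp: chart_orbits_def)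
      ultimately show "p = q" using inj(1) injf by (auto simp: inj_on_def chart_image_def)
    qed
  qed
  moreover have "chart_map c' (h w) = f (chart_map c w)" if "w \<in> chart_orbits c" for w
    using that h comm by (auto simp: chart_orbits_def)
  ultimately show ?thesis
    unfolding diffeo_chart_lift_def model_iso_lift_def using iso h by (intro exI[of _ h]) auto
qed

lemma has_derivative_vec_nth: "(f has_derivative D) F \<Longrightarrow> ((\<lambda>x. f x $ k) has_derivative (\<lambda>u. D u $ k)) F"
  by (rule bounded_linear.has_derivative[OF bounded_linear_vec_nth])

lemma has_derivative_exp_of_real:
  assumes "(f has_derivative D) (at x)"
  shows "((\<lambda>x. exp (a * complex_of_real (f x))) has_derivative
     (\<lambda>u. exp (a * complex_of_real (f x)) * (a * complex_of_real (D u)))) (at x)"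
proof -
  have "((\<lambda>x. a * complex_of_real (f x)) has_derivative (\<lambda>u. a * complex_of_real (D u))) (at x)"
    by (intro has_derivative_mult_right bounded_linear.has_derivative[OF bounded_linear_of_real] assms)
  from diff_chain_at[OF this DERIV_exp[unfolded has_field_derivative_def]] show ?thesis by (simp add: o_def)
qed

lemma has_derivative_unique_open:
  assumes "(f has_derivative D) (at x)" "(g has_derivative E) (at x)" "open T" "x \<in> T" "\<And>w. w \<in> T \<Longrightarrow> f w = g w"
  shows "D = E"
  using has_derivative_unique[OF has_derivative_transform_within_open[OF assms(1,3,4,5)] assms(2)] .

lemma has_derivative_cmod_squared:
  assumes "(z has_derivative D) (at x)"
  shows "((\<lambda>x. (cmod (z x))\<^sup>2) has_derivative (\<lambda>u. 2 * Re (cnj (z x) * D u))) (at x)"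
proof -
  have 1: "((\<lambda>x. Re (z x)) has_derivative (\<lambda>u. Re (D u))) (at x)" "((\<lambda>x. Im (z x)) has_derivative (\<lambda>u. Im (D u))) (at x)"
    using bounded_linear.has_derivative[OF bounded_linear_Re assms] bounded_linear.has_derivative[OF bounded_linear_Im assms] by auto
  show ?thesis unfolding cmod_power2 unfolding power2_eq_square
    by (rule has_derivative_eq_rhs[OF has_derivative_add[OF has_derivative_mult[OF 1(1) 1(1)] has_derivative_mult[OF 1(2) 1(2)]]])
       (auto simp: algebra_simps)
qed

context toric
begin

abbreviation "U r \<equiv> sym.U r"
abbreviation "sg r w \<equiv> sym.sg r w"

lemma slk_pos: "w \<in> U r \<Longrightarrow> h \<notin> range r \<Longrightarrow> slk r (modsq w) h > 0"
  by (simp add: reinhardt_def A_sym_def)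

definition fexp :: "('n \<Rightarrow> 'd) \<Rightarrow> complex^'n \<Rightarrow> 'n \<Rightarrow> real" where
  "fexp r w k = (\<Sum>h\<in>- range r. coef X r h k * (ln (slk r (modsq w) h) / 2))"

text \<open>The lift of \<open>\<chi>\<close> in the charts of a vertex.\<close>

definition Fm :: "('n \<Rightarrow> 'd) \<Rightarrow> complex^'n \<Rightarrow> complex^'n" where
  "Fm r w = (\<chi> k. exp (1 * complex_of_real (fexp r w k)) * w $ k)"

text \<open>The exponent in the kernel of \<open>pi_map\<close> that scales the outside coordinates,
  the square roots of the slacks, to 1. Its frame coordinates are then forced, and this is where
  \<open>fexp\<close> comes from.\<close>

definition yvec :: "('n \<Rightarrow> 'd) \<Rightarrow> complex^'n \<Rightarrow> real^'d" where
  "yvec r w = (\<chi> j. if j \<in> range r then fexp r w (inv_into UNIV r j) else - (ln (slk r (modsq w) j) / 2))"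

lemma yvec_pi:
  assumes r: "r \<in> R" shows "pi_map X (yvec r w) = 0"
proof -
  have "yvec r w $ j = Re (null_extend X r (\<lambda>h. complex_of_real (- (ln (slk r (modsq w) h) / 2))) $ j)" for j
  proof (cases "j \<in> range r")
    case True
    then obtain k where k: "j = r k" by blast
    then show ?thesis using inj_frame[OF r]
      by (simp add: yvec_def null_extend_range[OF r] fexp_def sum_negf)
  next
    case False
    then show ?thesis by (simp add: yvec_def null_extend_outside)
  qed
  then show ?thesis using null_extend_Re[OF r] by (simp add: pi_map_def)
qed

lemma Fm_slice:
  assumes r: "r \<in> R" and w: "w \<in> U r"
  shows "exp_act (complex_vec (yvec r w)) (sg r w) = slice_point r 1 (Fm r w)"
proof -
  have "exp_act (complex_vec (yvec r w)) (sg r w) $ j = slice_point r 1 (Fm r w) $ j" for j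
  proof (cases "j \<in> range r")
    case True
    then obtain k where k: "j = r k" by blast
    then show ?thesis using inj_frame[OF r] by (simp add: exp_act_def complex_vec_def yvec_def Fm_def)
  next
    case False
    have s: "slk r (modsq w) j > 0" using slk_pos[OF w False] .
    then have "exp (ln (slk r (modsq w) j) / 2) = sqrt (slk r (modsq w) j)"
      using exp_ln[of "sqrt (slk r (modsq w) j)"] by (simp add: ln_sqrt)
    then have "exp (- (ln (slk r (modsq w) j) / 2)) * sqrt (slk r (modsq w) j) = 1"
      using s by (simp add: exp_minus field_simps)
    then have "complex_of_real (exp (- (ln (slk r (modsq w) j) / 2)) * sqrt (slk r (modsq w) j)) = 1"
      by (simp only: of_real_1)
    then show ?thesis using False by (simp add: exp_act_def complex_vec_def yvec_def c_sym_def exp_of_real[symmetric])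
  qed
  then show ?thesis by (simp add: vec_eq_iff)
qed

lemma Fm_orb: "r \<in> R \<Longrightarrow> w \<in> U r \<Longrightarrow> cpx.orb (slice_point r 1 (Fm r w)) = cpx.orb (sg r w)"
  unfolding Fm_slice[symmetric] by (rule exp_orbit_act[OF complex_vec_exp_group[OF yvec_pi]])

lemma complex_vec_minus: "complex_vec (- y) = - complex_vec y"
  and complex_vec_add: "complex_vec (y + y') = complex_vec y + complex_vec y'"
  by (simp_all add: complex_vec_def vec_eq_iff)

lemma pi_map_add: "pi_map X (y + y') = pi_map X y + pi_map X y'"
  and pi_map_minus: "pi_map X (- y) = - pi_map X y"
  by (simp_all add: pi_map_def scaleR_add_left sum.distrib sum_negf)

text \<open>Two slice points of the zero level with the same image differ by a real exponent in the
  kernel of \<open>pi_map\<close>, so \<open>Psi_zero_unique\<close> identifies them.\<close>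

lemma Fm_inj: assumes r: "r \<in> R" shows "inj_on (Fm r) (U r)"
proof (rule inj_onI)
  fix w w' assume w: "w \<in> U r" "w' \<in> U r" and eq: "Fm r w = Fm r w'"
  let ?y = "- yvec r w' + yvec r w"
  have "sg r w' = exp_act (- complex_vec (yvec r w')) (slice_point r 1 (Fm r w'))"
    unfolding Fm_slice[OF r w(2), symmetric] by simp
  also have "\<dots> = exp_act (complex_vec ?y) (sg r w)"
    unfolding eq[symmetric] Fm_slice[OF r w(1), symmetric] complex_vec_add exp_act_add complex_vec_minus ..
  finally have sg: "sg r w' = exp_act (complex_vec ?y) (sg r w)" .
  have "pi_map X ?y = 0" unfolding pi_map_add pi_map_minus yvec_pi[OF r] by simp
  then have "exp_act (complex_vec ?y) (sg r w) = sg r w"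
    using sym.slice_in[OF r w(2)] unfolding sg by (rule Psi_zero_unique[OF sym.slice_in[OF r w(1)]])
  then have "select_coords r (sg r w') = select_coords r (sg r w)" using sg by simp
  then show "w = w'" using inj_frame[OF r] by simp
qed

lemma Fm_surj: assumes r: "r \<in> R" shows "\<exists>w\<in>U r. Fm r w = v"
proof -
  let ?z = "slice_point r 1 v"
  obtain y where y: "pi_map X y = 0" "exp_act (complex_vec y) ?z \<in> Psi_zero X lam"
    using Psi_zero_exists[OF cpx.slice_in[OF r, of v]] by auto
  let ?w = "select_coords r (exp_act (complex_vec y) ?z)"
  have "?w \<in> U r \<and> sg r ?w = exp_act (complex_vec y) ?z"
  proof (rule sym.slice[OF r y(2)])
    fix h assume "h \<notin> range r"
    then show "\<exists>t>0. exp_act (complex_vec y) ?z $ h = complex_of_real t \<and> ((0::real) = 1 \<longrightarrow> t = 1)"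
      by (intro exI[of _ "exp (y $ h)"]) (simp add: exp_act_def complex_vec_def exp_of_real)
  qed
  then have w: "?w \<in> U r" and sgw: "sg r ?w = exp_act (complex_vec y) ?z" by auto
  have Fz: "slice_point r 1 (Fm r ?w) = exp_act (complex_vec (yvec r ?w + y)) ?z"
    unfolding Fm_slice[OF r w, symmetric] unfolding sgw complex_vec_add exp_act_add ..
  \<comment> \<open>Both slice points have outside coordinates 1, so the real exponent vanishes
    there and hence everywhere.\<close>
  have "complex_vec (yvec r ?w + y) = 0"
  proof (rule null_vector_unique[OF r])
    have "pi_map X (yvec r ?w + y) = 0" using yvec_pi[OF r] y(1) by (simp add: pi_map_add)
    then show "(\<Sum>j\<in>UNIV. Re (complex_vec (yvec r ?w + y) $ j) *\<^sub>R X j) = 0"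
      by (simp add: complex_vec_def pi_map_def)
    show "(\<Sum>j\<in>UNIV. Im (complex_vec (yvec r ?w + y) $ j) *\<^sub>R X j) = 0" by (simp add: complex_vec_def)
    fix h assume h: "h \<notin> range r"
    have "exp (complex_of_real ((yvec r ?w + y) $ h)) = 1"
      using arg_cong[OF Fz, of "\<lambda>z. z $ h"] h by (simp add: exp_act_def complex_vec_def)
    then have "exp ((yvec r ?w + y) $ h) = 1" by (simp only: exp_of_real of_real_eq_1_iff)
    then have "(yvec r ?w + y) $ h = 0" by (simp only: exp_eq_one_iff)
    then show "complex_vec (yvec r ?w + y) $ h = 0" by (simp only: complex_vec_def vec_lambda_beta of_real_0)
  qed
  then have "slice_point r 1 (Fm r ?w) = ?z" using Fz by simp
  then have "select_coords r (slice_point r 1 (Fm r ?w)) = select_coords r ?z" by simp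
  then show ?thesis using w inj_frame[OF r] by auto
qed

definition Gm :: "('n \<Rightarrow> 'd) \<Rightarrow> complex^'n \<Rightarrow> complex^'n" where
  "Gm r = inv_into (U r) (Fm r)"

lemma Gm:
  assumes r: "r \<in> R"
  shows "Gm r v \<in> U r" "Fm r (Gm r v) = v" "w \<in> U r \<Longrightarrow> Gm r (Fm r w) = w"
proof -
  have "v \<in> Fm r ` U r" using Fm_surj[OF r, of v] by blast
  then show "Gm r v \<in> U r" "Fm r (Gm r v) = v" unfolding Gm_def by (auto intro: inv_into_into f_inv_into_f)
  show "w \<in> U r \<Longrightarrow> Gm r (Fm r w) = w" unfolding Gm_def by (rule inv_into_f_f[OF Fm_inj[OF r]])
qed

lemma open_Ur: "open (U r)" by (intro open_reinhardt open_A_sym)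

section \<open>Derivative and inverse of the lift\<close>

lemma smooth_on_Fm: "smooth_on (U r) (Fm r)"
proof (rule smooth_on_vec[OF open_Ur])
  fix k
  have "smooth_on (U r) (\<lambda>w. \<Sum>h\<in>- range r. coef X r h k * (inverse 2 * ln (slk r (modsq w) h)))"
    by (intro smooth_on_sum smooth_on_linear_comp[OF open_Ur bounded_linear_mult_right] smooth_on_ln smooth_on_slk open_Ur)
       (auto intro: slk_pos)
  then have f: "smooth_on (U r) (\<lambda>w. fexp r w k)" by (simp add: fexp_def)
  show "smooth_on (U r) (\<lambda>w. Fm r w $ k)"
    unfolding Fm_def vec_lambda_beta
    by (rule smooth_on_mult[OF open_Ur smooth_on_exp[OF open_Ur smooth_on_mult[OF open_Ur smooth_on_const[OF open_Ur]
          smooth_on_linear_comp[OF open_Ur bounded_linear_of_real f]]]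
        smooth_on_bounded_linear[OF open_Ur bounded_linear_vec_nth]])
qed

text \<open>Half the differential of the slack: the factor 2 from a squared modulus cancels against
  the 1/2 in \<open>fexp\<close>.\<close>

definition lder :: "('n \<Rightarrow> 'd) \<Rightarrow> complex^'n \<Rightarrow> 'd \<Rightarrow> complex^'n \<Rightarrow> real" where
  "lder r w h u = (\<Sum>k\<in>UNIV. coef X r h k * Re (cnj (w $ k) * u $ k))"

text \<open>The operator \<open>T\<close> of the overview, obtained by logarithmic differentiation
  of the scaling factors. Each component of its value is a real multiple of \<open>w $ k\<close>,
  that is, radial.\<close>

definition Top :: "('n \<Rightarrow> 'd) \<Rightarrow> complex^'n \<Rightarrow> complex^'n \<Rightarrow> complex^'n" where
  "Top r w u = (\<chi> k. complex_of_real (\<Sum>h\<in>- range r. coef X r h k * (lder r w h u / slk r (modsq w) h)) * w $ k)"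

lemma Fm_derivative:
  assumes w: "w \<in> U r"
  shows "(Fm r has_derivative (\<lambda>u. \<chi> k. exp (1 * complex_of_real (fexp r w k)) * (u + Top r w u) $ k)) (at w)"
proof (rule has_derivative_vec)
  fix k
  have m: "((\<lambda>w. modsq w $ k) has_derivative (\<lambda>u. 2 * Re (cnj (w $ k) * u $ k))) (at w)" for k
    unfolding modsq_def vec_lambda_beta
    by (rule has_derivative_cmod_squared[OF has_derivative_vec_nth[OF has_derivative_ident]])
  have s: "((\<lambda>w. slk r (modsq w) h) has_derivative (\<lambda>u. 2 * lder r w h u)) (at w)" for h
    unfolding slk_def
    by (rule has_derivative_eq_rhs[OF has_derivative_diff[OF has_derivative_sum[OF has_derivative_mult_right[OF
            has_derivative_add[OF m has_derivative_const]]] has_derivative_const]])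
       (auto simp: lder_def sum_distrib_left algebra_simps)
  have l: "((\<lambda>w. ln (slk r (modsq w) h) / 2) has_derivative (\<lambda>u. lder r w h u / slk r (modsq w) h)) (at w)"
    if "h \<in> - range r" for h
  proof -
    have "slk r (modsq w) h > 0" using slk_pos[OF w] that by simp
    then have "((\<lambda>w. ln (slk r (modsq w) h)) has_derivative (\<lambda>u. 2 * lder r w h u * inverse (slk r (modsq w) h))) (at w)"
      using has_derivative_ln[OF _ s] by simp
    then have "((\<lambda>w. ln (slk r (modsq w) h) / 2) has_derivative (\<lambda>u. (2 * lder r w h u * inverse (slk r (modsq w) h)) / 2)) (at w)"
      by (rule bounded_linear.has_derivative[OF bounded_linear_divide])
    moreover have "(\<lambda>u. (2 * lder r w h u * inverse (slk r (modsq w) h)) / 2) = (\<lambda>u. lder r w h u / slk r (modsq w) h)"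
      by (rule ext) (simp add: inverse_eq_divide)
    ultimately show ?thesis by (simp only:)
  qed
  have f: "((\<lambda>w. fexp r w k) has_derivative (\<lambda>u. \<Sum>h\<in>- range r. coef X r h k * (lder r w h u / slk r (modsq w) h))) (at w)"
    unfolding fexp_def by (intro has_derivative_sum has_derivative_mult_right l)
  show "((\<lambda>w. Fm r w $ k) has_derivative (\<lambda>u. exp (1 * complex_of_real (fexp r w k)) * (u + Top r w u) $ k)) (at w)"
    unfolding Fm_def vec_lambda_beta
    by (rule has_derivative_eq_rhs[OF has_derivative_mult[OF has_derivative_exp_of_real[OF f]
          has_derivative_vec_nth[OF has_derivative_ident]]])
       (auto simp: Top_def algebra_simps)
qed

text \<open>Written as a Gram form in the functionals \<open>lder\<close>, weighted by inverse
  slacks that are positive on the chart domain, \<open>Top\<close> is visibly symmetric and positive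
  semidefinite.\<close>

lemma inner_Top: "u \<bullet> Top r w v = (\<Sum>h\<in>- range r. lder r w h u * lder r w h v / slk r (modsq w) h)"
proof -
  have c: "x \<bullet> (complex_of_real t * y) = t * Re (cnj y * x)" for x y t
    by (simp add: inner_complex_def algebra_simps)
  have "u \<bullet> Top r w v = (\<Sum>k\<in>UNIV. \<Sum>h\<in>- range r. coef X r h k * Re (cnj (w $ k) * u $ k) * (lder r w h v / slk r (modsq w) h))"
    unfolding inner_vec_def Top_def vec_lambda_beta c sum_distrib_right by (intro sum.cong refl) (simp add: algebra_simps add_divide_distrib)
  also have "\<dots> = (\<Sum>h\<in>- range r. \<Sum>k\<in>UNIV. coef X r h k * Re (cnj (w $ k) * u $ k) * (lder r w h v / slk r (modsq w) h))"
    by (rule sum.swap)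
  also have "\<dots> = (\<Sum>h\<in>- range r. lder r w h u * lder r w h v / slk r (modsq w) h)"
    unfolding sum_distrib_right[symmetric] lder_def[symmetric] by simp
  finally show ?thesis .
qed

lemma Top_sym: "u \<bullet> Top r w v = v \<bullet> Top r w u"
  by (simp add: inner_Top mult.commute)

lemma Top_pos: "w \<in> U r \<Longrightarrow> u \<bullet> Top r w u \<ge> 0"
  unfolding inner_Top by (intro sum_nonneg divide_nonneg_pos) (auto intro: slk_pos)

lemma Top_null:
  assumes w: "w \<in> U r" and u: "u \<bullet> Top r w u = 0"
  shows "Top r w u = 0"
proof -
  have "(\<Sum>h\<in>- range r. lder r w h u * lder r w h u / slk r (modsq w) h) = 0" using u by (simp add: inner_Top)
  then have "\<forall>h\<in>- range r. lder r w h u * lder r w h u / slk r (modsq w) h = 0"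
    by (subst (asm) sum_nonneg_eq_0_iff) (auto intro!: divide_nonneg_pos slk_pos[OF w])
  then have "lder r w h u = 0" if "h \<in> - range r" for h using slk_pos[OF w, of h] that by auto
  then show ?thesis by (simp add: Top_def vec_eq_iff)
qed

text \<open>\<open>Top\<close> takes radial values, \<i> turns them into infinitesimal rotations of
  the coordinates, and rotations do not change the slacks.\<close>

lemma Top_i: "Top r w (\<i> *s Top r w u) = 0"
proof -
  have "Re (cnj x * (\<i> * (complex_of_real t * x))) = 0" for x t
    by (simp add: algebra_simps)
  then have "lder r w h (\<i> *s Top r w u) = 0" for h
    unfolding lder_def Top_def vector_smult_component vec_lambda_beta by simp
  then show ?thesis unfolding Top_def[of r w "\<i> *s Top r w u"] by (simp add: vec_eq_iff)
qed

lemma smooth_on_Gm: assumes r: "r \<in> R" shows "smooth_on UNIV (Gm r)"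
proof (rule smooth_on_inverse_function[OF open_Ur open_UNIV smooth_on_Fm, of r])
  show "Gm r ` UNIV \<subseteq> U r" using Gm[OF r] by auto
  fix w u assume w: "w \<in> U r" and D0: "frechet_derivative (Fm r) (at w) u = 0"
  have "(\<chi> k. exp (1 * complex_of_real (fexp r w k)) * (u + Top r w u) $ k) = 0"
    using fun_cong[OF frechet_derivative_at[OF Fm_derivative[OF w]], of u] unfolding D0 .
  then have "u + Top r w u = 0" by (simp add: vec_eq_iff)
  \<comment> \<open>Positivity of \<open>Top\<close> makes \<open>1 + T\<close> injective, so the
    derivative of the lift is invertible.\<close>
  then have "u \<bullet> (u + Top r w u) = 0" by simp
  then have "u \<bullet> u = 0" using Top_pos[OF w, of u] inner_ge_zero[of u] unfolding inner_add_right by linarith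
  then show "u = 0" by simp
qed (use Gm[OF r] in auto)

abbreviation "DG r v \<equiv> frechet_derivative (Gm r) (at v)"

lemma DG: "r \<in> R \<Longrightarrow> (Gm r has_derivative DG r v) (at v)"
  by (rule has_derivative_frechet[OF smooth_on_differentiable[OF smooth_on_Gm]]) auto

text \<open>Differentiating \<open>Fm r (Gm r v) = v\<close> gives this. The right side is complex
  linear in \<open>a\<close>, so the values of \<open>DG r v\<close> at \<open>\<i> *s a\<close> and
  at \<open>a\<close> satisfy the hypothesis shared by \<open>one_one_form\<close> and
  \<open>positive_form\<close>.\<close>

lemma DG_equation:
  assumes r: "r \<in> R"
  shows "DG r v a + Top r (Gm r v) (DG r v a) = (\<chi> k. exp (- complex_of_real (fexp r (Gm r v) k)) * a $ k)"
proof -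
  let ?w = "Gm r v"
  have "(Fm r \<circ> Gm r has_derivative (\<lambda>u. \<chi> k. exp (1 * complex_of_real (fexp r ?w k)) * (u + Top r ?w u) $ k) \<circ> DG r v) (at v)"
    by (rule diff_chain_at[OF DG[OF r] Fm_derivative[OF Gm(1)[OF r]]])
  moreover have "Fm r \<circ> Gm r = id" using Gm(2)[OF r] by auto
  ultimately have "(\<lambda>u. \<chi> k. exp (1 * complex_of_real (fexp r ?w k)) * (u + Top r ?w u) $ k) \<circ> DG r v = id"
    using has_derivative_unique[OF _ has_derivative_id] by simp
  from fun_cong[OF this, of a]
  have "(\<chi> k. exp (1 * complex_of_real (fexp r ?w k)) * (DG r v a + Top r ?w (DG r v a)) $ k) = a"
    by (simp only: comp_apply id_apply)
  then have "exp (complex_of_real (fexp r ?w k)) * (DG r v a + Top r ?w (DG r v a)) $ k = a $ k" for k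
    by (auto simp: vec_eq_iff)
  then have "(DG r v a + Top r ?w (DG r v a)) $ k = exp (- complex_of_real (fexp r ?w k)) * a $ k" for k
    by (metis (no_types, opaque_lifting) exp_minus exp_not_eq_zero mult.assoc left_inverse mult_1)
  then show ?thesis by (simp add: vec_eq_iff)
qed

text \<open>Pullback of the standard form along the inverse lift; the base point \<open>0\<close>
  stands for any point, the form being constant.\<close>

definition eta :: "('n \<Rightarrow> 'd) \<Rightarrow> (complex^'n) two_form" where
  "eta r v a b = standard_form 0 (DG r v a) (DG r v b)"

lemma eta_kahler:
  assumes r: "r \<in> R"
  shows "kahler_on UNIV (eta r)"
  unfolding kahler_on_def two_form_on_def
proof (intro conjI ballI allI impI)
  have lin: "linear (DG r v)" for v using DG[OF r] by (rule has_derivative_linear)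
  have bb: "bilinear (standard_form (0::complex^'n))"
    using standard_form_bilinear by (simp add: bilinear_conv_bounded_bilinear)
  show "bilinear (eta r v)" for v
    unfolding bilinear_def eta_def
    using linear_compose[OF lin[of v]] bb unfolding bilinear_def o_def by auto
  show "eta r v a a = 0" for v a using standard_form_alt[of 0 "DG r v a" "DG r v a"] by (simp add: eta_def)
  show "smooth_on UNIV (\<lambda>v. eta r v a b)" for a b
    unfolding eta_def
    by (rule smooth_on_bilinear[OF open_UNIV standard_form_bilinear]) (auto intro: smooth_on_derivative smooth_on_Gm[OF r])
  show "closed_two_form_on UNIV (eta r)"
    using closed_pullback_constant_form[OF open_UNIV smooth_on_Gm[OF r] standard_form_bilinear[of 0] standard_form_alt]
    unfolding eta_def .
  fix v
  let ?T = "Top r (Gm r v)"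
  have q: "DG r v (\<i> *s a) + ?T (DG r v (\<i> *s a)) = \<i> *s (DG r v a + ?T (DG r v a))" for a
    unfolding DG_equation[OF r] by (simp add: vec_eq_iff)
  note T = Top_sym[of _ r "Gm r v"] Top_pos[OF Gm(1)[OF r]] Top_null[OF Gm(1)[OF r]] Top_i[of r "Gm r v"]
  show "eta r v (\<i> *s a) (\<i> *s b) = eta r v a b" for a b
    unfolding eta_def standard_form_inner using one_one_form[OF T q q, of a b] by simp
  show "eta r v (\<i> *s a) a > 0" if "a \<noteq> 0" for a
  proof -
    have "DG r v a \<noteq> 0"
    proof
      assume "DG r v a = 0"
      moreover have "?T 0 = 0" by (simp add: Top_def lder_def vec_eq_iff)
      ultimately have "(\<chi> k. exp (- complex_of_real (fexp r (Gm r v) k)) * a $ k) = 0"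
        using DG_equation[OF r, of v a] by simp
      then show False using that by (simp add: vec_eq_iff)
    qed
    then show ?thesis unfolding eta_def standard_form_inner using positive_form[OF T q, of a] by simp
  qed
qed

section \<open>Invariance of the form along the zero level\<close>

lemma smooth_on_slice: "r \<in> R \<Longrightarrow> smooth_on (U r) (\<lambda>w. sg r w)"
  by (rule smooth_on_vec[OF open_Ur]) (rule sym.smooth_on_sg)

text \<open>Outside the frame a slice point has real coordinates, so their derivatives are real and
  contribute nothing to the imaginary parts. The forms of the full space and of the chart therefore
  agree along the slice.\<close>

lemma slice_derivative_form:
  assumes r: "r \<in> R" and T: "open T" "w0 \<in> T" "\<And>w. w \<in> T \<Longrightarrow> \<phi> w \<in> U r"
    and d: "(\<phi> has_derivative D) (at w0)"
  shows "\<exists>E. ((\<lambda>w. sg r (\<phi> w)) has_derivative E) (at w0) \<and>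
    (\<forall>u v. (\<Sum>j\<in>UNIV. Im (E u $ j * cnj (E v $ j))) = (\<Sum>k\<in>UNIV. Im (D u $ k * cnj (D v $ k))))"
proof -
  have "\<phi> w0 \<in> U r" using T by blast
  then have "(sg r has_derivative frechet_derivative (sg r) (at (\<phi> w0))) (at (\<phi> w0))"
    by (rule has_derivative_frechet[OF smooth_on_differentiable[OF smooth_on_slice[OF r]]])
  from diff_chain_at[OF d this] obtain E where E: "((\<lambda>w. sg r (\<phi> w)) has_derivative E) (at w0)" by (auto simp: o_def)
  have 1: "E u $ r k = D u $ k" for u k
  proof -
    have "((\<lambda>w. sg r (\<phi> w) $ r k) has_derivative (\<lambda>u. E u $ r k)) (at w0)" by (rule has_derivative_vec_nth[OF E])
    then have "((\<lambda>w. \<phi> w $ k) has_derivative (\<lambda>u. E u $ r k)) (at w0)" using inj_frame[OF r] by simp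
    from fun_cong[OF has_derivative_unique[OF this has_derivative_vec_nth[OF d]]] show ?thesis .
  qed
  have 2: "Im (E u $ h) = 0" if "h \<notin> range r" for u h
  proof -
    have "((\<lambda>w. Im (sg r (\<phi> w) $ h)) has_derivative (\<lambda>u. Im (E u $ h))) (at w0)"
      by (rule bounded_linear.has_derivative[OF bounded_linear_Im has_derivative_vec_nth[OF E]])
    then have "((\<lambda>w. 0) has_derivative (\<lambda>u. Im (E u $ h))) (at w0)" using that by simp
    from fun_cong[OF has_derivative_unique[OF this has_derivative_const]] show ?thesis .
  qed
  show ?thesis
    by (intro exI[of _ E] conjI E allI) (simp add: sum_split_range[OF inj_frame[OF r]] 1 2)
qed

text \<open>Rotating a path in the zero level by angles \<open>\<theta>\<close> with values in \<open>\<nn>\<close> does not change the pulled back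
  form, since the differentials of the squared moduli annihilate \<open>\<nn>\<close>.\<close>

lemma zero_level_pullback:
  fixes \<theta> :: "complex^'n \<Rightarrow> real^'d"
  assumes r: "r \<in> R" and r': "r' \<in> R" and T: "open T" "w0 \<in> T"
    and d\<phi>: "(\<phi> has_derivative D) (at w0)" and d\<psi>: "(\<psi> has_derivative D') (at w0)" and d\<theta>: "(\<theta> has_derivative B) (at w0)"
    and \<phi>: "\<And>w. w \<in> T \<Longrightarrow> \<phi> w \<in> U r" and \<psi>: "\<And>w. w \<in> T \<Longrightarrow> \<psi> w \<in> U r'"
    and \<theta>: "\<And>w. w \<in> T \<Longrightarrow> pi_map X (\<theta> w) = 0"
    and eq: "\<And>w. w \<in> T \<Longrightarrow> sg r' (\<psi> w) = exp_act (\<chi> j. \<i> * complex_of_real (\<theta> w $ j)) (sg r (\<phi> w))"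
  shows "standard_form x (D' u) (D' v) = standard_form y (D u) (D v)"
proof -
  obtain E where E: "((\<lambda>w. sg r (\<phi> w)) has_derivative E) (at w0)"
    "\<And>u v. (\<Sum>j\<in>UNIV. Im (E u $ j * cnj (E v $ j))) = (\<Sum>k\<in>UNIV. Im (D u $ k * cnj (D v $ k)))"
    using slice_derivative_form[OF r T \<phi> d\<phi>] by blast
  obtain E' where E': "((\<lambda>w. sg r' (\<psi> w)) has_derivative E') (at w0)"
    "\<And>u v. (\<Sum>j\<in>UNIV. Im (E' u $ j * cnj (E' v $ j))) = (\<Sum>k\<in>UNIV. Im (D' u $ k * cnj (D' v $ k)))"
    using slice_derivative_form[OF r' T \<psi> d\<psi>] by blast
  define z where "z = sg r (\<phi> w0)"
  define e where "e j = exp (\<i> * complex_of_real (\<theta> w0 $ j))" for j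
  have E'eq: "E' u $ j = e j * (E u $ j + \<i> * complex_of_real (B u $ j) * z $ j)" for u j
  proof -
    have "((\<lambda>w. exp (\<i> * complex_of_real (\<theta> w $ j)) * sg r (\<phi> w) $ j) has_derivative
        (\<lambda>u. exp (\<i> * complex_of_real (\<theta> w0 $ j)) * E u $ j +
          exp (\<i> * complex_of_real (\<theta> w0 $ j)) * (\<i> * complex_of_real (B u $ j)) * sg r (\<phi> w0) $ j)) (at w0)"
      by (rule has_derivative_mult[OF has_derivative_exp_of_real[OF has_derivative_vec_nth[OF d\<theta>]] has_derivative_vec_nth[OF E(1)]])
    from has_derivative_unique_open[OF has_derivative_vec_nth[OF E'(1)] this T]
    have "(\<lambda>u. E' u $ j) = (\<lambda>u. exp (\<i> * complex_of_real (\<theta> w0 $ j)) * E u $ j +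
          exp (\<i> * complex_of_real (\<theta> w0 $ j)) * (\<i> * complex_of_real (B u $ j)) * sg r (\<phi> w0) $ j)"
      using eq by (simp add: exp_act_def)
    from fun_cong[OF this, of u] show ?thesis by (simp add: e_def z_def algebra_simps)
  qed
  have e1: "e j * cnj (e j) = 1" for j
    using complex_norm_square[of "e j"] by (simp add: e_def norm_exp_i_times)
  \<comment> \<open>The unit factors \<open>e j\<close> cancel and the term quadratic in
    \<open>B\<close> is real; only the mixed terms remain.\<close>
  have summand: "Im (E' u $ j * cnj (E' v $ j)) = Im (E u $ j * cnj (E v $ j)) +
      (Re (cnj (z $ j) * E v $ j) * B u $ j - Re (cnj (z $ j) * E u $ j) * B v $ j)" for j
  proof -
    have "E' u $ j * cnj (E' v $ j) = (e j * cnj (e j)) * ((E u $ j + \<i> * complex_of_real (B u $ j) * z $ j) *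
        cnj (E v $ j + \<i> * complex_of_real (B v $ j) * z $ j))"
      unfolding E'eq by (simp add: mult_ac)
    then have "Im (E' u $ j * cnj (E' v $ j)) = Im ((E u $ j + \<i> * complex_of_real (B u $ j) * z $ j) *
        cnj (E v $ j + \<i> * complex_of_real (B v $ j) * z $ j))"
      unfolding e1 by simp
    also have "\<dots> = Im (E u $ j * cnj (E v $ j)) +
      (Re (cnj (z $ j) * E v $ j) * B u $ j - Re (cnj (z $ j) * E u $ j) * B v $ j)"
      by (simp add: algebra_simps)
    finally show ?thesis .
  qed
  have piB: "pi_map X (B u) = 0" for u
  proof -
    have bl: "bounded_linear (pi_map X)"
      unfolding linear_conv_bounded_linear[symmetric]
      by (rule linearI) (auto simp: pi_map_def scaleR_add_left sum.distrib scaleR_sum_right)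
    have "(\<lambda>u. pi_map X (B u)) = (\<lambda>u. 0)"
      by (rule has_derivative_unique_open[OF bounded_linear.has_derivative[OF bl d\<theta>] has_derivative_const T]) (rule \<theta>)
    then show ?thesis by metis
  qed
  \<comment> \<open>On the zero level \<open>J_map\<close> vanishes on the kernel of
    \<open>pi_map\<close> identically in \<open>w\<close>; differentiating gives twice this
    sum.\<close>
  have ann: "(\<Sum>j\<in>UNIV. Re (cnj (z $ j) * E v $ j) * x $ j) = 0" if x: "pi_map X x = 0" for v x
  proof -
    have "((\<lambda>w. \<Sum>j\<in>UNIV. ((cmod (sg r (\<phi> w) $ j))\<^sup>2 + lam j) * x $ j) has_derivative
        (\<lambda>v. \<Sum>j\<in>UNIV. (2 * Re (cnj (sg r (\<phi> w0) $ j) * E v $ j) + 0) * x $ j)) (at w0)"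
      by (intro has_derivative_sum has_derivative_mult_left has_derivative_add has_derivative_const
          has_derivative_cmod_squared has_derivative_vec_nth E(1))
    moreover have "(\<Sum>j\<in>UNIV. ((cmod (sg r (\<phi> w) $ j))\<^sup>2 + lam j) * x $ j) = 0" if w: "w \<in> T" for w
    proof -
      have "sg r (\<phi> w) \<in> Psi_zero X lam" using sym.slice_in[OF r \<phi>[OF w]] .
      then have "Psi_map X lam (sg r (\<phi> w)) x = 0" using x by (simp add: Psi_zero_def n_space_def)
      then show ?thesis using x by (simp add: Psi_map_def n_space_def J_map_def)
    qed
    ultimately have "(\<lambda>v. \<Sum>j\<in>UNIV. (2 * Re (cnj (sg r (\<phi> w0) $ j) * E v $ j) + 0) * x $ j) = (\<lambda>v. 0)"
      by (rule has_derivative_unique_open[OF _ has_derivative_const T])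
    from fun_cong[OF this, of v] have "2 * (\<Sum>j\<in>UNIV. Re (cnj (z $ j) * E v $ j) * x $ j) = 0"
      by (simp add: z_def sum_distrib_left algebra_simps)
    then show ?thesis by simp
  qed
  have "(\<Sum>j\<in>UNIV. Im (E' u $ j * cnj (E' v $ j))) = (\<Sum>j\<in>UNIV. Im (E u $ j * cnj (E v $ j)))"
    unfolding summand sum.distrib sum_subtractf using ann[OF piB[of u], of v] ann[OF piB[of v], of u] by simp
  then show ?thesis unfolding standard_form_sum using E(2)[of u v] E'(2)[of u v] by simp
qed

end

section \<open>Forms and the theorem\<close>

lemma closed_standard_form:
  fixes S :: "(complex^'n) set" shows "closed_two_form_on S standard_form"
proof -
  have "frechet_derivative (\<lambda>y. standard_form y u v) (at x) w = 0" for u v w x :: "complex^'n"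
    using frechet_derivative_at[OF has_derivative_const[of "standard_form 0 u v" "at x"]]
    by (metis (no_types, lifting) ext standard_form_indep)
  then show ?thesis by (simp add: closed_two_form_on_def)
qed

lemma two_form_standard_form:
  fixes S :: "(complex^'n) set" assumes "open S" shows "two_form_on S standard_form"
proof -
  have "bilinear (standard_form x)" for x :: "complex^'n"
    using standard_form_bilinear by (simp add: bilinear_conv_bounded_bilinear)
  moreover have "standard_form x v v = 0" for x v :: "complex^'n" using standard_form_alt[of x v v] by simp
  moreover have "smooth_on S (\<lambda>x. standard_form x u v)" for u v :: "complex^'n"
    by (rule smooth_on_cong[OF assms _ smooth_on_const[OF assms, of "standard_form 0 u v"]])
       (simp add: standard_form_inner)
  ultimately show ?thesis by (simp add: two_form_on_def)
qed

lemma symplectic_standard_form: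
  fixes S :: "(complex^'n) set" assumes "open S" shows "symplectic_on S standard_form"
proof -
  have "u = 0" if "\<forall>v. standard_form x u v = 0" for x u :: "complex^'n"
  proof -
    have "\<i> *s (- (\<i> *s u)) = u" using linear_neg[OF linear_i, of "\<i> *s u"] by simp
    then have "u \<bullet> u = 0" using that[rule_format, of "- (\<i> *s u)"] by (simp add: standard_form_inner)
    then show ?thesis by simp
  qed
  then show ?thesis
    using assms by (auto simp: symplectic_on_def closed_standard_form two_form_standard_form)
qed

lemma pulls_back_phase:
  assumes "open C" and "\<And>x u v. x \<in> C \<Longrightarrow> \<omega> (phase \<alpha> x) (phase \<alpha> u) (phase \<alpha> v) = \<omega> x u v"
  shows "pulls_back C id id (restrict (phase \<alpha>) C) \<omega> \<omega>"
  unfolding pulls_back_def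
proof
  fix x assume x: "x \<in> C"
  have bl: "bounded_linear (phase \<alpha>)" using linear_phase by (simp add: linear_conv_bounded_linear)
  have "frechet_derivative (id \<circ> restrict (phase \<alpha>) C \<circ> id) (at (id x)) = frechet_derivative (phase \<alpha>) (at (id x))"
    by (rule frechet_derivative_cong_open[OF assms(1)]) (use x in auto)
  also have "\<dots> = phase \<alpha>"
    using frechet_derivative_at[OF bounded_linear_imp_has_derivative[OF bl]] by simp
  finally show "\<exists>T s. local_section C id x T s \<and> (\<forall>u v. \<omega> (id x) u v =
      \<omega> (id (restrict (phase \<alpha>) C x)) (frechet_derivative (id \<circ> restrict (phase \<alpha>) C \<circ> s) (at (id x)) u)
        (frechet_derivative (id \<circ> restrict (phase \<alpha>) C \<circ> s) (at (id x)) v))"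
    using local_section_open_id[OF assms(1) x] assms(2)[OF x] x by (intro exI[of _ C] exI[of _ id]) auto
qed

lemma partial_exp_in_slit_domain:
  "x0 \<in> log_domain A K \<Longrightarrow> partial_exp K x0 \<in> slit_domain A K (partial_exp K x0)"
  by (auto simp: slit_domain_def log_domain_def) (simp add: partial_exp_def)

context toric
begin

text \<open>The scaling factors depend only on squared moduli, so the lift commutes with all phases,
  and so does its inverse.\<close>

lemma Gm_phase:
  assumes r: "r \<in> R" shows "Gm r (phase \<alpha> v) = phase \<alpha> (Gm r v)"
proof -
  have "Fm r (phase \<alpha> (Gm r v)) = phase \<alpha> (Fm r (Gm r v))"
    by (simp add: Fm_def fexp_def phase_def vec_eq_iff modsq_phase[unfolded phase_def])
  then have "Fm r (phase \<alpha> (Gm r v)) = phase \<alpha> v" using Gm(2)[OF r] by simp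
  moreover have "phase \<alpha> (Gm r v) \<in> U r" using Gm(1)[OF r] by (simp add: phase_reinhardt)
  ultimately show ?thesis using Gm(3)[OF r] by metis
qed

lemma eta_phase:
  assumes r: "r \<in> R" shows "eta r (phase \<alpha> v) (phase \<alpha> a) (phase \<alpha> b) = eta r v a b"
proof -
  have bl: "bounded_linear (phase \<alpha>)" using linear_phase by (simp add: linear_conv_bounded_linear)
  have 1: "(Gm r \<circ> phase \<alpha> has_derivative DG r (phase \<alpha> v) \<circ> phase \<alpha>) (at v)"
    by (rule diff_chain_at[OF bounded_linear_imp_has_derivative[OF bl] DG[OF r]])
  have 2: "(phase \<alpha> \<circ> Gm r has_derivative phase \<alpha> \<circ> DG r v) (at v)"
    by (rule diff_chain_at[OF DG[OF r] bounded_linear_imp_has_derivative[OF bl]])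
  have "Gm r \<circ> phase \<alpha> = phase \<alpha> \<circ> Gm r" using Gm_phase[OF r] by auto
  then have "DG r (phase \<alpha> v) \<circ> phase \<alpha> = phase \<alpha> \<circ> DG r v" using has_derivative_unique[OF 1] 2 by simp
  then have "DG r (phase \<alpha> v) (phase \<alpha> a) = phase \<alpha> (DG r v a)" for a by (metis comp_apply)
  then show ?thesis by (simp add: eta_def standard_form_phase[of 0 \<alpha> _ _ 0])
qed

text \<open>For \<open>\<kappa> = 0\<close> the exponent \<open>zeta\<close> is purely imaginary, so
  the chart change is a rotation by angles in the kernel of \<open>pi_map\<close>, as
  \<open>zero_level_pullback\<close> requires.\<close>

lemma sym_pulls_back:
  assumes r: "r \<in> R" and r': "r' \<in> R"
  shows "pulls_back (sym.CV r r') (sym.CP r r') (sym.CP r' r) (sym.lift_map r r') standard_form standard_form"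
proof (rule sym.pulls_back_lift_map[OF r r'])
  fix x0 u v assume x0: "x0 \<in> sym.LD r r'"
  let ?w0 = "sym.PE r r' x0" and ?T = "sym.SL r r' x0" and ?\<psi> = "sym.local_change r r' x0"
  let ?\<theta> = "\<lambda>w. \<chi> j. Im (sym.zeta r r' (sym.LS r r' x0 w) $ j)"
  have w0: "?w0 \<in> ?T" by (rule partial_exp_in_slit_domain[OF x0])
  have oT: "open ?T" by (rule sym.open_SL[OF r])
  have d\<psi>: "(?\<psi> has_derivative frechet_derivative ?\<psi> (at ?w0)) (at ?w0)"
    by (rule has_derivative_frechet[OF smooth_on_differentiable[OF sym.regular_local_change[OF r r'] w0]])
  have "smooth_on ?T ?\<theta>"
    by (rule smooth_on_vec[OF oT], unfold vec_lambda_beta)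
       (rule smooth_on_linear_comp[OF oT bounded_linear_Im sym.smooth_on_zeta[OF r r']])
  then have d\<theta>: "(?\<theta> has_derivative frechet_derivative ?\<theta> (at ?w0)) (at ?w0)"
    by (rule has_derivative_frechet[OF smooth_on_differentiable[OF _ w0]])
  show "standard_form ?w0 u v = standard_form (?\<psi> ?w0) (frechet_derivative ?\<psi> (at ?w0) u) (frechet_derivative ?\<psi> (at ?w0) v)"
  proof (rule zero_level_pullback[OF r r' oT w0 has_derivative_ident d\<psi> d\<theta>, symmetric])
    fix w assume w: "w \<in> ?T"
    show "w \<in> U r" by (rule sym.log_section_facts(3)[OF w])
    show "?\<psi> w \<in> U r'" by (rule sym.local_change_eq(3)[OF r r' w])
    show "pi_map X (?\<theta> w) = 0" using null_extend_Im[OF r'] by (simp add: pi_map_def sym.zeta_def)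
    have "sym.zeta r r' x $ j = \<i> * complex_of_real (Im (sym.zeta r r' x $ j))" for x j
      using sym.zeta_im_proj[of r r' x j] by (simp add: im_proj_def complex_eq_iff)
    then have "(\<chi> j. \<i> * complex_of_real (?\<theta> w $ j)) = sym.zeta r r' (sym.LS r r' x0 w)"
      by (simp add: vec_eq_iff)
    then show "sg r' (?\<psi> w) = exp_act (\<chi> j. \<i> * complex_of_real (?\<theta> w $ j)) (sg r w)"
      using sym.local_change_eq(2)[OF r r' w] by (simp only:)
  qed
qed

text \<open>Through \<open>Gm\<close> both charts are compared on the zero level. There the
  connecting exponent is \<open>zeta\<close> corrected by the real vectors \<open>yvec\<close>; by
  \<open>Psi_zero_orbit\<close> it acts as its imaginary part does, and this is the imaginary part
  of \<open>zeta\<close>, whose angles lie in the kernel of \<open>pi_map\<close>.\<close>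

lemma cpx_pulls_back:
  assumes r: "r \<in> R" and r': "r' \<in> R"
  shows "pulls_back (cpx.CV r r') (cpx.CP r r') (cpx.CP r' r) (cpx.lift_map r r') (eta r') (eta r)"
proof (rule cpx.pulls_back_lift_map[OF r r'])
  fix x0 u v assume x0: "x0 \<in> cpx.LD r r'"
  let ?w0 = "cpx.PE r r' x0" and ?T = "cpx.SL r r' x0" and ?h = "cpx.local_change r r' x0"
  let ?\<zeta> = "\<lambda>w. cpx.zeta r r' (cpx.LS r r' x0 w)"
  let ?\<theta> = "\<lambda>w. \<chi> j. Im (?\<zeta> w $ j)"
  have w0: "?w0 \<in> ?T" by (rule partial_exp_in_slit_domain[OF x0])
  have oT: "open ?T" by (rule cpx.open_SL[OF r])
  have "?h differentiable (at ?w0)"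
    using cpx.regular_local_change[OF r r', of x0] w0 unfolding holomorphic_map_on_def differentiable_def by blast
  then have dh: "(?h has_derivative frechet_derivative ?h (at ?w0)) (at ?w0)" by (rule has_derivative_frechet)
  have d\<psi>: "(Gm r' \<circ> ?h has_derivative DG r' (?h ?w0) \<circ> frechet_derivative ?h (at ?w0)) (at ?w0)"
    by (rule diff_chain_at[OF dh DG[OF r']])
  have "smooth_on ?T ?\<theta>"
    by (rule smooth_on_vec[OF oT], unfold vec_lambda_beta)
       (rule smooth_on_linear_comp[OF oT bounded_linear_Im cpx.smooth_on_zeta[OF r r']])
  then have d\<theta>: "(?\<theta> has_derivative frechet_derivative ?\<theta> (at ?w0)) (at ?w0)"
    by (rule has_derivative_frechet[OF smooth_on_differentiable[OF _ w0]])
  have "standard_form 0 ((DG r' (?h ?w0) \<circ> frechet_derivative ?h (at ?w0)) u) ((DG r' (?h ?w0) \<circ> frechet_derivative ?h (at ?w0)) v) =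
      standard_form 0 (DG r ?w0 u) (DG r ?w0 v)"
  proof (rule zero_level_pullback[OF r r' oT w0 DG[OF r] d\<psi> d\<theta>])
    fix w assume w: "w \<in> ?T"
    show "Gm r w \<in> U r" "(Gm r' \<circ> ?h) w \<in> U r'" using Gm(1) r r' by auto
    show "pi_map X (?\<theta> w) = 0" using null_extend_Im[OF r'] by (simp add: pi_map_def cpx.zeta_def)
    let ?y = "yvec r (Gm r w)" and ?y' = "yvec r' (Gm r' (?h w))"
    have "exp_act (complex_vec ?y') (sg r' (Gm r' (?h w))) = slice_point r' 1 (?h w)"
      using Fm_slice[OF r' Gm(1)[OF r']] Gm(2)[OF r'] by simp
    also have "\<dots> = exp_act (?\<zeta> w) (slice_point r 1 w)" by (rule cpx.local_change_eq(2)[OF r r' w])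
    also have "slice_point r 1 w = exp_act (complex_vec ?y) (sg r (Gm r w))"
      using Fm_slice[OF r Gm(1)[OF r, of w]] Gm(2)[OF r] by simp
    finally have "exp_act (complex_vec ?y') (sg r' (Gm r' (?h w))) = exp_act (?\<zeta> w) (exp_act (complex_vec ?y) (sg r (Gm r w)))" .
    then have "exp_act (- complex_vec ?y') (exp_act (complex_vec ?y') (sg r' (Gm r' (?h w)))) =
        exp_act (- complex_vec ?y') (exp_act (?\<zeta> w) (exp_act (complex_vec ?y) (sg r (Gm r w))))" by simp
    then have eq: "sg r' (Gm r' (?h w)) = exp_act (- complex_vec ?y' + (?\<zeta> w + complex_vec ?y)) (sg r (Gm r w))"
      unfolding exp_act_add by simp
    let ?\<xi> = "- complex_vec ?y' + (?\<zeta> w + complex_vec ?y)"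
    have \<xi>: "?\<xi> \<in> exp_group X Q 1"
      by (intro exp_group_add exp_group_minus complex_vec_exp_group yvec_pi cpx.zeta_H r r')
    have "exp_act ?\<xi> (sg r (Gm r w)) \<in> Psi_zero X lam"
      using sym.slice_in[OF r' Gm(1)[OF r', of "?h w"]] unfolding eq .
    from Psi_zero_orbit(1)[OF sym.slice_in[OF r Gm(1)[OF r]] \<xi> this]
    have "sg r' (Gm r' (?h w)) = exp_act (\<chi> j. \<i> * complex_of_real (Im (?\<xi> $ j))) (sg r (Gm r w))"
      unfolding eq .
    moreover have "Im (?\<xi> $ j) = ?\<theta> w $ j" for j by (simp add: complex_vec_def)
    ultimately show "sg r' ((Gm r' \<circ> ?h) w) = exp_act (\<chi> j. \<i> * complex_of_real (?\<theta> w $ j)) (sg r (Gm r w))"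
      by simp
  qed
  then show "eta r ?w0 u v = eta r' (?h ?w0) (frechet_derivative ?h (at ?w0) u) (frechet_derivative ?h (at ?w0) v)"
    by (simp add: eta_def)
qed

lemma symplectic_form_sym: "symplectic_form sym.M (sym.gchart ` R) (\<lambda>c. standard_form)"
  unfolding symplectic_form_def quasifold_two_form_def
proof (intro conjI ballI impI sym.quasifold_atlas_gchart)
  fix c assume "c \<in> sym.gchart ` R"
  then obtain r where r: "r \<in> R" "c = sym.gchart r" by blast
  have dom: "chart_dom c = U r" by (simp add: r sym.gchart_def)
  show "two_form_on (chart_dom c) standard_form" "symplectic_on (chart_dom c) standard_form"
    unfolding dom by (intro two_form_standard_form symplectic_standard_form open_Ur)+
  show "pulls_back (chart_dom c) id id g standard_form standard_form" if g: "g \<in> chart_group c" for g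
  proof -
    obtain \<alpha> where "g = restrict (phase \<alpha>) (U r)"
      using g by (auto simp: r sym.gchart_def phase_group.phase_maps_def[OF sym.pg[OF r(1)]])
    moreover have "pulls_back (U r) id id (restrict (phase \<alpha>) (U r)) standard_form standard_form"
      by (rule pulls_back_phase[OF open_Ur]) (rule standard_form_phase)
    ultimately show ?thesis unfolding dom by simp
  qed
next
  fix c c' assume "c \<in> sym.gchart ` R" "c' \<in> sym.gchart ` R"
  then obtain r r' where "r \<in> R" "c = sym.gchart r" "r' \<in> R" "c' = sym.gchart r'" by blast
  then show "\<exists>C \<rho> C' \<rho>' F. chart_change_lift smooth_on c C \<rho> c' C' \<rho>' F \<and> pulls_back C \<rho> \<rho>' F standard_form standard_form"
    using sym.chart_change_lift_gchart[of r r'] sym_pulls_back[of r r'] by blast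
qed

text \<open>Forms are indexed by charts, whereas \<open>eta\<close> is indexed by frames, so a frame
  is chosen for each chart; the facts below hold for whichever frame is picked.\<close>

definition eta_chart :: "(complex^'n, (complex^'d) set) quasi_chart \<Rightarrow> (complex^'n) two_form" where
  "eta_chart c = eta (SOME r. r \<in> R \<and> c = cpx.gchart r)"

lemma eta_chart:
  assumes "c \<in> cpx.gchart ` R"
  obtains r where "r \<in> R" "c = cpx.gchart r" "eta_chart c = eta r"
proof -
  define r where "r = (SOME r. r \<in> R \<and> c = cpx.gchart r)"
  have "\<exists>r. r \<in> R \<and> c = cpx.gchart r" using assms by blast
  from someI_ex[OF this] have "r \<in> R \<and> c = cpx.gchart r" unfolding r_def .
  then show ?thesis using that[of r] unfolding eta_chart_def r_def[symmetric] by blast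
qed

lemma cpx_dom: "chart_dom (cpx.gchart r) = UNIV" by (simp add: cpx.gchart_def)
lemma sym_dom: "chart_dom (sym.gchart r) = U r" by (simp add: sym.gchart_def)

lemma kahler_form_cpx: "kahler_form cpx.M (cpx.gchart ` R) eta_chart"
  unfolding kahler_form_def quasifold_two_form_def
proof (intro conjI ballI impI cpx.quasifold_atlas_gchart)
  fix c assume c: "c \<in> cpx.gchart ` R"
  obtain r where r: "r \<in> R" "c = cpx.gchart r" "eta_chart c = eta r" using eta_chart[OF c] .
  have dom: "chart_dom c = UNIV" unfolding r(2) by (rule cpx_dom)
  show k: "kahler_on (chart_dom c) (eta_chart c)" unfolding dom r(3) by (rule eta_kahler[OF r(1)])
  show "two_form_on (chart_dom c) (eta_chart c)" using k unfolding kahler_on_def by blast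
  show "pulls_back (chart_dom c) id id g (eta_chart c) (eta_chart c)" if g: "g \<in> chart_group c" for g
  proof -
    obtain \<alpha> where "g = restrict (phase \<alpha>) UNIV"
      using g by (auto simp: r(2) cpx.gchart_def phase_group.phase_maps_def[OF cpx.pg[OF r(1)]])
    moreover have "pulls_back UNIV id id (restrict (phase \<alpha>) UNIV) (eta r) (eta r)"
      by (rule pulls_back_phase[OF open_UNIV]) (rule eta_phase[OF r(1)])
    ultimately show ?thesis unfolding dom r(3) by simp
  qed
next
  fix c c' assume c: "c \<in> cpx.gchart ` R" "c' \<in> cpx.gchart ` R"
  obtain r where r: "r \<in> R" "c = cpx.gchart r" "eta_chart c = eta r" using eta_chart[OF c(1)] .
  obtain r' where r': "r' \<in> R" "c' = cpx.gchart r'" "eta_chart c' = eta r'" using eta_chart[OF c(2)] .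
  have "chart_change_lift holomorphic_map_on c (cpx.CV r r') (cpx.CP r r') c' (cpx.CV r' r) (cpx.CP r' r) (cpx.lift_map r r')"
    unfolding r(2) r'(2) by (rule cpx.chart_change_lift_gchart[OF r(1) r'(1)])
  moreover have "pulls_back (cpx.CV r r') (cpx.CP r r') (cpx.CP r' r) (cpx.lift_map r r') (eta_chart c') (eta_chart c)"
    unfolding r(3) r'(3) by (rule cpx_pulls_back[OF r(1) r'(1)])
  ultimately show "\<exists>C \<rho> C' \<rho>' F. chart_change_lift holomorphic_map_on c C \<rho> c' C' \<rho>' F \<and>
      pulls_back C \<rho> \<rho>' F (eta_chart c') (eta_chart c)" by blast
qed

section \<open>The quotient map and its inverse in the charts\<close>

lemma Fm_iso:
  assumes r: "r \<in> R" shows "manifold_iso smooth_on (U r) id UNIV id (Fm r)"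
  unfolding manifold_iso_def
proof (intro conjI)
  show "bij_betw (Fm r) (U r) UNIV"
    using Fm_inj[OF r] Fm_surj[OF r] by (auto simp: bij_betw_def image_iff) metis
  show "manifold_map smooth_on (U r) id UNIV id (Fm r)" by (rule manifold_map_open[OF open_Ur _ smooth_on_Fm]) simp
  show "manifold_map smooth_on UNIV id (U r) id (inv_into (U r) (Fm r))"
    unfolding Gm_def[symmetric] by (rule manifold_map_open[OF open_UNIV _ smooth_on_Gm[OF r]]) (use Gm(1)[OF r] in auto)
qed

lemma Gm_iso:
  assumes r: "r \<in> R" shows "manifold_iso smooth_on UNIV id (U r) id (Gm r)"
  unfolding manifold_iso_def
proof (intro conjI)
  show bij: "bij_betw (Gm r) UNIV (U r)"
    by (rule bij_betwI[where g="Fm r"]) (use Gm[OF r] in auto)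
  show "manifold_map smooth_on UNIV id (U r) id (Gm r)"
    by (rule manifold_map_open[OF open_UNIV _ smooth_on_Gm[OF r]]) (use Gm(1)[OF r] in auto)
  have "Fm r w = inv_into UNIV (Gm r) w" if "w \<in> U r" for w
    using inv_into_f_eq[OF bij_betw_imp_inj_on[OF bij], of "Fm r w" w] Gm(3)[OF r that] by simp
  from smooth_on_cong[OF open_Ur this smooth_on_Fm]
  show "manifold_map smooth_on (U r) id UNIV id (inv_into UNIV (Gm r))"
    by (intro manifold_map_open open_Ur) auto
qed

lemma sym_chart_map: "r \<in> R \<Longrightarrow> w \<in> U r \<Longrightarrow> chart_map (sym.gchart r) (group_orbit (chart_group (sym.gchart r)) w) = sym.orb (sg r w)"
  using sym.chart_map_gchart[of r w] by (simp add: sym.gchart_def)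

lemma cpx_chart_map: "r \<in> R \<Longrightarrow> chart_map (cpx.gchart r) (group_orbit (chart_group (cpx.gchart r)) w) = cpx.orb (slice_point r 1 w)"
  using cpx.chart_map_gchart[of r w] by (simp add: cpx.gchart_def)

lemma sym_chart_image_subset: "r \<in> R \<Longrightarrow> chart_image (sym.gchart r) \<subseteq> topspace sym.M"
  using sym.charts_cover by blast

lemma cpx_chart_image_subset: "r \<in> R \<Longrightarrow> chart_image (cpx.gchart r) \<subseteq> topspace cpx.M"
  using cpx.charts_cover by blast

lemma chi_lift:
  assumes r: "r \<in> R" shows "diffeo_chart_lift (sym.gchart r) (cpx.gchart r) (chi_map X Q) (Fm r)"
proof (rule diffeo_chart_liftI)
  show "manifold_iso smooth_on (chart_dom (sym.gchart r)) id (chart_dom (cpx.gchart r)) id (Fm r)"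
    unfolding sym_dom cpx_dom by (rule Fm_iso[OF r])
  show "chart_map (cpx.gchart r) (group_orbit (chart_group (cpx.gchart r)) (Fm r x)) =
     chi_map X Q (chart_map (sym.gchart r) (group_orbit (chart_group (sym.gchart r)) x))"
    if "x \<in> chart_dom (sym.gchart r)" for x
    using that sym_chart_map[OF r, of x] cpx_chart_map[OF r, of "Fm r x"] Fm_orb[OF r, of x]
    unfolding sym_dom by (simp add: chi_orbit)
  show "inj_on (chart_map (sym.gchart r)) (chart_orbits (sym.gchart r))"
    "inj_on (chart_map (cpx.gchart r)) (chart_orbits (cpx.gchart r))"
    unfolding sym.chart_orbits_gchart cpx.chart_orbits_gchart
    by (rule sym.chart_map_inj_on[OF r], rule cpx.chart_map_inj_on[OF r])
  show "inj_on (chi_map X Q) (chart_image (sym.gchart r))"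
    by (rule inj_on_subset[OF bij_betw_imp_inj_on[OF chi_bij] sym_chart_image_subset[OF r]])
qed

abbreviation "chi_inv \<equiv> inv_into (topspace sym.M) (chi_map X Q)"

lemma chi_inv_orbit:
  assumes r: "r \<in> R" shows "chi_inv (cpx.orb (slice_point r 1 v)) = sym.orb (sg r (Gm r v))"
proof (rule inv_into_f_eq[OF bij_betw_imp_inj_on[OF chi_bij]])
  show "sym.orb (sg r (Gm r v)) \<in> topspace sym.M"
    unfolding topspace_sym using sym.slice_in[OF r Gm(1)[OF r]] by blast
  show "chi_map X Q (sym.orb (sg r (Gm r v))) = cpx.orb (slice_point r 1 v)"
    using Fm_orb[OF r Gm(1)[OF r, of v]] Gm(2)[OF r] by (simp add: chi_orbit)
qed

lemma chi_inv_lift: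
  assumes r: "r \<in> R" shows "diffeo_chart_lift (cpx.gchart r) (sym.gchart r) chi_inv (Gm r)"
proof (rule diffeo_chart_liftI)
  show "manifold_iso smooth_on (chart_dom (cpx.gchart r)) id (chart_dom (sym.gchart r)) id (Gm r)"
    unfolding sym_dom cpx_dom by (rule Gm_iso[OF r])
  show "chart_map (sym.gchart r) (group_orbit (chart_group (sym.gchart r)) (Gm r x)) =
     chi_inv (chart_map (cpx.gchart r) (group_orbit (chart_group (cpx.gchart r)) x))" for x
    unfolding sym_chart_map[OF r Gm(1)[OF r]] cpx_chart_map[OF r] by (rule chi_inv_orbit[OF r, symmetric])
  show "inj_on (chart_map (cpx.gchart r)) (chart_orbits (cpx.gchart r))"
    "inj_on (chart_map (sym.gchart r)) (chart_orbits (sym.gchart r))"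
    unfolding sym.chart_orbits_gchart cpx.chart_orbits_gchart
    by (rule cpx.chart_map_inj_on[OF r], rule sym.chart_map_inj_on[OF r])
  show "inj_on chi_inv (chart_image (cpx.gchart r))"
    by (rule inj_on_inv_into) (use cpx_chart_image_subset[OF r] bij_betw_imp_surj_on[OF chi_bij] in simp)
qed

text \<open>The condition asks for one suitable pair of charts around each point, and the charts of
  a common vertex, contained in both maximal atlases, provide it.\<close>

lemma chi_diffeo:
  assumes "quasifold smooth_on sym.M \<A>" "sym.gchart ` R \<subseteq> \<A>" "quasifold smooth_on cpx.M \<B>" "cpx.gchart ` R \<subseteq> \<B>"
  shows "quasifold_diffeo sym.M \<A> cpx.M \<B> (chi_map X Q)"
  unfolding quasifold_diffeo_def
proof (intro conjI assms(1,3) chi_continuous chi_bij ballI)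
  fix m assume "m \<in> topspace sym.M"
  then obtain z where z: "z \<in> Psi_zero X lam" "m = sym.orb z" by (auto simp: topspace_sym)
  obtain r where r: "r \<in> R" "\<forall>h. h \<notin> range r \<longrightarrow> z $ h \<noteq> 0" using Psi_zero_cover[OF z(1)] by blast
  have "m \<in> chart_image (sym.gchart r)" using sym.mem_chart_image[OF r(1) z(1)] r(2) z(2) by simp
  moreover have "chi_map X Q m \<in> chart_image (cpx.gchart r)"
    using cpx.mem_chart_image[OF r(1), of z] Psi_zero_subset z r(2) by (auto simp: chi_orbit)
  ultimately show "\<exists>c\<in>\<A>. \<exists>c'\<in>\<B>. m \<in> chart_image c \<and> chi_map X Q m \<in> chart_image c' \<and>
      (\<exists>F. diffeo_chart_lift c c' (chi_map X Q) F)"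
    using chi_lift[OF r(1)] assms(2,4) r(1) by blast
qed

lemma pullback_form: "is_pullback_form (cpx.gchart ` R) eta_chart (sym.gchart ` R) (\<lambda>c. standard_form) chi_inv"
  unfolding is_pullback_form_def
proof (intro ballI)
  fix c m assume c: "c \<in> cpx.gchart ` R" and m: "m \<in> chart_image c"
  obtain r where r: "r \<in> R" "c = cpx.gchart r" "eta_chart c = eta r" using eta_chart[OF c] .
  obtain v where v: "m = cpx.orb (slice_point r 1 v)" using m by (auto simp: r(2) cpx.chart_image_gchart[OF r(1)])
  have "chi_inv m \<in> chart_image (sym.gchart r)"
    unfolding v chi_inv_orbit[OF r(1)] sym.chart_image_gchart[OF r(1)] using Gm(1)[OF r(1)] by blast
  moreover have "diffeo_chart_lift c (sym.gchart r) chi_inv (Gm r)" unfolding r(2) by (rule chi_inv_lift[OF r(1)])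
  moreover have "pulls_back (chart_dom c) id id (Gm r) standard_form (eta_chart c)"
    unfolding pulls_back_def r(3) unfolding r(2) cpx_dom
  proof
    fix x :: "complex^'n"
    have "local_section UNIV id x UNIV id" by (rule local_section_open_id) auto
    moreover have "eta r (id x) u v = standard_form (id (Gm r x)) (frechet_derivative (id \<circ> Gm r \<circ> id) (at (id x)) u)
        (frechet_derivative (id \<circ> Gm r \<circ> id) (at (id x)) v)" for u v
      using standard_form_indep[of 0 "Gm r x"] by (simp add: eta_def)
    ultimately show "\<exists>T s. local_section UNIV id x T s \<and> (\<forall>u v. eta r (id x) u v =
        standard_form (id (Gm r x)) (frechet_derivative (id \<circ> Gm r \<circ> s) (at (id x)) u)
          (frechet_derivative (id \<circ> Gm r \<circ> s) (at (id x)) v))" by blast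
  qed
  ultimately show "\<exists>c'\<in>sym.gchart ` R. chi_inv m \<in> chart_image c' \<and>
      (\<exists>F. diffeo_chart_lift c c' chi_inv F \<and> pulls_back (chart_dom c) id id F standard_form (eta_chart c))"
    using r(1) by blast
qed

end

theorem theorem3p2:
  fixes \<Delta> Q :: "'a::euclidean_space set"
    and X :: "'d::finite \<Rightarrow> 'a"
    and lam :: "'d \<Rightarrow> real"
    and \<G> \<H> :: "(complex^'n::finite, (complex^'d) set) quasi_chart set"
  assumes "CARD('n) = DIM('a)"
    and "simple_polytope \<Delta>"
    and "aff_dim \<Delta> = int DIM('a)"
    and "\<Delta> = (\<Inter>j. {\<mu>. \<mu> \<bullet> X j \<ge> lam j})"
    and "bij_betw (\<lambda>j. {\<mu> \<in> \<Delta>. \<mu> \<bullet> X j = lam j}) UNIV {F. F facet_of \<Delta>}"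
    and "quasilattice Q"
    and "range X \<subseteq> Q"
    and "\<G> = symplectic_charts \<Delta> X lam Q"
    and "\<H> = complex_charts \<Delta> X lam Q"
  shows
    "quasifold_atlas smooth_on (symplectic_quotient X lam Q) \<G> \<and>
     quasifold_atlas holomorphic_map_on (complex_quotient \<Delta> X lam Q) \<H> \<and>
     (\<forall>\<A> \<B>.
        quasifold smooth_on (symplectic_quotient X lam Q) \<A> \<and> \<G> \<subseteq> \<A> \<and>
        quasifold smooth_on (complex_quotient \<Delta> X lam Q) \<B> \<and> \<H> \<subseteq> \<B> \<longrightarrow>
        quasifold_diffeo (symplectic_quotient X lam Q) \<A> (complex_quotient \<Delta> X lam Q) \<B>
          (chi_map X Q)) \<and>
     (\<forall>t\<in>quasitorus Q. \<forall>x\<in>topspace (symplectic_quotient X lam Q).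
        chi_map X Q (quasitorus_act X t x) =
        complex_quasitorus_act X (quasitorus_incl t) (chi_map X Q x)) \<and>
     symplectic_form (symplectic_quotient X lam Q) \<G> (\<lambda>c. standard_form) \<and>
     (\<exists>\<eta>. is_pullback_form \<H> \<eta> \<G> (\<lambda>c. standard_form)
            (inv_into (topspace (symplectic_quotient X lam Q)) (chi_map X Q)) \<and>
          kahler_form (complex_quotient \<Delta> X lam Q) \<H> \<eta>)"
proof -
  interpret toric \<Delta> X lam Q "vertex_enums \<Delta> X lam :: ('n \<Rightarrow> 'd) set"
    by unfold_locales (use assms in auto)
  show ?thesis
    unfolding assms(8,9) symplectic_charts_eq complex_charts_eq symplectic_quotient_eq complex_quotient_eq
    using sym.quasifold_atlas_gchart cpx.quasifold_atlas_gchart chi_diffeo chi_equivariant symplectic_form_sym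
      pullback_form kahler_form_cpx by blast
qed

end
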